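(* Let $\alpha_0>0$ be such that $1+\frac{\mu\lambda_1}{2}k\ge e^{\alpha k}$ for $0<\alpha<\alpha_0$, and let $0<\alpha<\min\{\alpha_0,\delta,\frac{\mu\lambda_1}{2}\}$. Then the backward Euler solution $\mathbf U^n$, $1\le n\le N$, satisfies the uniform estimate $$\|\nabla\mathbf U^n\|^2+\frac{e^{-\delta k}}{\gamma}\|\tilde\Delta_h\mathbf U^n_\beta\|^2\le K,\qquad 1\le n\le N,$$ where $\mathbf U^n_\beta=k\sum_{j=1}^n\beta(t_n-t_j)\mathbf U^j$, and $K>0$ depends on the given data but not on $n$ (so the bound is uniform in time, as $t_N\to+\infty$).
   Context: Notation and standing assumptions. $\Omega\subset\mathbb R^2$ is a bounded domain; $\mu,\gamma,\delta>0$; $\beta(t)=\gamma e^{-\delta t}$. $(\cdot,\cdot)$ and $\|\cdot\|$ are the $L^2$ inner product and norm (scalar or vector valued); $\mathbf L^2=[L^2(\Omega)]^2$, $\mathbf H^m=[H^m(\Omega)]^2$, $\mathbf H_0^1=[H_0^1(\Omega)]^2$; $\|\cdot\|_m$ is the $H^m$ norm; $\mathbf J_1=\{\boldsymbol\phi\in\mathbf H_0^1:\nabla\cdot\boldsymbol\phi=0\}$. $\lambda_1>0$ is the least positive eigenvalue of the Stokes operator on $\Omega$ (homogeneous Dirichlet condition). Standing assumptions: (A1) For every $\mathbf g\in\mathbf L^2$, the unique solution $(\mathbf v,q)\in\mathbf J_1\times L^2/\mathbb R$ of the Stokes problem $-\Delta\mathbf v+\nabla q=\mathbf g$, $\nabla\cdot\mathbf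 v=0$ in $\Omega$, $\mathbf v|_{\partial\Omega}=0$, satisfies $\|\mathbf v\|_2+\|q\|_{H^1/\mathbb R}\le C\|\mathbf g\|$. (A2) $\mathbf u_0\in\mathbf J_1$, $\mathbf f,\mathbf f_t\in L^\infty(\mathbb R_+;\mathbf L^2)$ with $\|\mathbf u_0\|_1\le M_0$ and $\sup_{t>0}\{\|\mathbf f(t)\|,\|\mathbf f_t(t)\|\}\le M_0$. For $0<h<1$, $\mathbf H_h\subset\mathbf H_0^1$ and $L_h\subset L^2$ are finite dimensional, and $\mathbf J_h=\{\mathbf v_h\in\mathbf H_h:(\chi_h,\nabla\cdot\mathbf v_h)=0\ \forall\chi_h\in L_h\}$. (B1) For $\mathbf w\in\mathbf H_0^1\cap\mathbf H^2$, $q\in H^1/\mathbb R$ there are $i_h\mathbf w\in\mathbf H_h$, $j_hq\in L_h$ with $\|\mathbf w-i_h\mathbf w\|+h\|\nabla(\mathbf w-i_h\mathbf w)\|\le Ch^2\|\mathbf w\|_2$ and $\|q-j_hq\|_{L^2/\mathbb R}\le Ch\|q\|_{H^1/\mathbb R}$; moreover $\|\nabla\mathbf w_h\|\le Ch^{-1}\|\mathbf w_h\|$ for $\mathbf w_h\in\mathbf H_h$. (B2) For every $\mathbf w\in\mathbf J_1\cap\mathbf H^2$ there is $r_h\mathbf w\in\mathbf J_h$ with $\|\mathbf w-r_h\mathbf w\|+h\|\nabla(\mathbf w-r_h\mathbf w)\|\le Ch^2\|\mathbf w\|_2$. $P_h:\mathbf L^2\to\mathbf J_h$ is the $L^2$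 projection; $a(\mathbf v,\boldsymbol\phi)=(\nabla\mathbf v,\nabla\boldsymbol\phi)$; $b(\mathbf v,\mathbf w,\boldsymbol\phi)=\frac12(\mathbf v\cdot\nabla\mathbf w,\boldsymbol\phi)-\frac12(\mathbf v\cdot\nabla\boldsymbol\phi,\mathbf w)$. $\Delta_h:\mathbf H_h\to\mathbf H_h$ is defined by $a(\mathbf v_h,\boldsymbol\phi_h)=(-\Delta_h\mathbf v_h,\boldsymbol\phi_h)$ for all $\mathbf v_h,\boldsymbol\phi_h\in\mathbf H_h$, and $\tilde\Delta_h=P_h\Delta_h$. Time discretization: $k=T/N$ with $N$ a positive integer, $t_n=nk$, $\partial_t\boldsymbol\phi^n=\frac1k(\boldsymbol\phi^n-\boldsymbol\phi^{n-1})$, $\mathbf f^n=\mathbf f(t_n)$, $q_r^n(\boldsymbol\phi)=k\sum_{j=1}^n\beta(t_n-t_j)\boldsymbol\phi^j$. Backward Euler scheme: $\mathbf U^0=P_h\mathbf u_0$ and, for $1\le n\le N$, $\mathbf U^n\in\mathbf J_h$ satisfies, for all $\boldsymbol\phi_h\in\mathbf J_h$, $(\partial_t\mathbf U^n,\boldsymbol\phi_h)+\mu a(\mathbf U^n,\boldsymbol\phi_h)+a(q_r^n(\mathbf U),\boldsymbol\phi_h)=(\mathbf f^n,\boldsymbol\phi_h)-b(\mathbf U^n,\mathbf U^n,\boldsymbol\phi_h)$. "Given data" means $\Omega,\mu,\gamma,\delta,\alpha,M_0$ and the constants in (A1), (B1), (B2). *)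

theory Defs
  imports "HOL-Analysis.Analysis"
begin

section \<open>Lebesgue spaces\<close>

text \<open>
  Elements of function spaces over \<open>\<Omega>\<close> are represented by functions on the whole space whose values
  outside \<open>\<Omega>\<close> are irrelevant; equality in \<open>L\<^sup>2(\<Omega>)\<close> is \<open>ae_eq \<Omega>\<close>.
  Scalar, vector and matrix valued fields are treated uniformly: the inner product on
  \<open>real ^ 2 ^ 2\<close> is the Frobenius product.
\<close>

definition ae_eq :: "'a::euclidean_space set \<Rightarrow> ('a \<Rightarrow> 'b) \<Rightarrow> ('a \<Rightarrow> 'b) \<Rightarrow> bool" where
  "ae_eq \<Omega> u v \<longleftrightarrow> (AE x in lebesgue_on \<Omega>. u x = v x)"

definition L2 :: "'a::euclidean_space set \<Rightarrow> ('a \<Rightarrow> 'b::euclidean_space) set" where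
  "L2 \<Omega> = {u \<in> borel_measurable (lebesgue_on \<Omega>). integrable (lebesgue_on \<Omega>) (\<lambda>x. (norm (u x))\<^sup>2)}"

definition L2_inner ::
  "'a::euclidean_space set \<Rightarrow> ('a \<Rightarrow> 'b::euclidean_space) \<Rightarrow> ('a \<Rightarrow> 'b) \<Rightarrow> real" where
  "L2_inner \<Omega> u v = (LINT x|lebesgue_on \<Omega>. u x \<bullet> v x)"

definition L2_norm :: "'a::euclidean_space set \<Rightarrow> ('a \<Rightarrow> 'b::euclidean_space) \<Rightarrow> real" where
  "L2_norm \<Omega> u = sqrt (L2_inner \<Omega> u u)"

definition locally_integrable :: "'a::euclidean_space set \<Rightarrow> ('a \<Rightarrow> real) \<Rightarrow> bool" where
  "locally_integrable \<Omega> u \<longleftrightarrow> (\<forall>S. compact S \<and> S \<subseteq> \<Omega> \<longrightarrow> integrable (lebesgue_on S) u)"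


section \<open>Weak derivatives\<close>

abbreviation dir_deriv :: "'a::euclidean_space \<Rightarrow> ('a \<Rightarrow> real) \<Rightarrow> 'a \<Rightarrow> real" where
  "dir_deriv e \<phi> \<equiv> (\<lambda>x. frechet_derivative \<phi> (at x) e)"

primrec Ck :: "nat \<Rightarrow> ('a::euclidean_space \<Rightarrow> real) \<Rightarrow> bool" where
  "Ck 0 \<phi> \<longleftrightarrow> continuous_on UNIV \<phi>"
| "Ck (Suc m) \<phi> \<longleftrightarrow> (\<forall>x. \<phi> differentiable (at x)) \<and> (\<forall>e\<in>Basis. Ck m (dir_deriv e \<phi>))"

text \<open>\<open>C\<^sub>c\<^sup>\<infinity>(\<Omega>)\<close>, each function being extended by zero.\<close>

definition test_functions :: "'a::euclidean_space set \<Rightarrow> ('a \<Rightarrow> real) set" where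
  "test_functions \<Omega> =
     {\<phi>. (\<forall>m. Ck m \<phi>) \<and> (\<exists>S. compact S \<and> S \<subseteq> \<Omega> \<and> (\<forall>x. x \<notin> S \<longrightarrow> \<phi> x = 0))}"

definition has_weak_deriv ::
  "'a::euclidean_space set \<Rightarrow> 'a \<Rightarrow> ('a \<Rightarrow> real) \<Rightarrow> ('a \<Rightarrow> real) \<Rightarrow> bool" where
  "has_weak_deriv \<Omega> e u g \<longleftrightarrow>
     locally_integrable \<Omega> u \<and> locally_integrable \<Omega> g \<and>
     (\<forall>\<phi>\<in>test_functions \<Omega>. L2_inner \<Omega> u (dir_deriv e \<phi>) = - L2_inner \<Omega> g \<phi>)"

text \<open>The weak derivative is unique only almost everywhere; some representative is chosen.\<close>

definition weak_deriv :: "'a::euclidean_space set \<Rightarrow> 'a \<Rightarrow> ('a \<Rightarrow> real) \<Rightarrow> 'a \<Rightarrow> real" where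
  "weak_deriv \<Omega> e u = (SOME g. has_weak_deriv \<Omega> e u g)"


section \<open>Sobolev spaces on planar domains\<close>

type_synonym scalar_field = "real^2 \<Rightarrow> real"
type_synonym vector_field = "real^2 \<Rightarrow> real^2"

abbreviation coord :: "vector_field \<Rightarrow> 2 \<Rightarrow> scalar_field" where
  "coord v i \<equiv> (\<lambda>x. v x $ i)"

definition planar_domain :: "(real^2) set \<Rightarrow> bool" where
  "planar_domain \<Omega> \<longleftrightarrow> open \<Omega> \<and> connected \<Omega> \<and> \<Omega> \<noteq> {}"

abbreviation pd :: "(real^2) set \<Rightarrow> 2 \<Rightarrow> scalar_field \<Rightarrow> scalar_field" where
  "pd \<Omega> j u \<equiv> weak_deriv \<Omega> (axis j 1) u"

primrec Hm :: "nat \<Rightarrow> (real^2) set \<Rightarrow> scalar_field set" where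
  "Hm 0 \<Omega> = L2 \<Omega>"
| "Hm (Suc m) \<Omega> = {u \<in> L2 \<Omega>. \<forall>j::2. \<exists>g\<in>Hm m \<Omega>. has_weak_deriv \<Omega> (axis j 1) u g}"

text \<open>The sum runs over the multi-indices \<open>(a, b)\<close> of order at most \<open>m\<close>.\<close>

definition Hm_norm :: "nat \<Rightarrow> (real^2) set \<Rightarrow> scalar_field \<Rightarrow> real" where
  "Hm_norm m \<Omega> u =
     sqrt (\<Sum>(a, b)\<in>{(a, b). a + b \<le> m}. (L2_norm \<Omega> ((pd \<Omega> 1 ^^ a) ((pd \<Omega> 2 ^^ b) u)))\<^sup>2)"

definition H10 :: "(real^2) set \<Rightarrow> scalar_field set" where
  "H10 \<Omega> =
     {u \<in> Hm 1 \<Omega>. \<forall>\<epsilon>>0. \<exists>\<phi>\<in>test_functions \<Omega>. Hm_norm 1 \<Omega> (\<lambda>x. u x - \<phi> x) < \<epsilon>}"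

definition vHm :: "nat \<Rightarrow> (real^2) set \<Rightarrow> vector_field set" where
  "vHm m \<Omega> = {v. \<forall>i. coord v i \<in> Hm m \<Omega>}"

definition vHm_norm :: "nat \<Rightarrow> (real^2) set \<Rightarrow> vector_field \<Rightarrow> real" where
  "vHm_norm m \<Omega> v = sqrt (\<Sum>i\<in>UNIV. (Hm_norm m \<Omega> (coord v i))\<^sup>2)"

definition vH10 :: "(real^2) set \<Rightarrow> vector_field set" where
  "vH10 \<Omega> = {v. \<forall>i. coord v i \<in> H10 \<Omega>}"

definition L2_quot_norm :: "(real^2) set \<Rightarrow> scalar_field \<Rightarrow> real" where
  "L2_quot_norm \<Omega> q = (INF c::real. L2_norm \<Omega> (\<lambda>x. q x - c))"

definition H1_quot_norm :: "(real^2) set \<Rightarrow> scalar_field \<Rightarrow> real" where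
  "H1_quot_norm \<Omega> q = (INF c::real. Hm_norm 1 \<Omega> (\<lambda>x. q x - c))"

definition grad :: "(real^2) set \<Rightarrow> vector_field \<Rightarrow> real^2 \<Rightarrow> real^2^2" where
  "grad \<Omega> v x = (\<chi> i j. pd \<Omega> j (coord v i) x)"

definition diverg :: "(real^2) set \<Rightarrow> vector_field \<Rightarrow> scalar_field" where
  "diverg \<Omega> v x = (\<Sum>i\<in>UNIV. pd \<Omega> i (coord v i) x)"

definition J1 :: "(real^2) set \<Rightarrow> vector_field set" where
  "J1 \<Omega> = {v \<in> vH10 \<Omega>. ae_eq \<Omega> (diverg \<Omega> v) (\<lambda>x. 0)}"

definition a_form :: "(real^2) set \<Rightarrow> vector_field \<Rightarrow> vector_field \<Rightarrow> real" where
  "a_form \<Omega> v \<phi> = L2_inner \<Omega> (grad \<Omega> v) (grad \<Omega> \<phi>)"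

text \<open>\<open>(v \<cdot> \<nabla>) w\<close> is the Jacobian matrix of \<open>w\<close> applied to \<open>v\<close>.\<close>

definition convect :: "(real^2) set \<Rightarrow> vector_field \<Rightarrow> vector_field \<Rightarrow> vector_field" where
  "convect \<Omega> v w x = grad \<Omega> w x *v v x"

definition b_form ::
  "(real^2) set \<Rightarrow> vector_field \<Rightarrow> vector_field \<Rightarrow> vector_field \<Rightarrow> real" where
  "b_form \<Omega> v w \<phi> =
     1/2 * L2_inner \<Omega> (convect \<Omega> v w) \<phi> - 1/2 * L2_inner \<Omega> (convect \<Omega> v \<phi>) w"


section \<open>The Stokes problem\<close>

text \<open>
  The momentum equation is understood weakly (tested with \<open>H\<^sub>0\<^sup>1\<close>, equivalently with
  \<open>C\<^sub>c\<^sup>\<infinity>\<close> fields); incompressibility and the boundary condition are contained in \<open>v \<in> J1 \<Omega>\<close>.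
\<close>

definition stokes_solution ::
  "(real^2) set \<Rightarrow> vector_field \<Rightarrow> vector_field \<Rightarrow> scalar_field \<Rightarrow> bool" where
  "stokes_solution \<Omega> g v q \<longleftrightarrow>
     v \<in> J1 \<Omega> \<and> q \<in> L2 \<Omega> \<and>
     (\<forall>\<phi>\<in>vH10 \<Omega>. a_form \<Omega> v \<phi> - L2_inner \<Omega> q (diverg \<Omega> \<phi>) = L2_inner \<Omega> g \<phi>)"

definition stokes_regularity :: "(real^2) set \<Rightarrow> real \<Rightarrow> bool" where
  "stokes_regularity \<Omega> C \<longleftrightarrow>
     (\<forall>g\<in>L2 \<Omega>. \<exists>v q. stokes_solution \<Omega> g v q \<and>
        (\<forall>v' q'. stokes_solution \<Omega> g v' q' \<longrightarrow>
           ae_eq \<Omega> v' v \<and> (\<exists>c. ae_eq \<Omega> q' (\<lambda>x. q x + c))) \<and>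
        v \<in> vHm 2 \<Omega> \<and> q \<in> Hm 1 \<Omega> \<and>
        vHm_norm 2 \<Omega> v + H1_quot_norm \<Omega> q \<le> C * L2_norm \<Omega> g)"

definition stokes_eigenvalue :: "(real^2) set \<Rightarrow> real \<Rightarrow> bool" where
  "stokes_eigenvalue \<Omega> \<nu> \<longleftrightarrow>
     (\<exists>v q. \<not> ae_eq \<Omega> v (\<lambda>x. 0) \<and> stokes_solution \<Omega> (\<lambda>x. \<nu> *\<^sub>R v x) v q)"

definition least_stokes_eigenvalue :: "(real^2) set \<Rightarrow> real \<Rightarrow> bool" where
  "least_stokes_eigenvalue \<Omega> \<nu> \<longleftrightarrow>
     0 < \<nu> \<and> stokes_eigenvalue \<Omega> \<nu> \<and> (\<forall>\<nu>'>0. stokes_eigenvalue \<Omega> \<nu>' \<longrightarrow> \<nu> \<le> \<nu>')"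


section \<open>Initial velocity and forcing\<close>

text \<open>
  Membership in \<open>L\<^sup>\<infinity>(0, \<infinity>; L\<^sup>2(\<Omega>))\<close>. As \<open>L\<^sup>2(\<Omega>)\<close> is separable, strong measurability amounts to
  weak measurability.
\<close>

definition Linf_L2 :: "(real^2) set \<Rightarrow> (real \<Rightarrow> vector_field) \<Rightarrow> bool" where
  "Linf_L2 \<Omega> f \<longleftrightarrow>
     (\<forall>t>0. f t \<in> L2 \<Omega>) \<and>
     (\<forall>w\<in>L2 \<Omega>. (\<lambda>t. L2_inner \<Omega> (f t) w) \<in> borel_measurable (lebesgue_on {0<..})) \<and>
     (\<exists>M. AE t in lebesgue_on {0<..}. L2_norm \<Omega> (f t) \<le> M)"

text \<open>\<open>f\<^sub>t = g\<close> on \<open>(0, \<infinity>)\<close> in the sense of \<open>L\<^sup>2(\<Omega>)\<close>-valued distributions.\<close>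

definition has_weak_time_deriv ::
  "(real^2) set \<Rightarrow> (real \<Rightarrow> vector_field) \<Rightarrow> (real \<Rightarrow> vector_field) \<Rightarrow> bool" where
  "has_weak_time_deriv \<Omega> f g \<longleftrightarrow>
     (\<forall>w\<in>L2 \<Omega>. has_weak_deriv {0<..} 1 (\<lambda>t. L2_inner \<Omega> (f t) w) (\<lambda>t. L2_inner \<Omega> (g t) w))"

definition admissible_data ::
  "(real^2) set \<Rightarrow> real \<Rightarrow> vector_field \<Rightarrow> (real \<Rightarrow> vector_field) \<Rightarrow> bool" where
  "admissible_data \<Omega> M\<^sub>0 u\<^sub>0 f \<longleftrightarrow>
     u\<^sub>0 \<in> J1 \<Omega> \<and> vHm_norm 1 \<Omega> u\<^sub>0 \<le> M\<^sub>0 \<and> Linf_L2 \<Omega> f \<and>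
     (\<exists>f\<^sub>t. Linf_L2 \<Omega> f\<^sub>t \<and> has_weak_time_deriv \<Omega> f f\<^sub>t \<and>
        (\<forall>t>0. L2_norm \<Omega> (f t) \<le> M\<^sub>0 \<and> L2_norm \<Omega> (f\<^sub>t t) \<le> M\<^sub>0))"


section \<open>Finite element spaces\<close>

definition finite_dim_space :: "('a \<Rightarrow> 'b::real_vector) set \<Rightarrow> bool" where
  "finite_dim_space V \<longleftrightarrow>
     (\<exists>B. finite B \<and> V = {u. \<exists>c::('a \<Rightarrow> 'b) \<Rightarrow> real. u = (\<lambda>x. \<Sum>b\<in>B. c b *\<^sub>R b x)})"

definition Jh :: "(real^2) set \<Rightarrow> vector_field set \<Rightarrow> scalar_field set \<Rightarrow> vector_field set" where
  "Jh \<Omega> H L = {v \<in> H. \<forall>q\<in>L. L2_inner \<Omega> q (diverg \<Omega> v) = 0}"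

definition discrete_spaces ::
  "(real^2) set \<Rightarrow> (real \<Rightarrow> vector_field set) \<Rightarrow> (real \<Rightarrow> scalar_field set) \<Rightarrow> bool" where
  "discrete_spaces \<Omega> H L \<longleftrightarrow>
     (\<forall>h\<in>{0<..<1}. finite_dim_space (H h) \<and> H h \<subseteq> vH10 \<Omega> \<and>
                   finite_dim_space (L h) \<and> L h \<subseteq> L2 \<Omega>)"

text \<open>Approximation properties of both spaces and the inverse inequality.\<close>

definition approximation_inverse ::
  "(real^2) set \<Rightarrow> (real \<Rightarrow> vector_field set) \<Rightarrow> (real \<Rightarrow> scalar_field set) \<Rightarrow> real \<Rightarrow> bool"
where
  "approximation_inverse \<Omega> H L C \<longleftrightarrow>
     (\<forall>h\<in>{0<..<1}.
        (\<forall>w\<in>vH10 \<Omega> \<inter> vHm 2 \<Omega>. \<exists>w\<^sub>h\<in>H h.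
           L2_norm \<Omega> (\<lambda>x. w x - w\<^sub>h x) + h * L2_norm \<Omega> (grad \<Omega> (\<lambda>x. w x - w\<^sub>h x))
             \<le> C * h\<^sup>2 * vHm_norm 2 \<Omega> w) \<and>
        (\<forall>q\<in>Hm 1 \<Omega>. \<exists>q\<^sub>h\<in>L h.
           L2_quot_norm \<Omega> (\<lambda>x. q x - q\<^sub>h x) \<le> C * h * H1_quot_norm \<Omega> q) \<and>
        (\<forall>w\<^sub>h\<in>H h. L2_norm \<Omega> (grad \<Omega> w\<^sub>h) \<le> C * inverse h * L2_norm \<Omega> w\<^sub>h))"

text \<open>Approximation of solenoidal fields within the discretely solenoidal ones.\<close>

definition solenoidal_approximation ::
  "(real^2) set \<Rightarrow> (real \<Rightarrow> vector_field set) \<Rightarrow> (real \<Rightarrow> scalar_field set) \<Rightarrow> real \<Rightarrow> bool"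
where
  "solenoidal_approximation \<Omega> H L C \<longleftrightarrow>
     (\<forall>h\<in>{0<..<1}. \<forall>w\<in>J1 \<Omega> \<inter> vHm 2 \<Omega>. \<exists>w\<^sub>h\<in>Jh \<Omega> (H h) (L h).
        L2_norm \<Omega> (\<lambda>x. w x - w\<^sub>h x) + h * L2_norm \<Omega> (grad \<Omega> (\<lambda>x. w x - w\<^sub>h x))
          \<le> C * h\<^sup>2 * vHm_norm 2 \<Omega> w)"

text \<open>
  In the next two definitions the element selected is determined up to equality almost everywhere.
\<close>

definition L2_proj :: "(real^2) set \<Rightarrow> vector_field set \<Rightarrow> vector_field \<Rightarrow> vector_field" where
  "L2_proj \<Omega> V u = (SOME w. w \<in> V \<and> (\<forall>\<phi>\<in>V. L2_inner \<Omega> w \<phi> = L2_inner \<Omega> u \<phi>))"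

definition disc_laplacian ::
  "(real^2) set \<Rightarrow> vector_field set \<Rightarrow> vector_field \<Rightarrow> vector_field" where
  "disc_laplacian \<Omega> H v =
     (SOME w. w \<in> H \<and> (\<forall>\<phi>\<in>H. a_form \<Omega> v \<phi> = L2_inner \<Omega> (\<lambda>x. - w x) \<phi>))"

definition disc_stokes_laplacian ::
  "(real^2) set \<Rightarrow> vector_field set \<Rightarrow> scalar_field set \<Rightarrow> vector_field \<Rightarrow> vector_field" where
  "disc_stokes_laplacian \<Omega> H L v = L2_proj \<Omega> (Jh \<Omega> H L) (disc_laplacian \<Omega> H v)"


section \<open>The backward Euler scheme\<close>

definition kernel :: "real \<Rightarrow> real \<Rightarrow> real \<Rightarrow> real" where
  "kernel \<gamma> \<delta> t = \<gamma> * exp (- \<delta> * t)"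

definition memory_sum ::
  "real \<Rightarrow> real \<Rightarrow> real \<Rightarrow> (nat \<Rightarrow> vector_field) \<Rightarrow> nat \<Rightarrow> vector_field" where
  "memory_sum \<gamma> \<delta> k \<phi> n x =
     k *\<^sub>R (\<Sum>j=1..n. kernel \<gamma> \<delta> (real n * k - real j * k) *\<^sub>R \<phi> j x)"

definition bdiff :: "real \<Rightarrow> (nat \<Rightarrow> vector_field) \<Rightarrow> nat \<Rightarrow> vector_field" where
  "bdiff k \<phi> n x = (1 / k) *\<^sub>R (\<phi> n x - \<phi> (n - 1) x)"

definition backward_euler ::
  "(real^2) set \<Rightarrow> real \<Rightarrow> real \<Rightarrow> real \<Rightarrow> vector_field set \<Rightarrow> scalar_field set \<Rightarrow>
   vector_field \<Rightarrow> (real \<Rightarrow> vector_field) \<Rightarrow> real \<Rightarrow> nat \<Rightarrow> (nat \<Rightarrow> vector_field) \<Rightarrow> bool" where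
  "backward_euler \<Omega> \<mu> \<gamma> \<delta> H L u\<^sub>0 f k N U \<longleftrightarrow>
     U 0 \<in> Jh \<Omega> H L \<and> ae_eq \<Omega> (U 0) (L2_proj \<Omega> (Jh \<Omega> H L) u\<^sub>0) \<and>
     (\<forall>n\<in>{1..N}. U n \<in> Jh \<Omega> H L \<and>
        (\<forall>\<phi>\<in>Jh \<Omega> H L.
           L2_inner \<Omega> (bdiff k U n) \<phi> + \<mu> * a_form \<Omega> (U n) \<phi>
             + a_form \<Omega> (memory_sum \<gamma> \<delta> k U n) \<phi>
           = L2_inner \<Omega> (f (real n * k)) \<phi> - b_form \<Omega> (U n) (U n) \<phi>))"

end

theory Submission
  imports Defs "HOL-Computational_Algebra.Polynomial" "HOL-Library.Function_Algebras"
begin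

text \<open>
  The estimate is uniform in time because viscosity dissipates at a fixed rate: the energy
  \<open>\<parallel>U\<parallel>\<^sup>2 + (q/\<gamma>) \<parallel>\<nabla>G\<parallel>\<^sup>2\<close>, with \<open>G\<close> the memory sum and \<open>q = e\<^sup>-\<^sup>\<delta>\<^sup>k\<close>, stays bounded, and the
  gradients are summable over every time window of unit length (\<open>energy_step\<close>). A bound for \<open>\<parallel>\<nabla>U\<parallel>\<close>
  then follows from a discrete uniform Gronwall argument.

  In that argument the scheme is tested with the discrete Stokes operator applied to
  \<open>Z = U + G/\<mu>\<close>. In terms of \<open>Z\<close>, viscosity and memory form a single coercive term, and the
  recursion \<open>G\<^sub>n\<^sub>+\<^sub>1 = k\<gamma> U\<^sub>n\<^sub>+\<^sub>1 + q G\<^sub>n\<close> of the exponential kernel shows that \<open>G\<close> relaxes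
  towards \<open>\<mu> Z\<close> (\<open>memory_step\<close>). The convective term brings \<open>\<parallel>\<nabla>U\<parallel>\<^sup>4\<close>, which is linear in \<open>\<parallel>\<nabla>Z\<parallel>\<^sup>2\<close>
  with a coefficient summable over unit windows, and a term of order \<open>3/2\<close> in \<open>\<parallel>\<Delta>\<^sub>hG\<parallel>\<close>. As
  \<open>3/2 < 2\<close>, the bound for \<open>\<parallel>\<Delta>\<^sub>hG\<parallel>\<^sup>2\<close> that results from the memory recursion closes
  (\<open>uniform_bound\<close>, \<open>dissipation_step\<close>). The implicit treatment of the convective term is
  harmless, because one step multiplies \<open>\<parallel>\<nabla>U\<parallel>\<^sup>2\<close> by a bounded factor only (\<open>growth\<close>) and, the
  assumption on \<open>\<alpha>\<^sub>0\<close> bounding \<open>k\<close>, a step never exceeds a fixed length.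

  The analytic core is the estimate of the convective term,
  \<open>\<bar>b(u, u, \<phi>)\<bar> \<le> C (\<parallel>u\<parallel> \<parallel>\<Delta>\<^sub>hu\<parallel>)\<^sup>3\<^sup>/\<^sup>4 \<parallel>\<nabla>u\<parallel>\<^sup>1\<^sup>/\<^sup>2 \<parallel>\<phi>\<parallel>\<close> (\<open>nonlinear_bound\<close>). A discretely
  solenoidal \<open>u\<close> is compared with the \<open>H\<^sup>2\<close> solution \<open>w\<close> of the Stokes problem whose finite
  element approximation it is (\<open>stokes_comparison\<close>); the difference is small enough for the
  inverse inequality. For \<open>w\<close> one needs bounds that hold on an arbitrary bounded open set, without
  extension operators: Ladyzhenskaya's inequality (\<open>ladyzhenskaya\<close>), Agmon's inequality
  (\<open>H10_sup_bound\<close>) and a bound of \<open>u \<partial>\<^sub>jw\<close> by integration by parts (\<open>H10_mult_deriv\<close>) are derived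
  from the zero trace alone, by approximation with test functions.
\<close>

section \<open>Smooth functions\<close>

definition smooth :: "('a::euclidean_space \<Rightarrow> real) \<Rightarrow> bool" where
  "smooth \<phi> \<longleftrightarrow> (\<forall>m. Ck m \<phi>)"

lemma Ck_continuous: "Ck m \<phi> \<Longrightarrow> continuous_on UNIV \<phi>"
  by (cases m)
    (auto intro!: differentiable_imp_continuous_on simp: differentiable_on_def
      intro: differentiable_at_withinI)

lemma Ck_Suc_imp_Ck: "Ck (Suc m) \<phi> \<Longrightarrow> Ck m \<phi>"
proof (induction m arbitrary: \<phi>)
  case 0
  then show ?case using Ck_continuous by fastforce
next
  case (Suc m)
  then show ?case by (metis Ck.simps(2))
qed

lemma has_derivative_frechet:
  "(\<And>x. (\<phi> has_derivative D x) (at x)) \<Longrightarrow> dir_deriv e \<phi> = (\<lambda>x. D x e)"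
  by (metis frechet_derivative_at)

lemma Ck_SucI:
  assumes "\<And>x. (\<phi> has_derivative D x) (at x)" "\<And>e. e \<in> Basis \<Longrightarrow> Ck m (\<lambda>x. D x e)"
  shows "Ck (Suc m) \<phi>"
  using assms has_derivative_frechet[OF assms(1)] by (auto simp: differentiable_def)

lemma Ck_Suc_has_derivative:
  "Ck (Suc m) \<phi> \<Longrightarrow> (\<phi> has_derivative frechet_derivative \<phi> (at x)) (at x)"
  by (simp add: frechet_derivative_works)

lemma Ck_const [simp]: "Ck m (\<lambda>x. c)"
proof (induction m arbitrary: c)
  case (Suc m)
  show ?case by (rule Ck_SucI[where D="\<lambda>x h. 0"]) (auto intro: Suc)
qed simp

lemma Ck_add: "Ck m \<phi> \<Longrightarrow> Ck m \<psi> \<Longrightarrow> Ck m (\<lambda>x. \<phi> x + \<psi> x)"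
proof (induction m arbitrary: \<phi> \<psi>)
  case (Suc m)
  show ?case
    by (rule Ck_SucI[where D="\<lambda>x h. frechet_derivative \<phi> (at x) h + frechet_derivative \<psi> (at x) h"])
      (use Suc in \<open>auto intro!: has_derivative_add Ck_Suc_has_derivative\<close>)
qed (auto intro: continuous_intros)

lemma Ck_mult: "Ck m \<phi> \<Longrightarrow> Ck m \<psi> \<Longrightarrow> Ck m (\<lambda>x. \<phi> x * \<psi> x)"
proof (induction m arbitrary: \<phi> \<psi>)
  case (Suc m)
  have *: "Ck m \<phi>" "Ck m \<psi>" using Suc.prems Ck_Suc_imp_Ck by blast+
  show ?case
    by (rule Ck_SucI[where D="\<lambda>x h. \<phi> x * frechet_derivative \<psi> (at x) h
        + frechet_derivative \<phi> (at x) h * \<psi> x"])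
      (use Suc * in \<open>auto intro!: has_derivative_mult Ck_Suc_has_derivative Ck_add Suc.IH\<close>)
qed (auto intro: continuous_intros)

lemma Ck_affine:
  fixes f :: "real \<Rightarrow> real"
  shows "Ck m f \<Longrightarrow> Ck m (\<lambda>x. f (a \<bullet> x + c))"
proof (induction m arbitrary: f)
  case 0
  then show ?case
    by (auto intro!: continuous_on_compose2[of UNIV f] continuous_intros)
next
  case (Suc m)
  have lin: "frechet_derivative f (at y) t = t * frechet_derivative f (at y) 1" for y t
  proof -
    have "linear (frechet_derivative f (at y))"
      using Suc.prems by (auto intro: linear_frechet_derivative)
    from linear_scale[OF this, of t 1] show ?thesis by simp
  qed
  show ?case
  proof (rule Ck_SucI[where D="\<lambda>x h. frechet_derivative f (at (a \<bullet> x + c)) (a \<bullet> h)"])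
    show "((\<lambda>x. f (a \<bullet> x + c)) has_derivative
        (\<lambda>h. frechet_derivative f (at (a \<bullet> x + c)) (a \<bullet> h))) (at x)" for x
      by (rule has_derivative_compose[where g=f, OF _ Ck_Suc_has_derivative[OF Suc.prems]])
        (auto intro!: derivative_eq_intros)
    fix e :: 'a
    have "Ck m (dir_deriv 1 f)" using Suc.prems by auto
    from Ck_mult[OF Ck_const[of m "a \<bullet> e"] Suc.IH[OF this]]
    show "Ck m (\<lambda>x. frechet_derivative f (at (a \<bullet> x + c)) (a \<bullet> e))"
      by (simp add: lin[of _ "a \<bullet> e"])
  qed
qed

lemma smooth_const [simp]: "smooth (\<lambda>x. c)" by (simp add: smooth_def)

lemma smooth_add: "smooth \<phi> \<Longrightarrow> smooth \<psi> \<Longrightarrow> smooth (\<lambda>x. \<phi> x + \<psi> x)"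
  by (simp add: smooth_def Ck_add)

lemma smooth_mult: "smooth \<phi> \<Longrightarrow> smooth \<psi> \<Longrightarrow> smooth (\<lambda>x. \<phi> x * \<psi> x)"
  by (simp add: smooth_def Ck_mult)

lemma smooth_affine: "smooth (f :: real \<Rightarrow> real) \<Longrightarrow> smooth (\<lambda>x. f (a \<bullet> x + c))"
  by (simp add: smooth_def Ck_affine)

lemma smooth_component: "smooth f \<Longrightarrow> smooth (\<lambda>x::real^'n. f (x $ i))"
  using smooth_affine[of f "axis i 1 :: real^'n" 0] by (simp add: inner_axis')

lemma smooth_continuous: "smooth \<phi> \<Longrightarrow> continuous_on UNIV \<phi>"
  using Ck_continuous smooth_def by blast

lemma smooth_has_derivative:
  "smooth \<phi> \<Longrightarrow> (\<phi> has_derivative frechet_derivative \<phi> (at x)) (at x)"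
  unfolding smooth_def using Ck_Suc_has_derivative by blast

lemma smooth_dir_deriv: "smooth \<phi> \<Longrightarrow> e \<in> Basis \<Longrightarrow> smooth (dir_deriv e \<phi>)"
  unfolding smooth_def by (metis Ck.simps(2))

lemma dir_deriv_add:
  "smooth \<phi> \<Longrightarrow> smooth \<psi> \<Longrightarrow> dir_deriv e (\<lambda>x. \<phi> x + \<psi> x) = (\<lambda>x. dir_deriv e \<phi> x + dir_deriv e \<psi> x)"
  by (rule has_derivative_frechet) (auto intro!: has_derivative_add smooth_has_derivative)

lemma dir_deriv_mult:
  "smooth \<phi> \<Longrightarrow> smooth \<psi> \<Longrightarrow>
    dir_deriv e (\<lambda>x. \<phi> x * \<psi> x) = (\<lambda>x. \<phi> x * dir_deriv e \<psi> x + dir_deriv e \<phi> x * \<psi> x)"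
  by (rule has_derivative_frechet) (auto intro!: has_derivative_mult smooth_has_derivative)

lemma dir_deriv_cmult:
  "smooth \<phi> \<Longrightarrow> dir_deriv e (\<lambda>x. c * \<phi> x) = (\<lambda>x. c * dir_deriv e \<phi> x)"
  by (subst dir_deriv_mult) auto

text \<open>
  The functions \<open>p (1/x) exp (-1/x)\<close>, extended by zero to \<open>x \<le> 0\<close>, are closed under
  differentiation: the derivative is of the same form with another polynomial \<open>p\<close>. This makes
  smoothness a plain induction.
\<close>

definition flat :: "real poly \<Rightarrow> real \<Rightarrow> real" where
  "flat p x = (if x > 0 then poly p (1 / x) * exp (- (1 / x)) else 0)"

lemma poly_exp_decay: "((\<lambda>t. poly p t * exp (- t)) \<longlongrightarrow> 0) at_top" for p :: "real poly"
proof -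
  have "((\<lambda>t. t ^ k * poly p t * exp (- t)) \<longlongrightarrow> 0) at_top" for k
  proof (induction p arbitrary: k rule: pCons_induct)
    case (pCons a p)
    have "((\<lambda>t::real. t ^ k / exp t) \<longlongrightarrow> 0) at_top" by (rule tendsto_power_div_exp_0)
    from tendsto_add[OF tendsto_mult_left[OF this, of a] pCons.IH[of "Suc k"]]
    show ?case by (simp add: algebra_simps exp_minus divide_inverse)
  qed simp
  from this[of 0] show ?thesis by simp
qed

lemma flat_has_derivative:
  "(flat p has_real_derivative flat ([:0, 0, 1:] * (p - pderiv p)) x) (at x)"
proof -
  consider "x > 0" | "x < 0" | "x = 0" by linarith
  then show ?thesis
  proof cases
    case 1
    have "((\<lambda>x. poly p (1 / x) * exp (- (1 / x))) has_real_derivative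
        flat ([:0, 0, 1:] * (p - pderiv p)) x) (at x)"
    proof -
      have "((\<lambda>x. 1 / x) has_real_derivative - (1 / x * (1 / x))) (at x)"
        using 1 by (auto intro!: derivative_eq_intros)
      from DERIV_mult[OF DERIV_chain2[OF poly_DERIV[of p] this] DERIV_chain2[OF DERIV_exp DERIV_minus[OF this]]]
      show ?thesis
        by (rule DERIV_cong) (use 1 in \<open>simp add: flat_def algebra_simps\<close>)
    qed
    then show ?thesis
      by (rule DERIV_cong_ev[THEN iffD1, rotated -1])
        (use 1 in \<open>auto simp: flat_def intro: eventually_mono[OF eventually_nhds_in_open[of "{0<..}"]]\<close>)
  next
    case 2
    have "((\<lambda>x. 0) has_real_derivative flat ([:0, 0, 1:] * (p - pderiv p)) x) (at x)"
      using 2 by (simp add: flat_def)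
    then show ?thesis
      by (rule DERIV_cong_ev[THEN iffD1, rotated -1])
        (use 2 in \<open>auto simp: flat_def intro: eventually_mono[OF eventually_nhds_in_open[of "{..<0}"]]\<close>)
  next
    case 3
    have "((\<lambda>h. flat p h / h) \<longlongrightarrow> 0) (at_right 0)"
    proof -
      have "((\<lambda>h. poly ([:0, 1:] * p) (inverse h) * exp (- inverse h)) \<longlongrightarrow> 0) (at_right 0)"
        by (rule filterlim_compose[OF poly_exp_decay filterlim_inverse_at_top_right])
      then show ?thesis
        by (rule Lim_transform_eventually)
          (auto simp: flat_def eventually_at_right_field divide_inverse mult_ac intro!: exI[of _ 1])
    qed
    moreover have "((\<lambda>h. flat p h / h) \<longlongrightarrow> 0) (at_left 0)"
      by (rule Lim_transform_eventually[OF tendsto_const])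
        (auto simp: flat_def eventually_at_left_field intro!: exI[of _ "-1"])
    ultimately have "((\<lambda>h. flat p h / h) \<longlongrightarrow> 0) (at 0)"
      by (simp add: filterlim_at_split)
    then show ?thesis using 3 by (simp add: DERIV_def flat_def)
  qed
qed

lemma smooth_flat: "smooth (flat p)"
proof -
  have "Ck m (flat p)" for m
  proof (induction m arbitrary: p)
    case 0
    show ?case
      by (simp add: continuous_at_imp_continuous_on DERIV_isCont[OF flat_has_derivative])
  next
    case (Suc m)
    show ?case
      by (rule Ck_SucI[OF flat_has_derivative[unfolded has_field_derivative_def]]) (use Suc in auto)
  qed
  then show ?thesis by (simp add: smooth_def)
qed

text \<open>
  As \<open>n\<close> grows, \<open>bump a b n\<close> increases to the indicator of the open interval.
\<close>

definition bump :: "real \<Rightarrow> real \<Rightarrow> nat \<Rightarrow> real \<Rightarrow> real" where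
  "bump a b n x = flat 1 (real n * (x - a)) * flat 1 (real n * (b - x))"

lemma smooth_bump: "smooth (bump a b n)"
proof -
  have "smooth (\<lambda>x. flat 1 (real n \<bullet> x + (- real n * a)) * flat 1 ((- real n) \<bullet> x + real n * b))"
    by (intro smooth_mult smooth_affine smooth_flat)
  then show ?thesis by (simp add: bump_def[abs_def] algebra_simps)
qed

lemma bump_nonneg: "0 \<le> bump a b n x" and bump_le_1: "bump a b n x \<le> 1"
  and bump_outside: "x \<notin> {a..b} \<Longrightarrow> bump a b n x = 0"
  by (auto simp: bump_def flat_def mult_le_one zero_less_mult_iff)

lemma bump_tendsto: "(\<lambda>n. bump a b n x) \<longlonglongrightarrow> indicat_real {a<..<b} x"
proof (cases "x \<in> {a<..<b}")
  case True
  have *: "(\<lambda>n. flat 1 (real n * c)) \<longlonglongrightarrow> 1" if "c > 0" for c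
  proof -
    have "(\<lambda>n. exp (- (1 / (real n * c)))) \<longlonglongrightarrow> exp (- 0)"
    proof (intro tendsto_intros)
      have "(\<lambda>n. (1 / real n) * (1 / c)) \<longlonglongrightarrow> 0 * (1 / c)"
        by (intro tendsto_intros lim_1_over_n)
      then show "(\<lambda>n. 1 / (real n * c)) \<longlonglongrightarrow> 0" by simp
    qed
    then have "(\<lambda>n. exp (- (1 / (real n * c)))) \<longlonglongrightarrow> 1" by simp
    then show ?thesis
      by (rule Lim_transform_eventually)
        (use that in \<open>auto simp: flat_def eventually_sequentially intro!: exI[of _ 1]\<close>)
  qed
  from tendsto_mult[OF *[of "x - a"] *[of "b - x"]] True show ?thesis
    by (simp add: bump_def)
next
  case False
  then have "x < a \<or> x > b \<or> x = a \<or> x = b" by auto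
  then have "bump a b n x = 0" for n
    by (auto simp: bump_def flat_def zero_less_mult_iff)
  then show ?thesis using False by simp
qed

text \<open>
  A primitive of a bump stays between \<open>0\<close> and the length of the interval. These functions are the
  multipliers in the pointwise bound further below, where that length turns into the side of a
  box.
\<close>

lemma smooth_primitive:
  assumes "smooth f" "a \<le> b" "\<And>x. 0 \<le> f x" "\<And>x. f x \<le> 1" "\<And>x. x \<notin> {a..b} \<Longrightarrow> f x = (0::real)"
  obtains F where "smooth F" "\<And>x. (F has_real_derivative f x) (at x)"
    "\<And>x. 0 \<le> F x" "\<And>x. F x \<le> b - a"
proof -
  define F where "F x = integral {a - 1..x} f" for x
  have cont: "continuous_on S f" for S using smooth_continuous[OF assms(1)] continuous_on_subset by blast
  have int: "f integrable_on {c..d}" for c d by (rule integrable_continuous_real[OF cont])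
  have neg: "F x = 0" if "x < a" for x
    unfolding F_def by (subst integral_cong[of _ f "\<lambda>_. 0"]) (use that assms(5) in auto)
  have der: "(F has_real_derivative f x) (at x)" for x
  proof (cases "x < a")
    case True
    have "((\<lambda>x. 0) has_real_derivative f x) (at x)" using True assms(5) by simp
    then show ?thesis
      by (rule DERIV_cong_ev[THEN iffD1, rotated -1])
        (use True neg in \<open>auto intro: eventually_mono[OF eventually_nhds_in_open[of "{..<a}"]]\<close>)
  next
    case False
    have "(F has_real_derivative f x) (at x within {a - 1..x + 1})"
      unfolding F_def by (rule integral_has_real_derivative[OF cont]) (use False in auto)
    moreover have "at x within {a - 1..x + 1} = at x"
      by (rule at_within_interior) (use False in auto)
    ultimately show ?thesis by simp
  qed
  have F0: "0 \<le> F x" for x unfolding F_def by (rule integral_nonneg[OF int]) (use assms(3) in auto)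
  have mono: "F x \<le> F y" if "x \<le> y" for x y
    unfolding F_def using that int assms(3) by (intro integral_subset_le) auto
  have "F x \<le> b - a" for x
  proof -
    have "F x \<le> F (max x b)" by (rule mono) simp
    also have "F (max x b) = integral {a..b} f"
      unfolding F_def
      by (rule integral_unique, rule has_integral_on_superset[OF integrable_integral[OF int]])
        (use assms(5) in \<open>auto\<close>)
    also have "\<dots> \<le> integral {a..b} (\<lambda>_. 1)"
      using int assms(4) by (intro integral_le) auto
    also have "\<dots> = b - a" using assms(2) by simp
    finally show ?thesis .
  qed
  moreover have "smooth F"
    unfolding smooth_def
  proof
    fix m show "Ck m F"
    proof (cases m)
      case 0
      then show ?thesis by (simp add: continuous_at_imp_continuous_on DERIV_isCont[OF der])
    next
      case (Suc l)
      show ?thesis unfolding Suc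
        by (rule Ck_SucI[OF der[unfolded has_field_derivative_def]])
          (use assms(1) in \<open>auto simp: smooth_def\<close>)
    qed
  qed
  ultimately show ?thesis using der F0 that by blast
qed

section \<open>The fundamental lemma of the calculus of variations\<close>

text \<open>
  Boxes with disjoint interiors overlap only in their frontiers, which are null sets.
\<close>

lemma indicator_Union_nonoverlapping:
  fixes D :: "'a::euclidean_space set set"
  assumes "countable D" "\<And>K. K \<in> D \<Longrightarrow> \<exists>c d. K = cbox c d"
    "pairwise (\<lambda>A B. interior A \<inter> interior B = {}) D"
  shows "AE x in lebesgue. \<forall>F. finite F \<longrightarrow> F \<subseteq> D \<longrightarrow>
           indicat_real (\<Union>F) x = (\<Sum>K\<in>F. indicator K x)"
proof -
  have "frontier K \<in> null_sets lebesgue" if "K \<in> D" for K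
  proof -
    from assms(2)[OF that] obtain c d where "K = cbox c d" by blast
    then show ?thesis using negligible_frontier_interval[of c d] by (simp add: negligible_iff_null_sets frontier_cbox)
  qed
  then have "AE x in lebesgue. \<forall>K\<in>D. x \<notin> frontier K"
    by (subst AE_ball_countable[OF assms(1)]) (auto intro: AE_not_in)
  then show ?thesis
  proof (rule AE_mp, intro AE_I2 impI allI)
    fix x F assume x: "\<forall>K\<in>D. x \<notin> frontier K" and F: "finite F" "F \<subseteq> D"
    have int: "x \<in> interior K" if "K \<in> F" "x \<in> K" for K
      using that x F by (auto simp: frontier_def closure_def)
    show "indicat_real (\<Union>F) x = (\<Sum>K\<in>F. indicator K x)"
    proof (cases "x \<in> \<Union>F")
      case True
      then obtain K where K: "K \<in> F" "x \<in> K" by blast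
      have "indicat_real L x = 0" if "L \<in> F - {K}" for L
        using that int[OF K] int[of L] assms(3) K F by (auto simp: pairwise_def indicator_def)
      then have "(\<Sum>L\<in>F. indicat_real L x) = indicat_real K x"
        using F K by (subst sum.remove[of F K]) auto
      then show ?thesis using True K by simp
    next
      case False
      then show ?thesis by (auto simp: indicator_def intro!: sum.neutral[symmetric])
    qed
  qed
qed

lemma integral_nonneg_Union_boxes:
  fixes g :: "'a::euclidean_space \<Rightarrow> real"
  assumes g: "integrable lebesgue g"
    and pos: "\<And>a b. 0 \<le> (LINT x|lebesgue. indicator (cbox a b) x * g x)"
    and D: "countable D" "\<And>K. K \<in> D \<Longrightarrow> \<exists>c d. K = cbox c d"
      "pairwise (\<lambda>A B. interior A \<inter> interior B = {}) D"
  shows "0 \<le> (LINT x|lebesgue. indicator (\<Union>D) x * g x)"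
proof (cases "D = {}")
  case False
  define F where "F m = from_nat_into D ` {..<m}" for m
  have F: "finite (F m)" "F m \<subseteq> D" for m
    using from_nat_into[OF False] by (auto simp: F_def)
  have meas: "K \<in> sets lebesgue" if "K \<in> D" for K using D(2)[OF that] by auto
  then have measU: "\<Union>(F m) \<in> sets lebesgue" for m using F by (intro sets.finite_Union) auto
  have int: "integrable lebesgue (\<lambda>x. indicat_real K x * g x)" if "K \<in> sets lebesgue" for K
    using integrable_mult_indicator[OF that g] by simp
  have "(\<lambda>m. LINT x|lebesgue. indicator (\<Union>(F m)) x * g x) \<longlonglongrightarrow>
      (LINT x|lebesgue. indicator (\<Union>D) x * g x)"
  proof (rule integral_dominated_convergence[where w="\<lambda>x. \<bar>g x\<bar>"])
    show "(\<lambda>x. indicator (\<Union>D) x * g x) \<in> borel_measurable lebesgue"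
      using borel_measurable_integrable[OF int[of "\<Union>D"]] meas D(1)
      by (metis (no_types, lifting) sets.countable_Union subsetI)
    show "(\<lambda>x. indicator (\<Union>(F m)) x * g x) \<in> borel_measurable lebesgue" for m
      using borel_measurable_integrable[OF int[OF measU]] by simp
    show "integrable lebesgue (\<lambda>x. \<bar>g x\<bar>)" using g by simp
    show "AE x in lebesgue. norm (indicat_real (\<Union>(F m)) x * g x) \<le> \<bar>g x\<bar>" for m
      by (auto simp: indicator_def)
    show "AE x in lebesgue. (\<lambda>m. indicat_real (\<Union>(F m)) x * g x) \<longlonglongrightarrow> indicat_real (\<Union>D) x * g x"
    proof (intro AE_I2 tendsto_mult_right)
      fix x
      show "(\<lambda>m. indicat_real (\<Union>(F m)) x) \<longlonglongrightarrow> indicat_real (\<Union>D) x"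
      proof (cases "x \<in> \<Union>D")
        case True
        then obtain K where K: "K \<in> D" "x \<in> K" by blast
        from from_nat_into_surj[OF D(1) K(1)] obtain i where "from_nat_into D i = K" by blast
        then have "K \<in> F m" if "m \<ge> Suc i" for m
          unfolding F_def by (intro image_eqI[of _ _ i]) (use that in simp_all)
        then have "indicat_real (\<Union>(F m)) x = 1" if "m \<ge> Suc i" for m
          using K(2) that by (metis UnionI indicator_simps(1))
        moreover have "indicat_real (\<Union>D) x = 1" using True by simp
        ultimately have "\<forall>\<^sub>F m in sequentially. indicat_real (\<Union>(F m)) x = indicat_real (\<Union>D) x"
          unfolding eventually_sequentially by metis
        then show ?thesis by (rule tendsto_eventually)
      next
        case False
        then have "x \<notin> \<Union>(F m)" for m using F(2) by blast
        then show ?thesis using False by (simp add: indicator_def)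
      qed
    qed
  qed
  moreover have "0 \<le> (LINT x|lebesgue. indicator (\<Union>(F m)) x * g x)" for m
  proof -
    have nonoverlap: "AE x in lebesgue. \<forall>F. finite F \<longrightarrow> F \<subseteq> D \<longrightarrow>
        indicat_real (\<Union>F) x = (\<Sum>K\<in>F. indicator K x)"
      by (rule indicator_Union_nonoverlapping) (use D in blast)+
    have ae: "AE x in lebesgue. indicator (\<Union>(F m)) x * g x = (\<Sum>K\<in>F m. indicator K x * g x)"
      using nonoverlap
    proof eventually_elim
      case (elim x)
      then have "indicat_real (\<Union>(F m)) x = (\<Sum>K\<in>F m. indicator K x)" using F by blast
      then show ?case by (simp add: sum_distrib_right)
    qed
    have m1: "(\<lambda>x. indicator (\<Union>(F m)) x * g x) \<in> borel_measurable lebesgue"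
      using int[OF measU] by (rule borel_measurable_integrable)
    have m2: "(\<lambda>x. \<Sum>K\<in>F m. indicator K x * g x) \<in> borel_measurable lebesgue"
      by (intro borel_measurable_sum borel_measurable_integrable[OF int] meas) (use F in blast)
    from integral_cong_AE[OF m1 m2 ae]
    have "(LINT x|lebesgue. indicator (\<Union>(F m)) x * g x)
        = (LINT x|lebesgue. (\<Sum>K\<in>F m. indicator K x * g x))" .
    also have "\<dots> = (\<Sum>K\<in>F m. LINT x|lebesgue. indicator K x * g x)"
      by (intro Bochner_Integration.integral_sum int meas) (use F in blast)
    also have "\<dots> \<ge> 0"
    proof (rule sum_nonneg)
      fix K assume "K \<in> F m"
      then obtain c d where "K = cbox c d" using D(2) F by blast
      then show "0 \<le> (LINT x|lebesgue. indicator K x * g x)" using pos by simp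
    qed
    finally show ?thesis .
  qed
  ultimately show ?thesis by (auto intro: LIMSEQ_le_const)
qed simp

text \<open>
  The part \<open>N\<close> of \<open>{x. g x < 0}\<close> inside a box is covered up to a small error by countably many
  non-overlapping boxes. The integral of \<open>g\<close> over the cover is nonnegative, and in the limit so is
  the integral over \<open>N\<close>, which forces \<open>N\<close> to be null.
\<close>

lemma AE_nonneg_of_boxes:
  fixes g :: "'a::euclidean_space \<Rightarrow> real"
  assumes g: "integrable lebesgue g"
    and pos: "\<And>a b. 0 \<le> (LINT x|lebesgue. indicator (cbox a b) x * g x)"
  shows "AE x in lebesgue. 0 \<le> g x"
proof -
  have gm [measurable]: "g \<in> borel_measurable lebesgue" using g by simp
  have int: "integrable lebesgue (\<lambda>x. indicat_real K x * g x)" if "K \<in> sets lebesgue" for K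
    using integrable_mult_indicator[OF that g] by simp
  have "AE x in lebesgue. x \<in> cbox a b \<longrightarrow> 0 \<le> g x" for a b :: 'a
  proof -
    define N where "N = {x. g x < 0} \<inter> cbox a b"
    have "{x \<in> space lebesgue. g x < 0} \<in> sets lebesgue" by measurable
    then have N: "N \<in> lmeasurable" "N \<subseteq> cbox a b"
      unfolding N_def using lmeasurable_cbox[of a b] by (auto intro: fmeasurable_Int_fmeasurable simp: Int_commute)
    have "\<exists>U. U \<in> lmeasurable \<and> N \<subseteq> U \<and> measure lebesgue U \<le> measure lebesgue N + 1 / real (Suc n)
        \<and> 0 \<le> (LINT x|lebesgue. indicator U x * g x)" for n
    proof -
      have "0 < 1 / real (Suc n)" by simp
      obtain D where D: "countable D" "\<And>K. K \<in> D \<Longrightarrow> K \<subseteq> cbox a b \<and> K \<noteq> {} \<and> (\<exists>c d. K = cbox c d)"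
        "pairwise (\<lambda>A B. interior A \<inter> interior B = {}) D"
        "N \<subseteq> \<Union>D" "\<Union>D \<in> lmeasurable" "measure lebesgue (\<Union>D) \<le> measure lebesgue N + 1 / real (Suc n)"
        by (rule measurable_outer_intervals_bounded[OF N \<open>0 < 1 / real (Suc n)\<close>]) blast
      have "0 \<le> (LINT x|lebesgue. indicator (\<Union>D) x * g x)"
        by (rule integral_nonneg_Union_boxes[OF g pos D(1) _ D(3)]) (use D(2) in blast)
      with D(4-6) show ?thesis by blast
    qed
    then obtain U where U: "\<And>n. U n \<in> lmeasurable" "\<And>n. N \<subseteq> U n"
      "\<And>n. measure lebesgue (U n) \<le> measure lebesgue N + 1 / real (Suc n)"
      "\<And>n. 0 \<le> (LINT x|lebesgue. indicator (U n) x * g x)" by metis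
    have UN: "U n - N \<in> lmeasurable" for n using U(1) N(1) by blast
    have "(\<lambda>n. measure lebesgue (U n - N)) \<longlonglongrightarrow> 0"
    proof (rule tendsto_sandwich[OF _ _ tendsto_const LIMSEQ_Suc[OF lim_1_over_n]])
      show "\<forall>\<^sub>F n in sequentially. measure lebesgue (U n - N) \<le> 1 / real (Suc n)"
        using U N by (intro always_eventually allI)
          (subst measurable_measure_Diff, auto simp: algebra_simps intro: fmeasurableD)
    qed auto
    then have "\<exists>r::nat\<Rightarrow>nat. strict_mono r \<and> (AE x in lebesgue. (\<lambda>n. indicat_real (U (r n) - N) x) \<longlonglongrightarrow> 0)"
      by (intro tendsto_L1_AE_subseq) (use UN in \<open>auto simp: lmeasurable_iff_integrable\<close>)
    then obtain r :: "nat \<Rightarrow> nat" where r: "AE x in lebesgue. (\<lambda>n. indicat_real (U (r n) - N) x) \<longlonglongrightarrow> 0" by blast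
    have "(\<lambda>n. LINT x|lebesgue. indicator (U (r n)) x * g x) \<longlonglongrightarrow> (LINT x|lebesgue. indicator N x * g x)"
    proof (rule integral_dominated_convergence[where w="\<lambda>x. \<bar>g x\<bar>"])
      show "(\<lambda>x. indicator N x * g x) \<in> borel_measurable lebesgue"
        using borel_measurable_integrable[OF int] N(1) by blast
      show "(\<lambda>x. indicator (U (r m)) x * g x) \<in> borel_measurable lebesgue" for m
        using borel_measurable_integrable[OF int] U(1) by blast
      show "integrable lebesgue (\<lambda>x. \<bar>g x\<bar>)" using g by simp
      show "AE x in lebesgue. norm (indicat_real (U (r m)) x * g x) \<le> \<bar>g x\<bar>" for m
        by (auto simp: indicator_def)
      show "AE x in lebesgue. (\<lambda>m. indicat_real (U (r m)) x * g x) \<longlonglongrightarrow> indicat_real N x * g x"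
        using r
      proof (rule AE_mp, intro AE_I2 impI tendsto_mult_right)
        fix x assume *: "(\<lambda>n. indicat_real (U (r n) - N) x) \<longlonglongrightarrow> 0"
        have "indicat_real (U (r n)) x = indicat_real N x + indicat_real (U (r n) - N) x" for n
          using U(2)[of "r n"] by (auto simp: indicator_def)
        then show "(\<lambda>n. indicat_real (U (r n)) x) \<longlonglongrightarrow> indicat_real N x"
          using tendsto_add[OF tendsto_const *] by simp
      qed
    qed
    then have "0 \<le> (LINT x|lebesgue. indicator N x * g x)"
      by (rule LIMSEQ_le_const) (use U(4) in auto)
    moreover have le: "indicator N x * g x \<le> 0" for x by (auto simp: N_def indicator_def)
    moreover have "0 \<le> (LINT x|lebesgue. - (indicator N x * g x))"
      by (rule integral_nonneg_AE) (use le in simp)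
    ultimately have "(LINT x|lebesgue. - (indicator N x * g x)) = 0" by simp
    then have "AE x in lebesgue. - (indicat_real N x * g x) = 0"
      using le int N(1) by (subst (asm) integral_nonneg_eq_0_iff_AE) auto
    then show ?thesis by (rule AE_mp) (auto simp: N_def indicator_def split: if_splits)
  qed
  then have "AE x in lebesgue. \<forall>n::nat. x \<in> cbox (- real n *\<^sub>R One) (real n *\<^sub>R One) \<longrightarrow> 0 \<le> g x"
    by (subst AE_all_countable) auto
  then show ?thesis
  proof (rule AE_mp, intro AE_I2 impI)
    fix x assume *: "\<forall>n::nat. x \<in> cbox (- real n *\<^sub>R One) (real n *\<^sub>R One) \<longrightarrow> 0 \<le> g x"
    obtain n :: nat where n: "norm x \<le> real n" using real_arch_simple by blast
    have "x \<in> cbox (- real n *\<^sub>R One) (real n *\<^sub>R One)"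
      unfolding mem_box
    proof
      fix i :: 'a assume i: "i \<in> Basis"
      from Basis_le_norm[OF this, of x] n i
      show "(- real n *\<^sub>R One) \<bullet> i \<le> x \<bullet> i \<and> x \<bullet> i \<le> (real n *\<^sub>R One) \<bullet> i"
        by (auto simp: abs_le_iff inner_sum_left_Basis)
    qed
    with * show "0 \<le> g x" by blast
  qed
qed

lemma test_functionsI:
  assumes "smooth \<phi>" "compact S" "S \<subseteq> \<Omega>" "\<And>x. x \<notin> S \<Longrightarrow> \<phi> x = 0"
  shows "\<phi> \<in> test_functions \<Omega>"
  using assms by (auto simp: test_functions_def smooth_def)

lemma test_functionsE:
  assumes "\<phi> \<in> test_functions \<Omega>"
  obtains S where "smooth \<phi>" "compact S" "S \<subseteq> \<Omega>" "\<And>x. x \<notin> S \<Longrightarrow> \<phi> x = 0"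
  using assms by (auto simp: test_functions_def smooth_def)

lemma test_smooth: "\<phi> \<in> test_functions \<Omega> \<Longrightarrow> smooth \<phi>"
  by (auto elim: test_functionsE)

definition box_bump :: "'a::euclidean_space \<Rightarrow> 'a \<Rightarrow> nat \<Rightarrow> 'a \<Rightarrow> real" where
  "box_bump a b n x = (\<Prod>i\<in>Basis. bump (a \<bullet> i) (b \<bullet> i) n (x \<bullet> i))"

lemma smooth_prod: "finite I \<Longrightarrow> (\<And>i. i \<in> I \<Longrightarrow> smooth (f i)) \<Longrightarrow> smooth (\<lambda>x. \<Prod>i\<in>I. f i x)"
  by (induction I rule: finite_induct) (auto intro: smooth_mult)

lemma smooth_box_bump: "smooth (box_bump a b n)"
proof -
  have "smooth (\<lambda>x. \<Prod>i\<in>Basis. bump (a \<bullet> i) (b \<bullet> i) n (i \<bullet> x + 0))"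
    by (intro smooth_prod smooth_affine smooth_bump) auto
  then show ?thesis by (simp add: box_bump_def[abs_def] inner_commute)
qed

lemma box_bump_nonneg: "0 \<le> box_bump a b n x"
  unfolding box_bump_def by (intro prod_nonneg) (auto intro: bump_nonneg)

lemma box_bump_le_1: "box_bump a b n x \<le> 1"
  unfolding box_bump_def by (intro prod_le_1) (auto intro: bump_nonneg bump_le_1)

lemma box_bump_outside: "x \<notin> cbox a b \<Longrightarrow> box_bump a b n x = 0"
  unfolding box_bump_def mem_box by (auto simp: prod_zero_iff intro!: bump_outside)

lemma box_bump_tendsto: "(\<lambda>n. box_bump a b n x) \<longlonglongrightarrow> indicat_real (box a b) x"
proof -
  have "(\<lambda>n. box_bump a b n x) \<longlonglongrightarrow> (\<Prod>i\<in>Basis. indicat_real {a \<bullet> i<..<b \<bullet> i} (x \<bullet> i))"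
    unfolding box_bump_def by (intro tendsto_prod bump_tendsto)
  also have "(\<Prod>i\<in>Basis. indicat_real {a \<bullet> i<..<b \<bullet> i} (x \<bullet> i)) = indicat_real (box a b) x"
    by (auto simp: indicator_def mem_box prod_zero_iff)
  finally show ?thesis .
qed

lemma integral_lebesgue_on:
  "\<Omega> \<in> sets lebesgue \<Longrightarrow> (LINT x|lebesgue_on \<Omega>. f x) = (LINT x|lebesgue. indicator \<Omega> x * (f x :: real))"
  by (simp add: integral_restrict_space)

lemma integrable_lebesgue_on:
  "\<Omega> \<in> sets lebesgue \<Longrightarrow> integrable (lebesgue_on \<Omega>) f \<longleftrightarrow> integrable lebesgue (\<lambda>x. indicator \<Omega> x * (f x :: real))"
  by (simp add: integrable_restrict_space)

text \<open>
  The lemma of du Bois-Reymond. Box bumps are test functions once the box lies in \<open>\<Omega>\<close>, so that \<open>f\<close>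
  integrates to zero over every such box, and \<open>f\<close> and \<open>-f\<close> are both nonnegative almost everywhere.
\<close>

lemma fundamental_lemma:
  fixes f :: "'a::euclidean_space \<Rightarrow> real"
  assumes "open \<Omega>" "locally_integrable \<Omega> f"
    and zero: "\<And>\<phi>. \<phi> \<in> test_functions \<Omega> \<Longrightarrow> L2_inner \<Omega> f \<phi> = 0"
  shows "AE x in lebesgue_on \<Omega>. f x = 0"
proof -
  have \<Omega>: "\<Omega> \<in> sets lebesgue" using assms(1) by (intro sets_completionI_sets) auto
  have zero_cbox: "AE x in lebesgue. x \<in> Q \<longrightarrow> f x = 0" if Q: "Q \<subseteq> \<Omega>" "Q = cbox p q" for p q Q
  proof -
    define g where "g x = indicator Q x * f x" for x
    have g: "integrable lebesgue g"
      using assms(2) that by (simp add: locally_integrable_def g_def[abs_def] integrable_lebesgue_on[symmetric])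
    have zero_box: "(LINT x|lebesgue. indicator (cbox a b) x * g x) = 0" for a b
    proof -
      obtain c d where cd: "cbox p q \<inter> cbox a b = cbox c d" by (rule that) (rule Int_interval)
      have sub: "cbox c d \<subseteq> Q" using cd that by blast
      have "(\<lambda>n. LINT x|lebesgue. box_bump c d n x * g x) \<longlonglongrightarrow> (LINT x|lebesgue. indicator (box c d) x * g x)"
      proof (rule integral_dominated_convergence[where w="\<lambda>x. \<bar>g x\<bar>"])
        have "(\<lambda>x. box_bump c d n x) \<in> borel_measurable lebesgue" for n
          using borel_measurable_continuous_onI[OF smooth_continuous[OF smooth_box_bump]]
          by (intro measurable_completion) simp
        then show "(\<lambda>x. box_bump c d n x * g x) \<in> borel_measurable lebesgue" for n
          using g by (intro borel_measurable_times) auto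
        show "AE x in lebesgue. norm (box_bump c d n x * g x) \<le> \<bar>g x\<bar>" for n
          using box_bump_le_1[of c d n] box_bump_nonneg[of c d n]
          by (auto simp: abs_mult intro!: mult_left_le_one_le)
        show "AE x in lebesgue. (\<lambda>n. box_bump c d n x * g x) \<longlonglongrightarrow> indicator (box c d) x * g x"
          by (auto intro!: tendsto_intros box_bump_tendsto)
      qed (use g fmeasurableD[OF lmeasurable_box] in \<open>auto intro!: borel_measurable_times borel_measurable_indicator\<close>)
      moreover have "(LINT x|lebesgue. box_bump c d n x * g x) = 0" for n
      proof -
        have "box_bump c d n \<in> test_functions \<Omega>"
          using sub that by (intro test_functionsI[of _ "cbox c d"] smooth_box_bump) (auto simp: box_bump_outside)
        from zero[OF this]
        have "(LINT x|lebesgue. indicator \<Omega> x * (f x * box_bump c d n x)) = 0"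
          by (simp add: L2_inner_def integral_lebesgue_on[OF \<Omega>])
        moreover have "indicator \<Omega> x * (f x * box_bump c d n x) = box_bump c d n x * g x" for x
        proof (cases "x \<in> cbox c d")
          case True
          then have "x \<in> Q" "x \<in> \<Omega>" using sub that by auto
          then show ?thesis by (simp add: g_def)
        qed (simp add: box_bump_outside)
        ultimately show ?thesis by simp
      qed
      ultimately have "(LINT x|lebesgue. indicator (box c d) x * g x) = 0"
        by (simp add: LIMSEQ_const_iff)
      moreover have ae: "AE x in lebesgue. indicat_real (box c d) x * g x = indicator (cbox a b) x * g x"
      proof -
        have "cbox c d - box c d \<in> null_sets lebesgue"
          using negligible_frontier_interval[of c d] negligible_iff_null_sets by blast
        from AE_not_in[OF this] show ?thesis
        proof (rule AE_mp, intro AE_I2 impI)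
          fix x assume x: "x \<notin> cbox c d - box c d"
          have "x \<in> cbox c d \<longleftrightarrow> x \<in> Q \<and> x \<in> cbox a b" using cd that by blast
          then show "indicat_real (box c d) x * g x = indicator (cbox a b) x * g x"
            using x box_subset_cbox[of c d] by (auto simp: g_def indicator_def)
        qed
      qed
      moreover have m: "(\<lambda>x. indicat_real (box c d) x * g x) \<in> borel_measurable lebesgue"
        "(\<lambda>x. indicat_real (cbox a b) x * g x) \<in> borel_measurable lebesgue"
        using g fmeasurableD[OF lmeasurable_box] fmeasurableD[OF lmeasurable_cbox]
        by (auto intro!: borel_measurable_times borel_measurable_indicator)
      ultimately show ?thesis using integral_cong_AE[OF m ae] by simp
    qed
    have "AE x in lebesgue. 0 \<le> g x" by (rule AE_nonneg_of_boxes[OF g]) (simp add: zero_box)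
    moreover have "AE x in lebesgue. 0 \<le> - g x"
      by (rule AE_nonneg_of_boxes) (use g zero_box in auto)
    ultimately show ?thesis by eventually_elim (auto simp: g_def)
  qed
  obtain D where D: "countable D" "D \<subseteq> Pow \<Omega>" "\<And>X. X \<in> D \<Longrightarrow> \<exists>a b. X = cbox a b" "\<Union>D = \<Omega>"
    by (rule open_countable_Union_open_cbox[OF assms(1)]) (rule that, assumption+)
  have "AE x in lebesgue. \<forall>Q\<in>D. x \<in> Q \<longrightarrow> f x = 0"
    unfolding AE_ball_countable[OF D(1)]
  proof
    fix Q assume Q: "Q \<in> D"
    then obtain a b where "Q = cbox a b" using D(3) by blast
    moreover have "Q \<subseteq> \<Omega>" using Q D(2) by blast
    ultimately show "AE x in lebesgue. x \<in> Q \<longrightarrow> f x = 0" by (rule zero_cbox[rotated])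
  qed
  then have "AE x in lebesgue. x \<in> \<Omega> \<longrightarrow> f x = 0"
    by eventually_elim (use D(4) in blast)
  then show ?thesis using \<Omega> by (simp add: AE_restrict_space_iff)
qed

section \<open>Semi-inner products\<close>

instantiation "fun" :: (type, real_vector) real_vector
begin

definition scaleR_fun :: "real \<Rightarrow> ('a \<Rightarrow> 'b) \<Rightarrow> 'a \<Rightarrow> 'b" where
  "scaleR_fun c f = (\<lambda>x. c *\<^sub>R f x)"

instance
  by standard (auto simp: scaleR_fun_def plus_fun_def algebra_simps)

end

lemma scaleR_fun_apply [simp]: "(c *\<^sub>R f) x = c *\<^sub>R f x"
  by (simp add: scaleR_fun_def)

lemma sum_fun_apply [simp]: "(\<Sum>i\<in>A. f i) x = (\<Sum>i\<in>A. f i x)"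
  by (induction A rule: infinite_finite_induct) auto

text \<open>
  Elements of the function spaces are functions, not equivalence classes, so that the inner
  product of \<open>L\<^sup>2\<close> and the Dirichlet form are only positive semidefinite. Their linear algebra is
  shared through this locale; the pointwise vector space structure on functions makes \<open>span\<close> and
  \<open>subspace\<close> available.
\<close>

locale semi_inner =
  fixes V :: "'v::real_vector set" and ip :: "'v \<Rightarrow> 'v \<Rightarrow> real"
  assumes V: "subspace V"
    and commute: "x \<in> V \<Longrightarrow> y \<in> V \<Longrightarrow> ip x y = ip y x"
    and add_left: "x \<in> V \<Longrightarrow> y \<in> V \<Longrightarrow> z \<in> V \<Longrightarrow> ip (x + y) z = ip x z + ip y z"
    and scale_left: "x \<in> V \<Longrightarrow> z \<in> V \<Longrightarrow> ip (c *\<^sub>R x) z = c * ip x z"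
    and nonneg: "x \<in> V \<Longrightarrow> 0 \<le> ip x x"
begin

lemmas mem = subspace_add[OF V] subspace_scale[OF V] subspace_diff[OF V] subspace_0[OF V] subspace_neg[OF V]

lemma add_right: "x \<in> V \<Longrightarrow> y \<in> V \<Longrightarrow> z \<in> V \<Longrightarrow> ip z (x + y) = ip z x + ip z y"
  and scale_right: "x \<in> V \<Longrightarrow> z \<in> V \<Longrightarrow> ip z (c *\<^sub>R x) = c * ip z x"
  by (simp_all add: commute[of z] mem add_left scale_left)

lemma minus_left: "x \<in> V \<Longrightarrow> z \<in> V \<Longrightarrow> ip (- x) z = - ip x z"
  using scale_left[of x z "-1"] by simp

lemma minus_right: "x \<in> V \<Longrightarrow> z \<in> V \<Longrightarrow> ip z (- x) = - ip z x"
  using scale_right[of x z "-1"] by simp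

lemma diff_left: "x \<in> V \<Longrightarrow> y \<in> V \<Longrightarrow> z \<in> V \<Longrightarrow> ip (x - y) z = ip x z - ip y z"
  using add_left[of x "- y" z] by (simp add: mem minus_left)

lemma diff_right: "x \<in> V \<Longrightarrow> y \<in> V \<Longrightarrow> z \<in> V \<Longrightarrow> ip z (x - y) = ip z x - ip z y"
  using add_right[of x "- y" z] by (simp add: mem minus_right)

lemmas linear_simps = add_left add_right scale_left scale_right minus_left minus_right
  diff_left diff_right

lemma cauchy_schwarz_sq:
  assumes "x \<in> V" "y \<in> V"
  shows "(ip x y)\<^sup>2 \<le> ip x x * ip y y"
proof -
  have *: "0 \<le> ip x x + 2 * t * ip x y + t\<^sup>2 * ip y y" for t
  proof -
    have "0 \<le> ip (x + t *\<^sub>R y) (x + t *\<^sub>R y)" using assms by (intro nonneg mem)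
    also have "\<dots> = ip x x + 2 * t * ip x y + t\<^sup>2 * ip y y"
      using assms by (simp add: linear_simps mem commute[of y x] algebra_simps power2_eq_square)
    finally show ?thesis .
  qed
  show ?thesis
  proof (cases "ip y y = 0")
    case True
    have "ip x y = 0"
    proof (rule ccontr)
      assume "ip x y \<noteq> 0"
      then have "2 * (- (ip x x + 1) / (2 * ip x y)) * ip x y = - (ip x x + 1)" by simp
      then show False using *[of "- (ip x x + 1) / (2 * ip x y)"] True by simp
    qed
    then show ?thesis using True by simp
  next
    case False
    with nonneg[OF assms(2)] have pos: "0 < ip y y" by simp
    from *[of "- ip x y / ip y y"] pos
    have "0 \<le> ip x x - (ip x y)\<^sup>2 / ip y y" by (simp add: field_simps power2_eq_square)
    then show ?thesis using pos by (simp add: field_simps)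
  qed
qed

lemma cauchy_schwarz:
  assumes "x \<in> V" "y \<in> V"
  shows "\<bar>ip x y\<bar> \<le> sqrt (ip x x) * sqrt (ip y y)"
  using real_sqrt_le_mono[OF cauchy_schwarz_sq[OF assms]] by (simp add: real_sqrt_mult)

lemma triangle:
  assumes "x \<in> V" "y \<in> V"
  shows "sqrt (ip (x + y) (x + y)) \<le> sqrt (ip x x) + sqrt (ip y y)"
proof (rule real_le_lsqrt)
  have "ip (x + y) (x + y) = ip x x + 2 * ip x y + ip y y"
    using assms by (simp add: linear_simps mem commute[of y x])
  also have "\<dots> \<le> (sqrt (ip x x) + sqrt (ip y y))\<^sup>2"
    using cauchy_schwarz[OF assms] nonneg[OF assms(1)] nonneg[OF assms(2)]
    by (simp add: power2_sum)
  finally show "ip (x + y) (x + y) \<le> (sqrt (ip x x) + sqrt (ip y y))\<^sup>2" .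
qed (use assms nonneg in auto)

lemma triangle_diff:
  assumes "x \<in> V" "y \<in> V"
  shows "sqrt (ip (x - y) (x - y)) \<le> sqrt (ip x x) + sqrt (ip y y)"
  using triangle[OF assms(1) mem(5)[OF assms(2)]] assms by (simp add: mem linear_simps)

text \<open>
  The Riesz representation on a finite-dimensional subspace, by a Gram-Schmidt induction over the
  spanning set. In the semidefinite setting the functional has to vanish on null vectors, and the
  representative is unique only up to such vectors.
\<close>

lemma riesz_span:
  assumes "finite B" "B \<subseteq> V"
    and F_add: "\<And>x y. x \<in> V \<Longrightarrow> y \<in> V \<Longrightarrow> F (x + y) = F x + F y"
    and F_scale: "\<And>x c. x \<in> V \<Longrightarrow> F (c *\<^sub>R x) = c * F x"
    and F_null: "\<And>x. x \<in> V \<Longrightarrow> ip x x = 0 \<Longrightarrow> F x = (0::real)"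
  shows "\<exists>w\<in>span B. \<forall>v\<in>span B. ip w v = F v"
  using assms
proof (induction B arbitrary: F rule: finite_induct)
  case empty
  have "F 0 = 0" using empty(3)[of 0 0] by (simp add: mem)
  then show ?case by (simp add: scale_left[of 0 0 0, simplified] mem)
next
  case (insert b B)
  have BV: "span B \<subseteq> V" using insert.prems(1) V by (intro span_minimal) auto
  have bV: "b \<in> V" using insert.prems by auto
  obtain p where p: "p \<in> span B" "\<And>v. v \<in> span B \<Longrightarrow> ip p v = ip b v"
  proof -
    have "\<exists>w\<in>span B. \<forall>v\<in>span B. ip w v = ip b v"
    proof (rule insert.IH)
      fix x assume "x \<in> V" "ip x x = 0"
      with cauchy_schwarz_sq[OF bV this(1)] show "ip b x = 0" by simp
    qed (use insert.prems bV in \<open>auto simp: linear_simps\<close>)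
    then show ?thesis using that by blast
  qed
  obtain w where w: "w \<in> span B" "\<And>v. v \<in> span B \<Longrightarrow> ip w v = F v"
    using insert.IH[of F] insert.prems by auto
  define b' where "b' = b - p"
  have inV: "p \<in> V" "w \<in> V" "b' \<in> V" using p w bV BV by (auto simp: b'_def mem)
  have orth: "ip b' v = 0" if "v \<in> span B" for v
    using p(2)[OF that] that BV inV bV by (auto simp: b'_def linear_simps)
  \<comment> \<open>if \<open>b'\<close> is a null vector, then \<open>c = 0\<close> by division by zero, and \<open>F b' = 0\<close>\<close>
  define c where "c = F b' / ip b' b'"
  have c: "c * ip b' b' = F b'" using insert.prems(4)[OF inV(3)] by (auto simp: c_def)
  have b': "b' \<in> span (insert b B)"
    unfolding b'_def using p(1) by (meson insertI1 span_base span_diff span_mono subset_insertI subsetD)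
  have "ip (w + c *\<^sub>R b') v = F v" if "v \<in> span (insert b B)" for v
  proof -
    from that[unfolded span_breakdown_eq] obtain k where "v - k *\<^sub>R b \<in> span B" by blast
    then have s: "v - k *\<^sub>R b + k *\<^sub>R p \<in> span B" using p(1) by (intro span_add span_scale)
    define s where "s = v - k *\<^sub>R b + k *\<^sub>R p"
    have v: "v = s + k *\<^sub>R b'" by (simp add: s_def b'_def algebra_simps)
    have sV: "s \<in> V" "s \<in> span B" using s BV by (auto simp: s_def)
    have "ip (w + c *\<^sub>R b') v = ip w s + k * ip w b' + c * ip b' s + k * (c * ip b' b')"
      unfolding v using sV inV by (simp add: linear_simps mem algebra_simps)
    also have "\<dots> = F s + k * F b'"
      using w(2)[OF sV(2)] orth[OF sV(2)] orth[OF w(1)] c commute[OF inV(2,3)] by simp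
    also have "\<dots> = F v" unfolding v using sV inV insert.prems by (simp add: mem)
    finally show ?thesis .
  qed
  moreover have "w + c *\<^sub>R b' \<in> span (insert b B)"
    using w(1) b' by (meson span_add span_mono span_scale subset_insertI subsetD)
  ultimately show ?case by blast
qed

end

section \<open>Square integrable functions\<close>

lemma L2D:
  assumes "u \<in> L2 \<Omega>"
  shows "u \<in> borel_measurable (lebesgue_on \<Omega>)" "integrable (lebesgue_on \<Omega>) (\<lambda>x. (norm (u x))\<^sup>2)"
  using assms by (auto simp: L2_def)

lemma L2_inner_integrable:
  assumes "u \<in> L2 \<Omega>" "v \<in> L2 \<Omega>"
  shows "integrable (lebesgue_on \<Omega>) (\<lambda>x. u x \<bullet> v x)"
proof (rule Bochner_Integration.integrable_bound)
  show "integrable (lebesgue_on \<Omega>) (\<lambda>x. (norm (u x))\<^sup>2 + (norm (v x))\<^sup>2)"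
    using L2D(2)[OF assms(1)] L2D(2)[OF assms(2)] by simp
  show "(\<lambda>x. u x \<bullet> v x) \<in> borel_measurable (lebesgue_on \<Omega>)"
    using L2D(1)[OF assms(1)] L2D(1)[OF assms(2)] by simp
  have "norm (u x \<bullet> v x) \<le> norm ((norm (u x))\<^sup>2 + (norm (v x))\<^sup>2)" for x
  proof -
    have "\<bar>u x \<bullet> v x\<bar> \<le> norm (u x) * norm (v x)" by (rule Cauchy_Schwarz_ineq2)
    moreover have "2 * (norm (u x) * norm (v x)) \<le> (norm (u x))\<^sup>2 + (norm (v x))\<^sup>2"
      using sum_squares_bound[of "norm (u x)" "norm (v x)"] by simp
    moreover have "0 \<le> norm (u x) * norm (v x)" by simp
    ultimately show ?thesis by simp
  qed
  then show "AE x in lebesgue_on \<Omega>. norm (u x \<bullet> v x) \<le> norm ((norm (u x))\<^sup>2 + (norm (v x))\<^sup>2)"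
    by blast
qed

lemma subspace_L2: "subspace (L2 \<Omega> :: ('a::euclidean_space \<Rightarrow> 'b::euclidean_space) set)"
proof (rule subspaceI)
  show "0 \<in> (L2 \<Omega> :: ('a \<Rightarrow> 'b) set)" by (simp add: L2_def zero_fun_def)
  fix u v :: "'a \<Rightarrow> 'b" and c :: real assume u: "u \<in> L2 \<Omega>"
  show "c *\<^sub>R u \<in> L2 \<Omega>"
    using L2D[OF u] by (simp add: L2_def scaleR_fun_def power_mult_distrib)
  assume v: "v \<in> L2 \<Omega>"
  have "integrable (lebesgue_on \<Omega>) (\<lambda>x. u x \<bullet> u x + 2 * (u x \<bullet> v x) + v x \<bullet> v x)"
    using u v by (intro Bochner_Integration.integrable_add integrable_mult_right L2_inner_integrable)
  moreover have "u x \<bullet> u x + 2 * (u x \<bullet> v x) + v x \<bullet> v x = (norm (u x + v x))\<^sup>2" for x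
    by (simp add: power2_norm_eq_inner inner_add inner_commute)
  ultimately show "u + v \<in> L2 \<Omega>"
    using L2D[OF u] L2D[OF v] by (simp add: L2_def plus_fun_def)
qed

interpretation L2: semi_inner "L2 \<Omega> :: ('a::euclidean_space \<Rightarrow> 'b::euclidean_space) set" "L2_inner \<Omega>" for \<Omega>
proof
  show "subspace (L2 \<Omega> :: ('a \<Rightarrow> 'b) set)" by (rule subspace_L2)
  fix u v w :: "'a \<Rightarrow> 'b" and c :: real assume u: "u \<in> L2 \<Omega>"
  show "0 \<le> L2_inner \<Omega> u u" by (simp add: L2_inner_def integral_nonneg_AE)
  assume w: "w \<in> L2 \<Omega>"
  show "L2_inner \<Omega> (c *\<^sub>R u) w = c * L2_inner \<Omega> u w" by (simp add: L2_inner_def)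
  show "L2_inner \<Omega> u w = L2_inner \<Omega> w u" by (simp add: L2_inner_def inner_commute)
  assume v: "v \<in> L2 \<Omega>"
  show "L2_inner \<Omega> (u + v) w = L2_inner \<Omega> u w + L2_inner \<Omega> v w"
    using L2_inner_integrable[OF u w] L2_inner_integrable[OF v w] by (simp add: L2_inner_def inner_add_left)
qed

lemma L2_norm_sq: "u \<in> L2 \<Omega> \<Longrightarrow> (L2_norm \<Omega> u)\<^sup>2 = L2_inner \<Omega> u u"
  by (simp add: L2_norm_def L2.nonneg)

lemma L2_norm_nonneg [simp]: "0 \<le> L2_norm \<Omega> u"
  by (simp add: L2_norm_def L2_inner_def integral_nonneg_AE)

lemma L2_cauchy_schwarz: "u \<in> L2 \<Omega> \<Longrightarrow> v \<in> L2 \<Omega> \<Longrightarrow> \<bar>L2_inner \<Omega> u v\<bar> \<le> L2_norm \<Omega> u * L2_norm \<Omega> v"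
  unfolding L2_norm_def by (rule L2.cauchy_schwarz)

lemma L2_triangle: "u \<in> L2 \<Omega> \<Longrightarrow> v \<in> L2 \<Omega> \<Longrightarrow> L2_norm \<Omega> (u + v) \<le> L2_norm \<Omega> u + L2_norm \<Omega> v"
  unfolding L2_norm_def by (rule L2.triangle)

lemma L2_triangle_diff: "u \<in> L2 \<Omega> \<Longrightarrow> v \<in> L2 \<Omega> \<Longrightarrow> L2_norm \<Omega> (u - v) \<le> L2_norm \<Omega> u + L2_norm \<Omega> v"
  unfolding L2_norm_def by (rule L2.triangle_diff)

lemma L2_norm_scale: "u \<in> L2 \<Omega> \<Longrightarrow> L2_norm \<Omega> (c *\<^sub>R u) = \<bar>c\<bar> * L2_norm \<Omega> u"
  by (simp add: L2_norm_def L2.linear_simps L2.mem real_sqrt_mult)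

lemma L2_norm_minus_commute: "L2_norm \<Omega> (u - v) = L2_norm \<Omega> (v - u)"
  by (simp add: L2_norm_def L2_inner_def inner_diff algebra_simps)

lemma borel_measurable_lebesgue_on_AE:
  fixes u v :: "'a::euclidean_space \<Rightarrow> 'b::euclidean_space"
  assumes "\<Omega> \<in> sets lebesgue" "u \<in> borel_measurable (lebesgue_on \<Omega>)" "AE x in lebesgue_on \<Omega>. u x = v x"
  shows "v \<in> borel_measurable (lebesgue_on \<Omega>)"
proof -
  have "(\<lambda>x. if x \<in> \<Omega> then u x else 0) \<in> borel_measurable lebesgue"
    using assms(1,2) by (simp add: borel_measurable_if)
  moreover have "AE x in lebesgue. (if x \<in> \<Omega> then u x else 0) = (if x \<in> \<Omega> then v x else 0)"
    using assms(1,3) by (simp add: AE_restrict_space_iff)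
  ultimately have "(\<lambda>x. if x \<in> \<Omega> then v x else 0) \<in> borel_measurable lebesgue"
    by (rule borel_measurable_AE)
  then show ?thesis using assms(1) by (simp add: borel_measurable_if)
qed

lemma L2_ae:
  assumes "\<Omega> \<in> sets lebesgue" "u \<in> L2 \<Omega>" "ae_eq \<Omega> u v"
  shows "v \<in> L2 \<Omega>"
proof -
  have ae: "AE x in lebesgue_on \<Omega>. u x = v x" using assms(3) by (simp add: ae_eq_def)
  have m: "v \<in> borel_measurable (lebesgue_on \<Omega>)"
    by (rule borel_measurable_lebesgue_on_AE[OF assms(1) L2D(1)[OF assms(2)] ae])
  have "integrable (lebesgue_on \<Omega>) (\<lambda>x. (norm (v x))\<^sup>2)"
    by (rule integrable_cong_AE_imp[OF L2D(2)[OF assms(2)]]) (use m ae in auto)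
  with m show ?thesis by (simp add: L2_def)
qed

lemma L2_inner_cong:
  assumes "u \<in> L2 \<Omega>" "u' \<in> L2 \<Omega>" "v \<in> L2 \<Omega>" "v' \<in> L2 \<Omega>" "ae_eq \<Omega> u u'" "ae_eq \<Omega> v v'"
  shows "L2_inner \<Omega> u v = L2_inner \<Omega> u' v'"
  unfolding L2_inner_def
  by (rule integral_cong_AE) (use assms L2_inner_integrable in \<open>auto simp: ae_eq_def elim: eventually_elim2\<close>)

lemma L2_norm_cong:
  assumes "u \<in> L2 \<Omega>" "u' \<in> L2 \<Omega>" "ae_eq \<Omega> u u'"
  shows "L2_norm \<Omega> u = L2_norm \<Omega> u'"
  unfolding L2_norm_def using L2_inner_cong[of u \<Omega> u' u u'] assms by simp

lemma ae_eq_refl [simp]: "ae_eq \<Omega> u u" by (simp add: ae_eq_def)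
lemma ae_eq_sym: "ae_eq \<Omega> u v \<Longrightarrow> ae_eq \<Omega> v u" by (auto simp: ae_eq_def elim: eventually_mono)
lemma ae_eq_trans: "ae_eq \<Omega> u v \<Longrightarrow> ae_eq \<Omega> v w \<Longrightarrow> ae_eq \<Omega> u w"
  unfolding ae_eq_def by (rule eventually_elim2) auto
lemma ae_eq_add: "ae_eq \<Omega> u u' \<Longrightarrow> ae_eq \<Omega> v v' \<Longrightarrow> ae_eq \<Omega> (u + v) (u' + v')"
  unfolding ae_eq_def by (rule eventually_elim2) auto
lemma ae_eq_diff: "ae_eq \<Omega> u u' \<Longrightarrow> ae_eq \<Omega> v v' \<Longrightarrow> ae_eq \<Omega> (u - v) (u' - v')"
  unfolding ae_eq_def by (rule eventually_elim2) auto
text \<open>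
  Used for products with a bounded function: \<open>v\<close> is \<open>u\<close> times a factor of size at most \<open>B\<close>.
\<close>

lemma L2_dominated:
  fixes v :: "'a::euclidean_space \<Rightarrow> 'b::euclidean_space" and u :: "'a \<Rightarrow> 'c::euclidean_space"
  assumes "u \<in> L2 \<Omega>" "v \<in> borel_measurable (lebesgue_on \<Omega>)"
    "AE x in lebesgue_on \<Omega>. norm (v x) \<le> B * norm (u x)" "0 \<le> B"
  shows "v \<in> L2 \<Omega>" "L2_norm \<Omega> v \<le> B * L2_norm \<Omega> u"
proof -
  have ae: "AE x in lebesgue_on \<Omega>. (norm (v x))\<^sup>2 \<le> B\<^sup>2 * (norm (u x))\<^sup>2"
    using assms(3) by eventually_elim (metis norm_ge_zero power_mono power_mult_distrib)
  have i: "integrable (lebesgue_on \<Omega>) (\<lambda>x. B\<^sup>2 * (norm (u x))\<^sup>2)" using L2D(2)[OF assms(1)] by simp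
  have iv: "integrable (lebesgue_on \<Omega>) (\<lambda>x. (norm (v x))\<^sup>2)"
    by (rule Bochner_Integration.integrable_bound[OF i]) (use assms(2) ae in auto)
  then show "v \<in> L2 \<Omega>" using assms(2) by (simp add: L2_def)
  have "(LINT x|lebesgue_on \<Omega>. (norm (v x))\<^sup>2) \<le> (LINT x|lebesgue_on \<Omega>. B\<^sup>2 * (norm (u x))\<^sup>2)"
    by (rule integral_mono_AE[OF iv i ae])
  then have "sqrt (LINT x|lebesgue_on \<Omega>. (norm (v x))\<^sup>2) \<le> sqrt (B\<^sup>2 * (LINT x|lebesgue_on \<Omega>. (norm (u x))\<^sup>2))"
    by simp
  then show "L2_norm \<Omega> v \<le> B * L2_norm \<Omega> u"
    using assms(4) by (simp add: L2_norm_def L2_inner_def power2_norm_eq_inner real_sqrt_mult)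
qed

section \<open>Integrals of test functions\<close>

text \<open>
  Keeps \<open>Hm 1 \<Omega>\<close> folded: otherwise it is rewritten to \<open>Hm (Suc 0) \<Omega>\<close> and then unfolded.
\<close>

declare One_nat_def [simp del] Hm.simps(2) [simp del]

lemma open_in_lebesgue: "open \<Omega> \<Longrightarrow> \<Omega> \<in> sets lebesgue"
  by (intro sets_completionI_sets) auto

lemma continuous_lebesgue_measurable:
  "continuous_on UNIV f \<Longrightarrow> f \<in> borel_measurable (lebesgue_on \<Omega>)"
  for f :: "'a::euclidean_space \<Rightarrow> 'b::euclidean_space"
  using borel_measurable_continuous_onI[of f]
  by (intro measurable_restrict_space1 measurable_completion) simp

lemma integrable_compact_support:
  fixes f :: "'a::euclidean_space \<Rightarrow> real"
  assumes "continuous_on UNIV f" "compact S" "\<And>x. x \<notin> S \<Longrightarrow> f x = 0"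
  shows "integrable lborel f" "integrable lebesgue f"
proof -
  have "integrable lborel (\<lambda>x. indicator S x *\<^sub>R f x)"
    using assms by (intro borel_integrable_compact) (auto intro: continuous_on_subset)
  moreover have "(\<lambda>x. indicator S x *\<^sub>R f x) = f" using assms(3) by (fastforce simp: indicator_def)
  ultimately show *: "integrable lborel f" by metis
  then show "integrable lebesgue f" by (simp add: integrable_completion)
qed

lemma dir_deriv_outside:
  assumes "closed S" "\<And>x. x \<notin> S \<Longrightarrow> \<phi> x = 0" "x \<notin> S"
  shows "dir_deriv e \<phi> x = 0"
proof -
  have "((\<lambda>_. 0) has_derivative (\<lambda>_. 0)) (at x)" by simp
  then have "(\<phi> has_derivative (\<lambda>_. 0)) (at x)"
    by (rule has_derivative_transform_within_open[of _ _ _ _ "- S"]) (use assms in auto)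
  then show ?thesis using frechet_derivative_at by metis
qed

lemma smooth_dir_has_real_derivative:
  assumes "smooth \<phi>"
  shows "((\<lambda>s. \<phi> (x + s *\<^sub>R e)) has_real_derivative dir_deriv e \<phi> (x + s *\<^sub>R e)) (at s)"
proof -
  define D where "D = frechet_derivative \<phi> (at (x + s *\<^sub>R e))"
  have D: "(\<phi> has_derivative D) (at (x + s *\<^sub>R e))"
    unfolding D_def by (rule smooth_has_derivative[OF assms])
  have "((\<lambda>s. \<phi> (x + s *\<^sub>R e)) has_derivative (\<lambda>h. D (h *\<^sub>R e))) (at s)"
    by (rule has_derivative_compose[where f="\<lambda>s. x + s *\<^sub>R e", OF _ D]) (auto intro!: derivative_eq_intros)
  moreover have "(\<lambda>h. D (h *\<^sub>R e)) = (*) (D e)"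
    using linear_scale[OF has_derivative_linear[OF D]] by (auto simp: mult.commute)
  ultimately show ?thesis by (simp add: has_field_derivative_def D_def)
qed

lemma compact_support_bounded:
  fixes f :: "'a::euclidean_space \<Rightarrow> real"
  assumes "continuous_on UNIV f" "compact S" "\<And>x. x \<notin> S \<Longrightarrow> f x = 0"
  obtains B where "0 \<le> B" "\<And>x. \<bar>f x\<bar> \<le> B"
proof -
  have "bounded (f ` S)"
    using assms by (intro compact_imp_bounded compact_continuous_image) (auto intro: continuous_on_subset)
  then obtain B where "\<And>x. x \<in> S \<Longrightarrow> \<bar>f x\<bar> \<le> B" by (auto simp: bounded_iff)
  then have "\<bar>f x\<bar> \<le> max B 0" for x using assms(3)[of x] by (cases "x \<in> S") force+
  then show ?thesis using that[of "max B 0"] by simp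
qed

text \<open>
  The difference quotients have vanishing integral because Lebesgue measure is translation
  invariant, and they converge to the derivative boundedly on a fixed ball.
\<close>

lemma integral_dir_deriv:
  fixes \<phi> :: "'a::euclidean_space \<Rightarrow> real"
  assumes "smooth \<phi>" "compact S" "\<And>x. x \<notin> S \<Longrightarrow> \<phi> x = 0" "e \<in> Basis"
  shows "(LINT x|lborel. dir_deriv e \<phi> x) = 0"
proof -
  have cont: "continuous_on UNIV \<phi>" "continuous_on UNIV (dir_deriv e \<phi>)"
    using assms by (auto intro: smooth_continuous smooth_dir_deriv)
  have out: "dir_deriv e \<phi> x = 0" if "x \<notin> S" for x
    using dir_deriv_outside[OF compact_imp_closed[OF assms(2)] assms(3) that] .
  obtain B where B: "0 \<le> B" "\<And>x. \<bar>dir_deriv e \<phi> x\<bar> \<le> B"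
    using compact_support_bounded[OF cont(2) assms(2) out] by blast
  obtain R where R: "\<And>x. x \<in> S \<Longrightarrow> norm x \<le> R"
    using compact_imp_bounded[OF assms(2)] by (auto simp: bounded_iff)
  define t where "t n = 1 / real (Suc n)" for n
  have t: "0 < t n" "t n \<le> 1" for n by (auto simp: t_def)
  define g where "g n x = (\<phi> (x + t n *\<^sub>R e) - \<phi> x) / t n" for n x
  have bnd: "\<bar>g n x\<bar> \<le> indicator (cball 0 (R + 1)) x * B" for n x
  proof (cases "x \<in> cball 0 (R + 1)")
    case True
    obtain z where "\<phi> (x + t n *\<^sub>R e) - \<phi> (x + 0 *\<^sub>R e) = (t n - 0) * dir_deriv e \<phi> (x + z *\<^sub>R e)"
      using MVT2[OF t(1)[of n] smooth_dir_has_real_derivative[OF assms(1), of x e]] by blast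
    then have "g n x = dir_deriv e \<phi> (x + z *\<^sub>R e)" using t(1)[of n] by (simp add: g_def)
    then show ?thesis using B(2) True by simp
  next
    case False
    then have x: "norm x > R + 1" by simp
    have "norm x \<le> norm (x + t n *\<^sub>R e) + norm (t n *\<^sub>R e)" using norm_triangle_ineq4[of "x + t n *\<^sub>R e" "t n *\<^sub>R e"] by simp
    moreover have "norm (t n *\<^sub>R e) \<le> 1" using t[of n] assms(4) by simp
    ultimately have "x \<notin> S" "x + t n *\<^sub>R e \<notin> S" using R[of x] R[of "x + t n *\<^sub>R e"] x by auto
    then show ?thesis using assms(3) False by (simp add: g_def)
  qed
  have "(\<lambda>n. LINT x|lborel. g n x) \<longlonglongrightarrow> (LINT x|lborel. dir_deriv e \<phi> x)"
  proof (rule integral_dominated_convergence[where w="\<lambda>x. indicator (cball 0 (R + 1)) x * B"])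
    show "dir_deriv e \<phi> \<in> borel_measurable lborel"
      using borel_measurable_continuous_onI[OF cont(2)] by simp
    have "continuous_on UNIV (g n)" for n
      unfolding g_def[abs_def] using t(1)[of n]
      by (intro continuous_intros continuous_on_compose2[OF cont(1)]) auto
    then show "g n \<in> borel_measurable lborel" for n
      using borel_measurable_continuous_onI by auto
    show "integrable lborel (\<lambda>x. indicator (cball 0 (R + 1)) x * B :: real)"
      by (intro integrable_mult_left integrable_real_indicator)
        (auto intro!: emeasure_bounded_finite[unfolded infinity_ennreal_def])
    show "AE x in lborel. norm (g n x) \<le> indicator (cball 0 (R + 1)) x * B" for n
      using bnd by simp
    show "AE x in lborel. (\<lambda>n. g n x) \<longlonglongrightarrow> dir_deriv e \<phi> x"
    proof (intro AE_I2)
      fix x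
      have "((\<lambda>h. (\<phi> (x + (0 + h) *\<^sub>R e) - \<phi> (x + 0 *\<^sub>R e)) / h) \<longlongrightarrow> dir_deriv e \<phi> (x + 0 *\<^sub>R e)) (at 0)"
        using smooth_dir_has_real_derivative[OF assms(1), of x e 0] unfolding DERIV_def .
      moreover have "filterlim t (at 0) sequentially"
        unfolding filterlim_at using LIMSEQ_Suc[OF lim_1_over_n] t(1) by (auto simp: t_def[abs_def])
      ultimately show "(\<lambda>n. g n x) \<longlonglongrightarrow> dir_deriv e \<phi> x"
        unfolding g_def using filterlim_compose by fastforce
    qed
  qed
  moreover have "(LINT x|lborel. g n x) = 0" for n
  proof -
    have i: "integrable lborel \<phi>" using integrable_compact_support[OF cont(1) assms(2,3)] by simp
    have i': "integrable lborel (\<lambda>x. \<phi> (x + t n *\<^sub>R e))"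
    proof (rule integrable_compact_support[where S="(\<lambda>x. x - t n *\<^sub>R e) ` S"])
      show "continuous_on UNIV (\<lambda>x. \<phi> (x + t n *\<^sub>R e))"
        by (intro continuous_on_compose2[OF cont(1)] continuous_intros) auto
      show "compact ((\<lambda>x. x - t n *\<^sub>R e) ` S)"
        using assms(2) by (intro compact_continuous_image continuous_intros)
      show "\<phi> (x + t n *\<^sub>R e) = 0" if "x \<notin> (\<lambda>x. x - t n *\<^sub>R e) ` S" for x
        by (rule assms(3)) (use that in \<open>auto simp: image_iff\<close>)
    qed
    have "(LINT x|lborel. \<phi> (x + t n *\<^sub>R e)) = (LINT x|distr lborel borel ((+) (t n *\<^sub>R e)). \<phi> x)"
      using borel_measurable_continuous_onI[OF cont(1)] by (subst integral_distr) (auto simp: add.commute)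
    also have "\<dots> = (LINT x|lborel. \<phi> x)" by (simp add: lborel_distr_plus)
    finally show ?thesis using i i' by (simp add: g_def)
  qed
  ultimately show ?thesis by (simp add: LIMSEQ_const_iff)
qed

lemma integral_lebesgue_on_support:
  fixes f :: "'a::euclidean_space \<Rightarrow> real"
  assumes "\<Omega> \<in> sets lebesgue" "continuous_on UNIV f" "\<And>x. x \<notin> \<Omega> \<Longrightarrow> f x = 0"
  shows "(LINT x|lebesgue_on \<Omega>. f x) = (LINT x|lborel. f x)"
proof -
  have "(LINT x|lebesgue_on \<Omega>. f x) = (LINT x|lebesgue. f x)"
    unfolding integral_lebesgue_on[OF assms(1)]
    by (rule Bochner_Integration.integral_cong) (use assms(3) in \<open>auto simp: indicator_def\<close>)
  also have "\<dots> = (LINT x|lborel. f x)"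
    by (rule integral_completion) (use borel_measurable_continuous_onI[OF assms(2)] in simp)
  finally show ?thesis .
qed

lemma test_dir_deriv: "\<phi> \<in> test_functions \<Omega> \<Longrightarrow> e \<in> Basis \<Longrightarrow> dir_deriv e \<phi> \<in> test_functions \<Omega>"
  by (elim test_functionsE) (auto intro!: test_functionsI smooth_dir_deriv dir_deriv_outside compact_imp_closed)

lemma test_mult: "\<phi> \<in> test_functions \<Omega> \<Longrightarrow> smooth \<psi> \<Longrightarrow> (\<lambda>x. \<phi> x * \<psi> x) \<in> test_functions \<Omega>"
  by (elim test_functionsE) (rule test_functionsI, auto intro: smooth_mult)

lemma test_mult': "\<phi> \<in> test_functions \<Omega> \<Longrightarrow> smooth \<psi> \<Longrightarrow> (\<lambda>x. \<psi> x * \<phi> x) \<in> test_functions \<Omega>"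
  using test_mult[of \<phi> \<Omega> \<psi>] by (simp add: mult.commute)

lemma subspace_test: "subspace (test_functions \<Omega>)"
proof (rule subspaceI)
  show "0 \<in> test_functions \<Omega>" by (rule test_functionsI[of _ "{}"]) (auto simp: zero_fun_def)
  fix u v and c :: real assume u: "u \<in> test_functions \<Omega>"
  show "c *\<^sub>R u \<in> test_functions \<Omega>"
    using test_mult'[OF u smooth_const, of c] by (simp add: scaleR_fun_def)
  assume v: "v \<in> test_functions \<Omega>"
  from u obtain S where S: "smooth u" "compact S" "S \<subseteq> \<Omega>" "\<And>x. x \<notin> S \<Longrightarrow> u x = 0"
    by (rule test_functionsE) (rule that, assumption+)
  from v obtain T where T: "smooth v" "compact T" "T \<subseteq> \<Omega>" "\<And>x. x \<notin> T \<Longrightarrow> v x = 0"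
    by (rule test_functionsE) (rule that, assumption+)
  show "u + v \<in> test_functions \<Omega>"
    by (rule test_functionsI[of _ "S \<union> T"]) (use S T in \<open>auto simp: plus_fun_def intro: smooth_add\<close>)
qed

lemma test_zero_outside: "\<phi> \<in> test_functions \<Omega> \<Longrightarrow> x \<notin> \<Omega> \<Longrightarrow> \<phi> x = 0"
  by (elim test_functionsE) auto

lemma test_continuous: "\<phi> \<in> test_functions \<Omega> \<Longrightarrow> continuous_on S \<phi>"
  using smooth_continuous test_smooth continuous_on_subset by blast

lemma test_bounded:
  assumes "\<phi> \<in> test_functions \<Omega>"
  obtains B where "0 \<le> B" "\<And>x. \<bar>\<phi> x\<bar> \<le> B"
  using assms by (elim test_functionsE) (metis compact_support_bounded smooth_continuous)

lemma integral_test_dir_deriv: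
  assumes "open \<Omega>" "\<phi> \<in> test_functions \<Omega>" "e \<in> Basis"
  shows "(LINT x|lebesgue_on \<Omega>. dir_deriv e \<phi> x) = 0"
proof -
  from assms(2) obtain S where S: "smooth \<phi>" "compact S" "\<And>x. x \<notin> S \<Longrightarrow> \<phi> x = 0" by (rule test_functionsE) (rule that, assumption+)
  have "(LINT x|lebesgue_on \<Omega>. dir_deriv e \<phi> x) = (LINT x|lborel. dir_deriv e \<phi> x)"
    using test_dir_deriv[OF assms(2,3)] assms(1)
    by (intro integral_lebesgue_on_support open_in_lebesgue test_continuous test_zero_outside)
  also have "\<dots> = 0" by (rule integral_dir_deriv[OF S assms(3)])
  finally show ?thesis .
qed

lemma test_integrable:
  assumes "open \<Omega>" "\<phi> \<in> test_functions \<Omega>"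
  shows "integrable (lebesgue_on \<Omega>) \<phi>"
proof -
  from assms(2) obtain S where S: "smooth \<phi>" "compact S" "\<And>x. x \<notin> S \<Longrightarrow> \<phi> x = 0" by (rule test_functionsE) (rule that, assumption+)
  have "integrable lebesgue \<phi>" using integrable_compact_support(2)[OF smooth_continuous[OF S(1)] S(2,3)] .
  moreover have "(\<lambda>x. indicator \<Omega> x * \<phi> x) = \<phi>"
    using test_zero_outside[OF assms(2)] by (fastforce simp: indicator_def)
  ultimately show ?thesis
    using integrable_lebesgue_on[OF open_in_lebesgue[OF assms(1)], of \<phi>] by metis
qed

lemma test_in_L2:
  assumes "open \<Omega>" "\<phi> \<in> test_functions \<Omega>"
  shows "\<phi> \<in> L2 \<Omega>"
proof -
  have "integrable (lebesgue_on \<Omega>) (\<lambda>x. \<phi> x * \<phi> x)"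
    using assms by (intro test_integrable test_mult test_smooth)
  then show ?thesis
    using assms continuous_lebesgue_measurable[OF test_continuous[OF assms(2)]] by (simp add: L2_def power2_eq_square)
qed

lemma ibp_smooth_test:
  assumes "open \<Omega>" "smooth \<eta>" "\<phi> \<in> test_functions \<Omega>" "e \<in> Basis"
  shows "L2_inner \<Omega> \<eta> (dir_deriv e \<phi>) = - L2_inner \<Omega> (dir_deriv e \<eta>) \<phi>"
proof -
  have i: "integrable (lebesgue_on \<Omega>) (\<lambda>x. \<eta> x * dir_deriv e \<phi> x)"
    "integrable (lebesgue_on \<Omega>) (\<lambda>x. dir_deriv e \<eta> x * \<phi> x)"
    using assms by (auto intro!: test_integrable test_mult' test_dir_deriv smooth_dir_deriv)
  have "0 = (LINT x|lebesgue_on \<Omega>. dir_deriv e (\<lambda>x. \<eta> x * \<phi> x) x)"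
    using assms by (intro integral_test_dir_deriv[symmetric] test_mult')
  also have "\<dots> = (LINT x|lebesgue_on \<Omega>. \<eta> x * dir_deriv e \<phi> x + dir_deriv e \<eta> x * \<phi> x)"
    using assms by (subst dir_deriv_mult) (auto intro: test_smooth)
  also have "\<dots> = L2_inner \<Omega> \<eta> (dir_deriv e \<phi>) + L2_inner \<Omega> (dir_deriv e \<eta>) \<phi>"
    using i by (simp add: L2_inner_def)
  finally show ?thesis by simp
qed

section \<open>Weak derivatives and Sobolev spaces\<close>

lemma locally_integrable_L2:
  assumes "\<Omega> \<in> sets lebesgue" "u \<in> L2 \<Omega>"
  shows "locally_integrable \<Omega> u"
  unfolding locally_integrable_def
proof (intro allI impI)
  fix S assume S: "compact S \<and> S \<subseteq> \<Omega>"
  have Sm: "S \<in> lmeasurable" using S lmeasurable_compact by blast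
  then have Sl: "S \<in> sets lebesgue" by blast
  have i1: "integrable lebesgue (\<lambda>x. indicator \<Omega> x * (u x)\<^sup>2)"
    using L2D(2)[OF assms(2)] integrable_lebesgue_on[OF assms(1), of "\<lambda>x. (u x)\<^sup>2"] by simp
  have i2: "integrable lebesgue (indicat_real S)" using Sm by (simp add: lmeasurable_iff_integrable)
  have m: "(\<lambda>x. indicator \<Omega> x * u x) \<in> borel_measurable lebesgue"
    using L2D(1)[OF assms(2)] borel_measurable_restrict_space_iff[of \<Omega> lebesgue u] assms(1)
    by simp
  have "integrable lebesgue (\<lambda>x. indicator S x * (indicator \<Omega> x * u x))"
  proof (rule Bochner_Integration.integrable_bound[OF Bochner_Integration.integrable_add[OF i2 i1]])
    show "(\<lambda>x. indicator S x * (indicator \<Omega> x * u x)) \<in> borel_measurable lebesgue"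
      by (rule borel_measurable_times[OF borel_measurable_indicator[OF Sl] m])
    have "\<bar>c\<bar> \<le> 1 + c\<^sup>2" for c :: real
      using sum_squares_bound[of "\<bar>c\<bar>" 1] abs_ge_zero[of c] unfolding power2_abs one_power2 by linarith
    then show "AE x in lebesgue. norm (indicat_real S x * (indicat_real \<Omega> x * u x))
        \<le> norm (indicat_real S x + indicat_real \<Omega> x * (u x)\<^sup>2)"
      by (auto simp: indicator_def)
  qed
  moreover have "indicator S x * (indicator \<Omega> x * u x) = indicator S x * u x" for x
    using S by (auto simp: indicator_def)
  ultimately show "integrable (lebesgue_on S) u" by (simp add: integrable_lebesgue_on[OF Sl])
qed

lemma locally_integrable_add:
  "locally_integrable \<Omega> u \<Longrightarrow> locally_integrable \<Omega> v \<Longrightarrow> locally_integrable \<Omega> (u + v)"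
  by (auto simp: locally_integrable_def plus_fun_def)

lemma locally_integrable_scale: "locally_integrable \<Omega> u \<Longrightarrow> locally_integrable \<Omega> (c *\<^sub>R u)"
  by (auto simp: locally_integrable_def scaleR_fun_def)

lemma integrable_loc_test:
  assumes "open \<Omega>" "locally_integrable \<Omega> u" "\<phi> \<in> test_functions \<Omega>"
  shows "integrable (lebesgue_on \<Omega>) (\<lambda>x. u x * \<phi> x)"
proof -
  from assms(3) obtain S where S: "compact S" "S \<subseteq> \<Omega>" "\<And>x. x \<notin> S \<Longrightarrow> \<phi> x = 0" by (rule test_functionsE) (rule that, assumption+)
  obtain B where B: "0 \<le> B" "\<And>x. \<bar>\<phi> x\<bar> \<le> B" using test_bounded[OF assms(3)] by blast
  have Sl: "S \<in> sets lebesgue" using S lmeasurable_compact by blast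
  have i: "integrable lebesgue (\<lambda>x. indicator S x * u x)"
    using assms(2) S by (simp add: locally_integrable_def integrable_lebesgue_on[OF Sl, symmetric])
  have "integrable lebesgue (\<lambda>x. indicator S x * u x * \<phi> x)"
  proof (rule Bochner_Integration.integrable_bound[OF integrable_mult_left[OF i, of B]])
    have "\<phi> \<in> borel_measurable lebesgue"
      using continuous_lebesgue_measurable[OF test_continuous[OF assms(3)], of UNIV] by simp
    then show "(\<lambda>x. indicator S x * u x * \<phi> x) \<in> borel_measurable lebesgue"
      using i by (intro borel_measurable_times[OF borel_measurable_integrable])
    show "AE x in lebesgue. norm (indicator S x * u x * \<phi> x) \<le> norm (indicator S x * u x * B)"
      using B by (auto simp: abs_mult intro!: AE_I2 mult_left_mono)
  qed
  moreover have "indicator S x * u x * \<phi> x = indicator \<Omega> x * (u x * \<phi> x)" for x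
    using S by (cases "x \<in> S") (auto simp: indicator_def)
  ultimately show ?thesis by (simp add: integrable_lebesgue_on[OF open_in_lebesgue[OF assms(1)]])
qed

lemma L2_inner_loc_add:
  assumes "open \<Omega>" "locally_integrable \<Omega> u" "locally_integrable \<Omega> v" "\<phi> \<in> test_functions \<Omega>"
  shows "L2_inner \<Omega> (u + v) \<phi> = L2_inner \<Omega> u \<phi> + L2_inner \<Omega> v \<phi>"
  using integrable_loc_test[OF assms(1,2,4)] integrable_loc_test[OF assms(1,3,4)]
  by (simp add: L2_inner_def distrib_right)

lemma L2_inner_scale: "L2_inner \<Omega> (c *\<^sub>R u) \<phi> = c * L2_inner \<Omega> u \<phi>"
  by (simp add: L2_inner_def)

lemma has_weak_deriv_add:
  assumes "open \<Omega>" "e \<in> Basis" "has_weak_deriv \<Omega> e u g" "has_weak_deriv \<Omega> e v k"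
  shows "has_weak_deriv \<Omega> e (u + v) (g + k)"
  using assms by (auto simp: has_weak_deriv_def locally_integrable_add L2_inner_loc_add test_dir_deriv)

lemma has_weak_deriv_scale:
  "has_weak_deriv \<Omega> e u g \<Longrightarrow> has_weak_deriv \<Omega> e (c *\<^sub>R u) (c *\<^sub>R g)"
  by (auto simp: has_weak_deriv_def locally_integrable_scale L2_inner_scale)

text \<open>
  Without uniqueness nothing could be said about the representative that is chosen by
  \<open>weak_deriv\<close>; this is where the fundamental lemma enters.
\<close>

lemma has_weak_deriv_unique:
  assumes "open \<Omega>" "has_weak_deriv \<Omega> e u g" "has_weak_deriv \<Omega> e u k"
  shows "ae_eq \<Omega> g k"
proof -
  have l: "locally_integrable \<Omega> g" "locally_integrable \<Omega> ((-1) *\<^sub>R k)"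
    using assms locally_integrable_scale[of \<Omega> k "-1"] by (auto simp: has_weak_deriv_def)
  have "AE x in lebesgue_on \<Omega>. (g + (-1) *\<^sub>R k) x = 0"
  proof (rule fundamental_lemma[OF assms(1) locally_integrable_add[OF l]])
    fix \<phi> assume \<phi>: "\<phi> \<in> test_functions \<Omega>"
    show "L2_inner \<Omega> (g + (-1) *\<^sub>R k) \<phi> = 0"
      using assms \<phi> unfolding L2_inner_loc_add[OF assms(1) l \<phi>] L2_inner_scale
      by (simp add: has_weak_deriv_def)
  qed
  then show ?thesis by (simp add: ae_eq_def)
qed

lemma has_weak_deriv_cong:
  assumes "open \<Omega>" "e \<in> Basis" "has_weak_deriv \<Omega> e u g" "u \<in> L2 \<Omega>" "ae_eq \<Omega> u v"
  shows "has_weak_deriv \<Omega> e v g"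
proof -
  have \<Omega>: "\<Omega> \<in> sets lebesgue" using assms(1) by (rule open_in_lebesgue)
  have v: "v \<in> L2 \<Omega>" by (rule L2_ae[OF \<Omega> assms(4,5)])
  have "L2_inner \<Omega> v (dir_deriv e \<phi>) = L2_inner \<Omega> u (dir_deriv e \<phi>)" if "\<phi> \<in> test_functions \<Omega>" for \<phi>
    using assms that v by (intro L2_inner_cong ae_eq_sym[OF assms(5)])
      (auto intro!: test_in_L2 test_dir_deriv)
  then show ?thesis using assms(3) locally_integrable_L2[OF \<Omega> v] by (simp add: has_weak_deriv_def)
qed

lemma has_weak_deriv_test:
  assumes "open \<Omega>" "e \<in> Basis" "\<phi> \<in> test_functions \<Omega>"
  shows "has_weak_deriv \<Omega> e \<phi> (dir_deriv e \<phi>)"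
  using assms by (auto simp: has_weak_deriv_def ibp_smooth_test test_smooth
      intro!: locally_integrable_L2 open_in_lebesgue test_in_L2 test_dir_deriv)

lemma axis_Basis [simp]: "axis j (1::real) \<in> Basis"
  by (simp add: axis_in_Basis_iff)

lemma Hm_L2: "u \<in> Hm m \<Omega> \<Longrightarrow> u \<in> L2 \<Omega>"
  by (cases m) (auto simp: Hm.simps(2))

lemma Hm_ae:
  assumes "open \<Omega>" "u \<in> Hm m \<Omega>" "ae_eq \<Omega> u v"
  shows "v \<in> Hm m \<Omega>"
  using assms L2_ae[OF open_in_lebesgue[OF assms(1)]] has_weak_deriv_cong[OF assms(1) axis_Basis]
  by (cases m) (auto simp: Hm.simps(2), blast+)

lemma Hm_pd:
  assumes "open \<Omega>" "u \<in> Hm (Suc m) \<Omega>"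
  shows "has_weak_deriv \<Omega> (axis j 1) u (pd \<Omega> j u)" "pd \<Omega> j u \<in> Hm m \<Omega>"
proof -
  obtain g where g: "g \<in> Hm m \<Omega>" "has_weak_deriv \<Omega> (axis j 1) u g"
    using assms(2) by (auto simp: Hm.simps(2))
  show *: "has_weak_deriv \<Omega> (axis j 1) u (pd \<Omega> j u)"
    unfolding weak_deriv_def by (rule someI[of "has_weak_deriv \<Omega> (axis j 1) u", OF g(2)])
  show "pd \<Omega> j u \<in> Hm m \<Omega>"
    using has_weak_deriv_unique[OF assms(1) g(2) *] by (rule Hm_ae[OF assms(1) g(1)])
qed

lemma pd_unique:
  assumes "open \<Omega>" "has_weak_deriv \<Omega> (axis j 1) u g"
  shows "ae_eq \<Omega> (pd \<Omega> j u) g"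
  using has_weak_deriv_unique[OF assms(1) _ assms(2)] someI[of "has_weak_deriv \<Omega> (axis j 1) u", OF assms(2)]
  by (simp add: weak_deriv_def)

lemma subspace_Hm: "open \<Omega> \<Longrightarrow> subspace (Hm m \<Omega>)"
proof (induction m)
  case 0
  then show ?case by (simp add: subspace_L2)
next
  case (Suc m)
  note S = Suc.IH[OF Suc.prems]
  show ?case
  proof (rule subspaceI)
    have "has_weak_deriv \<Omega> (axis j 1) 0 0" for j
      using has_weak_deriv_test[OF Suc.prems axis_Basis subspace_0[OF subspace_test]]
      by (simp add: zero_fun_def)
    then show "0 \<in> Hm (Suc m) \<Omega>"
      using subspace_0[OF S] subspace_0[OF subspace_L2] by (auto simp: Hm.simps(2) intro: bexI[of _ 0])
  next
    fix u v assume uv: "u \<in> Hm (Suc m) \<Omega>" "v \<in> Hm (Suc m) \<Omega>"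
    have "\<exists>g\<in>Hm m \<Omega>. has_weak_deriv \<Omega> (axis j 1) (u + v) g" for j
    proof
      show "has_weak_deriv \<Omega> (axis j 1) (u + v) (pd \<Omega> j u + pd \<Omega> j v)"
        by (rule has_weak_deriv_add[OF Suc.prems axis_Basis Hm_pd(1)[OF Suc.prems uv(1)] Hm_pd(1)[OF Suc.prems uv(2)]])
      show "pd \<Omega> j u + pd \<Omega> j v \<in> Hm m \<Omega>"
        by (rule subspace_add[OF S Hm_pd(2)[OF Suc.prems uv(1)] Hm_pd(2)[OF Suc.prems uv(2)]])
    qed
    then show "u + v \<in> Hm (Suc m) \<Omega>"
      using L2.mem(1)[OF Hm_L2[OF uv(1)] Hm_L2[OF uv(2)]] by (simp add: Hm.simps(2))
  next
    fix u and c :: real assume u: "u \<in> Hm (Suc m) \<Omega>"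
    have "\<exists>g\<in>Hm m \<Omega>. has_weak_deriv \<Omega> (axis j 1) (c *\<^sub>R u) g" for j
    proof
      show "has_weak_deriv \<Omega> (axis j 1) (c *\<^sub>R u) (c *\<^sub>R pd \<Omega> j u)"
        by (rule has_weak_deriv_scale[OF Hm_pd(1)[OF Suc.prems u]])
      show "c *\<^sub>R pd \<Omega> j u \<in> Hm m \<Omega>"
        by (rule subspace_scale[OF S Hm_pd(2)[OF Suc.prems u]])
    qed
    then show "c *\<^sub>R u \<in> Hm (Suc m) \<Omega>"
      using L2.mem(2)[OF Hm_L2[OF u]] by (simp add: Hm.simps(2))
  qed
qed

lemma Hm_1_pd:
  assumes "open \<Omega>" "u \<in> Hm 1 \<Omega>"
  shows "has_weak_deriv \<Omega> (axis j 1) u (pd \<Omega> j u)" "pd \<Omega> j u \<in> L2 \<Omega>" "u \<in> L2 \<Omega>"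
  using Hm_pd[OF assms(1), of u 0 j] assms(2) Hm_L2 by (auto simp: One_nat_def)

lemma pd_add:
  "open \<Omega> \<Longrightarrow> u \<in> Hm 1 \<Omega> \<Longrightarrow> v \<in> Hm 1 \<Omega> \<Longrightarrow> ae_eq \<Omega> (pd \<Omega> j (u + v)) (pd \<Omega> j u + pd \<Omega> j v)"
  by (intro pd_unique has_weak_deriv_add Hm_1_pd axis_Basis)

lemma pd_scale:
  "open \<Omega> \<Longrightarrow> u \<in> Hm 1 \<Omega> \<Longrightarrow> ae_eq \<Omega> (pd \<Omega> j (c *\<^sub>R u)) (c *\<^sub>R pd \<Omega> j u)"
  by (intro pd_unique has_weak_deriv_scale Hm_1_pd)

lemma pd_diff:
  "open \<Omega> \<Longrightarrow> u \<in> Hm 1 \<Omega> \<Longrightarrow> v \<in> Hm 1 \<Omega> \<Longrightarrow> ae_eq \<Omega> (pd \<Omega> j (u - v)) (pd \<Omega> j u - pd \<Omega> j v)"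
  using pd_unique[OF _ has_weak_deriv_add[OF _ axis_Basis Hm_1_pd(1) has_weak_deriv_scale[OF Hm_1_pd(1), where c="-1"]], of \<Omega> u v j]
  by simp

text \<open>
  The classical partial derivative, to be distinguished from the weak one \<open>pd\<close>; for a test
  function the two agree almost everywhere.
\<close>

definition cpd :: "2 \<Rightarrow> scalar_field \<Rightarrow> scalar_field" where
  "cpd j \<phi> = dir_deriv (axis j 1) \<phi>"

lemma smooth_cpd: "smooth \<phi> \<Longrightarrow> smooth (cpd j \<phi>)"
  unfolding cpd_def by (rule smooth_dir_deriv) auto

lemma test_cpd: "\<phi> \<in> test_functions \<Omega> \<Longrightarrow> cpd j \<phi> \<in> test_functions \<Omega>"
  unfolding cpd_def by (rule test_dir_deriv) auto

lemma cpd_add: "smooth \<phi> \<Longrightarrow> smooth \<psi> \<Longrightarrow> cpd j (\<phi> + \<psi>) = cpd j \<phi> + cpd j \<psi>"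
  using dir_deriv_add[of \<phi> \<psi> "axis j 1"] by (simp add: cpd_def plus_fun_def)

lemma cpd_scale: "smooth \<phi> \<Longrightarrow> cpd j (c *\<^sub>R \<phi>) = c *\<^sub>R cpd j \<phi>"
  using dir_deriv_cmult[of \<phi> c "axis j 1"] by (simp add: cpd_def scaleR_fun_def)

lemma cpd_mult: "smooth \<phi> \<Longrightarrow> smooth \<psi> \<Longrightarrow> cpd j (\<lambda>x. \<phi> x * \<psi> x) = (\<lambda>x. \<phi> x * cpd j \<psi> x + cpd j \<phi> x * \<psi> x)"
  unfolding cpd_def by (rule dir_deriv_mult)

lemma integral_cpd_test: "open \<Omega> \<Longrightarrow> \<phi> \<in> test_functions \<Omega> \<Longrightarrow> (LINT x|lebesgue_on \<Omega>. cpd j \<phi> x) = 0"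
  unfolding cpd_def by (rule integral_test_dir_deriv) auto

lemma has_weak_deriv_cpd: "open \<Omega> \<Longrightarrow> \<phi> \<in> test_functions \<Omega> \<Longrightarrow> has_weak_deriv \<Omega> (axis j 1) \<phi> (cpd j \<phi>)"
  unfolding cpd_def by (rule has_weak_deriv_test) auto

lemma pd_test: "open \<Omega> \<Longrightarrow> \<phi> \<in> test_functions \<Omega> \<Longrightarrow> ae_eq \<Omega> (pd \<Omega> j \<phi>) (cpd j \<phi>)"
  by (rule pd_unique[OF _ has_weak_deriv_cpd])

lemma test_in_Hm1:
  assumes "open \<Omega>" "\<phi> \<in> test_functions \<Omega>"
  shows "\<phi> \<in> Hm 1 \<Omega>"
proof -
  have "\<exists>g\<in>L2 \<Omega>. has_weak_deriv \<Omega> (axis j 1) \<phi> g" for j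
  proof
    show "has_weak_deriv \<Omega> (axis j 1) \<phi> (cpd j \<phi>)"
      by (rule has_weak_deriv_cpd[OF assms])
    show "cpd j \<phi> \<in> L2 \<Omega>"
      by (rule test_in_L2[OF assms(1) test_cpd[OF assms(2)]])
  qed
  then show ?thesis using test_in_L2[OF assms] by (simp add: One_nat_def Hm.simps)
qed

lemma Hm_norm_1_sq:
  "(Hm_norm 1 \<Omega> u)\<^sup>2 = (L2_norm \<Omega> u)\<^sup>2 + (L2_norm \<Omega> (pd \<Omega> 1 u))\<^sup>2 + (L2_norm \<Omega> (pd \<Omega> 2 u))\<^sup>2"
proof -
  have "{(a::nat, b::nat). a + b \<le> 1} = {(0, 0), (1, 0), (0, 1)}" by auto
  then show ?thesis by (simp add: Hm_norm_def One_nat_def)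
qed

lemma Hm_norm_nonneg [simp]: "0 \<le> Hm_norm m \<Omega> u"
  by (auto simp: Hm_norm_def intro!: sum_nonneg)

lemma L2_norm_le_Hm_norm: "a + b \<le> m \<Longrightarrow> L2_norm \<Omega> ((pd \<Omega> 1 ^^ a) ((pd \<Omega> 2 ^^ b) u)) \<le> Hm_norm m \<Omega> u"
proof -
  assume ab: "a + b \<le> m"
  have fin: "finite {(a::nat, b::nat). a + b \<le> m}"
    by (rule finite_subset[of _ "{..m} \<times> {..m}"]) auto
  have "(L2_norm \<Omega> ((pd \<Omega> 1 ^^ a) ((pd \<Omega> 2 ^^ b) u)))\<^sup>2
      \<le> (\<Sum>(a, b)\<in>{(a, b). a + b \<le> m}. (L2_norm \<Omega> ((pd \<Omega> 1 ^^ a) ((pd \<Omega> 2 ^^ b) u)))\<^sup>2)"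
    using member_le_sum[of "(a, b)" "{(a, b). a + b \<le> m}"
        "\<lambda>(a, b). (L2_norm \<Omega> ((pd \<Omega> 1 ^^ a) ((pd \<Omega> 2 ^^ b) u)))\<^sup>2"] ab fin by auto
  then show ?thesis by (simp add: Hm_norm_def real_le_rsqrt)
qed

lemma two_cases: "(j::2) = 1 \<or> j = 2"
  using exhaust_2 by blast

lemma pd_norm_le_Hm_norm: "L2_norm \<Omega> (pd \<Omega> j u) \<le> Hm_norm 1 \<Omega> u"
  using L2_norm_le_Hm_norm[of 1 0 1 \<Omega> u] L2_norm_le_Hm_norm[of 0 1 1 \<Omega> u] two_cases[of j] by (auto simp: One_nat_def)

lemma H10_Hm: "u \<in> H10 \<Omega> \<Longrightarrow> u \<in> Hm 1 \<Omega>"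
  by (simp add: H10_def)

text \<open>
  The estimates in \<open>H\<^sub>0\<^sup>1\<close> are proved for test functions and passed to the limit along this
  sequence.
\<close>

lemma H10_approx:
  assumes "open \<Omega>" "u \<in> H10 \<Omega>"
  obtains \<phi> where "\<And>n::nat. \<phi> n \<in> test_functions \<Omega>" "(\<lambda>n. L2_norm \<Omega> (u - \<phi> n)) \<longlonglongrightarrow> 0"
    "\<And>j. (\<lambda>n. L2_norm \<Omega> (pd \<Omega> j u - cpd j (\<phi> n))) \<longlonglongrightarrow> 0"
proof -
  have u: "u \<in> Hm 1 \<Omega>" using assms(2) by (rule H10_Hm)
  have "\<exists>\<phi>\<in>test_functions \<Omega>. Hm_norm 1 \<Omega> (u - \<phi>) < \<epsilon>" if "\<epsilon> > 0" for \<epsilon>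
    using assms(2) that by (simp add: H10_def fun_diff_def)
  then have "\<exists>\<phi>\<in>test_functions \<Omega>. Hm_norm 1 \<Omega> (u - \<phi>) < 1 / real (Suc n)" for n by simp
  then obtain \<phi> where \<phi>: "\<And>n. \<phi> n \<in> test_functions \<Omega>" "\<And>n. Hm_norm 1 \<Omega> (u - \<phi> n) < 1 / real (Suc n)"
    by metis
  have lim: "X \<longlonglongrightarrow> 0" if "\<And>n. 0 \<le> X n" "\<And>n. X n \<le> Hm_norm 1 \<Omega> (u - \<phi> n)" for X :: "nat \<Rightarrow> real"
  proof (rule tendsto_sandwich[OF _ _ tendsto_const LIMSEQ_Suc[OF lim_1_over_n]])
    show "\<forall>\<^sub>F n in sequentially. 0 \<le> X n" using that(1) by simp
    show "\<forall>\<^sub>F n in sequentially. X n \<le> 1 / real (Suc n)"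
      using order_trans[OF that(2) less_imp_le[OF \<phi>(2)]] by (rule always_eventually[OF allI])
  qed
  show ?thesis
  proof (rule that[OF \<phi>(1)])
    show "(\<lambda>n. L2_norm \<Omega> (u - \<phi> n)) \<longlonglongrightarrow> 0"
      by (rule lim) (use L2_norm_le_Hm_norm[of 0 0 1 \<Omega>] in auto)
    fix j
    have eq: "L2_norm \<Omega> (pd \<Omega> j u - cpd j (\<phi> n)) = L2_norm \<Omega> (pd \<Omega> j (u - \<phi> n))" for n
    proof (rule L2_norm_cong[symmetric])
      have t: "\<phi> n \<in> Hm 1 \<Omega>" by (rule test_in_Hm1[OF assms(1) \<phi>(1)])
      show "ae_eq \<Omega> (pd \<Omega> j (u - \<phi> n)) (pd \<Omega> j u - cpd j (\<phi> n))"
        by (rule ae_eq_trans[OF pd_diff[OF assms(1) u t]])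
          (intro ae_eq_diff ae_eq_refl pd_test assms \<phi>)
      show "pd \<Omega> j (u - \<phi> n) \<in> L2 \<Omega>"
        by (intro Hm_1_pd[OF assms(1)] subspace_diff[OF subspace_Hm[OF assms(1)]] u t)
      show "pd \<Omega> j u - cpd j (\<phi> n) \<in> L2 \<Omega>"
        using Hm_1_pd[OF assms(1) u] test_in_L2[OF assms(1) test_cpd[OF \<phi>(1)]]
        by (intro L2.mem) auto
    qed
    show "(\<lambda>n. L2_norm \<Omega> (pd \<Omega> j u - cpd j (\<phi> n))) \<longlonglongrightarrow> 0"
      unfolding eq by (rule lim) (auto simp: pd_norm_le_Hm_norm)
  qed
qed

lemma Hm_norm_1_le:
  "Hm_norm 1 \<Omega> u \<le> L2_norm \<Omega> u + L2_norm \<Omega> (pd \<Omega> 1 u) + L2_norm \<Omega> (pd \<Omega> 2 u)"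
proof (rule power2_le_imp_le)
  have "0 \<le> L2_norm \<Omega> a * L2_norm \<Omega> b" for a b :: "real^2 \<Rightarrow> real" by simp
  then show "(Hm_norm 1 \<Omega> u)\<^sup>2 \<le> (L2_norm \<Omega> u + L2_norm \<Omega> (pd \<Omega> 1 u) + L2_norm \<Omega> (pd \<Omega> 2 u))\<^sup>2"
    unfolding Hm_norm_1_sq by (simp add: power2_sum algebra_simps)
qed simp

lemma test_in_H10: 
  assumes "open \<Omega>" "\<phi> \<in> test_functions \<Omega>"
  shows "\<phi> \<in> H10 \<Omega>"
proof -
  have "L2_norm \<Omega> (0 :: real^2 \<Rightarrow> real) = 0" by (simp add: L2_norm_def L2_inner_def)
  moreover have "L2_norm \<Omega> (pd \<Omega> j 0) = 0" for j
  proof -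
    have t: "0 \<in> test_functions \<Omega>" using subspace_test by (rule subspace_0)
    have "L2_norm \<Omega> (pd \<Omega> j 0) = L2_norm \<Omega> (cpd j (0 :: real^2 \<Rightarrow> real))"
      by (rule L2_norm_cong[OF Hm_1_pd(2)[OF assms(1) test_in_Hm1[OF assms(1) t]] test_in_L2[OF assms(1) test_cpd[OF t]] pd_test[OF assms(1) t]])
    then show ?thesis by (simp add: L2_norm_def L2_inner_def zero_fun_def cpd_def)
  qed
  ultimately have "Hm_norm 1 \<Omega> 0 \<le> 0" using Hm_norm_1_le[of \<Omega> 0] by simp
  then have "Hm_norm 1 \<Omega> 0 = 0" using Hm_norm_nonneg[of 1 \<Omega> 0] by (rule antisym)
  then have "Hm_norm 1 \<Omega> (\<lambda>x. \<phi> x - \<phi> x) = 0" by (simp add: zero_fun_def)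
  then show ?thesis using assms by (auto simp: H10_def test_in_Hm1 intro!: bexI[of _ \<phi>])
qed

lemma H10_I:
  assumes "open \<Omega>" "u \<in> Hm 1 \<Omega>" "\<And>n::nat. \<phi> n \<in> test_functions \<Omega>"
    "(\<lambda>n. L2_norm \<Omega> (u - \<phi> n)) \<longlonglongrightarrow> 0"
    "\<And>j. (\<lambda>n. L2_norm \<Omega> (pd \<Omega> j u - cpd j (\<phi> n))) \<longlonglongrightarrow> 0"
  shows "u \<in> H10 \<Omega>"
proof -
  have le: "Hm_norm 1 \<Omega> (u - \<phi> n) \<le> L2_norm \<Omega> (u - \<phi> n)
      + L2_norm \<Omega> (pd \<Omega> 1 u - cpd 1 (\<phi> n)) + L2_norm \<Omega> (pd \<Omega> 2 u - cpd 2 (\<phi> n))" for n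
  proof -
    have "L2_norm \<Omega> (pd \<Omega> j (u - \<phi> n)) = L2_norm \<Omega> (pd \<Omega> j u - cpd j (\<phi> n))" for j
    proof (rule L2_norm_cong)
      have t: "\<phi> n \<in> Hm 1 \<Omega>" by (rule test_in_Hm1[OF assms(1,3)])
      show "ae_eq \<Omega> (pd \<Omega> j (u - \<phi> n)) (pd \<Omega> j u - cpd j (\<phi> n))"
        by (rule ae_eq_trans[OF pd_diff[OF assms(1,2) t]])
          (intro ae_eq_diff ae_eq_refl pd_test assms)
      show "pd \<Omega> j (u - \<phi> n) \<in> L2 \<Omega>"
        by (intro Hm_1_pd[OF assms(1)] subspace_diff[OF subspace_Hm[OF assms(1)]] assms(2) t)
      show "pd \<Omega> j u - cpd j (\<phi> n) \<in> L2 \<Omega>"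
        using Hm_1_pd[OF assms(1,2)] test_in_L2[OF assms(1) test_cpd[OF assms(3)]]
        by (intro L2.mem) auto
    qed
    then show ?thesis using Hm_norm_1_le[of \<Omega> "u - \<phi> n"] by simp
  qed
  have "(\<lambda>n. L2_norm \<Omega> (u - \<phi> n)
      + L2_norm \<Omega> (pd \<Omega> 1 u - cpd 1 (\<phi> n)) + L2_norm \<Omega> (pd \<Omega> 2 u - cpd 2 (\<phi> n))) \<longlonglongrightarrow> 0 + 0 + 0"
    by (intro tendsto_add assms)
  then have "\<forall>\<^sub>F n in sequentially. L2_norm \<Omega> (u - \<phi> n)
      + L2_norm \<Omega> (pd \<Omega> 1 u - cpd 1 (\<phi> n)) + L2_norm \<Omega> (pd \<Omega> 2 u - cpd 2 (\<phi> n)) < \<epsilon>" if "\<epsilon> > 0" for \<epsilon>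
    by (rule order_tendstoD) (use that in simp)
  note small = this
  have ev: "\<forall>\<^sub>F n in sequentially. Hm_norm 1 \<Omega> (u - \<phi> n) < \<epsilon>" if "\<epsilon> > 0" for \<epsilon>
    using eventually_mono[OF small[OF that] le_less_trans[OF le]] by simp
  have "\<exists>\<psi>\<in>test_functions \<Omega>. Hm_norm 1 \<Omega> (u - \<psi>) < \<epsilon>" if "\<epsilon> > 0" for \<epsilon>
    using eventually_happens'[OF sequentially_bot ev[OF that]] assms(3) by blast
  then show ?thesis using assms(2) by (simp add: H10_def fun_diff_def)
qed

lemma subspace_H10:
  assumes "open \<Omega>"
  shows "subspace (H10 \<Omega>)"
proof (rule subspaceI)
  note [simp] = H10_Hm
  note S = subspace_Hm[OF assms, of 1]
  note L = L2.mem Hm_1_pd[OF assms] test_in_L2[OF assms] test_cpd subspace_add[OF S] subspace_scale[OF S]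
  show "0 \<in> H10 \<Omega>" by (intro test_in_H10 assms subspace_0 subspace_test)
  fix u and c :: real assume u: "u \<in> H10 \<Omega>"
  obtain \<phi> where \<phi>: "\<And>n::nat. \<phi> n \<in> test_functions \<Omega>" "(\<lambda>n. L2_norm \<Omega> (u - \<phi> n)) \<longlonglongrightarrow> 0"
    "\<And>j. (\<lambda>n. L2_norm \<Omega> (pd \<Omega> j u - cpd j (\<phi> n))) \<longlonglongrightarrow> 0"
    using H10_approx[OF assms u] by blast
  show "c *\<^sub>R u \<in> H10 \<Omega>"
  proof (rule H10_I[OF assms, where \<phi>="\<lambda>n. c *\<^sub>R \<phi> n"])
    show "c *\<^sub>R u \<in> Hm 1 \<Omega>" using u by (intro L) auto
    show "c *\<^sub>R \<phi> n \<in> test_functions \<Omega>" for n using \<phi>(1) by (intro subspace_scale subspace_test)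
    have "L2_norm \<Omega> (c *\<^sub>R u - c *\<^sub>R \<phi> n) = \<bar>c\<bar> * L2_norm \<Omega> (u - \<phi> n)" for n
      unfolding scaleR_diff_right[symmetric] using u \<phi>(1) by (intro L2_norm_scale L) auto
    then show "(\<lambda>n. L2_norm \<Omega> (c *\<^sub>R u - c *\<^sub>R \<phi> n)) \<longlonglongrightarrow> 0"
      using tendsto_mult_right_zero[OF \<phi>(2), of "\<bar>c\<bar>"] by simp
    fix j
    have "L2_norm \<Omega> (pd \<Omega> j (c *\<^sub>R u) - cpd j (c *\<^sub>R \<phi> n))
        = \<bar>c\<bar> * L2_norm \<Omega> (pd \<Omega> j u - cpd j (\<phi> n))" for n
    proof -
      have d: "cpd j (c *\<^sub>R \<phi> n) = c *\<^sub>R cpd j (\<phi> n)"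
        by (rule cpd_scale[OF test_smooth[OF \<phi>(1)]])
      have "L2_norm \<Omega> (pd \<Omega> j (c *\<^sub>R u) - cpd j (c *\<^sub>R \<phi> n))
          = L2_norm \<Omega> (c *\<^sub>R (pd \<Omega> j u - cpd j (\<phi> n)))"
        unfolding d scaleR_diff_right
      proof (rule L2_norm_cong)
        have m: "pd \<Omega> j u \<in> L2 \<Omega>" "pd \<Omega> j (c *\<^sub>R u) \<in> L2 \<Omega>" "cpd j (\<phi> n) \<in> L2 \<Omega>"
          using u \<phi>(1) Hm_1_pd(2)[OF assms subspace_scale[OF S H10_Hm[OF u]]] by (auto intro: L)
        show "pd \<Omega> j (c *\<^sub>R u) - c *\<^sub>R cpd j (\<phi> n) \<in> L2 \<Omega>"
          "c *\<^sub>R pd \<Omega> j u - c *\<^sub>R cpd j (\<phi> n) \<in> L2 \<Omega>" using m by (auto intro: L2.mem)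
        show "ae_eq \<Omega> (pd \<Omega> j (c *\<^sub>R u) - c *\<^sub>R cpd j (\<phi> n)) (c *\<^sub>R pd \<Omega> j u - c *\<^sub>R cpd j (\<phi> n))"
          by (rule ae_eq_diff[OF pd_scale[OF assms H10_Hm[OF u]] ae_eq_refl])
      qed
      then show ?thesis using u \<phi>(1) by (simp add: L2_norm_scale L)
    qed
    then show "(\<lambda>n. L2_norm \<Omega> (pd \<Omega> j (c *\<^sub>R u) - cpd j (c *\<^sub>R \<phi> n))) \<longlonglongrightarrow> 0"
      using tendsto_mult_right_zero[OF \<phi>(3), of "\<bar>c\<bar>"] by simp
  qed
next
  note S = subspace_Hm[OF assms, of 1]
  note L = L2.mem Hm_1_pd[OF assms] test_in_L2[OF assms] test_cpd subspace_add[OF S] subspace_scale[OF S]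
  fix u v assume uv: "u \<in> H10 \<Omega>" "v \<in> H10 \<Omega>"
  then have uv1: "u \<in> Hm 1 \<Omega>" "v \<in> Hm 1 \<Omega>" by (auto intro: H10_Hm)
  obtain \<phi> where \<phi>: "\<And>n::nat. \<phi> n \<in> test_functions \<Omega>" "(\<lambda>n. L2_norm \<Omega> (u - \<phi> n)) \<longlonglongrightarrow> 0"
    "\<And>j. (\<lambda>n. L2_norm \<Omega> (pd \<Omega> j u - cpd j (\<phi> n))) \<longlonglongrightarrow> 0"
    using H10_approx[OF assms uv(1)] by blast
  obtain \<psi> where \<psi>: "\<And>n::nat. \<psi> n \<in> test_functions \<Omega>" "(\<lambda>n. L2_norm \<Omega> (v - \<psi> n)) \<longlonglongrightarrow> 0"
    "\<And>j. (\<lambda>n. L2_norm \<Omega> (pd \<Omega> j v - cpd j (\<psi> n))) \<longlonglongrightarrow> 0"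
    using H10_approx[OF assms uv(2)] by blast
  have lim: "X \<longlonglongrightarrow> 0" if "\<And>n. 0 \<le> X n" "\<And>n. X n \<le> Y n + Z n" "Y \<longlonglongrightarrow> 0" "Z \<longlonglongrightarrow> 0" for X Y Z :: "nat \<Rightarrow> real"
    by (rule tendsto_sandwich[of "\<lambda>_. 0" _ _ "\<lambda>n. Y n + Z n"]) (use that tendsto_add[OF that(3,4)] in auto)
  show "u + v \<in> H10 \<Omega>"
  proof (rule H10_I[OF assms, where \<phi>="\<lambda>n. \<phi> n + \<psi> n"])
    show "u + v \<in> Hm 1 \<Omega>" using uv1 by (intro L)
    show "\<phi> n + \<psi> n \<in> test_functions \<Omega>" for n using \<phi>(1) \<psi>(1) by (intro subspace_add subspace_test)
    show "(\<lambda>n. L2_norm \<Omega> (u + v - (\<phi> n + \<psi> n))) \<longlonglongrightarrow> 0"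
    proof (rule lim[OF _ _ \<phi>(2) \<psi>(2)])
      fix n show "L2_norm \<Omega> (u + v - (\<phi> n + \<psi> n)) \<le> L2_norm \<Omega> (u - \<phi> n) + L2_norm \<Omega> (v - \<psi> n)"
        unfolding add_diff_add using uv1 \<phi>(1) \<psi>(1) by (intro L2_triangle L)
    qed simp
    fix j
    show "(\<lambda>n. L2_norm \<Omega> (pd \<Omega> j (u + v) - cpd j (\<phi> n + \<psi> n))) \<longlonglongrightarrow> 0"
    proof (rule lim[OF _ _ \<phi>(3)[of j] \<psi>(3)[of j]])
      fix n
      have d: "cpd j (\<phi> n + \<psi> n) = cpd j (\<phi> n) + cpd j (\<psi> n)"
        by (rule cpd_add[OF test_smooth[OF \<phi>(1)] test_smooth[OF \<psi>(1)]])
      have "L2_norm \<Omega> (pd \<Omega> j (u + v) - cpd j (\<phi> n + \<psi> n))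
          = L2_norm \<Omega> ((pd \<Omega> j u - cpd j (\<phi> n)) + (pd \<Omega> j v - cpd j (\<psi> n)))"
        unfolding d add_diff_add[symmetric]
      proof (rule L2_norm_cong)
        have m: "pd \<Omega> j u \<in> L2 \<Omega>" "pd \<Omega> j v \<in> L2 \<Omega>" "pd \<Omega> j (u + v) \<in> L2 \<Omega>"
          "cpd j (\<phi> n) \<in> L2 \<Omega>" "cpd j (\<psi> n) \<in> L2 \<Omega>"
          using uv1 \<phi>(1) \<psi>(1) Hm_1_pd(2)[OF assms subspace_add[OF S uv1]] by (auto intro: L)
        show "pd \<Omega> j (u + v) - (cpd j (\<phi> n) + cpd j (\<psi> n)) \<in> L2 \<Omega>"
          "pd \<Omega> j u + pd \<Omega> j v - (cpd j (\<phi> n) + cpd j (\<psi> n)) \<in> L2 \<Omega>"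
          using m by (auto intro: L2.mem)
        show "ae_eq \<Omega> (pd \<Omega> j (u + v) - (cpd j (\<phi> n) + cpd j (\<psi> n)))
            (pd \<Omega> j u + pd \<Omega> j v - (cpd j (\<phi> n) + cpd j (\<psi> n)))"
          by (rule ae_eq_diff[OF pd_add[OF assms uv1] ae_eq_refl])
      qed
      also have "\<dots> \<le> L2_norm \<Omega> (pd \<Omega> j u - cpd j (\<phi> n)) + L2_norm \<Omega> (pd \<Omega> j v - cpd j (\<psi> n))"
        using uv1 \<phi>(1) \<psi>(1) by (intro L2_triangle L)
      finally show "L2_norm \<Omega> (pd \<Omega> j (u + v) - cpd j (\<phi> n + \<psi> n))
          \<le> L2_norm \<Omega> (pd \<Omega> j u - cpd j (\<phi> n)) + L2_norm \<Omega> (pd \<Omega> j v - cpd j (\<psi> n))" .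
    qed simp
  qed
qed

section \<open>The Loomis-Whitney inequality\<close>

text \<open>
  The identification of \<open>\<real> \<times> \<real>\<close> with the plane, through which Fubini's theorem is applied.
\<close>

definition vec2 :: "real \<times> real \<Rightarrow> real^2" where
  "vec2 p = fst p *\<^sub>R axis 1 1 + snd p *\<^sub>R axis 2 1"

lemma vec2_nth [simp]: "vec2 p $ 1 = fst p" "vec2 p $ 2 = snd p"
  by (auto simp: vec2_def axis_def)

lemma continuous_vec2: "continuous_on UNIV vec2"
  unfolding vec2_def by (intro continuous_intros)

lemma measurable_vec2 [measurable]: "vec2 \<in> borel_measurable borel"
  using continuous_vec2 by (rule borel_measurable_continuous_onI)

lemma Basis_real2: "(Basis :: (real^2) set) = {axis 1 1, axis 2 1}"
  by (auto simp: Basis_vec_def UNIV_2)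

lemma axis_1_neq_2: "axis (1::2) (1::real) \<noteq> axis 2 1"
  by (simp add: axis_eq_axis)

lemma box_real2: "x \<in> box a b \<longleftrightarrow> a $ 1 < x $ 1 \<and> x $ 1 < b $ 1 \<and> a $ 2 < x $ 2 \<and> x $ 2 < b $ 2" for x :: "real^2"
  by (auto simp: mem_box Basis_real2 inner_axis)

lemma lborel_real2: "(lborel :: (real^2) measure) = distr (lborel \<Otimes>\<^sub>M lborel) borel vec2"
proof (rule lborel_eqI)
  fix l u :: "real^2" assume *: "\<And>b. b \<in> Basis \<Longrightarrow> l \<bullet> b \<le> u \<bullet> b"
  have le: "l $ 1 \<le> u $ 1" "l $ 2 \<le> u $ 2"
    using *[of "axis 1 1"] *[of "axis 2 1"] by (auto simp: inner_axis)
  have "vec2 -` box l u \<inter> space (lborel \<Otimes>\<^sub>M lborel) = {l $ 1<..<u $ 1} \<times> {l $ 2<..<u $ 2}"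
    by (auto simp: box_real2 space_pair_measure)
  then have "emeasure (distr (lborel \<Otimes>\<^sub>M lborel) borel vec2) (box l u)
      = emeasure (lborel \<Otimes>\<^sub>M lborel) ({l $ 1<..<u $ 1} \<times> {l $ 2<..<u $ 2})"
    by (subst emeasure_distr) (auto simp: lborel_prod)
  also have "\<dots> = ennreal (u $ 1 - l $ 1) * ennreal (u $ 2 - l $ 2)"
    using le by (subst lborel.emeasure_pair_measure_Times) auto
  also have "\<dots> = ennreal (\<Prod>b\<in>Basis. (u - l) \<bullet> b)"
    using le by (simp add: Basis_real2 axis_1_neq_2 inner_axis ennreal_mult)
  finally show "emeasure (distr (lborel \<Otimes>\<^sub>M lborel) borel vec2) (box l u) = (\<Prod>b\<in>Basis. (u - l) \<bullet> b)" .
qed simp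

lemma nn_integral_real2:
  assumes [measurable]: "f \<in> borel_measurable borel"
  shows "(\<integral>\<^sup>+z. f z \<partial>(lborel :: (real^2) measure)) = (\<integral>\<^sup>+x. \<integral>\<^sup>+y. f (vec2 (x, y)) \<partial>lborel \<partial>lborel)"
    "(\<integral>\<^sup>+z. f z \<partial>(lborel :: (real^2) measure)) = (\<integral>\<^sup>+y. \<integral>\<^sup>+x. f (vec2 (x, y)) \<partial>lborel \<partial>lborel)"
proof -
  have *: "(\<integral>\<^sup>+z. f z \<partial>(lborel :: (real^2) measure)) = (\<integral>\<^sup>+p. f (vec2 p) \<partial>(lborel \<Otimes>\<^sub>M lborel))"
    by (subst lborel_real2, subst nn_integral_distr) (auto simp: lborel_prod)
  have m: "(\<lambda>p. f (vec2 p)) \<in> borel_measurable (lborel \<Otimes>\<^sub>M lborel)"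
    by (simp add: lborel_prod)
  show "(\<integral>\<^sup>+z. f z \<partial>(lborel :: (real^2) measure)) = (\<integral>\<^sup>+x. \<integral>\<^sup>+y. f (vec2 (x, y)) \<partial>lborel \<partial>lborel)"
    unfolding * using lborel.nn_integral_fst[OF m] by simp
  show "(\<integral>\<^sup>+z. f z \<partial>(lborel :: (real^2) measure)) = (\<integral>\<^sup>+y. \<integral>\<^sup>+x. f (vec2 (x, y)) \<partial>lborel \<partial>lborel)"
    unfolding * using lborel_pair.nn_integral_snd[OF m] by simp
qed

lemma abs_le_nn_integral_deriv:
  fixes g :: "real \<Rightarrow> real"
  assumes "\<And>s. (g has_real_derivative g' s) (at s)" "continuous_on UNIV g'" "g a = 0" "a \<le> x"
  shows "ennreal \<bar>g x\<bar> \<le> (\<integral>\<^sup>+s. ennreal \<bar>g' s\<bar> \<partial>lborel)"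
proof -
  have i: "integrable lborel (\<lambda>s. g' s * indicator {a..x} s)"
    using borel_integrable_atLeastAtMost[of a x g'] assms(2)
    by (simp add: continuous_on_eq_continuous_at)
  have "(LINT s|lborel. g' s * indicator {a..x} s) = g x - g a"
    using assms(1,2,4) by (intro integral_FTC_Icc_real) (auto simp: continuous_on_eq_continuous_at)
  then have "\<bar>g x\<bar> \<le> (LINT s|lborel. \<bar>g' s * indicator {a..x} s\<bar>)"
    using assms(3) integral_abs_bound[of lborel "\<lambda>s. g' s * indicator {a..x} s"] by simp
  then have "ennreal \<bar>g x\<bar> \<le> ennreal (LINT s|lborel. \<bar>g' s * indicator {a..x} s\<bar>)"
    by (rule ennreal_leI)
  also have "\<dots> = (\<integral>\<^sup>+s. ennreal \<bar>g' s * indicator {a..x} s\<bar> \<partial>lborel)"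
    using i by (intro nn_integral_eq_integral[symmetric]) auto
  also have "\<dots> \<le> (\<integral>\<^sup>+s. ennreal \<bar>g' s\<bar> \<partial>lborel)"
    by (intro nn_integral_mono ennreal_leI) (auto simp: indicator_def)
  finally show ?thesis .
qed

text \<open>
  Integrating along a horizontal line bounds \<open>\<bar>F (x, y)\<bar>\<close> by a function of \<open>y\<close> alone, integrating
  along a vertical line by a function of \<open>x\<close> alone. The product of the two bounds has a product
  integral.
\<close>

lemma loomis_whitney:
  assumes "smooth F" "compact S" "\<And>x. x \<notin> S \<Longrightarrow> F x = 0"
  shows "(LINT x|lborel. (F x)\<^sup>2) \<le> (LINT x|lborel. \<bar>cpd 1 F x\<bar>) * (LINT x|lborel. \<bar>cpd 2 F x\<bar>)"
proof -
  have cF: "continuous_on UNIV F" and cD: "continuous_on UNIV (cpd j F)" for j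
    using assms(1) by (auto intro: smooth_continuous smooth_cpd)
  have mF [measurable]: "F \<in> borel_measurable borel" and mD [measurable]: "cpd j F \<in> borel_measurable borel" for j
    using cF cD by (auto intro: borel_measurable_continuous_onI)
  obtain R where R: "\<And>x. x \<in> S \<Longrightarrow> norm x \<le> R"
    using compact_imp_bounded[OF assms(2)] by (auto simp: bounded_iff)
  have zero: "F z = 0" if "\<bar>z $ i\<bar> > R" for z i
    using R[of z] component_le_norm_cart[of z i] that assms(3)[of z] by fastforce
  define p where "p y = (\<integral>\<^sup>+s. ennreal \<bar>cpd 1 F (vec2 (s, y))\<bar> \<partial>lborel)" for y
  define q where "q x = (\<integral>\<^sup>+s. ennreal \<bar>cpd 2 F (vec2 (x, s))\<bar> \<partial>lborel)" for x
  have mp [measurable]: "p \<in> borel_measurable borel" and mq [measurable]: "q \<in> borel_measurable borel"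
    unfolding p_def q_def by measurable
  have lineder: "((\<lambda>s. F (z + s *\<^sub>R axis i 1)) has_real_derivative cpd i F (z + s *\<^sub>R axis i 1)) (at s)" for i z s
    unfolding cpd_def by (rule smooth_dir_has_real_derivative[OF assms(1)])
  have linecont: "continuous_on UNIV (\<lambda>s::real. cpd i F (z + s *\<^sub>R axis i 1))" for i z
    by (intro continuous_on_compose2[OF cD] continuous_intros) auto
  have le_p: "ennreal \<bar>F (vec2 (x, y))\<bar> \<le> p y" for x y
  proof -
    have *: "vec2 (s, y) = vec2 (0, y) + s *\<^sub>R axis 1 1" for s by (simp add: vec2_def)
    have "F (vec2 (min x (- \<bar>R\<bar> - 1), y)) = 0" by (rule zero[of _ 1]) auto
    then have "F (vec2 (0, y) + min x (- \<bar>R\<bar> - 1) *\<^sub>R axis 1 1) = 0" by (simp only: *[symmetric])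
    from abs_le_nn_integral_deriv[OF lineder linecont this min.cobounded1]
    show ?thesis unfolding p_def by (simp only: *[symmetric])
  qed
  have le_q: "ennreal \<bar>F (vec2 (x, y))\<bar> \<le> q x" for x y
  proof -
    have *: "vec2 (x, s) = vec2 (x, 0) + s *\<^sub>R axis 2 1" for s by (simp add: vec2_def)
    have "F (vec2 (x, min y (- \<bar>R\<bar> - 1))) = 0" by (rule zero[of _ 2]) auto
    then have "F (vec2 (x, 0) + min y (- \<bar>R\<bar> - 1) *\<^sub>R axis 2 1) = 0" by (simp only: *[symmetric])
    from abs_le_nn_integral_deriv[OF lineder linecont this min.cobounded1]
    show ?thesis unfolding q_def by (simp only: *[symmetric])
  qed
  have out: "cpd j F x = 0" if "x \<notin> S" for j x
    unfolding cpd_def using dir_deriv_outside[OF compact_imp_closed[OF assms(2)] assms(3) that] .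
  have iD: "integrable lborel (cpd j F)" for j
    using integrable_compact_support(1)[OF cD assms(2) out] .
  have iF: "integrable lborel (\<lambda>x. (F x)\<^sup>2)"
    by (rule integrable_compact_support(1)[OF _ assms(2)]) (use assms(3) cF in \<open>auto intro!: continuous_intros\<close>)
  have "(\<integral>\<^sup>+z. ennreal ((F z)\<^sup>2) \<partial>lborel) = (\<integral>\<^sup>+x. \<integral>\<^sup>+y. ennreal ((F (vec2 (x, y)))\<^sup>2) \<partial>lborel \<partial>lborel)"
    by (rule nn_integral_real2) measurable
  also have "\<dots> \<le> (\<integral>\<^sup>+x. \<integral>\<^sup>+y. q x * p y \<partial>lborel \<partial>lborel)"
  proof (intro nn_integral_mono)
    fix x y
    have "ennreal ((F (vec2 (x, y)))\<^sup>2) = ennreal \<bar>F (vec2 (x, y))\<bar> * ennreal \<bar>F (vec2 (x, y))\<bar>"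
      by (simp add: ennreal_mult[symmetric] power2_eq_square)
    also have "\<dots> \<le> q x * p y" by (intro mult_mono le_p le_q) auto
    finally show "ennreal ((F (vec2 (x, y)))\<^sup>2) \<le> q x * p y" .
  qed
  also have "\<dots> = (\<integral>\<^sup>+x. q x \<partial>lborel) * (\<integral>\<^sup>+y. p y \<partial>lborel)"
    by (simp add: nn_integral_cmult nn_integral_multc)
  also have "(\<integral>\<^sup>+x. q x \<partial>lborel) = (\<integral>\<^sup>+z. ennreal \<bar>cpd 2 F z\<bar> \<partial>lborel)"
    unfolding q_def by (rule nn_integral_real2(1)[symmetric]) measurable
  also have "(\<integral>\<^sup>+y. p y \<partial>lborel) = (\<integral>\<^sup>+z. ennreal \<bar>cpd 1 F z\<bar> \<partial>lborel)"
    unfolding p_def by (rule nn_integral_real2(2)[symmetric]) measurable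
  also have "(\<integral>\<^sup>+z. ennreal \<bar>cpd 2 F z\<bar> \<partial>lborel) = ennreal (LINT x|lborel. \<bar>cpd 2 F x\<bar>)"
    using iD by (intro nn_integral_eq_integral) auto
  also have "(\<integral>\<^sup>+z. ennreal \<bar>cpd 1 F z\<bar> \<partial>lborel) = ennreal (LINT x|lborel. \<bar>cpd 1 F x\<bar>)"
    using iD by (intro nn_integral_eq_integral) auto
  also have "(\<integral>\<^sup>+z. ennreal ((F z)\<^sup>2) \<partial>lborel) = ennreal (LINT x|lborel. (F x)\<^sup>2)"
    using iF by (intro nn_integral_eq_integral) auto
  finally show ?thesis
    by (simp add: ennreal_mult[symmetric] integral_nonneg_AE mult.commute)
qed

section \<open>Ladyzhenskaya's inequality\<close>

text \<open>
  The square as a function: \<open>L2_norm \<Omega> (sqf u)\<close> is the square of the \<open>L\<^sup>4\<close> norm of \<open>u\<close>.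
\<close>

definition sqf :: "('a \<Rightarrow> real) \<Rightarrow> 'a \<Rightarrow> real" where "sqf u x = u x * u x"

definition gnorm :: "(real^2) set \<Rightarrow> scalar_field \<Rightarrow> real" where
  "gnorm \<Omega> u = sqrt ((L2_norm \<Omega> (pd \<Omega> 1 u))\<^sup>2 + (L2_norm \<Omega> (pd \<Omega> 2 u))\<^sup>2)"

lemma gnorm_nonneg [simp]: "0 \<le> gnorm \<Omega> u" by (simp add: gnorm_def)

lemma pd_le_gnorm: "L2_norm \<Omega> (pd \<Omega> j u) \<le> gnorm \<Omega> u"
  unfolding gnorm_def using two_cases[of j] by (auto intro!: real_le_rsqrt)

lemma L2_inner_abs_le:
  assumes "u \<in> L2 \<Omega>" "v \<in> L2 \<Omega>"
  shows "(LINT x|lebesgue_on \<Omega>. \<bar>u x * v x\<bar>) \<le> L2_norm \<Omega> u * L2_norm \<Omega> (v :: _ \<Rightarrow> real)"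
proof -
  have a: "(\<lambda>x. \<bar>w x\<bar>) \<in> L2 \<Omega>" "L2_norm \<Omega> (\<lambda>x. \<bar>w x\<bar>) = L2_norm \<Omega> w" if "w \<in> L2 \<Omega>" for w :: "'a \<Rightarrow> real"
    using that by (auto simp: L2_def L2_norm_def L2_inner_def)
  show ?thesis
    using L2_cauchy_schwarz[OF a(1)[OF assms(1)] a(1)[OF assms(2)]] a(2)[OF assms(1)] a(2)[OF assms(2)]
    by (simp add: L2_inner_def abs_mult)
qed

text \<open>
  The Loomis-Whitney inequality for \<open>F = \<phi>\<^sup>2\<close>, whose derivatives are \<open>2 \<phi> \<partial>\<^sub>j\<phi>\<close>.
\<close>

lemma ladyzhenskaya_test:
  assumes "open \<Omega>" "\<phi> \<in> test_functions \<Omega>"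
  shows "L2_norm \<Omega> (sqf \<phi>) \<le> 2 * L2_norm \<Omega> \<phi> * sqrt (L2_norm \<Omega> (cpd 1 \<phi>) * L2_norm \<Omega> (cpd 2 \<phi>))"
proof (rule power2_le_imp_le)
  note \<Omega> = open_in_lebesgue[OF assms(1)]
  have sm: "smooth \<phi>" using assms(2) by (rule test_smooth)
  have F: "sqf \<phi> \<in> test_functions \<Omega>" unfolding sqf_def[abs_def] by (rule test_mult[OF assms(2) sm])
  obtain S where S: "smooth (sqf \<phi>)" "compact S" "\<And>x. x \<notin> S \<Longrightarrow> sqf \<phi> x = 0"
    using F by (rule test_functionsE) (rule that, assumption+)
  have L: "\<phi> \<in> L2 \<Omega>" "cpd j \<phi> \<in> L2 \<Omega>" "sqf \<phi> \<in> L2 \<Omega>" for j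
    using assms F by (auto intro: test_in_L2 test_cpd)
  have c: "continuous_on UNIV (sqf \<phi>)" "continuous_on UNIV (cpd j (sqf \<phi>))" for j
    using F by (auto intro: test_continuous test_cpd)
  have d: "cpd j (sqf \<phi>) x = 2 * (\<phi> x * cpd j \<phi> x)" for j x
    using cpd_mult[OF sm sm, of j] by (simp add: sqf_def[abs_def])
  have D: "(LINT x|lborel. \<bar>cpd j (sqf \<phi>) x\<bar>) \<le> 2 * (L2_norm \<Omega> \<phi> * L2_norm \<Omega> (cpd j \<phi>))" for j
  proof -
    have "(LINT x|lborel. \<bar>cpd j (sqf \<phi>) x\<bar>) = (LINT x|lebesgue_on \<Omega>. \<bar>cpd j (sqf \<phi>) x\<bar>)"
      by (rule integral_lebesgue_on_support[symmetric, OF \<Omega>])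
        (use c in \<open>auto intro!: continuous_intros test_zero_outside[OF test_cpd[OF F]]\<close>)
    also have "\<dots> = 2 * (LINT x|lebesgue_on \<Omega>. \<bar>\<phi> x * cpd j \<phi> x\<bar>)" by (simp add: d abs_mult)
    also have "\<dots> \<le> 2 * (L2_norm \<Omega> \<phi> * L2_norm \<Omega> (cpd j \<phi>))"
      using L2_inner_abs_le[OF L(1) L(2)] by simp
    finally show ?thesis .
  qed
  have "(L2_norm \<Omega> (sqf \<phi>))\<^sup>2 = (LINT x|lebesgue_on \<Omega>. (sqf \<phi> x)\<^sup>2)"
    using L2_norm_sq[OF L(3)] by (simp add: L2_inner_def power2_eq_square)
  also have "\<dots> = (LINT x|lborel. (sqf \<phi> x)\<^sup>2)"
    by (rule integral_lebesgue_on_support[OF \<Omega>])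
      (use c test_zero_outside[OF F] in \<open>auto intro!: continuous_intros\<close>)
  also have "\<dots> \<le> (LINT x|lborel. \<bar>cpd 1 (sqf \<phi>) x\<bar>) * (LINT x|lborel. \<bar>cpd 2 (sqf \<phi>) x\<bar>)"
    by (rule loomis_whitney[OF S])
  also have "\<dots> \<le> (2 * (L2_norm \<Omega> \<phi> * L2_norm \<Omega> (cpd 1 \<phi>))) * (2 * (L2_norm \<Omega> \<phi> * L2_norm \<Omega> (cpd 2 \<phi>)))"
    by (intro mult_mono D) (auto intro!: mult_nonneg_nonneg integral_nonneg_AE)
  also have "\<dots> = (2 * L2_norm \<Omega> \<phi> * sqrt (L2_norm \<Omega> (cpd 1 \<phi>) * L2_norm \<Omega> (cpd 2 \<phi>)))\<^sup>2"
    by (simp add: power_mult_distrib power2_eq_square)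
  finally show "(L2_norm \<Omega> (sqf \<phi>))\<^sup>2 \<le> (2 * L2_norm \<Omega> \<phi> * sqrt (L2_norm \<Omega> (cpd 1 \<phi>) * L2_norm \<Omega> (cpd 2 \<phi>)))\<^sup>2" .
qed simp

lemma tendsto_of_abs_le:
  fixes a :: "nat \<Rightarrow> real"
  assumes "\<And>n. \<bar>a n - l\<bar> \<le> b n" "b \<longlonglongrightarrow> 0"
  shows "a \<longlonglongrightarrow> l"
proof -
  have "(\<lambda>n. \<bar>a n - l\<bar>) \<longlonglongrightarrow> 0"
    by (rule tendsto_sandwich[OF _ _ tendsto_const assms(2)]) (use assms(1) in simp_all)
  then show ?thesis by (simp add: LIM_zero_iff tendsto_rabs_zero_iff)
qed

lemma L2_norm_tendsto:
  assumes "u \<in> L2 \<Omega>" "\<And>n::nat. v n \<in> L2 \<Omega>" "(\<lambda>n. L2_norm \<Omega> (u - v n)) \<longlonglongrightarrow> 0"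
  shows "(\<lambda>n. L2_norm \<Omega> (v n)) \<longlonglongrightarrow> L2_norm \<Omega> u"
proof -
  have "\<bar>L2_norm \<Omega> (v n) - L2_norm \<Omega> u\<bar> \<le> L2_norm \<Omega> (u - v n)" for n
  proof -
    have "L2_norm \<Omega> (u - v n + v n) \<le> L2_norm \<Omega> (u - v n) + L2_norm \<Omega> (v n)"
      using assms by (intro L2_triangle L2.mem)
    moreover have "L2_norm \<Omega> (v n - u + u) \<le> L2_norm \<Omega> (v n - u) + L2_norm \<Omega> u"
      using assms by (intro L2_triangle L2.mem)
    ultimately show ?thesis by (simp add: L2_norm_minus_commute[of _ "v n" u])
  qed
  then show ?thesis using assms(3) by (rule tendsto_of_abs_le)
qed

lemma L2_inner_tendsto:
  assumes "u \<in> L2 \<Omega>" "\<And>n::nat. v n \<in> L2 \<Omega>" "(\<lambda>n. L2_norm \<Omega> (u - v n)) \<longlonglongrightarrow> 0" "g \<in> L2 \<Omega>"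
  shows "(\<lambda>n. L2_inner \<Omega> g (v n)) \<longlonglongrightarrow> L2_inner \<Omega> g u"
proof -
  have "\<bar>L2_inner \<Omega> g (v n) - L2_inner \<Omega> g u\<bar> \<le> L2_norm \<Omega> g * L2_norm \<Omega> (u - v n)" for n
    using L2_cauchy_schwarz[OF assms(4) L2.mem(3)[OF assms(1,2)], of n] assms
    by (simp add: L2.linear_simps abs_minus_commute)
  then show ?thesis using tendsto_mult_right_zero[OF assms(3)] by (rule tendsto_of_abs_le)
qed

lemma L2_AE_subseq:
  assumes "u \<in> L2 \<Omega>" "\<And>n::nat. v n \<in> L2 \<Omega>" "(\<lambda>n. L2_norm \<Omega> (u - v n)) \<longlonglongrightarrow> 0"
  obtains r :: "nat \<Rightarrow> nat" where "strict_mono r" "AE x in lebesgue_on \<Omega>. (\<lambda>n. v (r n) x) \<longlonglongrightarrow> (u x :: real)"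
proof -
  have L: "u - v n \<in> L2 \<Omega>" for n using assms by (intro L2.mem)
  have i: "integrable (lebesgue_on \<Omega>) (\<lambda>x. (u x - v n x)\<^sup>2)" for n
    using L2D(2)[OF L[of n]] by simp
  have "(LINT x|lebesgue_on \<Omega>. norm ((u x - v n x)\<^sup>2)) = (L2_norm \<Omega> (u - v n))\<^sup>2" for n
    using L2_norm_sq[OF L[of n]] by (simp add: L2_inner_def power2_eq_square)
  moreover have "(\<lambda>n. (L2_norm \<Omega> (u - v n))\<^sup>2) \<longlonglongrightarrow> 0\<^sup>2" by (intro tendsto_intros assms)
  ultimately have "(\<lambda>n. LINT x|lebesgue_on \<Omega>. norm ((u x - v n x)\<^sup>2)) \<longlonglongrightarrow> 0" by simp
  from tendsto_L1_AE_subseq[OF i this] obtain r :: "nat \<Rightarrow> nat"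
    where r: "strict_mono r" "AE x in lebesgue_on \<Omega>. (\<lambda>n. (u x - v (r n) x)\<^sup>2) \<longlonglongrightarrow> 0" by blast
  have "AE x in lebesgue_on \<Omega>. (\<lambda>n. v (r n) x) \<longlonglongrightarrow> u x"
    using r(2)
  proof eventually_elim
    case (elim x)
    have "(\<lambda>n. sqrt ((u x - v (r n) x)\<^sup>2)) \<longlonglongrightarrow> sqrt 0" by (intro tendsto_intros elim)
    then have "(\<lambda>n. \<bar>v (r n) x - u x\<bar>) \<longlonglongrightarrow> 0" by (simp add: abs_minus_commute)
    then show ?case by (simp add: LIM_zero_iff tendsto_rabs_zero_iff)
  qed
  with r(1) show ?thesis by (rule that)
qed

text \<open>
  Transfers a norm bound from approximations that converge only pointwise, as products of
  convergent sequences do.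
\<close>

lemma L2_fatou:
  assumes "\<And>n::nat. w n \<in> L2 \<Omega>" "v \<in> borel_measurable (lebesgue_on \<Omega>)"
    "AE x in lebesgue_on \<Omega>. (\<lambda>n. w n x) \<longlonglongrightarrow> (v x :: real)"
    "\<And>n. L2_norm \<Omega> (w n) \<le> c n" "c \<longlonglongrightarrow> C"
  shows "v \<in> L2 \<Omega>" "L2_norm \<Omega> v \<le> C"
proof -
  have C: "0 \<le> C"
    by (rule LIMSEQ_le_const[OF assms(5)]) (use assms(4) order_trans[OF L2_norm_nonneg] in blast)
  have wm: "w n \<in> borel_measurable (lebesgue_on \<Omega>)" for n using L2D(1)[OF assms(1)] .
  have sq: "(L2_norm \<Omega> u)\<^sup>2 = (LINT x|lebesgue_on \<Omega>. (u x)\<^sup>2)" if "u \<in> L2 \<Omega>" for u :: "'a \<Rightarrow> real"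
    using L2_norm_sq[OF that] by (simp add: L2_inner_def power2_eq_square)
  have "(\<integral>\<^sup>+x. ennreal ((v x)\<^sup>2) \<partial>lebesgue_on \<Omega>) \<le> (\<integral>\<^sup>+x. liminf (\<lambda>n. ennreal ((w n x)\<^sup>2)) \<partial>lebesgue_on \<Omega>)"
  proof (rule nn_integral_mono_AE, use assms(3) in eventually_elim)
    case (elim x)
    have "(\<lambda>n. ennreal ((w n x)\<^sup>2)) \<longlonglongrightarrow> ennreal ((v x)\<^sup>2)"
      by (intro tendsto_ennrealI tendsto_intros elim)
    from lim_imp_Liminf[OF sequentially_bot this] show ?case by (rule eq_refl[OF sym])
  qed
  also have "\<dots> \<le> liminf (\<lambda>n. \<integral>\<^sup>+x. ennreal ((w n x)\<^sup>2) \<partial>lebesgue_on \<Omega>)"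
    using wm by (intro nn_integral_liminf) auto
  also have "\<dots> \<le> liminf (\<lambda>n. ennreal ((c n)\<^sup>2))"
  proof (intro Liminf_mono always_eventually allI)
    fix n
    have "(\<integral>\<^sup>+x. ennreal ((w n x)\<^sup>2) \<partial>lebesgue_on \<Omega>) = ennreal ((L2_norm \<Omega> (w n))\<^sup>2)"
      unfolding sq[OF assms(1)] using L2D(2)[OF assms(1)[of n]] by (intro nn_integral_eq_integral) auto
    also have "\<dots> \<le> ennreal ((c n)\<^sup>2)" by (intro ennreal_leI power_mono assms(4)) simp
    finally show "(\<integral>\<^sup>+x. ennreal ((w n x)\<^sup>2) \<partial>lebesgue_on \<Omega>) \<le> ennreal ((c n)\<^sup>2)" .
  qed
  also have "\<dots> = ennreal (C\<^sup>2)"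
    by (intro lim_imp_Liminf tendsto_ennrealI tendsto_intros assms) simp
  finally have le: "(\<integral>\<^sup>+x. ennreal ((v x)\<^sup>2) \<partial>lebesgue_on \<Omega>) \<le> ennreal (C\<^sup>2)" .
  have i: "integrable (lebesgue_on \<Omega>) (\<lambda>x. (v x)\<^sup>2)"
    using le assms(2) by (intro integrableI_nonneg) (auto intro: le_less_trans)
  then show v: "v \<in> L2 \<Omega>" using assms(2) by (simp add: L2_def)
  have "ennreal ((L2_norm \<Omega> v)\<^sup>2) \<le> ennreal (C\<^sup>2)"
    using le i unfolding sq[OF v] by (subst nn_integral_eq_integral[symmetric]) auto
  then have "(L2_norm \<Omega> v)\<^sup>2 \<le> C\<^sup>2" by (simp add: ennreal_le_iff)
  then show "L2_norm \<Omega> v \<le> C" using C by (rule power2_le_imp_le)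
qed

lemma ladyzhenskaya:
  assumes "open \<Omega>" "u \<in> H10 \<Omega>"
  shows "sqf u \<in> L2 \<Omega>" "L2_norm \<Omega> (sqf u) \<le> 2 * L2_norm \<Omega> u * gnorm \<Omega> u"
proof -
  note u = Hm_1_pd[OF assms(1) H10_Hm[OF assms(2)]]
  obtain \<phi> where \<phi>: "\<And>n::nat. \<phi> n \<in> test_functions \<Omega>" "(\<lambda>n. L2_norm \<Omega> (u - \<phi> n)) \<longlonglongrightarrow> 0"
    "\<And>j. (\<lambda>n. L2_norm \<Omega> (pd \<Omega> j u - cpd j (\<phi> n))) \<longlonglongrightarrow> 0"
    using H10_approx[OF assms] by blast
  have L: "\<phi> n \<in> L2 \<Omega>" "cpd j (\<phi> n) \<in> L2 \<Omega>" for n j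
    using \<phi>(1) assms(1) by (auto intro: test_in_L2 test_cpd)
  obtain r :: "nat \<Rightarrow> nat" where r: "strict_mono r" "AE x in lebesgue_on \<Omega>. (\<lambda>n. \<phi> (r n) x) \<longlonglongrightarrow> u x"
    using L2_AE_subseq[OF u(3) L(1) \<phi>(2)] by blast
  define C where "C = 2 * L2_norm \<Omega> u * sqrt (L2_norm \<Omega> (pd \<Omega> 1 u) * L2_norm \<Omega> (pd \<Omega> 2 u))"
  have "(\<lambda>n. 2 * L2_norm \<Omega> (\<phi> n) * sqrt (L2_norm \<Omega> (cpd 1 (\<phi> n)) * L2_norm \<Omega> (cpd 2 (\<phi> n)))) \<longlonglongrightarrow> C"
    unfolding C_def by (intro tendsto_intros L2_norm_tendsto[OF u(3) L(1) \<phi>(2)] L2_norm_tendsto[OF u(2) L(2) \<phi>(3)])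
  from LIMSEQ_subseq_LIMSEQ[OF this r(1)]
  have lim: "(\<lambda>n. 2 * L2_norm \<Omega> (\<phi> (r n)) * sqrt (L2_norm \<Omega> (cpd 1 (\<phi> (r n))) * L2_norm \<Omega> (cpd 2 (\<phi> (r n))))) \<longlonglongrightarrow> C"
    by (simp add: o_def)
  have m: "sqf u \<in> borel_measurable (lebesgue_on \<Omega>)"
    unfolding sqf_def[abs_def] using L2D(1)[OF u(3)] by measurable
  have ae: "AE x in lebesgue_on \<Omega>. (\<lambda>n. sqf (\<phi> (r n)) x) \<longlonglongrightarrow> sqf u x"
    using r(2) by eventually_elim (auto simp: sqf_def intro!: tendsto_intros)
  have sq: "sqf (\<phi> (r n)) \<in> L2 \<Omega>" for n
    unfolding sqf_def[abs_def] by (intro test_in_L2 test_mult assms \<phi>(1) test_smooth[OF \<phi>(1)])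
  note F = L2_fatou[OF sq m ae ladyzhenskaya_test[OF assms(1) \<phi>(1)] lim]
  show "sqf u \<in> L2 \<Omega>" by (rule F(1))
  have "sqrt (L2_norm \<Omega> (pd \<Omega> 1 u) * L2_norm \<Omega> (pd \<Omega> 2 u)) \<le> sqrt (gnorm \<Omega> u * gnorm \<Omega> u)"
    by (intro real_sqrt_le_mono mult_mono pd_le_gnorm) auto
  then have "C \<le> 2 * L2_norm \<Omega> u * gnorm \<Omega> u"
    unfolding C_def by (intro mult_left_mono) auto
  with F(2) show "L2_norm \<Omega> (sqf u) \<le> 2 * L2_norm \<Omega> u * gnorm \<Omega> u" by simp
qed

lemma L4_mult:
  fixes g h :: "'a::euclidean_space \<Rightarrow> real"
  assumes "g \<in> borel_measurable (lebesgue_on \<Omega>)" "sqf g \<in> L2 \<Omega>"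
    "h \<in> borel_measurable (lebesgue_on \<Omega>)" "sqf h \<in> L2 \<Omega>"
  shows "(\<lambda>x. g x * h x) \<in> L2 \<Omega>" "(L2_norm \<Omega> (\<lambda>x. g x * h x))\<^sup>2 \<le> L2_norm \<Omega> (sqf g) * L2_norm \<Omega> (sqf h)"
proof -
  have i: "integrable (lebesgue_on \<Omega>) (\<lambda>x. sqf g x * sqf h x)"
    using L2_inner_integrable[OF assms(2,4)] by simp
  have eq: "sqf g x * sqf h x = (g x * h x)\<^sup>2" for x by (simp add: sqf_def power2_eq_square mult_ac)
  show L: "(\<lambda>x. g x * h x) \<in> L2 \<Omega>"
    using i assms(1,3) by (simp add: L2_def eq power_mult_distrib[symmetric])
  have "(L2_norm \<Omega> (\<lambda>x. g x * h x))\<^sup>2 = L2_inner \<Omega> (sqf g) (sqf h)"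
    unfolding L2_norm_sq[OF L] by (simp add: L2_inner_def sqf_def mult_ac)
  also have "\<dots> \<le> L2_norm \<Omega> (sqf g) * L2_norm \<Omega> (sqf h)"
    using L2_cauchy_schwarz[OF assms(2,4)] by simp
  finally show "(L2_norm \<Omega> (\<lambda>x. g x * h x))\<^sup>2 \<le> L2_norm \<Omega> (sqf g) * L2_norm \<Omega> (sqf h)" .
qed

lemma H10_mult:
  assumes "open \<Omega>" "g \<in> H10 \<Omega>" "h \<in> H10 \<Omega>"
  shows "(\<lambda>x. g x * h x) \<in> L2 \<Omega>"
    "(L2_norm \<Omega> (\<lambda>x. g x * h x))\<^sup>2 \<le> 4 * (L2_norm \<Omega> g * gnorm \<Omega> g) * (L2_norm \<Omega> h * gnorm \<Omega> h)"
proof -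
  have m: "u \<in> borel_measurable (lebesgue_on \<Omega>)" "sqf u \<in> L2 \<Omega>" if "u \<in> H10 \<Omega>" for u
    using L2D(1)[OF Hm_1_pd(3)[OF assms(1) H10_Hm[OF that]]] ladyzhenskaya[OF assms(1) that] by auto
  show "(\<lambda>x. g x * h x) \<in> L2 \<Omega>" by (rule L4_mult(1)[OF m[OF assms(2)] m[OF assms(3)]])
  have "(L2_norm \<Omega> (\<lambda>x. g x * h x))\<^sup>2 \<le> L2_norm \<Omega> (sqf g) * L2_norm \<Omega> (sqf h)"
    using L4_mult(2)[OF m[OF assms(2)] m[OF assms(3)]] .
  also have "\<dots> \<le> (2 * L2_norm \<Omega> g * gnorm \<Omega> g) * (2 * L2_norm \<Omega> h * gnorm \<Omega> h)"
    by (intro mult_mono ladyzhenskaya assms) auto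
  finally show "(L2_norm \<Omega> (\<lambda>x. g x * h x))\<^sup>2 \<le> 4 * (L2_norm \<Omega> g * gnorm \<Omega> g) * (L2_norm \<Omega> h * gnorm \<Omega> h)"
    by (simp add: mult_ac)
qed

section \<open>Integration by parts and the Poincare inequality\<close>

text \<open>
  The integral of a product of three functions, the building block of the trilinear form.
\<close>

definition tri :: "'a::euclidean_space set \<Rightarrow> ('a \<Rightarrow> real) \<Rightarrow> ('a \<Rightarrow> real) \<Rightarrow> ('a \<Rightarrow> real) \<Rightarrow> real" where
  "tri \<Omega> f g h = L2_inner \<Omega> f (\<lambda>x. g x * h x)"

lemma smooth_bounded_on:
  fixes \<eta> :: "'a::euclidean_space \<Rightarrow> real"
  assumes "smooth \<eta>" "bounded \<Omega>"
  obtains B where "0 \<le> B" "\<And>x. x \<in> \<Omega> \<Longrightarrow> \<bar>\<eta> x\<bar> \<le> B"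
proof -
  have "compact (\<eta> ` closure \<Omega>)"
    using assms(2) continuous_on_subset[OF smooth_continuous[OF assms(1)]]
    by (intro compact_continuous_image) (auto simp: compact_closure)
  then obtain B where "\<And>x. x \<in> closure \<Omega> \<Longrightarrow> \<bar>\<eta> x\<bar> \<le> B"
    using compact_imp_bounded by (force simp: bounded_iff)
  then have "\<bar>\<eta> x\<bar> \<le> max B 0" if "x \<in> \<Omega>" for x using that closure_subset by force
  then show ?thesis using that[of "max B 0"] by simp
qed

lemma L2_mult_smooth:
  fixes \<eta> :: "'a::euclidean_space \<Rightarrow> real"
  assumes "smooth \<eta>" "bounded \<Omega>" "\<Omega> \<in> sets lebesgue" "u \<in> L2 \<Omega>"
  shows "(\<lambda>x. u x * \<eta> x) \<in> L2 \<Omega>"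
proof -
  obtain B where B: "0 \<le> B" "\<And>x. x \<in> \<Omega> \<Longrightarrow> \<bar>\<eta> x\<bar> \<le> B" using smooth_bounded_on[OF assms(1,2)] by blast
  show ?thesis
  proof (rule L2_dominated[OF assms(4)])
    show "(\<lambda>x. u x * \<eta> x) \<in> borel_measurable (lebesgue_on \<Omega>)"
      using L2D(1)[OF assms(4)] continuous_lebesgue_measurable[OF smooth_continuous[OF assms(1)]] by simp
    show "AE x in lebesgue_on \<Omega>. norm (u x * \<eta> x) \<le> B * norm (u x)"
      using B by (intro AE_I2) (auto simp: abs_mult mult.commute[of B] intro: mult_left_mono)
  qed (rule B)
qed

lemma tri_move:
  "tri \<Omega> f g h = L2_inner \<Omega> (\<lambda>x. f x * h x) g" "tri \<Omega> f g h = L2_inner \<Omega> (\<lambda>x. f x * g x) h"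
  "tri \<Omega> f g h = tri \<Omega> g f h" "tri \<Omega> f g h = tri \<Omega> f h g"
  by (simp_all add: tri_def L2_inner_def mult_ac)

lemma L2_inner_cong_left:
  assumes "u \<in> L2 \<Omega>" "u' \<in> L2 \<Omega>" "v \<in> L2 \<Omega>" "ae_eq \<Omega> u u'"
  shows "L2_inner \<Omega> u v = L2_inner \<Omega> u' v"
  using L2_inner_cong[OF assms(1,2,3,3,4)] by simp

text \<open>
  The factor \<open>w\<close> has zero trace and the factor \<open>\<eta>\<close> is smooth up to the boundary, so the only thing
  needed from \<open>u\<close> is a weak gradient. For a test function in place of \<open>w\<close> this is the definition
  of the weak derivative.
\<close>

lemma ibp_smooth:
  assumes "open \<Omega>" "bounded \<Omega>" "u \<in> Hm 1 \<Omega>" "w \<in> H10 \<Omega>" "smooth \<eta>"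
  shows "tri \<Omega> (pd \<Omega> j u) w \<eta> + tri \<Omega> u (pd \<Omega> j w) \<eta> + tri \<Omega> u w (cpd j \<eta>) = 0"
proof -
  note \<Omega> = open_in_lebesgue[OF assms(1)]
  note u = Hm_1_pd[OF assms(1,3)] and w = Hm_1_pd[OF assms(1) H10_Hm[OF assms(4)]]
  note M = L2_mult_smooth[OF _ assms(2) \<Omega>]
  obtain \<phi> where \<phi>: "\<And>n::nat. \<phi> n \<in> test_functions \<Omega>" "(\<lambda>n. L2_norm \<Omega> (w - \<phi> n)) \<longlonglongrightarrow> 0"
    "\<And>j. (\<lambda>n. L2_norm \<Omega> (pd \<Omega> j w - cpd j (\<phi> n))) \<longlonglongrightarrow> 0"
    using H10_approx[OF assms(1,4)] by blast
  have L: "\<phi> n \<in> L2 \<Omega>" "cpd j (\<phi> n) \<in> L2 \<Omega>" for n j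
    using \<phi>(1) assms(1) by (auto intro: test_in_L2 test_cpd)
  have \<eta>': "smooth (cpd j \<eta>)" using assms(5) by (rule smooth_cpd)
  have zero: "tri \<Omega> (pd \<Omega> j u) (\<phi> n) \<eta> + tri \<Omega> u (cpd j (\<phi> n)) \<eta> + tri \<Omega> u (\<phi> n) (cpd j \<eta>) = 0" for n
  proof -
    have t: "(\<lambda>x. \<phi> n x * \<eta> x) \<in> test_functions \<Omega>" by (intro test_mult \<phi> assms)
    have "L2_inner \<Omega> u (cpd j (\<lambda>x. \<phi> n x * \<eta> x)) = - L2_inner \<Omega> (pd \<Omega> j u) (\<lambda>x. \<phi> n x * \<eta> x)"
      using u(1)[of j] t unfolding has_weak_deriv_def cpd_def by blast
    moreover have "cpd j (\<lambda>x. \<phi> n x * \<eta> x) = (\<lambda>x. \<phi> n x * cpd j \<eta> x) + (\<lambda>x. cpd j (\<phi> n) x * \<eta> x)"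
      unfolding cpd_mult[OF test_smooth[OF \<phi>(1)] assms(5)] by (simp add: plus_fun_def)
    ultimately show ?thesis
      using L2.add_right[OF M[OF \<eta>' L(1)] M[OF assms(5) L(2)] u(3)] by (simp add: tri_def)
  qed
  have "(\<lambda>n. tri \<Omega> (pd \<Omega> j u) (\<phi> n) \<eta> + tri \<Omega> u (cpd j (\<phi> n)) \<eta> + tri \<Omega> u (\<phi> n) (cpd j \<eta>))
      \<longlonglongrightarrow> tri \<Omega> (pd \<Omega> j u) w \<eta> + tri \<Omega> u (pd \<Omega> j w) \<eta> + tri \<Omega> u w (cpd j \<eta>)"
    unfolding tri_move(1)[of _ _ _ \<eta>] tri_move(1)[of _ _ _ "cpd j \<eta>"]
    by (intro tendsto_add L2_inner_tendsto[OF w(3) L(1) \<phi>(2)] L2_inner_tendsto[OF w(2) L(2) \<phi>(3)] M u \<eta>' assms)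
  then show ?thesis by (simp add: zero LIMSEQ_const_iff)
qed

text \<open>
  The product of two functions in \<open>H\<^sub>0\<^sup>1\<close> is again square integrable by Ladyzhenskaya's
  inequality, which lets the third factor be approximated by test functions.
\<close>

lemma ibp_H10:
  assumes "open \<Omega>" "bounded \<Omega>" "u \<in> H10 \<Omega>" "w \<in> H10 \<Omega>" "p \<in> H10 \<Omega>"
  shows "tri \<Omega> (pd \<Omega> j u) w p + tri \<Omega> u (pd \<Omega> j w) p + tri \<Omega> u w (pd \<Omega> j p) = 0"
proof -
  note \<Omega> = open_in_lebesgue[OF assms(1)]
  note H1 = H10_Hm[OF assms(3)] H10_Hm[OF assms(4)] H10_Hm[OF assms(5)]
  note u = Hm_1_pd[OF assms(1) H1(1)] and w = Hm_1_pd[OF assms(1) H1(2)] and p = Hm_1_pd[OF assms(1) H1(3)]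
  obtain \<phi> where \<phi>: "\<And>n::nat. \<phi> n \<in> test_functions \<Omega>" "(\<lambda>n. L2_norm \<Omega> (p - \<phi> n)) \<longlonglongrightarrow> 0"
    "\<And>j. (\<lambda>n. L2_norm \<Omega> (pd \<Omega> j p - cpd j (\<phi> n))) \<longlonglongrightarrow> 0"
    using H10_approx[OF assms(1,5)] by blast
  have L: "\<phi> n \<in> L2 \<Omega>" "cpd j (\<phi> n) \<in> L2 \<Omega>" for n j
    using \<phi>(1) assms(1) by (auto intro: test_in_L2 test_cpd)
  have H: "\<phi> n \<in> H10 \<Omega>" "p - \<phi> n \<in> H10 \<Omega>" for n
    using test_in_H10[OF assms(1) \<phi>(1)] subspace_diff[OF subspace_H10[OF assms(1)] assms(5)] by auto
  have gn: "(\<lambda>n. gnorm \<Omega> (p - \<phi> n)) \<longlonglongrightarrow> 0"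
  proof -
    have "L2_norm \<Omega> (pd \<Omega> j (p - \<phi> n)) = L2_norm \<Omega> (pd \<Omega> j p - cpd j (\<phi> n))" for j n
    proof (rule L2_norm_cong)
      show "pd \<Omega> j (p - \<phi> n) \<in> L2 \<Omega>" using Hm_1_pd(2)[OF assms(1) H10_Hm[OF H(2)]] .
      show "pd \<Omega> j p - cpd j (\<phi> n) \<in> L2 \<Omega>" by (rule L2.mem(3)[OF p(2) L(2)])
      show "ae_eq \<Omega> (pd \<Omega> j (p - \<phi> n)) (pd \<Omega> j p - cpd j (\<phi> n))"
        by (rule ae_eq_trans[OF pd_diff[OF assms(1) H1(3) H10_Hm[OF H(1)]]
              ae_eq_diff[OF ae_eq_refl pd_test[OF assms(1) \<phi>(1)]]])
    qed
    moreover have "(\<lambda>n. sqrt ((L2_norm \<Omega> (pd \<Omega> 1 p - cpd 1 (\<phi> n)))\<^sup>2 + (L2_norm \<Omega> (pd \<Omega> 2 p - cpd 2 (\<phi> n)))\<^sup>2))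
        \<longlonglongrightarrow> sqrt (0\<^sup>2 + 0\<^sup>2)"
      by (intro tendsto_intros \<phi>)
    ultimately show ?thesis by (simp add: gnorm_def)
  qed
  have prod: "(\<lambda>n. L2_norm \<Omega> ((\<lambda>x. v x * p x) - (\<lambda>x. v x * \<phi> n x))) \<longlonglongrightarrow> 0" if v: "v \<in> H10 \<Omega>" for v
  proof -
    have "(\<lambda>n. (L2_norm \<Omega> (\<lambda>x. v x * (p - \<phi> n) x))\<^sup>2) \<longlonglongrightarrow> 0"
    proof (rule tendsto_sandwich[OF _ _ tendsto_const])
      show "\<forall>\<^sub>F n in sequentially. (L2_norm \<Omega> (\<lambda>x. v x * (p - \<phi> n) x))\<^sup>2
          \<le> 4 * (L2_norm \<Omega> v * gnorm \<Omega> v) * (L2_norm \<Omega> (p - \<phi> n) * gnorm \<Omega> (p - \<phi> n))"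
        using H10_mult(2)[OF assms(1) v H(2)] by simp
      show "(\<lambda>n. 4 * (L2_norm \<Omega> v * gnorm \<Omega> v) * (L2_norm \<Omega> (p - \<phi> n) * gnorm \<Omega> (p - \<phi> n))) \<longlonglongrightarrow> 0"
        using tendsto_mult_right_zero[OF tendsto_mult_zero[OF \<phi>(2) gn]] by blast
    qed auto
    from tendsto_real_sqrt[OF this] show ?thesis by (simp add: fun_diff_def algebra_simps)
  qed
  have zero: "tri \<Omega> (pd \<Omega> j u) w (\<phi> n) + tri \<Omega> u (pd \<Omega> j w) (\<phi> n) + tri \<Omega> u w (cpd j (\<phi> n)) = 0" for n
    by (rule ibp_smooth[OF assms(1,2) H1(1) assms(4) test_smooth[OF \<phi>(1)]])
  have "(\<lambda>n. tri \<Omega> (pd \<Omega> j u) w (\<phi> n) + tri \<Omega> u (pd \<Omega> j w) (\<phi> n) + tri \<Omega> u w (cpd j (\<phi> n)))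
      \<longlonglongrightarrow> tri \<Omega> (pd \<Omega> j u) w p + tri \<Omega> u (pd \<Omega> j w) p + tri \<Omega> u w (pd \<Omega> j p)"
    unfolding tri_move(3)[of \<Omega> u "pd \<Omega> j w"] tri_move(2)[of \<Omega> u w]
    unfolding tri_def
    by (intro tendsto_add L2_inner_tendsto[OF H10_mult(1)[OF assms(1,4,5)] H10_mult(1)[OF assms(1,4) H(1)] prod[OF assms(4)]]
        L2_inner_tendsto[OF H10_mult(1)[OF assms(1,3,5)] H10_mult(1)[OF assms(1,3) H(1)] prod[OF assms(3)]]
        L2_inner_tendsto[OF p(2) L(2) \<phi>(3)] u w H10_mult(1)[OF assms(1,3,4)])
  then show ?thesis by (simp add: zero LIMSEQ_const_iff)
qed

lemma eq_minus_double: "a + b + c = 0 \<Longrightarrow> b = a \<Longrightarrow> c = n \<Longrightarrow> n = - 2 * (a::real)" by simp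

lemma smooth_id: "smooth (\<lambda>x::real. x)"
proof -
  have "Ck m (\<lambda>x::real. x)" for m
    by (cases m) (auto intro!: Ck_SucI[where D="\<lambda>x h. h"])
  then show ?thesis by (simp add: smooth_def)
qed

lemma cpd_component: "smooth f \<Longrightarrow> (\<And>x. (f has_real_derivative f' x) (at x)) \<Longrightarrow>
    cpd j (\<lambda>x. f (x $ i)) = (\<lambda>x. if i = j then f' (x $ i) else 0)"
  unfolding cpd_def
proof (rule ext)
  fix x :: "real^2" assume "smooth f" and d: "\<And>x. (f has_real_derivative f' x) (at x)"
  have "((\<lambda>x::real^2. f (x $ i)) has_derivative (\<lambda>h. f' (x $ i) * (h $ i))) (at x)"
    by (rule has_derivative_compose[of "\<lambda>x. x $ i", OF _ d[unfolded has_field_derivative_def]])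
      (auto intro!: derivative_eq_intros bounded_linear_vec_nth bounded_linear_imp_has_derivative)
  from fun_cong[OF frechet_derivative_at[OF this], of "axis j 1"]
  show "dir_deriv (axis j 1) (\<lambda>x. f (x $ i)) x = (if i = j then f' (x $ i) else 0)"
    by (simp add: axis_def split: if_splits)
qed

text \<open>
  Integration by parts against the coordinate \<open>x\<^sub>1\<close>, whose derivative is \<open>1\<close>, gives
  \<open>\<parallel>u\<parallel>\<^sup>2 = - 2 (u \<partial>\<^sub>1u, x\<^sub>1)\<close>.
\<close>

lemma poincare:
  assumes "open \<Omega>" "bounded \<Omega>" "\<And>x. x \<in> \<Omega> \<Longrightarrow> \<bar>x $ 1\<bar> \<le> R" "0 \<le> R" "u \<in> H10 \<Omega>"
  shows "L2_norm \<Omega> u \<le> 2 * R * L2_norm \<Omega> (pd \<Omega> 1 u)"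
proof (cases "L2_norm \<Omega> u = 0")
  case False
  note u = Hm_1_pd[OF assms(1) H10_Hm[OF assms(5)]]
  have sm: "smooth (\<lambda>x::real^2. x $ 1)" by (rule smooth_component[OF smooth_id])
  have c: "cpd 1 (\<lambda>x. x $ 1) = (\<lambda>x. 1)"
    by (subst cpd_component[of "\<lambda>x. x" "\<lambda>x. 1"]) (auto intro: smooth_id)
  have L: "(\<lambda>x. u x * x $ 1) \<in> L2 \<Omega>" "L2_norm \<Omega> (\<lambda>x. u x * x $ 1) \<le> R * L2_norm \<Omega> u"
  proof -
    have m: "(\<lambda>x. u x * x $ 1) \<in> borel_measurable (lebesgue_on \<Omega>)"
      using L2D(1)[OF L2_mult_smooth[OF sm assms(2) open_in_lebesgue[OF assms(1)] u(3)]] .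
    have ae: "AE x in lebesgue_on \<Omega>. norm (u x * x $ 1) \<le> R * norm (u x)"
      using assms(3) by (intro AE_I2) (auto simp: abs_mult mult.commute[of R] intro: mult_left_mono)
    show "(\<lambda>x. u x * x $ 1) \<in> L2 \<Omega>" "L2_norm \<Omega> (\<lambda>x. u x * x $ 1) \<le> R * L2_norm \<Omega> u"
      using L2_dominated[OF u(3) m ae assms(4)] by auto
  qed
  have "tri \<Omega> (pd \<Omega> 1 u) u (\<lambda>x. x $ 1) + tri \<Omega> u (pd \<Omega> 1 u) (\<lambda>x. x $ 1) + tri \<Omega> u u (\<lambda>x. 1) = 0"
    using ibp_smooth[OF assms(1,2) H10_Hm[OF assms(5)] assms(5) sm, of 1] unfolding c .
  moreover have "tri \<Omega> u (pd \<Omega> 1 u) (\<lambda>x. x $ 1) = tri \<Omega> (pd \<Omega> 1 u) u (\<lambda>x. x $ 1)" by (rule tri_move(3))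
  moreover have "tri \<Omega> u u (\<lambda>x. 1) = (L2_norm \<Omega> u)\<^sup>2"
    by (simp only: tri_def mult_1_right L2_norm_sq[OF u(3)])
  ultimately have eq: "(L2_norm \<Omega> u)\<^sup>2 = - 2 * tri \<Omega> (pd \<Omega> 1 u) u (\<lambda>x. x $ 1)" by (rule eq_minus_double)
  have "- 2 * tri \<Omega> (pd \<Omega> 1 u) u (\<lambda>x. x $ 1) \<le> 2 * (L2_norm \<Omega> (pd \<Omega> 1 u) * (R * L2_norm \<Omega> u))"
  proof -
    have "\<bar>tri \<Omega> (pd \<Omega> 1 u) u (\<lambda>x. x $ 1)\<bar> \<le> L2_norm \<Omega> (pd \<Omega> 1 u) * L2_norm \<Omega> (\<lambda>x. u x * x $ 1)"
      unfolding tri_def by (rule L2_cauchy_schwarz[OF u(2) L(1)])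
    also have "\<dots> \<le> L2_norm \<Omega> (pd \<Omega> 1 u) * (R * L2_norm \<Omega> u)"
      by (rule mult_left_mono[OF L(2)]) simp
    finally show ?thesis by linarith
  qed
  then have "(L2_norm \<Omega> u)\<^sup>2 \<le> 2 * (L2_norm \<Omega> (pd \<Omega> 1 u) * (R * L2_norm \<Omega> u))"
    unfolding eq .
  also have "\<dots> = L2_norm \<Omega> u * (2 * R * L2_norm \<Omega> (pd \<Omega> 1 u))" by (simp add: mult_ac)
  finally have "L2_norm \<Omega> u * L2_norm \<Omega> u \<le> L2_norm \<Omega> u * (2 * R * L2_norm \<Omega> (pd \<Omega> 1 u))"
    by (simp only: power2_eq_square)
  then show ?thesis using False L2_norm_nonneg[of \<Omega> u] by simp
next
  case True
  then show ?thesis using assms(4) by simp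
qed

section \<open>Agmon's inequality\<close>

lemma box_bump_real2:
  "box_bump a b n x = bump (a $ 1) (b $ 1) n (x $ 1) * bump (a $ 2) (b $ 2) n (x $ 2)" for x :: "real^2"
  by (simp add: box_bump_def Basis_real2 axis_1_neq_2 inner_axis)

text \<open>
  The bump over the box is \<open>\<partial>\<^sub>1\<partial>\<^sub>2\<Psi>\<close> with \<open>0 \<le> \<Psi> \<le> V\<close>, \<open>V\<close> being the area of the box. Two
  integrations by parts move both derivatives onto \<open>w\<^sup>2\<close>, and
  \<open>\<partial>\<^sub>1\<partial>\<^sub>2(w\<^sup>2) = 2 (w \<partial>\<^sub>1\<partial>\<^sub>2w + \<partial>\<^sub>1w \<partial>\<^sub>2w)\<close>. That \<open>\<Psi>\<close> does not vanish on the boundary is harmless,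
  because one factor \<open>w\<close> always does.
\<close>

lemma integral_sq_bump_le:
  assumes "open \<Omega>" "bounded \<Omega>" "w \<in> H10 \<Omega>" "pd \<Omega> 2 w \<in> Hm 1 \<Omega>" "a $ 1 \<le> b $ 1" "a $ 2 \<le> b $ 2"
  shows "(LINT x|lebesgue_on \<Omega>. (w x)\<^sup>2 * box_bump a b n x)
    \<le> 2 * (L2_norm \<Omega> w * L2_norm \<Omega> (pd \<Omega> 1 (pd \<Omega> 2 w)) + L2_norm \<Omega> (pd \<Omega> 1 w) * L2_norm \<Omega> (pd \<Omega> 2 w))
        * ((b $ 1 - a $ 1) * (b $ 2 - a $ 2))"
proof -
  note \<Omega> = open_in_lebesgue[OF assms(1)]
  note w = Hm_1_pd[OF assms(1) H10_Hm[OF assms(3)]]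
  note p = Hm_1_pd[OF assms(1,4)]
  define \<theta> where "\<theta> i = bump (a $ i) (b $ i) n" for i :: 2
  have sm\<theta>: "smooth (\<theta> i)" for i unfolding \<theta>_def by (rule smooth_bump)
  have "\<exists>F. smooth F \<and> (\<forall>x. (F has_real_derivative \<theta> i x) (at x)) \<and> (\<forall>x. 0 \<le> F x) \<and> (\<forall>x. F x \<le> b $ i - a $ i)" for i
  proof -
    have "a $ i \<le> b $ i" using two_cases[of i] assms by auto
    moreover have "0 \<le> \<theta> i x" "\<theta> i x \<le> 1" "x \<notin> {a $ i..b $ i} \<Longrightarrow> \<theta> i x = 0" for x
      unfolding \<theta>_def by (rule bump_nonneg, rule bump_le_1, rule bump_outside)
    ultimately show ?thesis
      by (rule smooth_primitive[OF sm\<theta>]) blast+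
  qed
  then obtain \<Theta> where sm\<Theta>: "\<And>i. smooth (\<Theta> i)" and der: "\<And>i x. (\<Theta> i has_real_derivative \<theta> i x) (at x)"
    and \<Theta>: "\<And>i x. 0 \<le> \<Theta> i x" "\<And>i x. \<Theta> i x \<le> b $ i - a $ i" by metis
  \<comment> \<open>\<open>\<Theta> i\<close> is a primitive of the one-dimensional bump \<open>\<theta> i\<close>, so that \<open>\<partial>\<^sub>1\<Psi> = \<eta>\<close> and \<open>\<partial>\<^sub>2\<eta>\<close> is the bump over the box\<close>
  define \<Psi> where "\<Psi> x = \<Theta> 1 (x $ 1) * \<Theta> 2 (x $ 2)" for x :: "real^2"
  define \<eta> where "\<eta> x = \<theta> 1 (x $ 1) * \<Theta> 2 (x $ 2)" for x :: "real^2"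
  define V where "V = (b $ 1 - a $ 1) * (b $ 2 - a $ 2)"
  have sc: "smooth (\<lambda>x::real^2. \<theta> i (x $ i))" "smooth (\<lambda>x::real^2. \<Theta> i (x $ i))" for i
    by (intro smooth_component sm\<theta> sm\<Theta>)+
  have sm: "smooth \<Psi>" "smooth \<eta>" unfolding \<Psi>_def[abs_def] \<eta>_def[abs_def] by (intro smooth_mult sc)+
  have c\<Theta>: "cpd j (\<lambda>x. \<Theta> i (x $ i)) = (\<lambda>x. if i = j then \<theta> i (x $ i) else 0)" for i j
    by (rule cpd_component[OF sm\<Theta> der])
  have "\<exists>d. \<forall>x. (\<theta> i has_real_derivative d x) (at x)" for i
  proof -
    have "(\<theta> i has_real_derivative dir_deriv 1 (\<theta> i) x) (at x)" for x
      using smooth_dir_has_real_derivative[OF sm\<theta>, of i 0 1 x] by simp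
    then show ?thesis by (intro exI allI)
  qed
  then obtain d where d: "\<And>i x. (\<theta> i has_real_derivative d i x) (at x)" by metis
  have c\<theta>: "cpd j (\<lambda>x. \<theta> i (x $ i)) = (\<lambda>x. if i = j then d i (x $ i) else 0)" for i j
    by (rule cpd_component[OF sm\<theta> d])
  have c\<Psi>: "cpd 1 \<Psi> = \<eta>"
    using cpd_mult[OF sc(2)[of 1] sc(2)[of 2], of 1] c\<Theta>[of 1 1] c\<Theta>[of 1 2]
    by (simp add: \<Psi>_def[abs_def] \<eta>_def[abs_def])
  have c\<eta>: "cpd 2 \<eta> = box_bump a b n"
    using cpd_mult[OF sc(1)[of 1] sc(2)[of 2], of 2] c\<theta>[of 2 1] c\<Theta>[of 2 2]
    by (auto simp: \<eta>_def[abs_def] box_bump_real2 \<theta>_def)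
  have bnd: "\<bar>\<Psi> x\<bar> \<le> V" for x
    unfolding \<Psi>_def V_def using \<Theta>[of 1 "x $ 1"] \<Theta>[of 2 "x $ 2"]
    by (auto simp: abs_mult intro!: mult_mono)
  have V: "0 \<le> V" using assms by (simp add: V_def)
  have mult\<Psi>: "(\<lambda>x. g x * \<Psi> x) \<in> L2 \<Omega>" "L2_norm \<Omega> (\<lambda>x. g x * \<Psi> x) \<le> V * L2_norm \<Omega> g" if g: "g \<in> L2 \<Omega>" for g
  proof -
    have m: "(\<lambda>x. g x * \<Psi> x) \<in> borel_measurable (lebesgue_on \<Omega>)"
      using L2D(1)[OF L2_mult_smooth[OF sm(1) assms(2) \<Omega> g]] .
    have ae: "AE x in lebesgue_on \<Omega>. norm (g x * \<Psi> x) \<le> V * norm (g x)"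
      using bnd by (intro AE_I2) (auto simp: abs_mult mult.commute[of V] intro: mult_left_mono)
    show "(\<lambda>x. g x * \<Psi> x) \<in> L2 \<Omega>" "L2_norm \<Omega> (\<lambda>x. g x * \<Psi> x) \<le> V * L2_norm \<Omega> g"
      using L2_dominated[OF g m ae V] by auto
  qed
  have est: "\<bar>tri \<Omega> f g \<Psi>\<bar> \<le> V * (L2_norm \<Omega> f * L2_norm \<Omega> g)" if "f \<in> L2 \<Omega>" "g \<in> L2 \<Omega>" for f g
    using L2_cauchy_schwarz[OF that(1) mult\<Psi>(1)[OF that(2)]] mult_left_mono[OF mult\<Psi>(2)[OF that(2)], of "L2_norm \<Omega> f"]
    by (simp add: tri_def mult_ac)
  have A: "tri \<Omega> (pd \<Omega> 2 w) w \<eta> + tri \<Omega> w (pd \<Omega> 2 w) \<eta> + tri \<Omega> w w (box_bump a b n) = 0"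
    using ibp_smooth[OF assms(1,2) H10_Hm[OF assms(3)] assms(3) sm(2), of 2] by (simp add: c\<eta>)
  have B: "tri \<Omega> (pd \<Omega> 1 (pd \<Omega> 2 w)) w \<Psi> + tri \<Omega> (pd \<Omega> 2 w) (pd \<Omega> 1 w) \<Psi> + tri \<Omega> (pd \<Omega> 2 w) w \<eta> = 0"
    using ibp_smooth[OF assms(1,2,4,3) sm(1), of 1] by (simp add: c\<Psi>)
  have "(LINT x|lebesgue_on \<Omega>. (w x)\<^sup>2 * box_bump a b n x) = tri \<Omega> w w (box_bump a b n)"
    by (simp add: tri_def L2_inner_def power2_eq_square mult_ac)
  also have "\<dots> = 2 * (tri \<Omega> (pd \<Omega> 1 (pd \<Omega> 2 w)) w \<Psi> + tri \<Omega> (pd \<Omega> 2 w) (pd \<Omega> 1 w) \<Psi>)"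
    using A B tri_move(3)[of \<Omega> w "pd \<Omega> 2 w" \<eta>] by simp
  also have "\<dots> \<le> 2 * (V * (L2_norm \<Omega> (pd \<Omega> 1 (pd \<Omega> 2 w)) * L2_norm \<Omega> w) + V * (L2_norm \<Omega> (pd \<Omega> 2 w) * L2_norm \<Omega> (pd \<Omega> 1 w)))"
    using est[OF p(2) w(3), of 1] est[OF p(3) w(2), of 1] by simp
  finally show ?thesis by (simp add: V_def algebra_simps)
qed

text \<open>
  Agmon's inequality on an arbitrary bounded open set: the mean of \<open>w\<^sup>2\<close> over every box is at most
  the right-hand side, hence so is \<open>w\<^sup>2\<close> itself almost everywhere. Only the zero trace of \<open>w\<close> is
  used, so that no extension of \<open>H\<^sup>2\<close> functions across a rough boundary is involved.
\<close>

lemma H10_sup_bound: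
  assumes "open \<Omega>" "bounded \<Omega>" "w \<in> H10 \<Omega>" "pd \<Omega> 2 w \<in> Hm 1 \<Omega>"
  shows "AE x in lebesgue_on \<Omega>. (w x)\<^sup>2
    \<le> 2 * (L2_norm \<Omega> w * L2_norm \<Omega> (pd \<Omega> 1 (pd \<Omega> 2 w)) + L2_norm \<Omega> (pd \<Omega> 1 w) * L2_norm \<Omega> (pd \<Omega> 2 w))"
    (is "AE x in _. _ \<le> ?S")
proof -
  note \<Omega> = open_in_lebesgue[OF assms(1)]
  note w = Hm_1_pd[OF assms(1) H10_Hm[OF assms(3)]]
  obtain l where Q: "\<Omega> \<subseteq> cbox (- l) l" using bounded_subset_cbox_symmetric[OF assms(2)] by blast
  define f where "f x = indicator \<Omega> x * (w x)\<^sup>2" for x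
  have fi: "integrable lebesgue f"
    using L2D(2)[OF w(3)] by (simp add: f_def[abs_def] integrable_lebesgue_on[OF \<Omega>, symmetric])
  define g where "g x = ?S * indicator (cbox (- l) l) x - f x" for x
  have ci: "integrable lebesgue (indicat_real (cbox c d))" for c d :: "real^2"
    using lmeasurable_cbox[of c d] by (simp add: lmeasurable_iff_integrable)
  have gi: "integrable lebesgue g"
    unfolding g_def[abs_def] by (intro Bochner_Integration.integrable_diff integrable_mult_right ci fi)
  have S: "0 \<le> ?S" by simp
  have "AE x in lebesgue. 0 \<le> g x"
  proof (rule AE_nonneg_of_boxes[OF gi])
    fix a b :: "real^2"
    obtain c d where cd: "cbox (- l) l \<inter> cbox a b = cbox c d" by (rule that) (rule Int_interval)
    have eq: "indicator (cbox a b) x * g x = ?S * indicator (cbox c d) x - indicator (cbox c d) x * f x" for x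
    proof -
      have "x \<in> cbox c d \<longleftrightarrow> x \<in> cbox (- l) l \<and> x \<in> cbox a b" using cd by blast
      moreover have "f x = 0" if "x \<notin> cbox (- l) l" using that Q by (auto simp: f_def indicator_def)
      ultimately show ?thesis by (auto simp: g_def indicator_def)
    qed
    have bf: "integrable lebesgue (\<lambda>x. indicator (cbox c d) x * f x)"
      using integrable_mult_indicator[OF fmeasurableD[OF lmeasurable_cbox] fi, of c d] by simp
    have "(LINT x|lebesgue. indicator (cbox c d) x * f x) \<le> ?S * measure lebesgue (cbox c d)"
    proof (cases "cbox c d = {}")
      case False
      then have le: "c $ 1 \<le> d $ 1" "c $ 2 \<le> d $ 2"
        by (auto simp: box_ne_empty Basis_real2 inner_axis)
      have V: "measure lebesgue (cbox c d) = (d $ 1 - c $ 1) * (d $ 2 - c $ 2)"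
      proof -
        have "measure lebesgue (cbox c d) = measure lborel (cbox c d)" by (simp add: measure_completion)
        also have "\<dots> = (\<Prod>i\<in>Basis. d \<bullet> i - c \<bullet> i)"
          using le by (intro content_cbox) (auto simp: Basis_real2 inner_axis)
        finally show ?thesis by (simp add: Basis_real2 axis_1_neq_2 inner_axis)
      qed
      have "(\<lambda>n. LINT x|lebesgue. f x * box_bump c d n x) \<longlonglongrightarrow> (LINT x|lebesgue. f x * indicator (box c d) x)"
      proof (rule integral_dominated_convergence[where w="\<lambda>x. \<bar>f x\<bar>"])
        have "(\<lambda>x. box_bump c d n x) \<in> borel_measurable lebesgue" for n
          using continuous_lebesgue_measurable[OF smooth_continuous[OF smooth_box_bump], of c d n UNIV] by simp
        then show "(\<lambda>x. f x * box_bump c d n x) \<in> borel_measurable lebesgue" for n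
          using fi by (intro borel_measurable_times) auto
        show "(\<lambda>x. f x * indicator (box c d) x) \<in> borel_measurable lebesgue"
          using fi fmeasurableD[OF lmeasurable_box[of c d]]
          by (intro borel_measurable_times borel_measurable_indicator) auto
        show "AE x in lebesgue. norm (f x * box_bump c d n x) \<le> \<bar>f x\<bar>" for n
          using box_bump_le_1[of c d n] box_bump_nonneg[of c d n]
          by (intro AE_I2) (auto simp: abs_mult intro!: mult_right_le_one_le)
        show "AE x in lebesgue. (\<lambda>n. f x * box_bump c d n x) \<longlonglongrightarrow> f x * indicator (box c d) x"
          by (intro AE_I2 tendsto_intros box_bump_tendsto)
      qed (use fi in auto)
      moreover have "(LINT x|lebesgue. f x * box_bump c d n x) \<le> ?S * measure lebesgue (cbox c d)" for n
      proof -
        have "(LINT x|lebesgue. f x * box_bump c d n x) = (LINT x|lebesgue_on \<Omega>. (w x)\<^sup>2 * box_bump c d n x)"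
          unfolding integral_lebesgue_on[OF \<Omega>] by (simp add: f_def mult_ac)
        then show ?thesis using integral_sq_bump_le[OF assms le, of n] by (simp add: V)
      qed
      ultimately have "(LINT x|lebesgue. f x * indicator (box c d) x) \<le> ?S * measure lebesgue (cbox c d)"
        by (meson LIMSEQ_le_const2)
      moreover have "(LINT x|lebesgue. indicator (cbox c d) x * f x) = (LINT x|lebesgue. f x * indicator (box c d) x)"
      proof (rule integral_cong_AE)
        show "(\<lambda>x. indicator (cbox c d) x * f x) \<in> borel_measurable lebesgue" using bf by blast
        show "(\<lambda>x. f x * indicator (box c d) x) \<in> borel_measurable lebesgue"
          using fi fmeasurableD[OF lmeasurable_box[of c d]]
          by (intro borel_measurable_times borel_measurable_indicator) auto
        have "cbox c d - box c d \<in> null_sets lebesgue"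
          using negligible_frontier_interval[of c d] negligible_iff_null_sets by blast
        from AE_not_in[OF this] show "AE x in lebesgue. indicator (cbox c d) x * f x = f x * indicator (box c d) x"
          by eventually_elim (use box_subset_cbox[of c d] in \<open>auto simp: indicator_def\<close>)
      qed
      ultimately show ?thesis by simp
    qed simp
    then show "0 \<le> (LINT x|lebesgue. indicator (cbox a b) x * g x)"
      unfolding eq using ci[of c d] bf by simp
  qed
  then have "AE x in lebesgue. x \<in> \<Omega> \<longrightarrow> (w x)\<^sup>2 \<le> ?S"
    by eventually_elim (use Q in \<open>auto simp: g_def f_def indicator_def\<close>)
  then show ?thesis using \<Omega> by (simp add: AE_restrict_space_iff)
qed

text \<open>
  Controls \<open>u \<partial>\<^sub>jw\<close> for \<open>w\<close> in \<open>H\<^sup>2\<close>. An \<open>L\<^sup>4\<close> bound for \<open>\<nabla>w\<close> would be natural, but \<open>\<nabla>w\<close> has no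
  zero trace and Ladyzhenskaya's inequality is not available for it. Instead
  \<open>\<parallel>u \<partial>\<^sub>jw\<parallel>\<^sup>2 = - (w, \<partial>\<^sub>j(u\<^sup>2 \<partial>\<^sub>jw))\<close>, and the undifferentiated \<open>w\<close> is estimated by its supremum.
\<close>

lemma H10_mult_deriv:
  assumes "open \<Omega>" "bounded \<Omega>" "w \<in> H10 \<Omega>" "pd \<Omega> j w \<in> Hm 1 \<Omega>" "u \<in> H10 \<Omega>"
    and S: "AE x in lebesgue_on \<Omega>. \<bar>w x\<bar> \<le> S" "0 \<le> S"
  shows "(\<lambda>x. u x * pd \<Omega> j w x) \<in> L2 \<Omega>"
    "(L2_norm \<Omega> (\<lambda>x. u x * pd \<Omega> j w x))\<^sup>2
      \<le> 4 * S\<^sup>2 * (L2_norm \<Omega> (pd \<Omega> j u))\<^sup>2 + 4 * S * L2_norm \<Omega> (pd \<Omega> j (pd \<Omega> j w)) * (L2_norm \<Omega> u * gnorm \<Omega> u)"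
proof -
  note \<Omega> = open_in_lebesgue[OF assms(1)]
  note w = Hm_1_pd[OF assms(1) H10_Hm[OF assms(3)]]
  note p = Hm_1_pd[OF assms(1,4)]
  note u = Hm_1_pd[OF assms(1) H10_Hm[OF assms(5)]]
  have multS: "(\<lambda>x. w x * g x) \<in> L2 \<Omega>" "L2_norm \<Omega> (\<lambda>x. w x * g x) \<le> S * L2_norm \<Omega> g" if g: "g \<in> L2 \<Omega>" for g
  proof -
    have m: "(\<lambda>x. w x * g x) \<in> borel_measurable (lebesgue_on \<Omega>)"
      using L2D(1)[OF g] L2D(1)[OF w(3)] by simp
    have ae: "AE x in lebesgue_on \<Omega>. norm (w x * g x) \<le> S * norm (g x)"
      using S(1) by eventually_elim (auto simp: abs_mult intro: mult_right_mono)
    show "(\<lambda>x. w x * g x) \<in> L2 \<Omega>" "L2_norm \<Omega> (\<lambda>x. w x * g x) \<le> S * L2_norm \<Omega> g"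
      using L2_dominated[OF g m ae S(2)] by auto
  qed
  have test: "(\<lambda>x. \<phi> x * pd \<Omega> j w x) \<in> L2 \<Omega>"
    "(L2_norm \<Omega> (\<lambda>x. \<phi> x * pd \<Omega> j w x))\<^sup>2
      \<le> 4 * S\<^sup>2 * (L2_norm \<Omega> (cpd j \<phi>))\<^sup>2 + 2 * S * L2_norm \<Omega> (pd \<Omega> j (pd \<Omega> j w)) * L2_norm \<Omega> (sqf \<phi>)"
    if \<phi>: "\<phi> \<in> test_functions \<Omega>" for \<phi>
  proof -
    have sm: "smooth \<phi>" using \<phi> by (rule test_smooth)
    have L: "\<phi> \<in> L2 \<Omega>" "cpd j \<phi> \<in> L2 \<Omega>" "sqf \<phi> \<in> L2 \<Omega>"
      using \<phi> assms(1) sm unfolding sqf_def[abs_def] by (auto intro: test_in_L2 test_cpd test_mult)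
    show Lp: "(\<lambda>x. \<phi> x * pd \<Omega> j w x) \<in> L2 \<Omega>"
      using L2_mult_smooth[OF sm assms(2) \<Omega> p(3)] by (simp add: mult.commute)
    define X where "X = L2_norm \<Omega> (\<lambda>x. \<phi> x * pd \<Omega> j w x)"
    define m where "m = L2_norm \<Omega> (pd \<Omega> j (pd \<Omega> j w))"
    have smq: "smooth (sqf \<phi>)" unfolding sqf_def[abs_def] by (rule smooth_mult[OF sm sm])
    have dq: "cpd j (sqf \<phi>) x = 2 * (\<phi> x * cpd j \<phi> x)" for x
      using cpd_mult[OF sm sm, of j] by (simp add: sqf_def[abs_def])
    have ibp: "tri \<Omega> (pd \<Omega> j (pd \<Omega> j w)) w (sqf \<phi>) + tri \<Omega> (pd \<Omega> j w) (pd \<Omega> j w) (sqf \<phi>)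
        + tri \<Omega> (pd \<Omega> j w) w (cpd j (sqf \<phi>)) = 0"
      by (rule ibp_smooth[OF assms(1,2,4,3) smq])
    have t1: "\<bar>tri \<Omega> (pd \<Omega> j (pd \<Omega> j w)) w (sqf \<phi>)\<bar> \<le> m * (S * L2_norm \<Omega> (sqf \<phi>))"
      using L2_cauchy_schwarz[OF p(2)[of j] multS(1)[OF L(3)]] mult_left_mono[OF multS(2)[OF L(3)], of m]
      by (simp add: tri_def m_def)
    have t2: "tri \<Omega> (pd \<Omega> j w) (pd \<Omega> j w) (sqf \<phi>) = X\<^sup>2"
      unfolding X_def L2_norm_sq[OF Lp] by (simp add: tri_def L2_inner_def sqf_def mult_ac)
    have t3: "\<bar>tri \<Omega> (pd \<Omega> j w) w (cpd j (sqf \<phi>))\<bar> \<le> 2 * (X * (S * L2_norm \<Omega> (cpd j \<phi>)))"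
    proof -
      have "tri \<Omega> (pd \<Omega> j w) w (cpd j (sqf \<phi>)) = 2 * L2_inner \<Omega> (\<lambda>x. \<phi> x * pd \<Omega> j w x) (\<lambda>x. w x * cpd j \<phi> x)"
        by (simp add: tri_def L2_inner_def dq mult_ac flip: integral_mult_right_zero)
      moreover have "\<bar>L2_inner \<Omega> (\<lambda>x. \<phi> x * pd \<Omega> j w x) (\<lambda>x. w x * cpd j \<phi> x)\<bar> \<le> X * (S * L2_norm \<Omega> (cpd j \<phi>))"
        using L2_cauchy_schwarz[OF Lp multS(1)[OF L(2)]] mult_left_mono[OF multS(2)[OF L(2)], of X]
        by (simp add: X_def)
      ultimately show ?thesis by simp
    qed
    have "X\<^sup>2 \<le> m * (S * L2_norm \<Omega> (sqf \<phi>)) + 2 * (X * (S * L2_norm \<Omega> (cpd j \<phi>)))"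
      using ibp t1 t2 t3 by linarith
    moreover have "2 * (X * (S * L2_norm \<Omega> (cpd j \<phi>))) \<le> X\<^sup>2 / 2 + 2 * (S * L2_norm \<Omega> (cpd j \<phi>))\<^sup>2"
      using zero_le_power2[of "X - 2 * (S * L2_norm \<Omega> (cpd j \<phi>))"] by (simp add: power2_diff power_mult_distrib)
    ultimately show "X\<^sup>2 \<le> 4 * S\<^sup>2 * (L2_norm \<Omega> (cpd j \<phi>))\<^sup>2 + 2 * S * m * L2_norm \<Omega> (sqf \<phi>)"
      by (simp add: power_mult_distrib algebra_simps)
  qed
  obtain \<phi> where \<phi>: "\<And>n::nat. \<phi> n \<in> test_functions \<Omega>" "(\<lambda>n. L2_norm \<Omega> (u - \<phi> n)) \<longlonglongrightarrow> 0"
    "\<And>j. (\<lambda>n. L2_norm \<Omega> (pd \<Omega> j u - cpd j (\<phi> n))) \<longlonglongrightarrow> 0"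
    using H10_approx[OF assms(1,5)] by blast
  have L: "\<phi> n \<in> L2 \<Omega>" "cpd i (\<phi> n) \<in> L2 \<Omega>" for n i
    using \<phi>(1) assms(1) by (auto intro: test_in_L2 test_cpd)
  obtain r :: "nat \<Rightarrow> nat" where r: "strict_mono r" "AE x in lebesgue_on \<Omega>. (\<lambda>n. \<phi> (r n) x) \<longlonglongrightarrow> u x"
    using L2_AE_subseq[OF u(3) L(1) \<phi>(2)] by blast
  define m where "m = L2_norm \<Omega> (pd \<Omega> j (pd \<Omega> j w))"
  define c where "c n = sqrt (4 * S\<^sup>2 * (L2_norm \<Omega> (cpd j (\<phi> n)))\<^sup>2
      + 2 * S * m * (2 * L2_norm \<Omega> (\<phi> n) * sqrt (L2_norm \<Omega> (cpd 1 (\<phi> n)) * L2_norm \<Omega> (cpd 2 (\<phi> n)))))" for n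
  define C where "C = sqrt (4 * S\<^sup>2 * (L2_norm \<Omega> (pd \<Omega> j u))\<^sup>2
      + 2 * S * m * (2 * L2_norm \<Omega> u * sqrt (L2_norm \<Omega> (pd \<Omega> 1 u) * L2_norm \<Omega> (pd \<Omega> 2 u))))"
  have "c \<longlonglongrightarrow> C"
    unfolding c_def C_def
    by (intro tendsto_intros L2_norm_tendsto[OF u(3) L(1) \<phi>(2)] L2_norm_tendsto[OF u(2) L(2) \<phi>(3)])
  from LIMSEQ_subseq_LIMSEQ[OF this r(1)] have lim: "(\<lambda>n. c (r n)) \<longlonglongrightarrow> C" by (simp add: o_def)
  have le: "L2_norm \<Omega> (\<lambda>x. \<phi> n x * pd \<Omega> j w x) \<le> c n" for n
  proof -
    have m0: "0 \<le> 2 * S * m" using S(2) by (simp add: m_def)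
    show ?thesis unfolding c_def
      by (rule real_le_rsqrt, rule order_trans[OF test(2)[OF \<phi>(1)]])
        (use mult_left_mono[OF ladyzhenskaya_test[OF assms(1) \<phi>(1), of n] m0] in \<open>simp add: m_def\<close>)
  qed
  have meas: "(\<lambda>x. u x * pd \<Omega> j w x) \<in> borel_measurable (lebesgue_on \<Omega>)"
    using L2D(1)[OF u(3)] L2D(1)[OF p(3)] by simp
  have ae: "AE x in lebesgue_on \<Omega>. (\<lambda>n. \<phi> (r n) x * pd \<Omega> j w x) \<longlonglongrightarrow> u x * pd \<Omega> j w x"
    using r(2) by eventually_elim (auto intro: tendsto_intros)
  note F = L2_fatou[OF test(1)[OF \<phi>(1)] meas ae le lim]
  show "(\<lambda>x. u x * pd \<Omega> j w x) \<in> L2 \<Omega>" by (rule F(1))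
  have g: "sqrt (L2_norm \<Omega> (pd \<Omega> 1 u) * L2_norm \<Omega> (pd \<Omega> 2 u)) \<le> gnorm \<Omega> u"
    by (rule real_le_lsqrt) (auto simp: power2_eq_square intro!: mult_mono pd_le_gnorm)
  have S4: "0 \<le> 4 * S * m * L2_norm \<Omega> u" using S(2) by (simp add: m_def)
  have "(L2_norm \<Omega> (\<lambda>x. u x * pd \<Omega> j w x))\<^sup>2 \<le> C\<^sup>2" by (intro power_mono F(2)) simp
  also have "C\<^sup>2 = 4 * S\<^sup>2 * (L2_norm \<Omega> (pd \<Omega> j u))\<^sup>2
      + 2 * S * m * (2 * L2_norm \<Omega> u * sqrt (L2_norm \<Omega> (pd \<Omega> 1 u) * L2_norm \<Omega> (pd \<Omega> 2 u)))"
    unfolding C_def using S(2) by (intro real_sqrt_pow2 add_nonneg_nonneg mult_nonneg_nonneg) (auto simp: m_def)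
  also have "\<dots> \<le> 4 * S\<^sup>2 * (L2_norm \<Omega> (pd \<Omega> j u))\<^sup>2 + 4 * S * m * (L2_norm \<Omega> u * gnorm \<Omega> u)"
    using mult_left_mono[OF g S4] by (simp add: mult_ac)
  finally show "(L2_norm \<Omega> (\<lambda>x. u x * pd \<Omega> j w x))\<^sup>2
      \<le> 4 * S\<^sup>2 * (L2_norm \<Omega> (pd \<Omega> j u))\<^sup>2 + 4 * S * L2_norm \<Omega> (pd \<Omega> j (pd \<Omega> j w)) * (L2_norm \<Omega> u * gnorm \<Omega> u)"
    by (simp add: m_def)
qed

section \<open>Vector fields and the convective form\<close>

lemma borel_measurable_vec_iff:
  fixes f :: "'a \<Rightarrow> ('b::euclidean_space)^'n"
  shows "f \<in> borel_measurable M \<longleftrightarrow> (\<forall>i. (\<lambda>x. f x $ i) \<in> borel_measurable M)"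
proof
  assume f: "f \<in> borel_measurable M"
  have "(\<lambda>v::'b^'n. v $ i) \<in> borel_measurable borel" for i
    by (intro borel_measurable_continuous_onI continuous_on_component continuous_on_id)
  then show "\<forall>i. (\<lambda>x. f x $ i) \<in> borel_measurable M"
    using measurable_compose[OF f] by blast
next
  assume f: "\<forall>i. (\<lambda>x. f x $ i) \<in> borel_measurable M"
  show "f \<in> borel_measurable M"
    unfolding borel_measurable_euclidean_space[of f]
    using f by (auto simp: Basis_vec_def inner_axis intro!: borel_measurable_inner)
qed

lemma L2_vec:
  fixes f :: "'a::euclidean_space \<Rightarrow> ('b::euclidean_space)^'n"
  assumes "\<And>i. (\<lambda>x. f x $ i) \<in> L2 \<Omega>"
  shows "f \<in> L2 \<Omega>"
proof -
  have "integrable (lebesgue_on \<Omega>) (\<lambda>x. \<Sum>i\<in>UNIV. (norm (f x $ i))\<^sup>2)"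
    using L2D(2)[OF assms] by (intro Bochner_Integration.integrable_sum)
  moreover have "(\<Sum>i\<in>UNIV. (norm (f x $ i))\<^sup>2) = (norm (f x))\<^sup>2" for x
    by (simp add: norm_vec_def L2_set_def sum_nonneg)
  ultimately show ?thesis
    using L2D(1)[OF assms] by (simp add: L2_def borel_measurable_vec_iff)
qed

lemma L2_inner_vec:
  fixes f g :: "'a::euclidean_space \<Rightarrow> ('b::euclidean_space)^'n"
  assumes "\<And>i. (\<lambda>x. f x $ i) \<in> L2 \<Omega>" "\<And>i. (\<lambda>x. g x $ i) \<in> L2 \<Omega>"
  shows "L2_inner \<Omega> f g = (\<Sum>i\<in>UNIV. L2_inner \<Omega> (\<lambda>x. f x $ i) (\<lambda>x. g x $ i))"
  unfolding L2_inner_def inner_vec_def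
  using L2_inner_integrable[OF assms] by (intro Bochner_Integration.integral_sum)

lemma L2_norm_vec_sq:
  fixes f :: "'a::euclidean_space \<Rightarrow> ('b::euclidean_space)^'n"
  assumes "\<And>i. (\<lambda>x. f x $ i) \<in> L2 \<Omega>"
  shows "(L2_norm \<Omega> f)\<^sup>2 = (\<Sum>i\<in>UNIV. (L2_norm \<Omega> (\<lambda>x. f x $ i))\<^sup>2)"
  using assms by (simp add: L2_norm_sq L2_vec L2_inner_vec)

lemma L2_norm_vec_component:
  fixes f :: "'a::euclidean_space \<Rightarrow> ('b::euclidean_space)^'n"
  assumes "\<And>i. (\<lambda>x. f x $ i) \<in> L2 \<Omega>"
  shows "L2_norm \<Omega> (\<lambda>x. f x $ i) \<le> L2_norm \<Omega> f"
proof (rule power2_le_imp_le)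
  show "(L2_norm \<Omega> (\<lambda>x. f x $ i))\<^sup>2 \<le> (L2_norm \<Omega> f)\<^sup>2"
    unfolding L2_norm_vec_sq[OF assms] by (rule member_le_sum) auto
qed simp

lemma coord_simps [simp]:
  "coord (u + v) i = coord u i + coord v i" "coord (c *\<^sub>R u) i = c *\<^sub>R coord u i"
  "coord (u - v) i = coord u i - coord v i" "coord 0 i = 0"
  by (auto simp: fun_eq_iff)

locale bounded_open =
  fixes \<Omega> :: "(real^2) set"
  assumes op: "open \<Omega>" and bd: "bounded \<Omega>"
begin

lemma meas: "\<Omega> \<in> sets lebesgue" using op by (rule open_in_lebesgue)

lemma subspace_vHm: "subspace (vHm m \<Omega>)"
  using subspace_Hm[OF op, of m] unfolding subspace_def vHm_def mem_Collect_eq coord_simps by blast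

lemma subspace_vH10: "subspace (vH10 \<Omega>)"
  using subspace_H10[OF op] unfolding subspace_def vH10_def mem_Collect_eq coord_simps by blast

lemma vHm_coord: "v \<in> vHm m \<Omega> \<Longrightarrow> coord v i \<in> Hm m \<Omega>" by (simp add: vHm_def)
lemma vH10_coord: "v \<in> vH10 \<Omega> \<Longrightarrow> coord v i \<in> H10 \<Omega>" by (simp add: vH10_def)

lemma vH10_vHm: "v \<in> vH10 \<Omega> \<Longrightarrow> v \<in> vHm 1 \<Omega>"
  by (auto simp: vH10_def vHm_def H10_Hm)

lemma coord_L2: "v \<in> vHm 1 \<Omega> \<Longrightarrow> coord v i \<in> L2 \<Omega>"
  by (intro Hm_L2[OF vHm_coord])

lemma vHm_L2: "v \<in> vHm 1 \<Omega> \<Longrightarrow> v \<in> L2 \<Omega>"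
  by (rule L2_vec[OF coord_L2])

lemma pd_coord_L2: "v \<in> vHm 1 \<Omega> \<Longrightarrow> pd \<Omega> j (coord v i) \<in> L2 \<Omega>"
  by (rule Hm_1_pd(2)[OF op vHm_coord])

lemma grad_nth [simp]: "grad \<Omega> v x $ i $ j = pd \<Omega> j (coord v i) x"
  by (simp add: grad_def)

lemma grad_row_L2: "v \<in> vHm 1 \<Omega> \<Longrightarrow> (\<lambda>x. grad \<Omega> v x $ i) \<in> L2 \<Omega>"
  by (rule L2_vec) (simp add: pd_coord_L2)

lemma grad_L2: "v \<in> vHm 1 \<Omega> \<Longrightarrow> grad \<Omega> v \<in> L2 \<Omega>"
  by (rule L2_vec[OF grad_row_L2])

lemma ae_eq_grad:
  assumes "\<And>i j. ae_eq \<Omega> (pd \<Omega> j (coord v i)) (\<lambda>x. M x $ i $ j)"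
  shows "ae_eq \<Omega> (grad \<Omega> v) M"
proof -
  have "AE x in lebesgue_on \<Omega>. \<forall>i j. pd \<Omega> j (coord v i) x = M x $ i $ j"
    using assms unfolding ae_eq_def by (simp add: forall_2)
  then show ?thesis unfolding ae_eq_def by eventually_elim (simp add: vec_eq_iff)
qed

lemma grad_add: "u \<in> vHm 1 \<Omega> \<Longrightarrow> v \<in> vHm 1 \<Omega> \<Longrightarrow> ae_eq \<Omega> (grad \<Omega> (u + v)) (grad \<Omega> u + grad \<Omega> v)"
  using pd_add[OF op vHm_coord[of u] vHm_coord[of v], unfolded coord_simps[symmetric]]
  by (intro ae_eq_grad) (simp add: plus_fun_def)

lemma grad_scale: "u \<in> vHm 1 \<Omega> \<Longrightarrow> ae_eq \<Omega> (grad \<Omega> (c *\<^sub>R u)) (c *\<^sub>R grad \<Omega> u)"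
  using pd_scale[OF op vHm_coord] by (intro ae_eq_grad) (simp add: scaleR_fun_def)

sublocale A: semi_inner "vHm 1 \<Omega>" "a_form \<Omega>"
proof
  note S = subspace_vHm[of 1]
  show "subspace (vHm 1 \<Omega>)" by (rule S)
  fix u v w :: vector_field and c :: real assume u: "u \<in> vHm 1 \<Omega>"
  show "0 \<le> a_form \<Omega> u u" unfolding a_form_def by (rule L2.nonneg[OF grad_L2[OF u]])
  assume w: "w \<in> vHm 1 \<Omega>"
  show "a_form \<Omega> u w = a_form \<Omega> w u" unfolding a_form_def by (rule L2.commute[OF grad_L2[OF u] grad_L2[OF w]])
  have "a_form \<Omega> (c *\<^sub>R u) w = L2_inner \<Omega> (c *\<^sub>R grad \<Omega> u) (grad \<Omega> w)"
    unfolding a_form_def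
    by (rule L2_inner_cong[OF grad_L2[OF subspace_scale[OF S u]] L2.mem(2)[OF grad_L2[OF u]] grad_L2[OF w] grad_L2[OF w]
          grad_scale[OF u] ae_eq_refl])
  then show "a_form \<Omega> (c *\<^sub>R u) w = c * a_form \<Omega> u w"
    using u w by (simp add: a_form_def L2.scale_left grad_L2)
  assume v: "v \<in> vHm 1 \<Omega>"
  have "a_form \<Omega> (u + v) w = L2_inner \<Omega> (grad \<Omega> u + grad \<Omega> v) (grad \<Omega> w)"
    unfolding a_form_def
    by (rule L2_inner_cong[OF grad_L2[OF subspace_add[OF S u v]] L2.mem(1)[OF grad_L2[OF u] grad_L2[OF v]] grad_L2[OF w] grad_L2[OF w]
          grad_add[OF u v] ae_eq_refl])
  then show "a_form \<Omega> (u + v) w = a_form \<Omega> u w + a_form \<Omega> v w"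
    using u v w by (simp add: a_form_def L2.add_left grad_L2)
qed

definition gn :: "vector_field \<Rightarrow> real" where "gn v = L2_norm \<Omega> (grad \<Omega> v)"

lemma gn_nonneg [simp]: "0 \<le> gn v" by (simp add: gn_def)

lemma gn_eq: "gn v = sqrt (a_form \<Omega> v v)" by (simp add: gn_def a_form_def L2_norm_def)

lemma gn_sq: "v \<in> vHm 1 \<Omega> \<Longrightarrow> (gn v)\<^sup>2 = a_form \<Omega> v v"
  by (simp add: gn_eq A.nonneg)

lemma a_cauchy_schwarz: "u \<in> vHm 1 \<Omega> \<Longrightarrow> v \<in> vHm 1 \<Omega> \<Longrightarrow> \<bar>a_form \<Omega> u v\<bar> \<le> gn u * gn v"
  unfolding gn_eq by (rule A.cauchy_schwarz)

lemma gn_triangle: "u \<in> vHm 1 \<Omega> \<Longrightarrow> v \<in> vHm 1 \<Omega> \<Longrightarrow> gn (u + v) \<le> gn u + gn v"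
  unfolding gn_eq by (rule A.triangle)

lemma gn_triangle_diff: "u \<in> vHm 1 \<Omega> \<Longrightarrow> v \<in> vHm 1 \<Omega> \<Longrightarrow> gn (u - v) \<le> gn u + gn v"
  unfolding gn_eq by (rule A.triangle_diff)

lemma pd_le_gn: "v \<in> vHm 1 \<Omega> \<Longrightarrow> L2_norm \<Omega> (pd \<Omega> j (coord v i)) \<le> gn v"
  unfolding gn_def
  using L2_norm_vec_component[of "\<lambda>x. grad \<Omega> v x $ i" \<Omega> j] L2_norm_vec_component[of "grad \<Omega> v" \<Omega> i]
  by (simp add: grad_row_L2 pd_coord_L2)

lemma coord_norm_le: "v \<in> vHm 1 \<Omega> \<Longrightarrow> L2_norm \<Omega> (coord v i) \<le> L2_norm \<Omega> v"
  by (rule L2_norm_vec_component[OF coord_L2])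

lemma gn_sq_sum: "v \<in> vHm 1 \<Omega> \<Longrightarrow> (gn v)\<^sup>2 = (\<Sum>i\<in>UNIV. \<Sum>j\<in>UNIV. (L2_norm \<Omega> (pd \<Omega> j (coord v i)))\<^sup>2)"
  unfolding gn_def
  using L2_norm_vec_sq[of "\<lambda>x. grad \<Omega> v x $ i" \<Omega> for i] 
  by (simp add: L2_norm_vec_sq grad_row_L2 pd_coord_L2)

lemma gnorm_le_gn:
  assumes "v \<in> vHm 1 \<Omega>"
  shows "gnorm \<Omega> (coord v i) \<le> gn v"
proof (rule power2_le_imp_le)
  have "(gnorm \<Omega> (coord v i))\<^sup>2 = (\<Sum>j\<in>UNIV. (L2_norm \<Omega> (pd \<Omega> j (coord v i)))\<^sup>2)"
    by (simp add: gnorm_def UNIV_2)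
  also have "\<dots> \<le> (gn v)\<^sup>2"
    unfolding gn_sq_sum[OF assms] by (rule member_le_sum) (auto intro: sum_nonneg)
  finally show "(gnorm \<Omega> (coord v i))\<^sup>2 \<le> (gn v)\<^sup>2" .
qed simp

lemma diverg_eq: "diverg \<Omega> v = pd \<Omega> 1 (coord v 1) + pd \<Omega> 2 (coord v 2)"
  by (simp add: diverg_def UNIV_2 plus_fun_def fun_eq_iff)

lemma diverg_L2: "v \<in> vHm 1 \<Omega> \<Longrightarrow> diverg \<Omega> v \<in> L2 \<Omega>"
  unfolding diverg_eq by (intro L2.mem pd_coord_L2)

lemma diverg_norm_le: "v \<in> vHm 1 \<Omega> \<Longrightarrow> L2_norm \<Omega> (diverg \<Omega> v) \<le> 2 * gn v"
  unfolding diverg_eq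
  using L2_triangle[OF pd_coord_L2[of v 1 1] pd_coord_L2[of v 2 2]] pd_le_gn[of v 1 1] pd_le_gn[of v 2 2] by simp

lemma diverg_add: "u \<in> vHm 1 \<Omega> \<Longrightarrow> v \<in> vHm 1 \<Omega> \<Longrightarrow> ae_eq \<Omega> (diverg \<Omega> (u + v)) (diverg \<Omega> u + diverg \<Omega> v)"
  using ae_eq_add[OF pd_add[OF op vHm_coord[of u 1 1] vHm_coord[of v 1 1], of 1] pd_add[OF op vHm_coord[of u 1 2] vHm_coord[of v 1 2], of 2]]
  unfolding diverg_eq coord_simps by (simp only: add_ac)

lemma diverg_scale: "u \<in> vHm 1 \<Omega> \<Longrightarrow> ae_eq \<Omega> (diverg \<Omega> (c *\<^sub>R u)) (c *\<^sub>R diverg \<Omega> u)"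
  using ae_eq_add[OF pd_scale[OF op vHm_coord[of u 1 1], of 1 c] pd_scale[OF op vHm_coord[of u 1 2], of 2 c]]
  unfolding diverg_eq coord_simps scaleR_add_right .

lemma L2_diverg_add:
  assumes "q \<in> L2 \<Omega>" "u \<in> vHm 1 \<Omega>" "v \<in> vHm 1 \<Omega>"
  shows "L2_inner \<Omega> q (diverg \<Omega> (u + v)) = L2_inner \<Omega> q (diverg \<Omega> u) + L2_inner \<Omega> q (diverg \<Omega> v)"
proof -
  note L = diverg_L2[OF assms(2)] diverg_L2[OF assms(3)] diverg_L2[OF A.mem(1)[OF assms(2,3)]]
  show ?thesis
    using L2_inner_cong[OF assms(1,1) L(3) L2.mem(1)[OF L(1,2)] ae_eq_refl diverg_add[OF assms(2,3)]]
      L2.add_right[OF L(1,2) assms(1)] by simp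
qed

lemma L2_diverg_scale:
  assumes "q \<in> L2 \<Omega>" "u \<in> vHm 1 \<Omega>"
  shows "L2_inner \<Omega> q (diverg \<Omega> (c *\<^sub>R u)) = c * L2_inner \<Omega> q (diverg \<Omega> u)"
proof -
  note L = diverg_L2[OF assms(2)] diverg_L2[OF A.mem(2)[OF assms(2), of c]]
  show ?thesis
    using L2_inner_cong[OF assms(1,1) L(2) L2.mem(2)[OF L(1)] ae_eq_refl diverg_scale[OF assms(2)]]
      L2.scale_right[OF L(1) assms(1), of c] by simp
qed

lemma L2_diverg_diff:
  "q \<in> L2 \<Omega> \<Longrightarrow> u \<in> vHm 1 \<Omega> \<Longrightarrow> v \<in> vHm 1 \<Omega> \<Longrightarrow>
    L2_inner \<Omega> q (diverg \<Omega> (u - v)) = L2_inner \<Omega> q (diverg \<Omega> u) - L2_inner \<Omega> q (diverg \<Omega> v)"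
  using L2_diverg_add[of q u "(-1) *\<^sub>R v"] L2_diverg_scale[of q v "-1"] A.mem(2)[of v "-1"]
  by (simp add: fun_diff_def)

lemma const_L2: "(\<lambda>x. c :: real) \<in> L2 \<Omega>"
proof -
  have "\<Omega> \<in> lmeasurable" using op bd by (simp add: lmeasurable_open)
  then have "integrable lebesgue (\<lambda>x. indicat_real \<Omega> x * c\<^sup>2)"
    by (intro integrable_mult_left) (simp add: lmeasurable_iff_integrable)
  then have "integrable (lebesgue_on \<Omega>) (\<lambda>x. c\<^sup>2)" by (simp add: integrable_lebesgue_on[OF meas])
  then show ?thesis by (simp add: L2_def)
qed

lemma integral_pd_H10: 
  assumes "u \<in> H10 \<Omega>"
  shows "L2_inner \<Omega> (\<lambda>x. c) (pd \<Omega> j u) = 0"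
proof -
  obtain \<phi> where \<phi>: "\<And>n::nat. \<phi> n \<in> test_functions \<Omega>" "(\<lambda>n. L2_norm \<Omega> (u - \<phi> n)) \<longlonglongrightarrow> 0"
    "\<And>j. (\<lambda>n. L2_norm \<Omega> (pd \<Omega> j u - cpd j (\<phi> n))) \<longlonglongrightarrow> 0"
    using H10_approx[OF op assms] by blast
  have "(\<lambda>n. L2_inner \<Omega> (\<lambda>x. c) (cpd j (\<phi> n))) \<longlonglongrightarrow> L2_inner \<Omega> (\<lambda>x. c) (pd \<Omega> j u)"
    by (rule L2_inner_tendsto[OF Hm_1_pd(2)[OF op H10_Hm[OF assms]] test_in_L2[OF op test_cpd[OF \<phi>(1)]] \<phi>(3) const_L2])
  moreover have "L2_inner \<Omega> (\<lambda>x. c) (cpd j (\<phi> n)) = 0" for n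
    using integral_cpd_test[OF op \<phi>(1), of j n] by (simp add: L2_inner_def)
  ultimately show ?thesis by (simp add: LIMSEQ_const_iff)
qed

lemma integral_diverg:
  assumes "v \<in> vH10 \<Omega>"
  shows "L2_inner \<Omega> (\<lambda>x. c) (diverg \<Omega> v) = 0"
  unfolding diverg_eq
  using L2.add_right[OF pd_coord_L2[OF vH10_vHm[OF assms]] pd_coord_L2[OF vH10_vHm[OF assms]] const_L2]
  by (simp add: integral_pd_H10[OF vH10_coord[OF assms]])

text \<open>
  The best constant is the projection of \<open>q\<close> onto the constants.
\<close>

lemma L2_quot_attained:
  assumes "q \<in> L2 \<Omega>"
  obtains c where "L2_norm \<Omega> (q - (\<lambda>x. c)) \<le> L2_quot_norm \<Omega> q"
proof -
  have "{\<lambda>x::real^2. 1::real} \<subseteq> L2 \<Omega>" using const_L2 by simp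
  then have "\<exists>w\<in>span {\<lambda>x::real^2. 1::real}. \<forall>v\<in>span {\<lambda>x. 1}. L2_inner \<Omega> w v = L2_inner \<Omega> q v"
  proof (rule L2.riesz_span[rotated])
    fix x :: "real^2 \<Rightarrow> real" assume x: "x \<in> L2 \<Omega>" "L2_inner \<Omega> x x = 0"
    then show "L2_inner \<Omega> q x = 0" using L2.cauchy_schwarz_sq[OF assms x(1)] by simp
  qed (use assms in \<open>auto simp: L2.linear_simps\<close>)
  then obtain w where w: "w \<in> span {\<lambda>x::real^2. 1::real}" "\<And>v. v \<in> span {\<lambda>x. 1} \<Longrightarrow> L2_inner \<Omega> w v = L2_inner \<Omega> q v"
    by blast
  obtain c where c: "w = (\<lambda>x. c)" using w(1) by (auto simp: span_singleton scaleR_fun_def)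
  have "L2_norm \<Omega> (q - w) \<le> L2_norm \<Omega> (\<lambda>x. q x - d)" for d
  proof -
    have L: "q - w \<in> L2 \<Omega>" "(\<lambda>x. c - d) \<in> L2 \<Omega>" unfolding c using assms const_L2 by (auto intro: L2.mem)
    have "L2_inner \<Omega> (q - w) (\<lambda>x. c - d) = 0"
    proof -
      have "(\<lambda>x. c - d) = (c - d) *\<^sub>R (\<lambda>x::real^2. 1::real)" by (simp add: scaleR_fun_def)
      then have "(\<lambda>x. c - d) \<in> span {\<lambda>x::real^2. 1::real}" by (simp add: span_base span_scale)
      from w(2)[OF this] show ?thesis using assms const_L2 L by (simp add: L2.diff_left c)
    qed
    then have "L2_inner \<Omega> (q - w + (\<lambda>x. c - d)) (q - w + (\<lambda>x. c - d))
        = L2_inner \<Omega> (q - w) (q - w) + L2_inner \<Omega> (\<lambda>x. c - d) (\<lambda>x. c - d)"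
      using L L2.commute[OF L] by (simp add: L2.linear_simps L2.mem)
    moreover have "q - w + (\<lambda>x. c - d) = (\<lambda>x. q x - d)" by (auto simp: c)
    ultimately show ?thesis using L2.nonneg[OF L(2)] by (simp add: L2_norm_def)
  qed
  then have "L2_norm \<Omega> (q - w) \<le> L2_quot_norm \<Omega> q"
    unfolding L2_quot_norm_def by (intro cINF_greatest) auto
  then show ?thesis using that c by blast
qed

lemma vector_poincare: "\<exists>C>0. \<forall>v\<in>vH10 \<Omega>. L2_norm \<Omega> v \<le> C * gn v"
proof -
  obtain R where R: "\<And>x. x \<in> \<Omega> \<Longrightarrow> norm x \<le> R" "R > 0" using bd by (auto simp: bounded_pos)
  have "L2_norm \<Omega> v \<le> 2 * R * gn v" if v: "v \<in> vH10 \<Omega>" for v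
  proof (rule power2_le_imp_le)
    note v1 = vH10_vHm[OF v]
    have "(L2_norm \<Omega> v)\<^sup>2 = (\<Sum>i\<in>UNIV. (L2_norm \<Omega> (coord v i))\<^sup>2)"
      by (rule L2_norm_vec_sq[OF coord_L2[OF v1]])
    also have "\<dots> \<le> (\<Sum>i\<in>UNIV. \<Sum>j\<in>UNIV. (2 * R)\<^sup>2 * (L2_norm \<Omega> (pd \<Omega> j (coord v i)))\<^sup>2)"
    proof (rule sum_mono)
      fix i
      have "L2_norm \<Omega> (coord v i) \<le> 2 * R * L2_norm \<Omega> (pd \<Omega> 1 (coord v i))"
        using R by (intro poincare[OF op bd _ _ vH10_coord[OF v]]) (auto intro: order_trans[OF component_le_norm_cart])
      then have "(L2_norm \<Omega> (coord v i))\<^sup>2 \<le> (2 * R * L2_norm \<Omega> (pd \<Omega> 1 (coord v i)))\<^sup>2"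
        by (rule power_mono) simp
      also have "\<dots> = (2 * R)\<^sup>2 * (L2_norm \<Omega> (pd \<Omega> 1 (coord v i)))\<^sup>2" by (simp add: power_mult_distrib)
      also have "\<dots> \<le> (\<Sum>j\<in>UNIV. (2 * R)\<^sup>2 * (L2_norm \<Omega> (pd \<Omega> j (coord v i)))\<^sup>2)"
        by (rule member_le_sum) auto
      finally show "(L2_norm \<Omega> (coord v i))\<^sup>2 \<le> (\<Sum>j\<in>UNIV. (2 * R)\<^sup>2 * (L2_norm \<Omega> (pd \<Omega> j (coord v i)))\<^sup>2)" .
    qed
    also have "\<dots> = (2 * R * gn v)\<^sup>2"
      by (simp add: gn_sq_sum[OF v1] power_mult_distrib sum_distrib_left)
    finally show "(L2_norm \<Omega> v)\<^sup>2 \<le> (2 * R * gn v)\<^sup>2" .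
  qed (use R(2) in simp)
  then show ?thesis using R(2) by (intro exI[of _ "2 * R"]) auto
qed

lemma tri_integrable:
  assumes "f \<in> L2 \<Omega>" "g \<in> H10 \<Omega>" "h \<in> H10 \<Omega>"
  shows "integrable (lebesgue_on \<Omega>) (\<lambda>x. f x * (g x * h x))"
  using L2_inner_integrable[OF assms(1) H10_mult(1)[OF op assms(2,3)]] by simp

lemma convect_inner:
  assumes "v \<in> vH10 \<Omega>" "w \<in> vHm 1 \<Omega>" "\<phi> \<in> vH10 \<Omega>"
  shows "L2_inner \<Omega> (convect \<Omega> v w) \<phi> = (\<Sum>i\<in>UNIV. \<Sum>j\<in>UNIV. tri \<Omega> (pd \<Omega> j (coord w i)) (coord v j) (coord \<phi> i))"
proof -
  have "convect \<Omega> v w x \<bullet> \<phi> x = (\<Sum>i\<in>UNIV. \<Sum>j\<in>UNIV. pd \<Omega> j (coord w i) x * (v x $ j * \<phi> x $ i))" for x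
    by (simp add: convect_def inner_vec_def matrix_vector_mult_def sum_distrib_right sum_distrib_left mult_ac)
  then show ?thesis
    using tri_integrable[OF pd_coord_L2[OF assms(2)] vH10_coord[OF assms(1)] vH10_coord[OF assms(3)]]
    unfolding L2_inner_def by (simp add: tri_def L2_inner_def)
qed

lemma b_form_eq:
  assumes "v \<in> vH10 \<Omega>" "w \<in> vH10 \<Omega>" "\<phi> \<in> vH10 \<Omega>"
  shows "b_form \<Omega> v w \<phi> = (\<Sum>i\<in>UNIV. \<Sum>j\<in>UNIV.
      1/2 * tri \<Omega> (pd \<Omega> j (coord w i)) (coord v j) (coord \<phi> i) - 1/2 * tri \<Omega> (pd \<Omega> j (coord \<phi> i)) (coord v j) (coord w i))"
  unfolding b_form_def convect_inner[OF assms(1) vH10_vHm[OF assms(2)] assms(3)]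
    convect_inner[OF assms(1) vH10_vHm[OF assms(3)] assms(2)]
  by (simp only: sum_distrib_left sum_subtractf)

lemma b_skew: "b_form \<Omega> v w w = 0"
  by (simp add: b_form_def)

text \<open>
  Integrating by parts the half in which \<open>\<phi>\<close> is differentiated leaves a form in which the test
  field enters only through its values; the divergence of \<open>v\<close> appears, since \<open>v\<close> is not
  solenoidal.
\<close>

lemma b_form_ibp:
  assumes "v \<in> vH10 \<Omega>" "w \<in> vH10 \<Omega>" "\<phi> \<in> vH10 \<Omega>"
  shows "b_form \<Omega> v w \<phi> = (\<Sum>i\<in>UNIV. \<Sum>j\<in>UNIV.
      tri \<Omega> (pd \<Omega> j (coord w i)) (coord v j) (coord \<phi> i) + 1/2 * tri \<Omega> (pd \<Omega> j (coord v j)) (coord w i) (coord \<phi> i))"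
  unfolding b_form_eq[OF assms]
proof (intro sum.cong refl)
  fix i j
  have "tri \<Omega> (pd \<Omega> j (coord v j)) (coord w i) (coord \<phi> i) + tri \<Omega> (coord v j) (pd \<Omega> j (coord w i)) (coord \<phi> i)
      + tri \<Omega> (coord v j) (coord w i) (pd \<Omega> j (coord \<phi> i)) = 0"
    using assms by (intro ibp_H10 op bd vH10_coord)
  moreover have "tri \<Omega> (coord v j) (pd \<Omega> j (coord w i)) (coord \<phi> i) = tri \<Omega> (pd \<Omega> j (coord w i)) (coord v j) (coord \<phi> i)"
    by (rule tri_move(3))
  moreover have "tri \<Omega> (coord v j) (coord w i) (pd \<Omega> j (coord \<phi> i)) = tri \<Omega> (pd \<Omega> j (coord \<phi> i)) (coord v j) (coord w i)"
    by (simp add: tri_def L2_inner_def mult_ac)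
  ultimately show "1/2 * tri \<Omega> (pd \<Omega> j (coord w i)) (coord v j) (coord \<phi> i) - 1/2 * tri \<Omega> (pd \<Omega> j (coord \<phi> i)) (coord v j) (coord w i)
      = tri \<Omega> (pd \<Omega> j (coord w i)) (coord v j) (coord \<phi> i) + 1/2 * tri \<Omega> (pd \<Omega> j (coord v j)) (coord w i) (coord \<phi> i)"
    by linarith
qed

lemma tri_add_left:
  assumes "u \<in> vH10 \<Omega>" "v \<in> vH10 \<Omega>" "g \<in> H10 \<Omega>" "h \<in> H10 \<Omega>"
  shows "tri \<Omega> (pd \<Omega> j (coord (u + v) i)) g h = tri \<Omega> (pd \<Omega> j (coord u i)) g h + tri \<Omega> (pd \<Omega> j (coord v i)) g h"
proof -
  note L = pd_coord_L2[OF vH10_vHm[OF assms(1)]] pd_coord_L2[OF vH10_vHm[OF assms(2)]]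
    pd_coord_L2[OF vH10_vHm[OF subspace_add[OF subspace_vH10 assms(1,2)]]]
  have ae: "ae_eq \<Omega> (pd \<Omega> j (coord (u + v) i)) (pd \<Omega> j (coord u i) + pd \<Omega> j (coord v i))"
    unfolding coord_simps by (rule pd_add[OF op vHm_coord[OF vH10_vHm[OF assms(1)]] vHm_coord[OF vH10_vHm[OF assms(2)]]])
  have "tri \<Omega> (pd \<Omega> j (coord (u + v) i)) g h = L2_inner \<Omega> (pd \<Omega> j (coord u i) + pd \<Omega> j (coord v i)) (\<lambda>x. g x * h x)"
    unfolding tri_def
    by (rule L2_inner_cong_left[OF L(3) L2.mem(1)[OF L(1,2)] H10_mult(1)[OF op assms(3,4)] ae])
  also have "\<dots> = tri \<Omega> (pd \<Omega> j (coord u i)) g h + tri \<Omega> (pd \<Omega> j (coord v i)) g h"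
    unfolding tri_def by (rule L2.add_left[OF L(1,2) H10_mult(1)[OF op assms(3,4)]])
  finally show ?thesis .
qed

lemma tri_add_mid:
  assumes "f \<in> L2 \<Omega>" "g \<in> H10 \<Omega>" "g' \<in> H10 \<Omega>" "h \<in> H10 \<Omega>"
  shows "tri \<Omega> f (g + g') h = tri \<Omega> f g h + tri \<Omega> f g' h"
proof -
  have "(\<lambda>x. (g + g') x * h x) = (\<lambda>x. g x * h x) + (\<lambda>x. g' x * h x)" by (auto simp: algebra_simps)
  then show ?thesis
    unfolding tri_def by (simp only: L2.add_right[OF H10_mult(1)[OF op assms(2,4)] H10_mult(1)[OF op assms(3,4)] assms(1)])
qed

lemma b_add_mid:
  assumes "v \<in> vH10 \<Omega>" "w \<in> vH10 \<Omega>" "w' \<in> vH10 \<Omega>" "\<phi> \<in> vH10 \<Omega>"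
  shows "b_form \<Omega> v (w + w') \<phi> = b_form \<Omega> v w \<phi> + b_form \<Omega> v w' \<phi>"
proof -
  note S = subspace_add[OF subspace_vH10 assms(2,3)]
  note c = vH10_coord[OF assms(1)] vH10_coord[OF assms(2)] vH10_coord[OF assms(3)] vH10_coord[OF assms(4)]
  show ?thesis
    unfolding b_form_ibp[OF assms(1) S assms(4)] b_form_ibp[OF assms(1,2,4)] b_form_ibp[OF assms(1,3,4)]
      sum.distrib[symmetric] tri_add_left[OF assms(2,3) c(1,4)]
    unfolding coord_simps tri_add_mid[OF pd_coord_L2[OF vH10_vHm[OF assms(1)]] c(2,3,4)]
    by (intro sum.cong refl) simp
qed

lemma tri_bound:
  assumes "f \<in> L2 \<Omega>" "g \<in> H10 \<Omega>" "h \<in> H10 \<Omega>"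
  shows "\<bar>tri \<Omega> f g h\<bar> \<le> L2_norm \<Omega> f * (2 * (sqrt (L2_norm \<Omega> g * gnorm \<Omega> g) * sqrt (L2_norm \<Omega> h * gnorm \<Omega> h)))"
proof -
  have "L2_norm \<Omega> (\<lambda>x. g x * h x) \<le> sqrt (4 * (L2_norm \<Omega> g * gnorm \<Omega> g) * (L2_norm \<Omega> h * gnorm \<Omega> h))"
    by (rule real_le_rsqrt[OF H10_mult(2)[OF op assms(2,3)]])
  also have "\<dots> = 2 * (sqrt (L2_norm \<Omega> g * gnorm \<Omega> g) * sqrt (L2_norm \<Omega> h * gnorm \<Omega> h))"
    by (simp only: real_sqrt_mult real_sqrt_four mult_ac)
  finally have "L2_norm \<Omega> (\<lambda>x. g x * h x) \<le> 2 * (sqrt (L2_norm \<Omega> g * gnorm \<Omega> g) * sqrt (L2_norm \<Omega> h * gnorm \<Omega> h))" .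
  then have "L2_norm \<Omega> f * L2_norm \<Omega> (\<lambda>x. g x * h x)
      \<le> L2_norm \<Omega> f * (2 * (sqrt (L2_norm \<Omega> g * gnorm \<Omega> g) * sqrt (L2_norm \<Omega> h * gnorm \<Omega> h)))"
    by (rule mult_left_mono) simp
  with L2_cauchy_schwarz[OF assms(1) H10_mult(1)[OF op assms(2,3)]] show ?thesis
    unfolding tri_def by (rule order_trans)
qed

text \<open>
  By Ladyzhenskaya's inequality, an upper bound for the \<open>L\<^sup>4\<close> norm up to a factor.
\<close>

definition N4 :: "vector_field \<Rightarrow> real" where "N4 v = sqrt (L2_norm \<Omega> v * gn v)"

lemma N4_nonneg [simp]: "0 \<le> N4 v" by (simp add: N4_def)

lemma coord_N4: "v \<in> vHm 1 \<Omega> \<Longrightarrow> sqrt (L2_norm \<Omega> (coord v i) * gnorm \<Omega> (coord v i)) \<le> N4 v"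
  unfolding N4_def by (intro real_sqrt_le_mono mult_mono coord_norm_le gnorm_le_gn) auto

lemma tri_bound_vec:
  assumes "u \<in> vHm 1 \<Omega>" "v \<in> vH10 \<Omega>" "w \<in> vH10 \<Omega>"
  shows "\<bar>tri \<Omega> (pd \<Omega> j (coord u i)) (coord v k) (coord w l)\<bar> \<le> 2 * gn u * N4 v * N4 w"
proof -
  have "\<bar>tri \<Omega> (pd \<Omega> j (coord u i)) (coord v k) (coord w l)\<bar>
    \<le> L2_norm \<Omega> (pd \<Omega> j (coord u i)) * (2 * (sqrt (L2_norm \<Omega> (coord v k) * gnorm \<Omega> (coord v k))
        * sqrt (L2_norm \<Omega> (coord w l) * gnorm \<Omega> (coord w l))))"
    by (rule tri_bound[OF pd_coord_L2[OF assms(1)] vH10_coord[OF assms(2)] vH10_coord[OF assms(3)]])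
  also have "\<dots> \<le> gn u * (2 * (N4 v * N4 w))"
    by (intro mult_mono pd_le_gn[OF assms(1)] coord_N4[OF vH10_vHm[OF assms(2)]] coord_N4[OF vH10_vHm[OF assms(3)]] order_refl)
      auto
  finally show ?thesis by (simp add: mult_ac)
qed

lemma sum_2_2: "(\<Sum>i\<in>UNIV. \<Sum>j\<in>UNIV. f i j) = f 1 1 + f 1 2 + (f 2 1 + f (2::2) (2::2))" for f :: "2 \<Rightarrow> 2 \<Rightarrow> real"
  by (simp add: UNIV_2)

lemma b_bound:
  assumes "v \<in> vH10 \<Omega>" "w \<in> vH10 \<Omega>" "\<phi> \<in> vH10 \<Omega>"
  shows "\<bar>b_form \<Omega> v w \<phi>\<bar> \<le> 4 * N4 v * (gn w * N4 \<phi> + gn \<phi> * N4 w)"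
proof -
  have "\<bar>b_form \<Omega> v w \<phi>\<bar> \<le> (\<Sum>i\<in>UNIV. \<Sum>j\<in>UNIV. \<bar>1/2 * tri \<Omega> (pd \<Omega> j (coord w i)) (coord v j) (coord \<phi> i)
      - 1/2 * tri \<Omega> (pd \<Omega> j (coord \<phi> i)) (coord v j) (coord w i)\<bar>)"
    unfolding b_form_eq[OF assms] by (intro order_trans[OF sum_abs] sum_mono sum_abs)
  also have "\<dots> \<le> (\<Sum>i\<in>(UNIV::2 set). \<Sum>j\<in>(UNIV::2 set). N4 v * (gn w * N4 \<phi> + gn \<phi> * N4 w))"
  proof (intro sum_mono)
    fix i j :: 2
    have "\<bar>tri \<Omega> (pd \<Omega> j (coord w i)) (coord v j) (coord \<phi> i)\<bar> \<le> 2 * gn w * N4 v * N4 \<phi>"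
      by (rule tri_bound_vec[OF vH10_vHm[OF assms(2)] assms(1,3)])
    moreover have "\<bar>tri \<Omega> (pd \<Omega> j (coord \<phi> i)) (coord v j) (coord w i)\<bar> \<le> 2 * gn \<phi> * N4 v * N4 w"
      by (rule tri_bound_vec[OF vH10_vHm[OF assms(3)] assms(1,2)])
    ultimately show "\<bar>1/2 * tri \<Omega> (pd \<Omega> j (coord w i)) (coord v j) (coord \<phi> i)
      - 1/2 * tri \<Omega> (pd \<Omega> j (coord \<phi> i)) (coord v j) (coord w i)\<bar> \<le> N4 v * (gn w * N4 \<phi> + gn \<phi> * N4 w)"
      by (simp add: algebra_simps)
  qed
  also have "\<dots> = 4 * N4 v * (gn w * N4 \<phi> + gn \<phi> * N4 w)" by (simp only: sum_2_2)
  finally show ?thesis .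
qed

end

section \<open>The discrete Stokes operator\<close>

lemma vHm_norm_nonneg [simp]: "0 \<le> vHm_norm m \<Omega> w"
  by (auto simp: vHm_norm_def intro!: sum_nonneg)

lemma Hm_norm_coord_le: "Hm_norm m \<Omega> (coord w i) \<le> vHm_norm m \<Omega> w"
proof -
  have "(Hm_norm m \<Omega> (coord w i))\<^sup>2 \<le> (\<Sum>i\<in>UNIV. (Hm_norm m \<Omega> (coord w i))\<^sup>2)"
    by (rule member_le_sum) auto
  then show ?thesis unfolding vHm_norm_def by (rule real_le_rsqrt)
qed

lemma second_deriv_le:
  "L2_norm \<Omega> (pd \<Omega> 1 (pd \<Omega> 2 (coord w i))) \<le> vHm_norm 2 \<Omega> w"
  "L2_norm \<Omega> (pd \<Omega> j (pd \<Omega> j (coord w i))) \<le> vHm_norm 2 \<Omega> w"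
proof -
  note le = order_trans[OF L2_norm_le_Hm_norm Hm_norm_coord_le, of _ _ 2]
  show "L2_norm \<Omega> (pd \<Omega> 1 (pd \<Omega> 2 (coord w i))) \<le> vHm_norm 2 \<Omega> w"
    using le[of 1 1 \<Omega> w i] by (simp add: One_nat_def)
  show "L2_norm \<Omega> (pd \<Omega> j (pd \<Omega> j (coord w i))) \<le> vHm_norm 2 \<Omega> w"
    using le[of 2 0 \<Omega> w i] le[of 0 2 \<Omega> w i] two_cases[of j] by (auto simp: numeral_2_eq_2)
qed

lemma H1_quot_norm_nonneg [simp]: "0 \<le> H1_quot_norm \<Omega> q"
  unfolding H1_quot_norm_def by (rule cINF_greatest) auto

lemma quadratic_bound: "0 \<le> (d::real) \<Longrightarrow> X\<^sup>2 \<le> 3 * d * X + 2 * d\<^sup>2 \<Longrightarrow> X \<le> 4 * d"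
proof (rule ccontr)
  assume d: "0 \<le> d" and q: "X\<^sup>2 \<le> 3 * d * X + 2 * d\<^sup>2" and "\<not> X \<le> 4 * d"
  then have X: "X > 4 * d" by simp
  have "0 < (X - 4 * d) * (X + d)" using X d by (intro mult_pos_pos) linarith+
  moreover have "(X - 4 * d) * (X + d) = X\<^sup>2 - 3 * d * X - 4 * d\<^sup>2" by (simp add: power2_eq_square algebra_simps)
  moreover have "0 \<le> d\<^sup>2" by simp
  ultimately show False using q by linarith
qed

text \<open>
  A single discretization level. The one constant \<open>c\<close> dominates those of the Poincare inequality,
  of the regularity of the Stokes problem, of the approximation properties and of the inverse
  inequality; all bounds below are explicit in \<open>c\<close> and free of \<open>h\<close>.
\<close>

locale fem = bounded_open +
  fixes c h :: real and Hh :: "vector_field set" and Lh :: "scalar_field set"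
  assumes c1: "1 \<le> c" and h0: "0 < h"
    and poincare': "\<And>v. v \<in> vH10 \<Omega> \<Longrightarrow> L2_norm \<Omega> v \<le> c * gn v"
    and regular: "\<And>g. g \<in> L2 \<Omega> \<Longrightarrow> \<exists>w q. stokes_solution \<Omega> g w q \<and> w \<in> vHm 2 \<Omega> \<and> q \<in> Hm 1 \<Omega> \<and>
        vHm_norm 2 \<Omega> w \<le> c * L2_norm \<Omega> g \<and> H1_quot_norm \<Omega> q \<le> c * L2_norm \<Omega> g"
    and fin: "\<exists>B. finite B \<and> Hh = span B"
    and Hh_sub: "Hh \<subseteq> vH10 \<Omega>" and Lh_sub: "Lh \<subseteq> L2 \<Omega>"
    and approx: "\<And>q. q \<in> Hm 1 \<Omega> \<Longrightarrow> \<exists>q\<^sub>h\<in>Lh. L2_quot_norm \<Omega> (q - q\<^sub>h) \<le> c * h * H1_quot_norm \<Omega> q"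
    and inverse_ineq: "\<And>w. w \<in> Hh \<Longrightarrow> h * gn w \<le> c * L2_norm \<Omega> w"
    and sol_approx: "\<And>w. w \<in> J1 \<Omega> \<Longrightarrow> w \<in> vHm 2 \<Omega> \<Longrightarrow> \<exists>w\<^sub>h\<in>Jh \<Omega> Hh Lh. gn (w - w\<^sub>h) \<le> c * h * vHm_norm 2 \<Omega> w"
begin

abbreviation J :: "vector_field set" where "J \<equiv> Jh \<Omega> Hh Lh"

lemma J_Hh: "v \<in> J \<Longrightarrow> v \<in> Hh" by (simp add: Jh_def)
lemma Hh_H10: "v \<in> Hh \<Longrightarrow> v \<in> vH10 \<Omega>" using Hh_sub by blast
lemma J_H10: "v \<in> J \<Longrightarrow> v \<in> vH10 \<Omega>" by (rule Hh_H10[OF J_Hh])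
lemma J_H1: "v \<in> J \<Longrightarrow> v \<in> vHm 1 \<Omega>" by (rule vH10_vHm[OF J_H10])
lemma J_L2: "v \<in> J \<Longrightarrow> v \<in> L2 \<Omega>" by (rule vHm_L2[OF J_H1])
lemma J_diverg: "v \<in> J \<Longrightarrow> q \<in> Lh \<Longrightarrow> L2_inner \<Omega> q (diverg \<Omega> v) = 0" by (simp add: Jh_def)

lemma subspace_Hh: "subspace Hh" using fin subspace_span by blast

lemma subspace_J: "subspace J"
proof -
  have H: "u + v \<in> Hh" "k *\<^sub>R u \<in> Hh" "0 \<in> Hh" if "u \<in> Hh" "v \<in> Hh" for u v k
    using that subspace_Hh by (auto simp: subspace_def)
  have 0: "L2_inner \<Omega> q (diverg \<Omega> 0) = 0" if "q \<in> L2 \<Omega>" for q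
    using L2_diverg_scale[OF that A.mem(4), of 0] by simp
  show ?thesis
    unfolding subspace_def
  proof (intro conjI ballI allI)
    show "0 \<in> J" using 0 Lh_sub subspace_0[OF subspace_Hh] by (auto simp: Jh_def)
    fix u assume u: "u \<in> J"
    show "k *\<^sub>R u \<in> J" for k
      using u L2_diverg_scale[OF _ J_H1[OF u]] Lh_sub subspace_scale[OF subspace_Hh J_Hh[OF u]]
      by (auto simp: Jh_def)
    fix v assume v: "v \<in> J"
    show "u + v \<in> J"
      using u v L2_diverg_add[OF _ J_H1[OF u] J_H1[OF v]] Lh_sub subspace_add[OF subspace_Hh J_Hh[OF u] J_Hh[OF v]]
      by (auto simp: Jh_def)
  qed
qed

lemmas J_mem = subspace_add[OF subspace_J] subspace_scale[OF subspace_J] subspace_diff[OF subspace_J] subspace_neg[OF subspace_J]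

lemma J_span: obtains B where "finite B" "J = span B"
proof -
  obtain B where B: "finite B" "Hh = span B" using fin by blast
  obtain B' where B': "B' \<subseteq> J" "independent B'" "J \<subseteq> span B'"
    by (rule basis_exists[of J]) (rule that, assumption+)
  have "B' \<subseteq> span B" using B'(1) B(2) J_Hh by blast
  then have "finite B'" using independent_span_bound[OF B(1) B'(2)] by blast
  moreover have "J = span B'" using B' span_minimal[OF B'(1) subspace_J] by blast
  ultimately show ?thesis by (rule that)
qed

lemma semi_inner_Hh: "semi_inner Hh (L2_inner \<Omega>)"
proof (rule semi_inner.intro)
  note L = vHm_L2[OF vH10_vHm[OF Hh_H10]]
  show "subspace Hh" by (rule subspace_Hh)
  fix x y z and k :: real assume x: "x \<in> Hh"
  show "0 \<le> L2_inner \<Omega> x x" by (rule L2.nonneg[OF L[OF x]])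
  assume z: "z \<in> Hh"
  show "L2_inner \<Omega> (k *\<^sub>R x) z = k * L2_inner \<Omega> x z" by (rule L2.scale_left[OF L[OF x] L[OF z]])
  show "L2_inner \<Omega> x z = L2_inner \<Omega> z x" by (rule L2.commute[OF L[OF x] L[OF z]])
  assume y: "y \<in> Hh"
  show "L2_inner \<Omega> (x + y) z = L2_inner \<Omega> x z + L2_inner \<Omega> y z" by (rule L2.add_left[OF L[OF x] L[OF y] L[OF z]])
qed

lemma L2_proj_spec:
  assumes "u \<in> L2 \<Omega>"
  shows "L2_proj \<Omega> J u \<in> J" "\<And>\<phi>. \<phi> \<in> J \<Longrightarrow> L2_inner \<Omega> (L2_proj \<Omega> J u) \<phi> = L2_inner \<Omega> u \<phi>"
proof -
  obtain B where B: "finite B" "J = span B" by (rule J_span)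
  have BL: "B \<subseteq> L2 \<Omega>" using B(2) J_L2 span_superset by blast
  have "\<exists>w\<in>span B. \<forall>v\<in>span B. L2_inner \<Omega> w v = L2_inner \<Omega> u v"
  proof (rule L2.riesz_span[OF B(1) BL])
    fix x :: vector_field assume "x \<in> L2 \<Omega>" "L2_inner \<Omega> x x = 0"
    then show "L2_inner \<Omega> u x = 0" using L2.cauchy_schwarz_sq[OF assms, of x] by simp
  qed (use assms in \<open>auto simp: L2.linear_simps\<close>)
  then have "\<exists>w. w \<in> J \<and> (\<forall>\<phi>\<in>J. L2_inner \<Omega> w \<phi> = L2_inner \<Omega> u \<phi>)" using B(2) by blast
  from someI_ex[OF this] show "L2_proj \<Omega> J u \<in> J" "\<And>\<phi>. \<phi> \<in> J \<Longrightarrow> L2_inner \<Omega> (L2_proj \<Omega> J u) \<phi> = L2_inner \<Omega> u \<phi>"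
    unfolding L2_proj_def by auto
qed

lemma disc_laplacian_spec:
  assumes "v \<in> Hh"
  shows "disc_laplacian \<Omega> Hh v \<in> Hh" "\<And>\<phi>. \<phi> \<in> Hh \<Longrightarrow> L2_inner \<Omega> (disc_laplacian \<Omega> Hh v) \<phi> = - a_form \<Omega> v \<phi>"
proof -
  obtain B where B: "finite B" "Hh = span B" using fin by blast
  note v = vH10_vHm[OF Hh_H10[OF assms]]
  have "\<exists>w\<in>span B. \<forall>\<phi>\<in>span B. L2_inner \<Omega> w \<phi> = - a_form \<Omega> v \<phi>"
  proof (rule semi_inner.riesz_span[OF semi_inner_Hh B(1)])
    show "B \<subseteq> Hh" using B(2) span_superset by blast
    fix x y assume x: "x \<in> Hh"
    note x1 = vH10_vHm[OF Hh_H10[OF x]]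
    show "- a_form \<Omega> v (k *\<^sub>R x) = k * - a_form \<Omega> v x" for k using A.scale_right[OF x1 v, of k] by simp
    show "- a_form \<Omega> v x = 0" if "L2_inner \<Omega> x x = 0"
    proof -
      have "h * gn x \<le> 0" using inverse_ineq[OF x] that by (simp add: L2_norm_def)
      then have "gn x = 0" using h0 gn_nonneg[of x] by (simp add: mult_le_0_iff)
      then show ?thesis using a_cauchy_schwarz[OF v x1] by simp
    qed
    assume y: "y \<in> Hh"
    show "- a_form \<Omega> v (x + y) = - a_form \<Omega> v x + - a_form \<Omega> v y"
      using A.add_right[OF x1 vH10_vHm[OF Hh_H10[OF y]] v] by simp
  qed
  then have "\<exists>w. w \<in> Hh \<and> (\<forall>\<phi>\<in>Hh. a_form \<Omega> v \<phi> = L2_inner \<Omega> (\<lambda>x. - w x) \<phi>)"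
    using B(2) by (auto simp: L2_inner_def)
  from someI_ex[OF this] show "disc_laplacian \<Omega> Hh v \<in> Hh"
    "\<And>\<phi>. \<phi> \<in> Hh \<Longrightarrow> L2_inner \<Omega> (disc_laplacian \<Omega> Hh v) \<phi> = - a_form \<Omega> v \<phi>"
    unfolding disc_laplacian_def by (auto simp: L2_inner_def)
qed

text \<open>
  The discrete Stokes operator \<open>- \<Delta>\<^sub>h\<close> on \<open>J\<close>, with the sign that makes it positive.
\<close>

definition St :: "vector_field \<Rightarrow> vector_field" where "St v = - disc_stokes_laplacian \<Omega> Hh Lh v"

lemma St_mem: "v \<in> J \<Longrightarrow> St v \<in> J"
  unfolding St_def disc_stokes_laplacian_def
  by (intro J_mem L2_proj_spec vHm_L2[OF vH10_vHm[OF Hh_H10]] disc_laplacian_spec J_Hh)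

lemma St_inner:
  assumes "v \<in> J" "\<phi> \<in> J"
  shows "L2_inner \<Omega> (St v) \<phi> = a_form \<Omega> v \<phi>"
proof -
  have D: "disc_laplacian \<Omega> Hh v \<in> L2 \<Omega>"
    by (rule vHm_L2[OF vH10_vHm[OF Hh_H10[OF disc_laplacian_spec(1)[OF J_Hh[OF assms(1)]]]]])
  show ?thesis
    unfolding St_def disc_stokes_laplacian_def
    using L2.minus_left[OF J_L2[OF L2_proj_spec(1)[OF D]] J_L2[OF assms(2)]] L2_proj_spec(2)[OF D assms(2)]
      disc_laplacian_spec(2)[OF J_Hh[OF assms(1)] J_Hh[OF assms(2)]] by simp
qed

lemma St_norm: "L2_norm \<Omega> (St v) = L2_norm \<Omega> (disc_stokes_laplacian \<Omega> Hh Lh v)"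
  by (simp add: St_def L2_norm_def L2_inner_def)

lemma St_norm_eqI:
  assumes "v \<in> J" "g \<in> J" "\<And>\<phi>. \<phi> \<in> J \<Longrightarrow> L2_inner \<Omega> g \<phi> = a_form \<Omega> v \<phi>"
  shows "L2_norm \<Omega> (St v) = L2_norm \<Omega> g"
proof -
  note S = St_mem[OF assms(1)]
  have "L2_inner \<Omega> (St v) (St v) = L2_inner \<Omega> g (St v)" using St_inner[OF assms(1) S] assms(3)[OF S] by simp
  also have "\<dots> = L2_inner \<Omega> (St v) g" by (rule L2.commute[OF J_L2[OF assms(2)] J_L2[OF S]])
  also have "\<dots> = L2_inner \<Omega> g g" using St_inner[OF assms(1,2)] assms(3)[OF assms(2)] by simp
  finally show ?thesis by (simp add: L2_norm_def)
qed

text \<open>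
  Against a divergence that is orthogonal to \<open>Lh\<close>, the pressure may be corrected by an element of
  \<open>Lh\<close> and, the boundary values being zero, by a constant. What remains is of order \<open>h\<close>.
\<close>

lemma pressure_approx:
  assumes "q \<in> Hm 1 \<Omega>" "H1_quot_norm \<Omega> q \<le> c * G" 
  obtains \<rho> where "\<rho> \<in> L2 \<Omega>" "L2_norm \<Omega> \<rho> \<le> c\<^sup>2 * h * G"
    "\<And>v. v \<in> vH10 \<Omega> \<Longrightarrow> (\<And>k. k \<in> Lh \<Longrightarrow> L2_inner \<Omega> k (diverg \<Omega> v) = 0) \<Longrightarrow>
       L2_inner \<Omega> q (diverg \<Omega> v) = L2_inner \<Omega> \<rho> (diverg \<Omega> v)"
proof -
  obtain qh where qh: "qh \<in> Lh" "L2_quot_norm \<Omega> (q - qh) \<le> c * h * H1_quot_norm \<Omega> q" using approx[OF assms(1)] by blast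
  have qL: "q \<in> L2 \<Omega>" "qh \<in> L2 \<Omega>" using Hm_L2[OF assms(1)] qh(1) Lh_sub by auto
  obtain k where k: "L2_norm \<Omega> (q - qh - (\<lambda>x. k)) \<le> L2_quot_norm \<Omega> (q - qh)"
    using L2_quot_attained[OF L2.mem(3)[OF qL]] by blast
  show ?thesis
  proof (rule that)
    show L: "q - qh - (\<lambda>x. k) \<in> L2 \<Omega>" by (intro L2.mem qL const_L2)
    have "c * h * H1_quot_norm \<Omega> q \<le> c * h * (c * G)" using assms(2) c1 h0 by (intro mult_left_mono) auto
    then show "L2_norm \<Omega> (q - qh - (\<lambda>x. k)) \<le> c\<^sup>2 * h * G"
      using k qh(2) by (simp add: power2_eq_square mult_ac)
    fix v assume v: "v \<in> vH10 \<Omega>" "\<And>k. k \<in> Lh \<Longrightarrow> L2_inner \<Omega> k (diverg \<Omega> v) = 0"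
    have "L2_inner \<Omega> (q - qh - (\<lambda>x. k)) (diverg \<Omega> v)
        = L2_inner \<Omega> q (diverg \<Omega> v) - L2_inner \<Omega> qh (diverg \<Omega> v) - L2_inner \<Omega> (\<lambda>x. k) (diverg \<Omega> v)"
      using L2.diff_left[OF L2.mem(3)[OF qL] const_L2 diverg_L2[OF vH10_vHm[OF v(1)]], of k]
        L2.diff_left[OF qL diverg_L2[OF vH10_vHm[OF v(1)]]] by simp
    then show "L2_inner \<Omega> q (diverg \<Omega> v) = L2_inner \<Omega> (q - qh - (\<lambda>x. k)) (diverg \<Omega> v)"
      using v(2)[OF qh(1)] integral_diverg[OF v(1), of k] by simp
  qed
qed

lemma J1_diverg: 
  assumes "w \<in> J1 \<Omega>" "q \<in> L2 \<Omega>"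
  shows "L2_inner \<Omega> q (diverg \<Omega> w) = 0"
proof -
  have w: "w \<in> vHm 1 \<Omega>" and ae: "ae_eq \<Omega> (diverg \<Omega> w) 0"
    using assms(1) vH10_vHm by (auto simp: J1_def zero_fun_def)
  have "L2_inner \<Omega> q (diverg \<Omega> w) = L2_inner \<Omega> q 0"
    by (rule L2_inner_cong[OF assms(2,2) diverg_L2[OF w] L2.mem(4) ae_eq_refl ae])
  then show ?thesis by (simp add: L2_inner_def)
qed

text \<open>
  The argument of Aubin and Nitsche: the error \<open>e\<close> is tested against the Stokes solution with
  right-hand side \<open>e\<close>, whose \<open>H\<^sup>2\<close> norm is at most \<open>c \<parallel>e\<parallel>\<close> and which is therefore approximable in
  \<open>J\<close> to order \<open>h\<close>. Here \<open>\<rho>\<close> is the pressure part of the residual.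
\<close>

lemma duality:
  assumes e: "e \<in> vH10 \<Omega>" "\<And>k. k \<in> Lh \<Longrightarrow> L2_inner \<Omega> k (diverg \<Omega> e) = 0"
    and \<rho>: "\<rho> \<in> L2 \<Omega>" "\<And>\<phi>. \<phi> \<in> J \<Longrightarrow> a_form \<Omega> e \<phi> = L2_inner \<Omega> \<rho> (diverg \<Omega> \<phi>)"
  shows "L2_norm \<Omega> e \<le> c\<^sup>2 * h * (3 * gn e + 2 * L2_norm \<Omega> \<rho>)"
proof (cases "L2_norm \<Omega> e = 0")
  case False
  note e1 = vH10_vHm[OF e(1)] and eL = vHm_L2[OF vH10_vHm[OF e(1)]]
  define E where "E = L2_norm \<Omega> e"
  obtain v q where vq: "stokes_solution \<Omega> e v q" "v \<in> vHm 2 \<Omega>" "q \<in> Hm 1 \<Omega>"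
    "vHm_norm 2 \<Omega> v \<le> c * E" "H1_quot_norm \<Omega> q \<le> c * E"
    using regular[OF eL] unfolding E_def by blast
  have v: "v \<in> J1 \<Omega>" and eq: "a_form \<Omega> v e - L2_inner \<Omega> q (diverg \<Omega> e) = L2_inner \<Omega> e e"
    using vq(1) e(1) by (auto simp: stokes_solution_def)
  have v1: "v \<in> vHm 1 \<Omega>" using v vH10_vHm by (auto simp: J1_def)
  obtain r where r: "r \<in> J" "gn (v - r) \<le> c * h * vHm_norm 2 \<Omega> v" using sol_approx[OF v vq(2)] by blast
  have "c * h * vHm_norm 2 \<Omega> v \<le> c * h * (c * E)" using vq(4) c1 h0 by (intro mult_left_mono) auto
  then have gr: "gn (v - r) \<le> c\<^sup>2 * h * E" using r(2) by (simp add: power2_eq_square mult_ac)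
  have vr1: "v - r \<in> vHm 1 \<Omega>" by (rule A.mem(3)[OF v1 J_H1[OF r(1)]])
  obtain \<sigma> where \<sigma>: "\<sigma> \<in> L2 \<Omega>" "L2_norm \<Omega> \<sigma> \<le> c\<^sup>2 * h * E" "L2_inner \<Omega> q (diverg \<Omega> e) = L2_inner \<Omega> \<sigma> (diverg \<Omega> e)"
    using pressure_approx[OF vq(3,5)] e by metis
  have t1: "\<bar>L2_inner \<Omega> q (diverg \<Omega> e)\<bar> \<le> (c\<^sup>2 * h * E) * (2 * gn e)"
    unfolding \<sigma>(3)
    by (rule order_trans[OF L2_cauchy_schwarz[OF \<sigma>(1) diverg_L2[OF e1]]])
      (intro mult_mono \<sigma>(2) diverg_norm_le e1, use \<sigma>(2) order_trans[OF L2_norm_nonneg \<sigma>(2)] in auto)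
  have t2: "\<bar>a_form \<Omega> (v - r) e\<bar> \<le> (c\<^sup>2 * h * E) * gn e"
    by (rule order_trans[OF a_cauchy_schwarz[OF vr1 e1]]) (intro mult_right_mono gr, simp)
  have "a_form \<Omega> r e = L2_inner \<Omega> \<rho> (diverg \<Omega> r)"
    using \<rho>(2)[OF r(1)] A.commute[OF J_H1[OF r(1)] e1] by simp
  also have "\<dots> = - L2_inner \<Omega> \<rho> (diverg \<Omega> (v - r))"
    using L2_diverg_diff[OF \<rho>(1) v1 J_H1[OF r(1)]] J1_diverg[OF v \<rho>(1)] by simp
  finally have t3: "\<bar>a_form \<Omega> r e\<bar> \<le> L2_norm \<Omega> \<rho> * (2 * (c\<^sup>2 * h * E))"
    using order_trans[OF L2_cauchy_schwarz[OF \<rho>(1) diverg_L2[OF vr1]]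
        mult_left_mono[OF order_trans[OF diverg_norm_le[OF vr1] mult_left_mono[OF gr]] L2_norm_nonneg]] by simp
  have "a_form \<Omega> v e = a_form \<Omega> (v - r) e + a_form \<Omega> r e"
    using A.diff_left[OF v1 J_H1[OF r(1)] e1] by simp
  then have "E\<^sup>2 \<le> (c\<^sup>2 * h * E) * gn e + L2_norm \<Omega> \<rho> * (2 * (c\<^sup>2 * h * E)) + (c\<^sup>2 * h * E) * (2 * gn e)"
    using eq t1 t2 t3 L2_norm_sq[OF eL] unfolding E_def by linarith
  then have "E * E \<le> E * (c\<^sup>2 * h * (3 * gn e + 2 * L2_norm \<Omega> \<rho>))"
    by (simp add: power2_eq_square algebra_simps)
  then show ?thesis using False L2_norm_nonneg[of \<Omega> e] unfolding E_def by simp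
qed (use c1 h0 in simp)

text \<open>
  The Dirichlet projection \<open>s\<close> of \<open>u\<^sub>0\<close> is stable in \<open>H\<^sup>1\<close> by definition and, by duality, of
  distance \<open>O(h)\<close> from \<open>u\<^sub>0\<close> in \<open>L\<^sup>2\<close>. Hence \<open>U - s\<close> is of order \<open>h\<close> in \<open>L\<^sup>2\<close>, and the inverse
  inequality turns this into a bound for its gradient.
\<close>

lemma proj_H1_stable:
  assumes "u\<^sub>0 \<in> J1 \<Omega>" "U \<in> J" "\<And>\<phi>. \<phi> \<in> J \<Longrightarrow> L2_inner \<Omega> U \<phi> = L2_inner \<Omega> u\<^sub>0 \<phi>"
  shows "L2_norm \<Omega> U \<le> L2_norm \<Omega> u\<^sub>0" "gn U \<le> 7 * c ^ 3 * gn u\<^sub>0"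
proof -
  have uH: "u\<^sub>0 \<in> vH10 \<Omega>" using assms(1) by (simp add: J1_def)
  note u1 = vH10_vHm[OF uH] and uL = vHm_L2[OF vH10_vHm[OF uH]]
  have abs_le: "L2_norm \<Omega> x \<le> L2_norm \<Omega> y" if "x \<in> L2 \<Omega>" "y \<in> L2 \<Omega>" "L2_inner \<Omega> x x = L2_inner \<Omega> y x" for x y :: vector_field
  proof (cases "L2_norm \<Omega> x = 0")
    case False
    have "L2_norm \<Omega> x * L2_norm \<Omega> x \<le> L2_norm \<Omega> y * L2_norm \<Omega> x"
      using L2_cauchy_schwarz[OF that(2,1)] L2_norm_sq[OF that(1)] that(3) by (simp add: power2_eq_square)
    then show ?thesis using False L2_norm_nonneg[of \<Omega> x] by simp
  qed simp
  show "L2_norm \<Omega> U \<le> L2_norm \<Omega> u\<^sub>0"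
    by (rule abs_le[OF J_L2[OF assms(2)] uL assms(3)[OF assms(2)]])
  obtain B where B: "finite B" "J = span B" by (rule J_span)
  have BL: "B \<subseteq> vHm 1 \<Omega>" using B(2) J_H1 span_superset by blast
  have "\<exists>w\<in>span B. \<forall>v\<in>span B. a_form \<Omega> w v = a_form \<Omega> u\<^sub>0 v"
  proof (rule A.riesz_span[OF B(1) BL])
    fix x assume "x \<in> vHm 1 \<Omega>" "a_form \<Omega> x x = 0"
    then show "a_form \<Omega> u\<^sub>0 x = 0" using A.cauchy_schwarz_sq[OF u1, of x] by simp
  qed (use u1 in \<open>auto simp: A.linear_simps\<close>)
  then obtain s where s: "s \<in> J" "\<And>\<phi>. \<phi> \<in> J \<Longrightarrow> a_form \<Omega> s \<phi> = a_form \<Omega> u\<^sub>0 \<phi>" using B(2) by blast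
  have s1: "s \<in> vHm 1 \<Omega>" and sL: "s \<in> L2 \<Omega>" using s(1) by (auto intro: J_H1 J_L2)
  have gs: "gn s \<le> gn u\<^sub>0"
  proof (cases "gn s = 0")
    case False
    have "gn s * gn s \<le> gn u\<^sub>0 * gn s"
      using a_cauchy_schwarz[OF u1 s1] gn_sq[OF s1] s(2)[OF s(1)] by (simp add: power2_eq_square)
    then show ?thesis using False gn_nonneg[of s] by simp
  qed simp
  define e where "e = u\<^sub>0 - s"
  have eH: "e \<in> vH10 \<Omega>" unfolding e_def by (rule subspace_diff[OF subspace_vH10 uH J_H10[OF s(1)]])
  have "L2_norm \<Omega> e \<le> c\<^sup>2 * h * (3 * gn e + 2 * L2_norm \<Omega> (0 :: scalar_field))"
  proof (rule duality[OF eH])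
    fix k assume k: "k \<in> Lh"
    then have kL: "k \<in> L2 \<Omega>" using Lh_sub by blast
    show "L2_inner \<Omega> k (diverg \<Omega> e) = 0"
      unfolding e_def L2_diverg_diff[OF kL u1 s1] using J1_diverg[OF assms(1) kL] J_diverg[OF s(1) k] by simp
  next
    show "0 \<in> L2 \<Omega>" by (rule L2.mem)
    fix \<phi> assume \<phi>: "\<phi> \<in> J"
    show "a_form \<Omega> e \<phi> = L2_inner \<Omega> 0 (diverg \<Omega> \<phi>)"
      unfolding e_def A.diff_left[OF u1 s1 J_H1[OF \<phi>]] using s(2)[OF \<phi>] by (simp add: L2_inner_def)
  qed
  also have "L2_norm \<Omega> (0 :: scalar_field) = 0" by (simp add: L2_norm_def L2_inner_def)
  also have "gn e \<le> gn u\<^sub>0 + gn u\<^sub>0" unfolding e_def using gn_triangle_diff[OF u1 s1] gs by simp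
  finally have eb: "L2_norm \<Omega> e \<le> c\<^sup>2 * h * (6 * gn u\<^sub>0)" using c1 h0 by (simp add: mult_left_mono)
  have UsJ: "U - s \<in> J" by (rule J_mem(3)[OF assms(2) s(1)])
  have "L2_norm \<Omega> (U - s) \<le> L2_norm \<Omega> e"
  proof (rule abs_le[OF J_L2[OF UsJ] vHm_L2[OF vH10_vHm[OF eH]]])
    show "L2_inner \<Omega> (U - s) (U - s) = L2_inner \<Omega> e (U - s)"
      unfolding e_def L2.diff_left[OF uL sL J_L2[OF UsJ]] L2.diff_left[OF J_L2[OF assms(2)] sL J_L2[OF UsJ]]
      using assms(3)[OF UsJ] by simp
  qed
  then have "h * gn (U - s) \<le> c * (c\<^sup>2 * h * (6 * gn u\<^sub>0))"
    using inverse_ineq[OF J_Hh[OF UsJ]] eb c1 mult_left_mono[of "L2_norm \<Omega> (U - s)" "c\<^sup>2 * h * (6 * gn u\<^sub>0)" c] by linarith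
  then have "h * gn (U - s) \<le> h * (6 * c ^ 3 * gn u\<^sub>0)"
    by (simp add: power3_eq_cube power2_eq_square mult_ac)
  then have gUs: "gn (U - s) \<le> 6 * c ^ 3 * gn u\<^sub>0" using h0 by simp
  have "gn U \<le> gn (U - s) + gn s" using gn_triangle[OF J_H1[OF UsJ] s1] by simp
  also have "\<dots> \<le> 6 * c ^ 3 * gn u\<^sub>0 + c ^ 3 * gn u\<^sub>0"
    using gUs gs mult_right_mono[OF one_le_power[OF c1, of 3], of "gn u\<^sub>0"] by (intro add_mono) simp_all
  finally show "gn U \<le> 7 * c ^ 3 * gn u\<^sub>0" by linarith
qed

end

section \<open>The discrete convective term\<close>

text \<open>
  The scalar part of the estimate of the convective term, to be read with \<open>n = \<parallel>u\<parallel>\<close>, \<open>a = \<parallel>\<nabla>u\<parallel>\<close>,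
  \<open>s = \<parallel>St u\<parallel>\<close>, \<open>f = \<parallel>\<phi>\<parallel>\<close>, \<open>g = \<parallel>\<nabla>\<phi>\<parallel>\<close> and with \<open>ge\<close>, \<open>ne\<close> the norms of \<open>\<nabla>e\<close> and \<open>e\<close> for the
  difference \<open>e\<close> between \<open>u\<close> and a smooth comparison field. The powers of \<open>h\<close> in \<open>ge\<close> and \<open>ne\<close> pay
  for the inverse inequalities, and everything is reduced to \<open>q = n\<^sup>3\<^sup>/\<^sup>4 s\<^sup>3\<^sup>/\<^sup>4 a\<^sup>1\<^sup>/\<^sup>2\<close>.
\<close>

lemma nonlinear_arith:
  fixes c R a n s f :: real
  assumes c: "1 \<le> c" and nn: "0 \<le> R" "0 \<le> a" "0 \<le> n" "0 \<le> s" "0 \<le> f" "0 < h" "0 \<le> g" "0 \<le> ge" "0 \<le> ne"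
    and R: "R\<^sup>2 = n * s" and aR: "a \<le> R" and hs: "h * s \<le> c * a" and ha: "h * a \<le> c * n" and hg: "h * g \<le> c * f"
    and ge: "ge \<le> 4 * c\<^sup>2 * (h * s)" and ne: "ne \<le> 14 * c ^ 4 * (h\<^sup>2 * s)"
  defines "q \<equiv> sqrt (R ^ 3 * a)"
  shows "X\<^sup>2 \<le> 4 * (9 * c ^ 4 * R)\<^sup>2 * a\<^sup>2 + 4 * (9 * c ^ 4 * R) * (c * s) * (n * a) \<Longrightarrow> X \<le> 19 * c ^ 4 * q"
    "9 * c ^ 4 * R * a \<le> 9 * c ^ 4 * q"
    "ge * sqrt (n * a) * sqrt (f * g) \<le> 4 * c ^ 3 * q * f"
    "a * sqrt (ne * ge) * sqrt (f * g) \<le> 8 * c ^ 5 * q * f"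
proof -
  have q0: "0 \<le> q" unfolding q_def using nn by simp
  have q2: "q\<^sup>2 = R ^ 3 * a" unfolding q_def using nn by simp
  have RRaa: "R\<^sup>2 * a\<^sup>2 \<le> q\<^sup>2"
  proof -
    have "R\<^sup>2 * a\<^sup>2 = (R\<^sup>2 * a) * a" by (simp add: power2_eq_square mult_ac)
    also have "\<dots> \<le> (R\<^sup>2 * a) * R" by (rule mult_left_mono[OF aR]) (use nn in simp)
    also have "\<dots> = q\<^sup>2" unfolding q2 by (simp add: power2_eq_square power3_eq_cube mult_ac)
    finally show ?thesis .
  qed
  have cp: "1 \<le> c ^ k" for k by (rule one_le_power[OF c])
  {
    assume X: "X\<^sup>2 \<le> 4 * (9 * c ^ 4 * R)\<^sup>2 * a\<^sup>2 + 4 * (9 * c ^ 4 * R) * (c * s) * (n * a)"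
    have "4 * (9 * c ^ 4 * R)\<^sup>2 * a\<^sup>2 = 324 * c ^ 8 * (R\<^sup>2 * a\<^sup>2)" by (simp add: power_mult_distrib flip: power_mult)
    also have "\<dots> \<le> 324 * c ^ 8 * q\<^sup>2" by (rule mult_left_mono[OF RRaa]) (use c in simp)
    finally have 1: "4 * (9 * c ^ 4 * R)\<^sup>2 * a\<^sup>2 \<le> 324 * c ^ 8 * q\<^sup>2" .
    have "4 * (9 * c ^ 4 * R) * (c * s) * (n * a) = 36 * c ^ 5 * (R * (n * s) * a)"
      by (simp add: power_numeral_reduce)
    also have "\<dots> = 36 * c ^ 5 * q\<^sup>2"
      unfolding R[symmetric] q2 by (simp add: power2_eq_square power3_eq_cube mult_ac)
    also have "\<dots> \<le> 36 * c ^ 8 * q\<^sup>2"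
      by (intro mult_right_mono mult_left_mono power_increasing c) auto
    finally have "X\<^sup>2 \<le> 360 * c ^ 8 * q\<^sup>2" using X 1 by linarith
    also have "\<dots> \<le> 361 * c ^ 8 * q\<^sup>2" by (intro mult_right_mono) (use c in auto)
    also have "\<dots> = (19 * c ^ 4 * q)\<^sup>2" by (simp add: power_mult_distrib flip: power_mult)
    finally have "X\<^sup>2 \<le> (19 * c ^ 4 * q)\<^sup>2" .
    then show "X \<le> 19 * c ^ 4 * q" by (rule power2_le_imp_le) (use q0 c in simp)
  }
  have Raq: "R * a \<le> q" by (rule power2_le_imp_le) (use RRaa q0 in \<open>simp_all add: power_mult_distrib\<close>)
  have "9 * c ^ 4 * (R * a) \<le> 9 * c ^ 4 * q" by (rule mult_left_mono[OF Raq]) (use c in simp)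
  then show "9 * c ^ 4 * R * a \<le> 9 * c ^ 4 * q" by (simp add: mult_ac)
  have ge2: "ge\<^sup>2 \<le> 16 * c ^ 4 * (h * s)\<^sup>2"
    using power_mono[OF ge nn(8), of 2] by (simp add: power_mult_distrib flip: power_mult)
  have hsa: "(h * s) * (h * g) \<le> (c * a) * (c * f)"
    by (rule mult_mono[OF hs hg]) (use nn c in auto)
  show "ge * sqrt (n * a) * sqrt (f * g) \<le> 4 * c ^ 3 * q * f"
  proof (rule power2_le_imp_le)
    have "(ge * sqrt (n * a) * sqrt (f * g))\<^sup>2 = ge\<^sup>2 * ((n * a) * (f * g))"
      using nn by (simp add: power_mult_distrib)
    also have "\<dots> \<le> (16 * c ^ 4 * (h * s)\<^sup>2) * ((n * a) * (f * g))"
      by (rule mult_right_mono[OF ge2]) (use nn in auto)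
    also have "\<dots> = 16 * c ^ 4 * (s * n * a * f) * ((h * s) * (h * g))"
      by (simp add: power2_eq_square mult_ac)
    also have "\<dots> \<le> 16 * c ^ 4 * (s * n * a * f) * ((c * a) * (c * f))"
      by (rule mult_left_mono[OF hsa]) (use nn c in auto)
    also have "\<dots> = 16 * c ^ 6 * f\<^sup>2 * ((n * s) * a\<^sup>2)"
      by (simp add: power2_eq_square power_numeral_reduce)
    also have "\<dots> \<le> 16 * c ^ 6 * f\<^sup>2 * q\<^sup>2"
      unfolding R[symmetric] by (rule mult_left_mono[OF RRaa]) (use c in simp)
    also have "\<dots> = (4 * c ^ 3 * q * f)\<^sup>2" by (simp add: power_mult_distrib flip: power_mult)
    finally show "(ge * sqrt (n * a) * sqrt (f * g))\<^sup>2 \<le> (4 * c ^ 3 * q * f)\<^sup>2" .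
  qed (use q0 c nn in simp)
  have nege: "ne * ge \<le> (14 * c ^ 4 * (h\<^sup>2 * s)) * (4 * c\<^sup>2 * (h * s))"
    by (rule mult_mono[OF ne ge]) (use nn c in auto)
  have hhs: "h * (h * s) \<le> c\<^sup>2 * n"
  proof -
    have "h * (h * s) \<le> h * (c * a)" by (rule mult_left_mono[OF hs]) (use nn in simp)
    also have "\<dots> = c * (h * a)" by simp
    also have "\<dots> \<le> c * (c * n)" by (rule mult_left_mono[OF ha]) (use c in simp)
    finally show ?thesis by (simp add: power2_eq_square mult_ac)
  qed
  show "a * sqrt (ne * ge) * sqrt (f * g) \<le> 8 * c ^ 5 * q * f"
  proof (rule power2_le_imp_le)
    have "(a * sqrt (ne * ge) * sqrt (f * g))\<^sup>2 = (ne * ge) * (a\<^sup>2 * (f * g))"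
      using nn by (simp add: power_mult_distrib)
    also have "\<dots> \<le> ((14 * c ^ 4 * (h\<^sup>2 * s)) * (4 * c\<^sup>2 * (h * s))) * (a\<^sup>2 * (f * g))"
      by (rule mult_right_mono[OF nege]) (use nn in auto)
    also have "\<dots> = 56 * c ^ 6 * (s * a\<^sup>2 * f) * ((h * (h * s)) * (h * g))"
      by (simp add: power2_eq_square power_numeral_reduce)
    also have "\<dots> \<le> 56 * c ^ 6 * (s * a\<^sup>2 * f) * ((c\<^sup>2 * n) * (c * f))"
      by (intro mult_left_mono mult_mono hhs hg) (use nn c in auto)
    also have "\<dots> = 56 * c ^ 9 * f\<^sup>2 * ((n * s) * a\<^sup>2)"
      by (simp add: power2_eq_square power_numeral_reduce)
    also have "\<dots> \<le> 56 * c ^ 9 * f\<^sup>2 * q\<^sup>2"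
      unfolding R[symmetric] by (rule mult_left_mono[OF RRaa]) (use c in simp)
    also have "\<dots> \<le> 64 * c ^ 10 * f\<^sup>2 * q\<^sup>2"
      by (intro mult_right_mono mult_mono power_increasing c) (use c in auto)
    also have "\<dots> = (8 * c ^ 5 * q * f)\<^sup>2" by (simp add: power_mult_distrib flip: power_mult)
    finally show "(a * sqrt (ne * ge) * sqrt (f * g))\<^sup>2 \<le> (8 * c ^ 5 * q * f)\<^sup>2" .
  qed (use q0 c nn in simp)
qed

context fem
begin

lemma discrete_basic:
  assumes u: "u \<in> J"
  shows "h * L2_norm \<Omega> (St u) \<le> c * gn u" "h * gn u \<le> c * L2_norm \<Omega> u"
    "(gn u)\<^sup>2 \<le> L2_norm \<Omega> u * L2_norm \<Omega> (St u)"
proof -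
  define s where "s = L2_norm \<Omega> (St u)"
  note S = St_mem[OF u]
  show "h * gn u \<le> c * L2_norm \<Omega> u" by (rule inverse_ineq[OF J_Hh[OF u]])
  have "s\<^sup>2 = a_form \<Omega> u (St u)" unfolding s_def using L2_norm_sq[OF J_L2[OF S]] St_inner[OF u S] by simp
  also have "\<dots> \<le> gn u * gn (St u)" using a_cauchy_schwarz[OF J_H1[OF u] J_H1[OF S]] by simp
  finally have "h * s\<^sup>2 \<le> gn u * (h * gn (St u))" using h0 by (simp add: mult_ac mult_left_mono)
  also have "\<dots> \<le> gn u * (c * s)" unfolding s_def by (intro mult_left_mono inverse_ineq J_Hh S) simp
  finally have "s * (h * s) \<le> s * (c * gn u)" by (simp add: power2_eq_square mult_ac)
  then show "h * L2_norm \<Omega> (St u) \<le> c * gn u"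
    using c1 unfolding s_def[symmetric] by (cases "s = 0") (auto simp: s_def mult_le_cancel_left order_less_le)
  show "(gn u)\<^sup>2 \<le> L2_norm \<Omega> u * L2_norm \<Omega> (St u)"
    using gn_sq[OF J_H1[OF u]] St_inner[OF u u] L2_cauchy_schwarz[OF J_L2[OF S] J_L2[OF u]] by (simp add: mult.commute)
qed

text \<open>
  The Stokes problem with right-hand side \<open>St u\<close> has \<open>u\<close> as its finite element solution. Its exact
  solution \<open>w\<close> lies in \<open>H\<^sup>2\<close> and differs from \<open>u\<close> by the usual finite element errors.
\<close>

lemma stokes_comparison:
  assumes u: "u \<in> J"
  obtains w where "w \<in> vH10 \<Omega>" "w \<in> vHm 2 \<Omega>" "vHm_norm 2 \<Omega> w \<le> c * L2_norm \<Omega> (St u)"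
    "gn (u - w) \<le> 4 * c\<^sup>2 * (h * L2_norm \<Omega> (St u))"
    "L2_norm \<Omega> (u - w) \<le> 14 * c ^ 4 * (h\<^sup>2 * L2_norm \<Omega> (St u))"
proof -
  define s where "s = L2_norm \<Omega> (St u)"
  note u1 = J_H1[OF u]
  obtain w q where wq: "stokes_solution \<Omega> (St u) w q" "w \<in> vHm 2 \<Omega>" "q \<in> Hm 1 \<Omega>"
    "vHm_norm 2 \<Omega> w \<le> c * s" "H1_quot_norm \<Omega> q \<le> c * s"
    using regular[OF J_L2[OF St_mem[OF u]]] unfolding s_def by blast
  have w: "w \<in> J1 \<Omega>" and weq: "\<And>\<phi>. \<phi> \<in> vH10 \<Omega> \<Longrightarrow> a_form \<Omega> w \<phi> - L2_inner \<Omega> q (diverg \<Omega> \<phi>) = L2_inner \<Omega> (St u) \<phi>"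
    using wq(1) by (auto simp: stokes_solution_def)
  have wH: "w \<in> vH10 \<Omega>" using w by (simp add: J1_def)
  note w1 = vH10_vHm[OF wH]
  obtain \<sigma> where \<sigma>: "\<sigma> \<in> L2 \<Omega>" "L2_norm \<Omega> \<sigma> \<le> c\<^sup>2 * h * s"
    "\<And>v. v \<in> vH10 \<Omega> \<Longrightarrow> (\<And>k. k \<in> Lh \<Longrightarrow> L2_inner \<Omega> k (diverg \<Omega> v) = 0) \<Longrightarrow>
       L2_inner \<Omega> q (diverg \<Omega> v) = L2_inner \<Omega> \<sigma> (diverg \<Omega> v)"
    by (rule pressure_approx[OF wq(3,5)]) (rule that, assumption, assumption, blast)
  obtain r where r: "r \<in> J" "gn (w - r) \<le> c * h * vHm_norm 2 \<Omega> w" using sol_approx[OF w wq(2)] by blast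
  have "c * h * vHm_norm 2 \<Omega> w \<le> c * h * (c * s)" using wq(4) c1 h0 by (intro mult_left_mono) auto
  then have gr: "gn (w - r) \<le> c\<^sup>2 * h * s" using r(2) by (simp add: power2_eq_square mult_ac)
  define e where "e = u - w"
  define d where "d = c\<^sup>2 * h * s"
  have d0: "0 \<le> d" using c1 h0 by (simp add: d_def s_def)
  have eH: "e \<in> vH10 \<Omega>" unfolding e_def by (rule subspace_diff[OF subspace_vH10 J_H10[OF u] wH])
  note e1 = vH10_vHm[OF eH]
  define \<rho> where "\<rho> = (-1) *\<^sub>R \<sigma>"
  have \<rho>L: "\<rho> \<in> L2 \<Omega>" unfolding \<rho>_def by (rule L2.mem(2)[OF \<sigma>(1)])
  have \<rho>n: "L2_norm \<Omega> \<rho> \<le> d" unfolding \<rho>_def L2_norm_scale[OF \<sigma>(1)] using \<sigma>(2) by (simp add: d_def)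
  have ae: "a_form \<Omega> e \<phi> = L2_inner \<Omega> \<rho> (diverg \<Omega> \<phi>)" if \<phi>: "\<phi> \<in> J" for \<phi>
  proof -
    have "a_form \<Omega> e \<phi> = a_form \<Omega> u \<phi> - a_form \<Omega> w \<phi>" unfolding e_def by (rule A.diff_left[OF u1 w1 J_H1[OF \<phi>]])
    also have "\<dots> = - L2_inner \<Omega> q (diverg \<Omega> \<phi>)" using weq[OF J_H10[OF \<phi>]] St_inner[OF u \<phi>] by simp
    also have "\<dots> = L2_inner \<Omega> \<rho> (diverg \<Omega> \<phi>)"
      using \<sigma>(3)[OF J_H10[OF \<phi>] J_diverg[OF \<phi>]] unfolding \<rho>_def L2_inner_scale by simp
    finally show ?thesis .
  qed
  have urJ: "u - r \<in> J" by (rule J_mem(3)[OF u r(1)])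
  have wr1: "w - r \<in> vHm 1 \<Omega>" by (rule A.mem(3)[OF w1 J_H1[OF r(1)]])
  have "gn (u - r) \<le> gn e + d"
  proof -
    have "u - r = e + (w - r)" by (simp add: e_def)
    then show ?thesis using gn_triangle[OF e1 wr1] gr unfolding d_def by (simp only:)
  qed
  then have dv: "L2_norm \<Omega> (diverg \<Omega> (u - r)) \<le> 2 * (gn e + d)"
    using diverg_norm_le[OF J_H1[OF urJ]] by simp
  have "a_form \<Omega> e (u - r) \<le> L2_norm \<Omega> \<rho> * L2_norm \<Omega> (diverg \<Omega> (u - r))"
    unfolding ae[OF urJ] using L2_cauchy_schwarz[OF \<rho>L diverg_L2[OF J_H1[OF urJ]]] by simp
  also have "\<dots> \<le> d * (2 * (gn e + d))" by (rule mult_mono[OF \<rho>n dv d0 L2_norm_nonneg])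
  finally have 1: "a_form \<Omega> e (u - r) \<le> d * (2 * (gn e + d))" .
  have "a_form \<Omega> e (w - r) \<ge> - (gn e * gn (w - r))" using a_cauchy_schwarz[OF e1 wr1] by simp
  moreover have "gn e * gn (w - r) \<le> gn e * d" using gr by (intro mult_left_mono) (auto simp: d_def)
  ultimately have 2: "- a_form \<Omega> e (w - r) \<le> gn e * d" by simp
  have "e = (u - r) - (w - r)" by (simp add: e_def)
  then have "a_form \<Omega> e e = a_form \<Omega> e (u - r) - a_form \<Omega> e (w - r)"
    using A.diff_right[OF J_H1[OF urJ] wr1 e1] by simp
  then have "(gn e)\<^sup>2 \<le> 3 * d * gn e + 2 * d\<^sup>2"
    using 1 2 gn_sq[OF e1] by (simp add: power2_eq_square algebra_simps)
  then have ge: "gn e \<le> 4 * d" by (rule quadratic_bound[OF d0])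
  have "L2_norm \<Omega> e \<le> c\<^sup>2 * h * (3 * gn e + 2 * L2_norm \<Omega> \<rho>)"
  proof (rule duality[OF eH _ \<rho>L ae])
    fix k assume k: "k \<in> Lh"
    then have kL: "k \<in> L2 \<Omega>" using Lh_sub by blast
    show "L2_inner \<Omega> k (diverg \<Omega> e) = 0"
      unfolding e_def L2_diverg_diff[OF kL u1 w1] using J1_diverg[OF w kL] J_diverg[OF u k] by simp
  qed
  also have "\<dots> \<le> c\<^sup>2 * h * (14 * d)" using ge \<rho>n c1 h0 by (intro mult_left_mono) auto
  finally have "L2_norm \<Omega> e \<le> 14 * c ^ 4 * (h\<^sup>2 * s)" by (simp add: d_def power2_eq_square power_numeral_reduce mult_ac)
  then show ?thesis
    using that[OF wH wq(2)] wq(4) ge by (simp add: e_def d_def s_def mult_ac)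
qed

text \<open>
  The field \<open>u\<close> has no second derivatives, so the middle argument is split into the comparison
  field \<open>w\<close> of the previous lemma and the error \<open>e\<close>. For \<open>w\<close>, the pointwise bound and the bound of
  \<open>u \<partial>\<^sub>jw\<close> apply; for \<open>e\<close>, the smallness in \<open>h\<close> compensates the inverse inequality that replaces
  \<open>\<nabla>\<phi>\<close> by \<open>\<phi>\<close>.
\<close>

lemma nonlinear_bound:
  assumes u: "u \<in> J" and \<phi>: "\<phi> \<in> J"
  shows "\<bar>b_form \<Omega> u u \<phi>\<bar> \<le> 160 * c ^ 5 * sqrt (sqrt (L2_norm \<Omega> u * L2_norm \<Omega> (St u)) ^ 3 * gn u) * L2_norm \<Omega> \<phi>"
proof -
  define n a s f where "n = L2_norm \<Omega> u" and "a = gn u" and "s = L2_norm \<Omega> (St u)" and "f = L2_norm \<Omega> \<phi>"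
  define R where "R = sqrt (n * s)"
  define q where "q = sqrt (R ^ 3 * a)"
  have nn: "0 \<le> n" "0 \<le> a" "0 \<le> s" "0 \<le> f" by (auto simp: n_def a_def s_def f_def)
  have R0: "0 \<le> R" and R2: "R\<^sup>2 = n * s" using nn by (auto simp: R_def)
  have q0: "0 \<le> q" using nn R0 by (simp add: q_def)
  note basic = discrete_basic[OF u, folded n_def a_def s_def]
  have aR: "a \<le> R" unfolding R_def by (rule real_le_rsqrt[OF basic(3)])
  have hg: "h * gn \<phi> \<le> c * f" unfolding f_def by (rule inverse_ineq[OF J_Hh[OF \<phi>]])
  obtain w where w': "w \<in> vH10 \<Omega>" "w \<in> vHm 2 \<Omega>" "vHm_norm 2 \<Omega> w \<le> c * L2_norm \<Omega> (St u)"
    "gn (u - w) \<le> 4 * c\<^sup>2 * (h * L2_norm \<Omega> (St u))"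
    "L2_norm \<Omega> (u - w) \<le> 14 * c ^ 4 * (h\<^sup>2 * L2_norm \<Omega> (St u))"
    by (rule stokes_comparison[OF u]) (rule that, assumption+)
  note w = w'[folded s_def]
  define e where "e = u - w"
  have uH: "u \<in> vH10 \<Omega>" and \<phi>H: "\<phi> \<in> vH10 \<Omega>" using u \<phi> by (auto intro: J_H10)
  have eH: "e \<in> vH10 \<Omega>" unfolding e_def by (rule subspace_diff[OF subspace_vH10 uH w(1)])
  note u1 = vH10_vHm[OF uH] and w1 = vH10_vHm[OF w(1)] and e1 = vH10_vHm[OF eH] and \<phi>1 = vH10_vHm[OF \<phi>H]
  note ar = nonlinear_arith[OF c1 R0 nn(2) nn(1) nn(3) nn(4) h0 gn_nonneg gn_nonneg L2_norm_nonneg R2 aR basic(1,2) hg w(4,5),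
      folded q_def e_def f_def]
  \<comment> \<open>the comparison field inherits the bounds of \<open>u\<close>, because \<open>h s \<le> c a\<close> and \<open>h a \<le> c n\<close>\<close>
  have uew: "w = u - e" by (simp add: e_def)
  have hhs: "h\<^sup>2 * s \<le> c\<^sup>2 * n"
  proof -
    have "h * (h * s) \<le> h * (c * a)" by (rule mult_left_mono[OF basic(1)]) (use h0 in simp)
    also have "\<dots> = c * (h * a)" by simp
    also have "\<dots> \<le> c * (c * n)" by (rule mult_left_mono[OF basic(2)]) (use c1 in simp)
    finally show ?thesis by (simp add: power2_eq_square mult_ac)
  qed
  have wn: "L2_norm \<Omega> w \<le> 15 * c ^ 6 * n"
  proof -
    have "L2_norm \<Omega> w \<le> n + L2_norm \<Omega> e"
      unfolding uew n_def by (rule L2_triangle_diff[OF vHm_L2[OF u1] vHm_L2[OF e1]])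
    also have "L2_norm \<Omega> e \<le> 14 * c ^ 4 * (c\<^sup>2 * n)"
      unfolding e_def by (rule order_trans[OF w(5)], rule mult_left_mono[OF hhs]) (use c1 in simp)
    also have "14 * c ^ 4 * (c\<^sup>2 * n) = 14 * c ^ 6 * n" by (simp add: power2_eq_square power_numeral_reduce)
    finally show ?thesis using mult_right_mono[OF one_le_power[OF c1, of 6] nn(1)] by simp
  qed
  have wg: "gn w \<le> 5 * c ^ 3 * a"
  proof -
    have "gn w \<le> a + gn e" unfolding uew a_def by (rule gn_triangle_diff[OF u1 e1])
    also have "gn e \<le> 4 * c\<^sup>2 * (c * a)"
      unfolding e_def by (rule order_trans[OF w(4)], rule mult_left_mono[OF basic(1)]) (use c1 in simp)
    also have "4 * c\<^sup>2 * (c * a) = 4 * c ^ 3 * a" by (simp add: power2_eq_square power_numeral_reduce)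
    finally show ?thesis using mult_right_mono[OF one_le_power[OF c1, of 3] nn(2)] by simp
  qed
  \<comment> \<open>\<open>81 c\<^sup>8 n s\<close> exceeds \<open>2 (15 + 25) c\<^sup>7 n s\<close>, the value of the bound in \<open>H10_sup_bound\<close>\<close>
  define S where "S = 9 * c ^ 4 * R"
  have S0: "0 \<le> S" using c1 R0 by (simp add: S_def)
  have pdw: "pd \<Omega> j (coord w i) \<in> Hm 1 \<Omega>" for i j
    using Hm_pd(2)[OF op, of "coord w i" 1 j] vHm_coord[OF w(2), of i] by (simp add: numeral_2_eq_2 One_nat_def)
  have sup: "AE x in lebesgue_on \<Omega>. \<bar>coord w i x\<bar> \<le> S" for i
  proof -
    have "2 * (L2_norm \<Omega> (coord w i) * L2_norm \<Omega> (pd \<Omega> 1 (pd \<Omega> 2 (coord w i)))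
        + L2_norm \<Omega> (pd \<Omega> 1 (coord w i)) * L2_norm \<Omega> (pd \<Omega> 2 (coord w i))) \<le> S\<^sup>2"
    proof -
      have 1: "L2_norm \<Omega> (coord w i) * L2_norm \<Omega> (pd \<Omega> 1 (pd \<Omega> 2 (coord w i))) \<le> (15 * c ^ 6 * n) * (c * s)"
        by (rule mult_mono[OF order_trans[OF coord_norm_le[OF w1] wn] order_trans[OF second_deriv_le(1) w(3)]])
          (use nn c1 in auto)
      have 2: "L2_norm \<Omega> (pd \<Omega> 1 (coord w i)) * L2_norm \<Omega> (pd \<Omega> 2 (coord w i)) \<le> (5 * c ^ 3 * a) * (5 * c ^ 3 * a)"
        by (rule mult_mono[OF order_trans[OF pd_le_gn[OF w1] wg] order_trans[OF pd_le_gn[OF w1] wg]])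
          (use nn c1 in auto)
      have "(5 * c ^ 3 * a) * (5 * c ^ 3 * a) = 25 * c ^ 6 * a\<^sup>2" by (simp add: power2_eq_square power_numeral_reduce)
      also have "\<dots> \<le> 25 * c ^ 7 * (n * s)"
        using basic(3) c1 by (intro mult_mono power_increasing) auto
      finally have 3: "(5 * c ^ 3 * a) * (5 * c ^ 3 * a) \<le> 25 * c ^ 7 * (n * s)" .
      have 4: "(15 * c ^ 6 * n) * (c * s) = 15 * c ^ 7 * (n * s)" by (simp add: power_numeral_reduce)
      have "80 * c ^ 7 * (n * s) \<le> 81 * c ^ 8 * (n * s)"
        using c1 nn by (intro mult_right_mono mult_mono power_increasing) auto
      also have "\<dots> = S\<^sup>2" by (simp add: S_def power_mult_distrib R2 flip: power_mult)
      finally show ?thesis using 1 2 3 4 by simp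
    qed
    note le = this
    have "AE x in lebesgue_on \<Omega>. (coord w i x)\<^sup>2 \<le> S\<^sup>2"
      using H10_sup_bound[OF op bd vH10_coord[OF w(1)] pdw] by eventually_elim (rule order_trans[OF _ le])
    then show ?thesis by eventually_elim (use S0 in \<open>simp add: abs_le_square_iff[symmetric]\<close>)
  qed
  have t1: "\<bar>tri \<Omega> (pd \<Omega> j (coord w i)) (coord u j) (coord \<phi> i)\<bar> \<le> 19 * c ^ 4 * q * f" for i j
  proof -
    note P = H10_mult_deriv[OF op bd vH10_coord[OF w(1)] pdw vH10_coord[OF uH] sup S0]
    define X where "X = L2_norm \<Omega> (\<lambda>x. coord u j x * pd \<Omega> j (coord w i) x)"
    have "X\<^sup>2 \<le> 4 * S\<^sup>2 * (L2_norm \<Omega> (pd \<Omega> j (coord u j)))\<^sup>2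
        + 4 * S * L2_norm \<Omega> (pd \<Omega> j (pd \<Omega> j (coord w i))) * (L2_norm \<Omega> (coord u j) * gnorm \<Omega> (coord u j))"
      unfolding X_def by (rule P(2))
    also have "\<dots> \<le> 4 * S\<^sup>2 * a\<^sup>2 + 4 * S * (c * s) * (n * a)"
      unfolding a_def n_def
      by (intro add_mono mult_mono mult_left_mono power_mono pd_le_gn[OF u1] coord_norm_le[OF u1] gnorm_le_gn[OF u1]
          order_trans[OF second_deriv_le(2) w(3)] order_refl) (use S0 nn c1 in auto)
    finally have X: "X \<le> 19 * c ^ 4 * q" unfolding S_def by (rule ar(1))
    have "tri \<Omega> (pd \<Omega> j (coord w i)) (coord u j) (coord \<phi> i) = L2_inner \<Omega> (\<lambda>x. coord u j x * pd \<Omega> j (coord w i) x) (coord \<phi> i)"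
      by (simp add: tri_move(2) mult.commute)
    then have "\<bar>tri \<Omega> (pd \<Omega> j (coord w i)) (coord u j) (coord \<phi> i)\<bar> \<le> X * L2_norm \<Omega> (coord \<phi> i)"
      unfolding X_def using L2_cauchy_schwarz[OF P(1) coord_L2[OF \<phi>1]] by simp
    also have "\<dots> \<le> (19 * c ^ 4 * q) * f"
      unfolding f_def by (rule mult_mono[OF X coord_norm_le[OF \<phi>1]]) (use c1 q0 in auto)
    finally show ?thesis .
  qed
  have t2: "\<bar>tri \<Omega> (pd \<Omega> j (coord u j)) (coord w i) (coord \<phi> i)\<bar> \<le> 9 * c ^ 4 * q * f" for i j
  proof -
    have m: "(\<lambda>x. coord w i x * coord \<phi> i x) \<in> borel_measurable (lebesgue_on \<Omega>)"
      using L2D(1)[OF coord_L2[OF w1]] L2D(1)[OF coord_L2[OF \<phi>1]] by (rule borel_measurable_times)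
    have ae: "AE x in lebesgue_on \<Omega>. norm (coord w i x * coord \<phi> i x) \<le> S * norm (coord \<phi> i x)"
      using sup[of i] by eventually_elim (simp add: abs_mult mult_right_mono)
    note D = L2_dominated[OF coord_L2[OF \<phi>1] m ae S0]
    have "\<bar>tri \<Omega> (pd \<Omega> j (coord u j)) (coord w i) (coord \<phi> i)\<bar>
        \<le> L2_norm \<Omega> (pd \<Omega> j (coord u j)) * L2_norm \<Omega> (\<lambda>x. coord w i x * coord \<phi> i x)"
      unfolding tri_def by (rule L2_cauchy_schwarz[OF pd_coord_L2[OF u1] D(1)])
    also have "\<dots> \<le> a * (S * f)"
      unfolding a_def f_def
      by (rule mult_mono[OF pd_le_gn[OF u1] order_trans[OF D(2) mult_left_mono[OF coord_norm_le[OF \<phi>1] S0]]]) auto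
    also have "\<dots> = (9 * c ^ 4 * R * a) * f" by (simp add: S_def)
    also have "\<dots> \<le> (9 * c ^ 4 * q) * f" by (rule mult_right_mono[OF ar(2) nn(4)])
    finally show ?thesis .
  qed
  have t3: "\<bar>tri \<Omega> (pd \<Omega> j (coord e i)) (coord u j) (coord \<phi> i)\<bar> \<le> 8 * c ^ 3 * q * f" for i j
  proof -
    have "\<bar>tri \<Omega> (pd \<Omega> j (coord e i)) (coord u j) (coord \<phi> i)\<bar> \<le> 2 * gn e * N4 u * N4 \<phi>"
      by (rule tri_bound_vec[OF e1 uH \<phi>H])
    also have "\<dots> = 2 * (gn e * sqrt (n * a) * sqrt (f * gn \<phi>))" by (simp add: N4_def n_def a_def f_def)
    finally show ?thesis using ar(3) by simp
  qed
  have t4: "\<bar>tri \<Omega> (pd \<Omega> j (coord u j)) (coord e i) (coord \<phi> i)\<bar> \<le> 16 * c ^ 5 * q * f" for i j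
  proof -
    have "\<bar>tri \<Omega> (pd \<Omega> j (coord u j)) (coord e i) (coord \<phi> i)\<bar> \<le> 2 * gn u * N4 e * N4 \<phi>"
      by (rule tri_bound_vec[OF u1 eH \<phi>H])
    also have "\<dots> = 2 * (a * sqrt (L2_norm \<Omega> e * gn e) * sqrt (f * gn \<phi>))" by (simp add: N4_def a_def f_def)
    finally show ?thesis using ar(4) by simp
  qed
  have "u = w + e" by (simp add: e_def)
  then have "b_form \<Omega> u u \<phi> = b_form \<Omega> u w \<phi> + b_form \<Omega> u e \<phi>"
    using b_add_mid[OF uH w(1) eH \<phi>H] by simp
  also have "\<bar>b_form \<Omega> u w \<phi> + b_form \<Omega> u e \<phi>\<bar> \<le> (\<Sum>i\<in>(UNIV::2 set). \<Sum>j\<in>(UNIV::2 set). 40 * c ^ 5 * q * f)"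
    unfolding b_form_ibp[OF uH w(1) \<phi>H] b_form_ibp[OF uH eH \<phi>H] sum.distrib[symmetric]
  proof (rule order_trans[OF sum_abs], rule sum_mono, rule order_trans[OF sum_abs], rule sum_mono)
    fix i j :: 2
    have qf: "0 \<le> q * f" using q0 nn by simp
    have p: "19 * c ^ 4 * q * f \<le> 19 * c ^ 5 * q * f" "9 * c ^ 4 * q * f \<le> 9 * c ^ 5 * q * f" "8 * c ^ 3 * q * f \<le> 8 * c ^ 5 * q * f"
      unfolding mult.assoc using qf c1 by (intro mult_left_mono mult_right_mono power_increasing; simp)+
    have "\<bar>tri \<Omega> (pd \<Omega> j (coord w i)) (coord u j) (coord \<phi> i) + 1 / 2 * tri \<Omega> (pd \<Omega> j (coord u j)) (coord w i) (coord \<phi> i)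
        + (tri \<Omega> (pd \<Omega> j (coord e i)) (coord u j) (coord \<phi> i) + 1 / 2 * tri \<Omega> (pd \<Omega> j (coord u j)) (coord e i) (coord \<phi> i))\<bar>
      \<le> 19 * c ^ 5 * q * f + 5 * (c ^ 5 * q * f) + 8 * c ^ 5 * q * f + 8 * c ^ 5 * q * f"
      using t1[of j i] t2[of j i] t3[of j i] t4[of j i] p mult_nonneg_nonneg[OF zero_le_power[OF order_trans[OF zero_le_one c1], of 5] qf]
      by (simp only: abs_le_iff mult.assoc) linarith
    also have "\<dots> = 40 * c ^ 5 * q * f" by (simp add: algebra_simps)
    finally show "\<bar>tri \<Omega> (pd \<Omega> j (coord w i)) (coord u j) (coord \<phi> i) + 1 / 2 * tri \<Omega> (pd \<Omega> j (coord u j)) (coord w i) (coord \<phi> i)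
        + (tri \<Omega> (pd \<Omega> j (coord e i)) (coord u j) (coord \<phi> i) + 1 / 2 * tri \<Omega> (pd \<Omega> j (coord u j)) (coord e i) (coord \<phi> i))\<bar>
      \<le> 40 * c ^ 5 * q * f" .
  qed
  also have "\<dots> = 160 * c ^ 5 * q * f" by (simp only: sum_2_2)
  finally show ?thesis by (simp add: q_def R_def n_def s_def a_def f_def)
qed

end

section \<open>Recursive inequalities with bounds uniform in time\<close>

lemma damped_recursion_bound:
  fixes V :: "nat \<Rightarrow> real"
  assumes "0 < k" "0 < \<theta>" "\<And>n. n < N \<Longrightarrow> (1 + k * \<theta>) * V (Suc n) \<le> V n + k * B" "V 0 \<le> M" "B \<le> \<theta> * M" "n \<le> N"
  shows "V n \<le> M"
  using assms(6)
proof (induction n)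
  case (Suc n)
  have "(1 + k * \<theta>) * V (Suc n) \<le> V n + k * B" using assms(3) Suc.prems by simp
  also have "\<dots> \<le> M + k * (\<theta> * M)" using Suc assms(1,5) by (intro add_mono mult_left_mono) auto
  also have "\<dots> = (1 + k * \<theta>) * M" by (simp add: algebra_simps)
  finally have "(1 + k * \<theta>) * V (Suc n) \<le> (1 + k * \<theta>) * M" .
  moreover have "0 < 1 + k * \<theta>" using assms(1,2) by (simp add: add_pos_pos)
  ultimately show ?case by simp
qed (use assms(4) in simp)

lemma discrete_gronwall:
  fixes x :: "nat \<Rightarrow> real"
  assumes "\<And>j. m \<le> j \<Longrightarrow> j < n \<Longrightarrow> x (Suc j) \<le> (1 + \<alpha> (Suc j)) * x j + \<beta> (Suc j)"
    "\<And>j. 0 \<le> \<alpha> j" "\<And>j. 0 \<le> \<beta> j" "0 \<le> x m" "m \<le> n"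
  shows "x n \<le> exp (\<Sum>j=Suc m..n. \<alpha> j) * (x m + (\<Sum>j=Suc m..n. \<beta> j))"
  using assms(5,1)
proof (induction n rule: dec_induct)
  case (step n)
  define A B where "A = (\<Sum>j=Suc m..n. \<alpha> j)" and "B = (\<Sum>j=Suc m..n. \<beta> j)"
  have B0: "0 \<le> x m + B" unfolding B_def using assms by (intro add_nonneg_nonneg sum_nonneg) auto
  have A0: "0 \<le> A" unfolding A_def using assms by (intro sum_nonneg) auto
  have IH: "x n \<le> exp A * (x m + B)" using step unfolding A_def B_def by simp
  have "x (Suc n) \<le> (1 + \<alpha> (Suc n)) * x n + \<beta> (Suc n)" using step by simp
  also have "\<dots> \<le> exp (\<alpha> (Suc n)) * (exp A * (x m + B)) + \<beta> (Suc n)"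
  proof (rule add_right_mono)
    have "(1 + \<alpha> (Suc n)) * x n \<le> (1 + \<alpha> (Suc n)) * (exp A * (x m + B))"
      by (rule mult_left_mono[OF IH]) (use assms(2)[of "Suc n"] in simp)
    also have "\<dots> \<le> exp (\<alpha> (Suc n)) * (exp A * (x m + B))"
      by (rule mult_right_mono[OF exp_ge_add_one_self]) (use B0 in simp)
    finally show "(1 + \<alpha> (Suc n)) * x n \<le> exp (\<alpha> (Suc n)) * (exp A * (x m + B))" .
  qed
  also have "\<dots> \<le> exp (\<alpha> (Suc n)) * (exp A * (x m + B)) + exp (A + \<alpha> (Suc n)) * \<beta> (Suc n)"
  proof (rule add_left_mono)
    have "1 \<le> exp (A + \<alpha> (Suc n))" using A0 assms(2)[of "Suc n"] by simp
    then show "\<beta> (Suc n) \<le> exp (A + \<alpha> (Suc n)) * \<beta> (Suc n)"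
      using assms(3)[of "Suc n"] mult_right_mono by fastforce
  qed
  also have "\<dots> = exp (A + \<alpha> (Suc n)) * (x m + (B + \<beta> (Suc n)))" by (simp add: exp_add algebra_simps)
  finally show ?case using step.hyps by (simp add: A_def B_def)
qed simp

lemma window_sum:
  fixes E a :: "nat \<Rightarrow> real"
  assumes "\<And>j. m \<le> j \<Longrightarrow> j < n \<Longrightarrow> E (Suc j) + k * c * a (Suc j) \<le> E j + k * C" "m \<le> n"
  shows "E n + c * (\<Sum>j=Suc m..n. k * a j) \<le> E m + real (n - m) * k * C"
  using assms(2,1)
proof (induction n rule: dec_induct)
  case (step n)
  have "E (Suc n) + k * c * a (Suc n) \<le> E n + k * C" using step by simp
  moreover have "E n + c * (\<Sum>j=Suc m..n. k * a j) \<le> E m + real (n - m) * k * C" using step by simp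
  moreover have "real (Suc n - m) = real (n - m) + 1" using step.hyps by (simp add: Suc_diff_le)
  ultimately show ?case using step.hyps by (simp add: algebra_simps)
qed simp

text \<open>
  Why a quantity that feeds back into its own bound with the power \<open>3/2 < 2\<close> stays bounded.
\<close>

lemma sublinear_bound:
  assumes "0 \<le> (Y::real)" "0 \<le> P" "Y\<^sup>2 \<le> P * ((1 + Y) * sqrt (1 + Y))"
  shows "(1 + Y) * sqrt (1 + Y) \<le> (2 + 2 * P) ^ 3"
proof -
  define t where "t = sqrt (1 + Y)"
  have t1: "1 \<le> t" and t2: "t\<^sup>2 = 1 + Y" using assms(1) by (auto simp: t_def)
  have "t ^ 3 = t\<^sup>2 * t" by (simp add: power2_eq_square power3_eq_cube)
  then have L: "(1 + Y) * sqrt (1 + Y) = t ^ 3" by (simp only: t2) (simp add: t_def)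
  have "t ^ 4 = (1 + Y)\<^sup>2" unfolding t2[symmetric] by (simp flip: power_mult)
  also have "\<dots> \<le> 2 + 2 * Y\<^sup>2" using sum_squares_bound[of 1 Y] by (simp add: power2_sum)
  also have "\<dots> \<le> 2 * t ^ 3 + 2 * (P * t ^ 3)"
    using assms(3) one_le_power[OF t1, of 3] unfolding L by linarith
  finally have "t * t ^ 3 \<le> (2 + 2 * P) * t ^ 3" by (simp add: algebra_simps power_numeral_reduce)
  then have "t \<le> 2 + 2 * P" using t1 by simp
  then show ?thesis unfolding L using t1 by (intro power_mono) auto
qed

text \<open>
  This is the time-stepping argument stripped of all function spaces. In the application \<open>E\<close> is
  the energy, \<open>a = \<parallel>\<nabla>U\<parallel>\<^sup>2\<close>, \<open>x = \<parallel>\<nabla>Z\<parallel>\<^sup>2\<close>, \<open>D = \<parallel>St Z\<parallel>\<close> and \<open>y = \<parallel>St G\<parallel>\<close>, where \<open>G\<close> is the memory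
  term and \<open>Z = U + G/\<mu>\<close>.

  The energy inequality bounds the sum of \<open>k a\<close> over every window of unit length. One of the two
  factors of \<open>a\<^sup>2\<close> may be replaced by \<open>x\<close> at the previous time, since a single step enlarges \<open>a\<close>
  by at most a bounded factor; the inequality for \<open>x\<close> is then linear, with a coefficient that is
  summable over unit windows. As in the uniform Gronwall lemma, each window contains a time to
  start from at which \<open>a\<close>, and with it \<open>x\<close>, is bounded; near the initial time that is the initial
  time itself. The result is \<open>x \<le> X \<Lambda>\<close> with \<open>\<Lambda> = (1 + Y)\<^sup>3\<^sup>/\<^sup>2\<close> and \<open>Y\<close> the maximum of \<open>y\<close>. Adding
  to \<open>x\<close> suitable multiples of \<open>y\<^sup>2\<close> and \<open>E\<close> gives a damped recursion, by which \<open>Y\<^sup>2 \<le> P \<Lambda>\<close>, and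
  the exponent \<open>3/2 < 2\<close> closes the circle.
\<close>

lemma uniform_bound:
  fixes c C kmax :: real
  assumes c: "0 < c" and C: "1 \<le> C" and kmax: "0 < kmax"
  shows "\<exists>K>0. \<forall>k N (E :: nat \<Rightarrow> real) a x D y.
    0 < k \<longrightarrow> k \<le> kmax \<longrightarrow>
    (\<forall>n\<le>N. 0 \<le> E n \<and> E n \<le> C \<and> 0 \<le> a n \<and> 0 \<le> x n \<and> 0 \<le> y n \<and> a n \<le> C * x n + C \<and> x n \<le> C * a n + C) \<longrightarrow>
    x 0 \<le> C \<longrightarrow> y 0 = 0 \<longrightarrow>
    (\<forall>n<N. E (Suc n) + k * c * a (Suc n) \<le> E n + k * C) \<longrightarrow>
    (\<forall>n<N. a (Suc n) \<le> C * a n + C) \<longrightarrow>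
    (\<forall>n<N. x (Suc n) + k * c * (D (Suc n))\<^sup>2
        \<le> x n + k * C * (1 + (a (Suc n))\<^sup>2 + sqrt (a (Suc n)) * (y (Suc n) * sqrt (y (Suc n))))) \<longrightarrow>
    (\<forall>n<N. (1 + k * c) * (y (Suc n))\<^sup>2 \<le> (y n)\<^sup>2 + k * C * (D (Suc n))\<^sup>2) \<longrightarrow>
    (\<forall>n\<le>N. a n + (y n)\<^sup>2 \<le> K)"
proof -
  \<comment> \<open>windows have length between \<open>1\<close> and \<open>T\<close>, as their number of steps is rounded up; \<open>W\<close> bounds the sum of \<open>k a\<close>\<close>
  define T where "T = 1 + kmax"
  define W where "W = (C + T * C) / c"
  define G where "G = 4 * C ^ 3"
  define X where "X = exp (G * W) * (C * W + C + G * (T + W))"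
  define B where "B = G * (1 + X) / c"
  define Z where "Z = G + c * X + B * C + c * B * C"
  define Z' where "Z' = Z / c + C + B * C"
  define P where "P = Z' / (c / C)"
  define \<Lambda>m where "\<Lambda>m = (2 + 2 * P) ^ 3"
  define K where "K = C * (X * \<Lambda>m) + C + P * \<Lambda>m"
  have T0: "0 < T" using kmax by (simp add: T_def)
  have W0: "0 < W" using c C T0 by (simp add: W_def add_pos_pos)
  have G0: "0 < G" using C by (simp add: G_def)
  have X0: "0 < X" unfolding X_def using C W0 G0 T0 by (intro mult_pos_pos add_pos_pos) auto
  have B0: "0 < B" using G0 X0 c by (simp add: B_def)
  have Z0: "0 < Z" unfolding Z_def using G0 c X0 B0 C by (intro add_pos_pos mult_pos_pos) auto
  have Z'0: "0 < Z'" unfolding Z'_def using Z0 c C B0 by (intro add_pos_pos) auto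
  have P0: "0 < P" unfolding P_def using Z'0 c C by simp
  have \<Lambda>m0: "0 < \<Lambda>m" using P0 by (simp add: \<Lambda>m_def)
  have K0: "0 < K" unfolding K_def using C X0 \<Lambda>m0 P0 by (intro add_pos_pos mult_pos_pos) auto
  show ?thesis
  proof (intro exI[of _ K] conjI K0 allI impI)
    fix k :: real and N :: nat and E a x D y :: "nat \<Rightarrow> real" and n :: nat
    assume k: "0 < k" "k \<le> kmax"
      and all: "\<forall>n\<le>N. 0 \<le> E n \<and> E n \<le> C \<and> 0 \<le> a n \<and> 0 \<le> x n \<and> 0 \<le> y n \<and> a n \<le> C * x n + C \<and> x n \<le> C * a n + C"
      and x0: "x 0 \<le> C" and y0: "y 0 = 0"
      and en: "\<forall>n<N. E (Suc n) + k * c * a (Suc n) \<le> E n + k * C"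
      and grow: "\<forall>n<N. a (Suc n) \<le> C * a n + C"
      and main: "\<forall>n<N. x (Suc n) + k * c * (D (Suc n))\<^sup>2
        \<le> x n + k * C * (1 + (a (Suc n))\<^sup>2 + sqrt (a (Suc n)) * (y (Suc n) * sqrt (y (Suc n))))"
      and mem: "\<forall>n<N. (1 + k * c) * (y (Suc n))\<^sup>2 \<le> (y n)\<^sup>2 + k * C * (D (Suc n))\<^sup>2"
      and n: "n \<le> N"
    have nn: "0 \<le> E j" "E j \<le> C" "0 \<le> a j" "0 \<le> x j" "0 \<le> y j" "a j \<le> C * x j + C" "x j \<le> C * a j + C" if "j \<le> N" for j
      using all that by auto
    define Y where "Y = Max (y ` {..N})"
    have yY: "y j \<le> Y" if "j \<le> N" for j unfolding Y_def using that by (intro Max_ge) auto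
    have Y0: "0 \<le> Y" using yY[of 0] y0 by simp
    define \<Lambda> where "\<Lambda> = (1 + Y) * sqrt (1 + Y)"
    have \<Lambda>1: "1 \<le> \<Lambda>"
      unfolding \<Lambda>_def using mult_mono[of 1 "1 + Y" 1 "sqrt (1 + Y)"] Y0 by simp
    have step: "x (Suc j) + k * c * (D (Suc j))\<^sup>2 \<le> (1 + k * G * a (Suc j)) * x j + k * G * \<Lambda> * (1 + a (Suc j))"
      if j: "j < N" for j
    proof -
      define A where "A = a (Suc j)"
      have A0: "0 \<le> A" using nn(3)[of "Suc j"] j by (simp add: A_def)
      have xj: "0 \<le> x j" using nn(4) j by simp
      have "A\<^sup>2 \<le> A * (C\<^sup>2 * x j + 2 * C\<^sup>2)"
      proof -
        have "a j \<le> C * x j + C" using nn(6) j by simp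
        then have "C * a j \<le> C * (C * x j + C)" by (rule mult_left_mono) (use C in simp)
        moreover have "A \<le> C * a j + C" using grow j by (simp add: A_def)
        moreover have "C \<le> C\<^sup>2" using mult_left_mono[OF C, of C] C by (simp add: power2_eq_square)
        ultimately have "A \<le> C\<^sup>2 * x j + 2 * C\<^sup>2" by (simp add: power2_eq_square algebra_simps)
        then show ?thesis unfolding power2_eq_square[of A] by (rule mult_left_mono[OF _ A0])
      qed
      moreover have "sqrt A * (y (Suc j) * sqrt (y (Suc j))) \<le> (1 + A) * \<Lambda>"
      proof (rule mult_mono)
        show "sqrt A \<le> 1 + A"
          by (rule real_le_lsqrt) (use A0 in \<open>auto simp: power2_eq_square algebra_simps\<close>)
        have "y (Suc j) \<le> 1 + Y" using yY[of "Suc j"] j by simp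
        moreover have "0 \<le> y (Suc j)" using nn(5) j by simp
        ultimately show "y (Suc j) * sqrt (y (Suc j)) \<le> \<Lambda>" "0 \<le> y (Suc j) * sqrt (y (Suc j))"
          unfolding \<Lambda>_def by (auto intro!: mult_mono)
      qed (use A0 in simp)
      moreover have "1 + 2 * C\<^sup>2 * A + (1 + A) * \<Lambda> \<le> 4 * C\<^sup>2 * (\<Lambda> * (1 + A))"
      proof -
        have C2: "1 \<le> C\<^sup>2" using one_le_power[OF C] .
        have CA: "C\<^sup>2 * A \<le> C\<^sup>2 * (\<Lambda> * A)" using mult_right_mono[OF \<Lambda>1 A0] C2 by (intro mult_left_mono) auto
        have "(1 + A) * \<Lambda> \<le> C\<^sup>2 * (\<Lambda> * (1 + A))"
          using mult_right_mono[OF C2, of "\<Lambda> * (1 + A)"] \<Lambda>1 A0 by (simp add: mult_ac)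
        moreover have "1 \<le> C\<^sup>2 * \<Lambda>" using mult_mono[OF C2 \<Lambda>1] by simp
        moreover have "0 \<le> C\<^sup>2 * (\<Lambda> * A)" using C2 \<Lambda>1 A0 by simp
        ultimately show ?thesis using CA by (simp add: algebra_simps)
      qed
      ultimately have "1 + A\<^sup>2 + sqrt A * (y (Suc j) * sqrt (y (Suc j))) \<le> C\<^sup>2 * A * x j + 4 * C\<^sup>2 * (\<Lambda> * (1 + A))"
        by (simp add: algebra_simps)
      then have "k * C * (1 + A\<^sup>2 + sqrt A * (y (Suc j) * sqrt (y (Suc j)))) \<le> k * C * (C\<^sup>2 * A * x j + 4 * C\<^sup>2 * (\<Lambda> * (1 + A)))"
        by (rule mult_left_mono) (use k C in simp)
      also have "\<dots> = k * C ^ 3 * A * x j + k * G * \<Lambda> * (1 + A)"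
        by (simp add: G_def power_numeral_reduce algebra_simps)
      also have "k * C ^ 3 * A * x j \<le> k * G * A * x j"
        using k C A0 xj by (intro mult_right_mono mult_left_mono) (auto simp: G_def)
      finally show ?thesis using main j unfolding A_def by (auto simp: algebra_simps)
    qed
    have win: "(\<Sum>j=Suc m..n. k * a j) \<le> W" if "m \<le> n" "n \<le> N" "real (n - m) * k \<le> T" for m n
    proof -
      have "E n + c * (\<Sum>j=Suc m..n. k * a j) \<le> E m + real (n - m) * k * C"
        by (rule window_sum) (use en that in auto)
      moreover have "real (n - m) * k * C \<le> T * C" using that(3) C by (intro mult_right_mono) auto
      ultimately have "c * (\<Sum>j=Suc m..n. k * a j) \<le> C + T * C" using nn(1)[of n] nn(2)[of m] that by simp
      then show ?thesis using c by (simp add: W_def field_simps)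
    qed
    define l where "l = nat \<lceil>1 / k\<rceil>"
    have l: "1 \<le> real l * k" "real l * k \<le> T"
    proof -
      have "0 < 1 / k" using k by simp
      then have "0 \<le> \<lceil>1 / k\<rceil>" by linarith
      then have rl: "real l = real_of_int \<lceil>1 / k\<rceil>" by (simp add: l_def)
      have "1 / k \<le> real l" "real l \<le> 1 / k + 1" unfolding rl by linarith+
      then show "1 \<le> real l * k" "real l * k \<le> T" using k by (simp_all add: T_def field_simps)
    qed
    have xbound: "x i \<le> X * \<Lambda>" if i: "i \<le> N" for i
    proof -
      obtain m where m: "m \<le> i" "real (i - m) * k \<le> T" "x m \<le> C * W + C"
      proof (cases "i \<le> l")
        case True
        then have "real (i - 0) * k \<le> real l * k" using k by (intro mult_right_mono) auto
        moreover have "x 0 \<le> C * W + C" using x0 C W0 by (simp add: add_increasing)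
        ultimately show ?thesis using that[of 0] l(2) by simp
      next
        case False
        define m0 where "m0 = i - l"
        have m0: "m0 \<le> i" "i - m0 = l" using False by (auto simp: m0_def)
        have s: "(\<Sum>j=Suc m0..i. k * a j) \<le> W" using win[of m0 i] m0 i l(2) by simp
        \<comment> \<open>otherwise the sum of \<open>k a\<close> over the window, of length at least one, would exceed \<open>W\<close>\<close>
        have "\<exists>j\<in>{Suc m0..i}. a j \<le> W"
        proof (rule ccontr)
          assume "\<not> ?thesis"
          then have no: "\<forall>j\<in>{Suc m0..i}. \<not> a j \<le> W" by blast
          have gt: "W < a j" if "j \<in> {Suc m0..i}" for j
            using bspec[OF no that] by linarith
          have "l \<noteq> 0" using l(1) by (intro notI) simp
          then have ne: "{Suc m0..i} \<noteq> {}" using False by (auto simp: m0_def)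
          have "W \<le> real l * k * W" using mult_right_mono[OF l(1), of W] W0 by simp
          also have "\<dots> = (\<Sum>j=Suc m0..i. k * W)" using m0 by (simp add: Suc_diff_le)
          also have "\<dots> < (\<Sum>j=Suc m0..i. k * a j)"
            using gt k ne by (intro sum_strict_mono) auto
          finally show False using s by simp
        qed
        then obtain j where j: "j \<in> {Suc m0..i}" "a j \<le> W" by blast
        have "x j \<le> C * a j + C" using nn(7)[of j] j i by simp
        also have "\<dots> \<le> C * W + C" using j(2) C by (intro add_right_mono mult_left_mono) auto
        finally have "x j \<le> C * W + C" .
        moreover have "real (i - j) * k \<le> real l * k" using j m0 k by (intro mult_right_mono) auto
        ultimately show ?thesis using that[of j] j l(2) by auto
      qed
      have s: "(\<Sum>j=Suc m..i. k * a j) \<le> W" by (rule win[OF m(1) i m(2)])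
      define a' where "a' j = (if j \<le> N then a j else 0)" for j
      have a'0: "0 \<le> a' j" for j using nn(3) by (simp add: a'_def)
      have sa: "(\<Sum>j=Suc m..i. k * a' j) = (\<Sum>j=Suc m..i. k * a j)"
        by (rule sum.cong) (use i in \<open>auto simp: a'_def\<close>)
      have "x i \<le> exp (\<Sum>j=Suc m..i. k * G * a' j) * (x m + (\<Sum>j=Suc m..i. k * G * \<Lambda> * (1 + a' j)))"
      proof (rule discrete_gronwall)
        fix j assume j: "m \<le> j" "j < i"
        have "0 \<le> k * c * (D (Suc j))\<^sup>2" using k c by simp
        then show "x (Suc j) \<le> (1 + k * G * a' (Suc j)) * x j + k * G * \<Lambda> * (1 + a' (Suc j))"
          using step[of j] j i by (simp add: a'_def)
      qed (use a'0 k G0 \<Lambda>1 nn(4)[of m] m i in auto)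
      also have "(\<Sum>j=Suc m..i. k * G * a' j) = G * (\<Sum>j=Suc m..i. k * a j)"
        unfolding sa[symmetric] by (simp add: sum_distrib_left mult_ac)
      also have "(\<Sum>j=Suc m..i. k * G * \<Lambda> * (1 + a' j)) = G * \<Lambda> * (real (i - m) * k + (\<Sum>j=Suc m..i. k * a j))"
        unfolding sa[symmetric] using m(1) by (simp add: sum_distrib_left algebra_simps sum.distrib)
      also have "exp (G * (\<Sum>j=Suc m..i. k * a j)) * (x m + G * \<Lambda> * (real (i - m) * k + (\<Sum>j=Suc m..i. k * a j)))
          \<le> exp (G * W) * ((C * W + C) + G * \<Lambda> * (T + W))"
      proof (rule mult_mono)
        show "exp (G * (\<Sum>j=Suc m..i. k * a j)) \<le> exp (G * W)" using s G0 by simp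
        show "x m + G * \<Lambda> * (real (i - m) * k + (\<Sum>j=Suc m..i. k * a j)) \<le> (C * W + C) + G * \<Lambda> * (T + W)"
          using s m G0 \<Lambda>1 by (intro add_mono mult_left_mono) auto
        have "0 \<le> (\<Sum>j=Suc m..i. k * a j)" unfolding sa[symmetric] using a'0 k by (intro sum_nonneg) auto
        then show "0 \<le> x m + G * \<Lambda> * (real (i - m) * k + (\<Sum>j=Suc m..i. k * a j))"
          using nn(4)[of m] m i G0 \<Lambda>1 k by (intro add_nonneg_nonneg mult_nonneg_nonneg) auto
      qed simp
      also have "\<dots> \<le> exp (G * W) * ((C * W + C) * \<Lambda> + G * \<Lambda> * (T + W))"
        using mult_left_mono[OF \<Lambda>1, of "C * W + C"] C W0 by (intro mult_left_mono add_right_mono) auto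
      also have "\<dots> = X * \<Lambda>" by (simp add: X_def algebra_simps)
      finally show ?thesis .
    qed
    define \<rho> where "\<rho> = c / C"
    have \<rho>0: "0 < \<rho>" using c C by (simp add: \<rho>_def)
    \<comment> \<open>the multiple of \<open>y\<^sup>2\<close> is what the dissipation can carry; the multiple of \<open>E\<close> absorbs the terms with \<open>a\<close>\<close>
    define V where "V j = x j + \<rho> * (y j)\<^sup>2 + \<Lambda> * B * E j" for j
    have V: "V i \<le> \<Lambda> * Z'" if "i \<le> N" for i
    proof (rule damped_recursion_bound[OF k(1) c _ _ _ that])
      fix j assume j: "j < N"
      have 1: "(1 + k * c) * (\<rho> * (y (Suc j))\<^sup>2) \<le> \<rho> * (y j)\<^sup>2 + k * c * (D (Suc j))\<^sup>2"
      proof -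
        have "\<rho> * ((1 + k * c) * (y (Suc j))\<^sup>2) \<le> \<rho> * ((y j)\<^sup>2 + k * C * (D (Suc j))\<^sup>2)"
          using mem j \<rho>0 by (intro mult_left_mono) auto
        moreover have "\<rho> * (k * C * (D (Suc j))\<^sup>2) = k * c * (D (Suc j))\<^sup>2" using C by (simp add: \<rho>_def)
        moreover have "\<rho> * ((1 + k * c) * (y (Suc j))\<^sup>2) = (1 + k * c) * (\<rho> * (y (Suc j))\<^sup>2)" by simp
        ultimately show ?thesis unfolding distrib_left by linarith
      qed
      define A where "A = a (Suc j)"
      have A0: "0 \<le> A" using nn(3)[of "Suc j"] j by (simp add: A_def)
      have 2: "x (Suc j) + k * c * (D (Suc j))\<^sup>2 \<le> x j + k * G * A * (X * \<Lambda>) + k * G * \<Lambda> * (1 + A)"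
      proof -
        have "k * G * A * x j \<le> k * G * A * (X * \<Lambda>)" using xbound[of j] j k G0 A0 by (intro mult_left_mono) auto
        then show ?thesis using step[OF j] unfolding A_def by (simp add: algebra_simps)
      qed
      have 3: "k * c * x (Suc j) \<le> k * c * (X * \<Lambda>)" using xbound[of "Suc j"] j k c by (intro mult_left_mono) auto
      have 4: "\<Lambda> * B * E (Suc j) + \<Lambda> * (G * (1 + X)) * (k * A) \<le> \<Lambda> * B * E j + k * (\<Lambda> * B * C)"
      proof -
        have "E (Suc j) + k * c * A \<le> E j + k * C" using en j by (simp add: A_def)
        then have "(\<Lambda> * B) * (E (Suc j) + k * c * A) \<le> (\<Lambda> * B) * (E j + k * C)"
          by (rule mult_left_mono) (use \<Lambda>1 B0 in simp)
        moreover have "(\<Lambda> * B) * (k * c * A) = \<Lambda> * (G * (1 + X)) * (k * A)" using c by (simp add: B_def)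
        ultimately show ?thesis by (simp add: algebra_simps)
      qed
      have 5: "k * c * (\<Lambda> * B * E (Suc j)) \<le> k * c * (\<Lambda> * B * C)"
        using nn(2)[of "Suc j"] j k c \<Lambda>1 B0 by (intro mult_left_mono) auto
      show "(1 + k * c) * V (Suc j) \<le> V j + k * (\<Lambda> * Z)"
        using 1 2 3 4 5 unfolding V_def Z_def by (simp add: algebra_simps)
    next
      have "x 0 \<le> \<Lambda> * C" using x0 mult_right_mono[OF \<Lambda>1, of C] C by linarith
      moreover have "\<Lambda> * B * E 0 \<le> \<Lambda> * B * C" using nn(2)[of 0] \<Lambda>1 B0 by (intro mult_left_mono) auto
      moreover have "0 \<le> \<Lambda> * (Z / c)" using \<Lambda>1 Z0 c by simp
      ultimately show "V 0 \<le> \<Lambda> * Z'" unfolding V_def Z'_def by (simp add: y0 algebra_simps)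
      have "Z \<le> c * Z'" unfolding Z'_def using c C B0 by (simp add: algebra_simps)
      then show "\<Lambda> * Z \<le> c * (\<Lambda> * Z')" using mult_left_mono[of Z "c * Z'" \<Lambda>] \<Lambda>1 by (simp add: mult_ac)
    qed
    have ybound: "(y i)\<^sup>2 \<le> P * \<Lambda>" if i: "i \<le> N" for i
    proof -
      have "0 \<le> \<Lambda> * B * E i" using \<Lambda>1 B0 nn(1)[OF i] by simp
      then have "\<rho> * (y i)\<^sup>2 \<le> \<Lambda> * Z'" using V[OF i] nn(4)[OF i] unfolding V_def by linarith
      then have "(y i)\<^sup>2 \<le> \<Lambda> * Z' / \<rho>" using \<rho>0 by (simp add: field_simps)
      then show ?thesis by (simp add: P_def \<rho>_def mult_ac)
    qed
    have "Y \<in> y ` {..N}" unfolding Y_def by (rule Max_in) auto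
    then have "Y\<^sup>2 \<le> P * \<Lambda>" using ybound by auto
    then have \<Lambda>: "\<Lambda> \<le> \<Lambda>m"
      unfolding \<Lambda>_def \<Lambda>m_def by (rule sublinear_bound[OF Y0 less_imp_le[OF P0]])
    have "a n \<le> C * x n + C" using nn(6)[OF n] .
    also have "\<dots> \<le> C * (X * \<Lambda>m) + C"
    proof -
      have "x n \<le> X * \<Lambda>m" using xbound[OF n] mult_left_mono[OF \<Lambda>, of X] X0 by linarith
      then show ?thesis using C by (intro add_right_mono mult_left_mono) auto
    qed
    finally have "a n \<le> C * (X * \<Lambda>m) + C" .
    moreover have "(y n)\<^sup>2 \<le> P * \<Lambda>m" using ybound[OF n] mult_left_mono[OF \<Lambda>, of P] P0 by linarith
    ultimately show "a n + (y n)\<^sup>2 \<le> K" by (simp add: K_def)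
  qed
qed

section \<open>Estimates along the backward Euler scheme\<close>

lemma young:
  fixes p r \<epsilon> :: real
  assumes "0 < \<epsilon>"
  shows "p * r \<le> \<epsilon> * p\<^sup>2 + r\<^sup>2 / (4 * \<epsilon>)"
proof -
  have "0 \<le> (2 * \<epsilon> * p - r)\<^sup>2 / (4 * \<epsilon>)" using assms by simp
  also have "\<dots> = \<epsilon> * p\<^sup>2 + r\<^sup>2 / (4 * \<epsilon>) - p * r" using assms by (simp add: power2_eq_square field_simps)
  finally show ?thesis by simp
qed

lemma mult_sqrt_add_le:
  fixes s p r :: real
  assumes "0 \<le> p" "0 \<le> r" "0 \<le> s" "s \<le> p + r"
  shows "s * sqrt s \<le> 3 * (p * sqrt p + r * sqrt r)"
proof -
  define m where "m = max p r"
  have m0: "0 \<le> m" "s \<le> 2 * m" using assms by (auto simp: m_def)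
  have "s * sqrt s \<le> (2 * m) * sqrt (2 * m)" using m0 assms(3) by (intro mult_mono) auto
  also have "\<dots> \<le> (2 * m) * (3 / 2 * sqrt m)"
  proof (rule mult_left_mono)
    have "sqrt 2 \<le> 3 / 2" by (rule real_le_lsqrt) (auto simp: power2_eq_square)
    then show "sqrt (2 * m) \<le> 3 / 2 * sqrt m" unfolding real_sqrt_mult by (rule mult_right_mono) (use m0 in simp)
  qed (use m0 in simp)
  also have "\<dots> = 3 * (m * sqrt m)" by simp
  also have "m * sqrt m \<le> p * sqrt p + r * sqrt r" using assms by (auto simp: m_def max_def)
  finally show ?thesis by simp
qed

text \<open>
  The forcing and the convective term absorbed into the dissipation \<open>D\<^sup>2\<close>. In the hypothesis on
  \<open>\<beta>\<close>, the norm \<open>s\<close> of \<open>St U\<close> is split into \<open>D\<close> and a part of size \<open>y/\<mu>\<close> that comes from the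
  memory. After one application of Young's inequality the former contributes \<open>u D\<^sup>3\<^sup>/\<^sup>2\<close>, which
  two more reduce to \<open>D\<^sup>2\<close> and \<open>u\<^sup>4\<close>; the latter leaves \<open>u y\<^sup>3\<^sup>/\<^sup>2\<close>.
\<close>

lemma dissipation_absorbs:
  fixes \<mu> M B m :: real
  assumes \<mu>: "0 < \<mu>" and B: "0 \<le> B" and m: "0 \<le> m"
  obtains C where "0 \<le> C"
    "\<And>u D y s \<beta>. 0 \<le> u \<Longrightarrow> 0 \<le> D \<Longrightarrow> 0 \<le> y \<Longrightarrow> 0 \<le> s \<Longrightarrow> s \<le> D + y / \<mu> \<Longrightarrow>
       \<beta> \<le> B * sqrt (sqrt (m * s) ^ 3 * u) * D \<Longrightarrow>
       2 * M * D + 2 * \<beta> \<le> \<mu> * D\<^sup>2 + C * (1 + (u\<^sup>2)\<^sup>2 + u * (y * sqrt y))"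
proof
  define Q where "Q = 12 * B\<^sup>2 * (m * sqrt m) / \<mu>"
  have Q: "0 \<le> Q" using \<mu> m by (simp add: Q_def)
  define C1 where "C1 = 4 * M\<^sup>2 / \<mu>"
  define C2 where "C2 = Q ^ 4 / \<mu> ^ 3"
  define C3 where "C3 = Q / (\<mu> * sqrt \<mu>)"
  have C0: "0 \<le> C1" "0 \<le> C2" "0 \<le> C3" using \<mu> Q by (simp_all add: C1_def C2_def C3_def)
  then show "0 \<le> C1 + C2 + C3" by simp
  fix u D y s \<beta> :: real
  assume nn: "0 \<le> u" "0 \<le> D" "0 \<le> y" "0 \<le> s" and s: "s \<le> D + y / \<mu>"
    and \<beta>: "\<beta> \<le> B * sqrt (sqrt (m * s) ^ 3 * u) * D"
  define X where "X = sqrt (sqrt (m * s) ^ 3 * u)"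
  have X2: "X\<^sup>2 = (m * sqrt m) * (s * sqrt s) * u"
  proof -
    have "X\<^sup>2 = sqrt (m * s) ^ 3 * u" using nn m by (simp add: X_def)
    also have "sqrt (m * s) ^ 3 = ((sqrt m)\<^sup>2 * sqrt m) * ((sqrt s)\<^sup>2 * sqrt s)"
      by (simp only: real_sqrt_mult power2_eq_square power3_eq_cube mult_ac)
    finally show ?thesis using m nn by simp
  qed
  define Y where "Y = u * (y * sqrt y)"
  have Y0: "0 \<le> Y" using nn by (simp add: Y_def)
  have 1: "2 * M * D \<le> \<mu> / 4 * D\<^sup>2 + C1"
    using young[of "\<mu> / 4" D "2 * M"] \<mu> by (simp add: C1_def mult_ac power_mult_distrib)
  have "2 * \<beta> \<le> D * (2 * B * X)" using \<beta> by (simp add: X_def mult_ac)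
  also have "\<dots> \<le> \<mu> / 4 * D\<^sup>2 + (2 * B * X)\<^sup>2 / \<mu>" using young[of "\<mu> / 4" D "2 * B * X"] \<mu> by simp
  also have "(2 * B * X)\<^sup>2 / \<mu> = (Q / 3) * (s * sqrt s) * u"
    using \<mu> by (simp add: power_mult_distrib X2 Q_def)
  also have "\<dots> \<le> (Q / 3) * (3 * (D * sqrt D + (y / \<mu>) * sqrt (y / \<mu>))) * u"
    using nn s \<mu> Q by (intro mult_right_mono mult_left_mono mult_sqrt_add_le) auto
  also have "\<dots> = D * (Q * u * sqrt D) + C3 * Y"
    using \<mu> by (simp add: C3_def Y_def real_sqrt_divide field_simps)
  finally have 2: "2 * \<beta> \<le> \<mu> / 4 * D\<^sup>2 + D * (Q * u * sqrt D) + C3 * Y" by simp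
  have 3: "D * (Q * u * sqrt D) \<le> \<mu> / 4 * D\<^sup>2 + D * (Q\<^sup>2 / \<mu> * u\<^sup>2)"
    using young[of "\<mu> / 4" D "Q * u * sqrt D"] \<mu> nn by (simp add: power_mult_distrib mult_ac)
  have "(Q\<^sup>2 / \<mu> * u\<^sup>2)\<^sup>2 / \<mu> = C2 * (u\<^sup>2)\<^sup>2"
    using \<mu> by (simp add: C2_def power2_eq_square power_numeral_reduce field_simps)
  then have 4: "D * (Q\<^sup>2 / \<mu> * u\<^sup>2) \<le> \<mu> / 4 * D\<^sup>2 + C2 * (u\<^sup>2)\<^sup>2"
    using young[of "\<mu> / 4" D "Q\<^sup>2 / \<mu> * u\<^sup>2"] \<mu> by simp
  have "C1 + C2 * (u\<^sup>2)\<^sup>2 + C3 * Y \<le> (C1 + C2 + C3) * (1 + (u\<^sup>2)\<^sup>2 + Y)"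
    using C0 Y0 by (simp add: algebra_simps)
  then show "2 * M * D + 2 * \<beta> \<le> \<mu> * D\<^sup>2 + (C1 + C2 + C3) * (1 + (u\<^sup>2)\<^sup>2 + u * (y * sqrt y))"
    using 1 2 3 4 unfolding Y_def[symmetric] by simp
qed

text \<open>
  Young's inequality with weight \<open>\<mu>/8\<close> on the products of the right-hand side; the quadratic terms
  in \<open>u'\<close> and \<open>g\<close> that this produces are smaller than those on the left.
\<close>

lemma growth_of_step:
  fixes \<mu> :: real
  assumes \<mu>: "0 < \<mu>" and m: "0 \<le> m" and \<Gamma>: "0 \<le> \<Gamma>"
    and nn: "0 \<le> u" "0 \<le> u'" "0 \<le> g"
    and le: "\<mu> / 2 * (u'\<^sup>2 - u\<^sup>2 + g\<^sup>2) \<le> F + \<Gamma> * g + 4 * m * (u * (u' + g) + g * sqrt (u * u'))"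
  defines "R \<equiv> 32 * m\<^sup>2 / \<mu>"
  shows "u'\<^sup>2 \<le> (2 + 8 * R / \<mu> + 8 * R\<^sup>2 / \<mu>\<^sup>2) * u\<^sup>2 + (4 * F / \<mu> + 8 * \<Gamma>\<^sup>2 / \<mu>\<^sup>2)"
proof -
  have e: "0 < \<mu> / 8" using \<mu> by simp
  have 1: "\<Gamma> * g \<le> \<mu> / 8 * g\<^sup>2 + 2 * \<Gamma>\<^sup>2 / \<mu>" using young[OF e, of g \<Gamma>] \<mu> by (simp add: mult_ac)
  have 2: "4 * m * (u * u') \<le> \<mu> / 8 * u'\<^sup>2 + R * u\<^sup>2"
    using young[OF e, of u' "4 * m * u"] \<mu> by (simp add: mult_ac R_def power_mult_distrib)
  have 3: "4 * m * (u * g) \<le> \<mu> / 8 * g\<^sup>2 + R * u\<^sup>2"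
    using young[OF e, of g "4 * m * u"] \<mu> by (simp add: mult_ac R_def power_mult_distrib)
  have "(4 * m * sqrt (u * u'))\<^sup>2 = 16 * m\<^sup>2 * (u * u')" using nn by (simp add: power_mult_distrib)
  then have 4: "4 * m * (g * sqrt (u * u')) \<le> \<mu> / 8 * g\<^sup>2 + u' * (R * u)"
    using young[OF e, of g "4 * m * sqrt (u * u')"] \<mu> by (simp add: mult_ac R_def)
  have 5: "u' * (R * u) \<le> \<mu> / 8 * u'\<^sup>2 + 2 * R\<^sup>2 / \<mu> * u\<^sup>2"
    using young[OF e, of u' "R * u"] \<mu> by (simp add: power_mult_distrib)
  have "\<mu> / 4 * u'\<^sup>2 \<le> (\<mu> / 2 + 2 * R + 2 * R\<^sup>2 / \<mu>) * u\<^sup>2 + (F + 2 * \<Gamma>\<^sup>2 / \<mu>)"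
  proof -
    have "0 \<le> \<mu> * g\<^sup>2" using \<mu> by simp
    then show ?thesis using le 1 2 3 4 5 by (simp add: algebra_simps)
  qed
  then have "4 / \<mu> * (\<mu> / 4 * u'\<^sup>2) \<le> 4 / \<mu> * ((\<mu> / 2 + 2 * R + 2 * R\<^sup>2 / \<mu>) * u\<^sup>2 + (F + 2 * \<Gamma>\<^sup>2 / \<mu>))"
    by (rule mult_left_mono) (use \<mu> in simp)
  moreover have "4 / \<mu> * (\<mu> / 4 * u'\<^sup>2) = u'\<^sup>2" using \<mu> by simp
  moreover have "4 / \<mu> * ((\<mu> / 2 + 2 * R + 2 * R\<^sup>2 / \<mu>) * u\<^sup>2 + (F + 2 * \<Gamma>\<^sup>2 / \<mu>))
      = (2 + 8 * R / \<mu> + 8 * R\<^sup>2 / \<mu>\<^sup>2) * u\<^sup>2 + (4 * F / \<mu> + 8 * \<Gamma>\<^sup>2 / \<mu>\<^sup>2)"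
    using \<mu> by (simp add: field_simps power2_eq_square)
  ultimately show ?thesis by linarith
qed

lemma memory_sum_0: "memory_sum \<gamma> \<delta> k U 0 = 0"
  by (simp add: memory_sum_def zero_fun_def fun_eq_iff)

text \<open>
  The exponential kernel makes the memory term a one-step recursion.
\<close>

lemma memory_sum_Suc:
  "memory_sum \<gamma> \<delta> k U (Suc n) = (k * \<gamma>) *\<^sub>R U (Suc n) + exp (- \<delta> * k) *\<^sub>R memory_sum \<gamma> \<delta> k U n"
proof
  fix x
  have "kernel \<gamma> \<delta> (real (Suc n) * k - real j * k) = exp (- \<delta> * k) * kernel \<gamma> \<delta> (real n * k - real j * k)" for j
    by (simp add: kernel_def exp_add[symmetric] algebra_simps)
  then have "(\<Sum>j=1..n. kernel \<gamma> \<delta> (real (Suc n) * k - real j * k) *\<^sub>R U j x)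
      = exp (- \<delta> * k) *\<^sub>R (\<Sum>j=1..n. kernel \<gamma> \<delta> (real n * k - real j * k) *\<^sub>R U j x)"
    by (simp only: scaleR_sum_right scaleR_scaleR)
  then show "memory_sum \<gamma> \<delta> k U (Suc n) x = ((k * \<gamma>) *\<^sub>R U (Suc n) + exp (- \<delta> * k) *\<^sub>R memory_sum \<gamma> \<delta> k U n) x"
    by (simp add: memory_sum_def scaleR_fun_def scaleR_add_right kernel_def)
qed

text \<open>
  A run of the scheme, multiplied by \<open>k\<close>; \<open>F n\<close> is the force at the time of \<open>U (Suc n)\<close>, so that
  indices start at zero. The bounds on the initial value are those of \<open>proj_H1_stable\<close>.
\<close>

locale euler = fem +
  fixes \<mu> \<gamma> \<delta> k kmax M\<^sub>0 :: real and N :: nat and U F :: "nat \<Rightarrow> vector_field"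
  assumes \<mu>: "0 < \<mu>" and \<gamma>: "0 < \<gamma>" and \<delta>: "0 < \<delta>" and k: "0 < k" "k \<le> kmax" and M0: "0 \<le> M\<^sub>0"
    and U_J: "\<And>n. n \<le> N \<Longrightarrow> U n \<in> J"
    and F: "\<And>n. n < N \<Longrightarrow> F n \<in> L2 \<Omega>" "\<And>n. n < N \<Longrightarrow> L2_norm \<Omega> (F n) \<le> M\<^sub>0"
    and init: "L2_norm \<Omega> (U 0) \<le> M\<^sub>0" "gn (U 0) \<le> 7 * c ^ 3 * M\<^sub>0"
    and scheme: "\<And>n \<phi>. n < N \<Longrightarrow> \<phi> \<in> J \<Longrightarrow>
      L2_inner \<Omega> (U (Suc n) - U n) \<phi> + k * \<mu> * a_form \<Omega> (U (Suc n)) \<phi>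
        + k * a_form \<Omega> (memory_sum \<gamma> \<delta> k U (Suc n)) \<phi>
      = k * L2_inner \<Omega> (F n) \<phi> - k * b_form \<Omega> (U (Suc n)) (U (Suc n)) \<phi>"
begin

abbreviation "G n \<equiv> memory_sum \<gamma> \<delta> k U n"

definition "q = exp (- \<delta> * k)"

text \<open>
  The viscous and the memory term of the scheme together are \<open>\<mu> a(Z, \<phi>)\<close>. Testing with \<open>St Z\<close>
  rather than \<open>St U\<close> keeps the dissipation coercive in the presence of the memory.
\<close>

definition "Z n = U n + (1 / \<mu>) *\<^sub>R G n"

lemma q: "0 < q" "q \<le> 1" "1 - q \<le> \<delta> * k" "q * (1 + \<delta> * k) \<le> 1"
proof -
  show "0 < q" by (simp add: q_def)
  show "q \<le> 1" using \<delta> k by (simp add: q_def)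
  show "1 - q \<le> \<delta> * k" using exp_ge_add_one_self[of "- \<delta> * k"] by (simp add: q_def)
  have "q * (1 + \<delta> * k) \<le> q * exp (\<delta> * k)"
    by (rule mult_left_mono) (use exp_ge_add_one_self[of "\<delta> * k"] in \<open>auto simp: q_def\<close>)
  then show "q * (1 + \<delta> * k) \<le> 1" by (simp add: q_def exp_minus)
qed

lemma G_Suc: "G (Suc n) = (k * \<gamma>) *\<^sub>R U (Suc n) + q *\<^sub>R G n"
  unfolding q_def by (rule memory_sum_Suc)

lemma G_J: "n \<le> N \<Longrightarrow> G n \<in> J"
proof (induction n)
  case 0
  show ?case unfolding memory_sum_0 by (rule subspace_0[OF subspace_J])
next
  case (Suc n)
  then show ?case unfolding G_Suc by (intro J_mem U_J) auto
qed

lemma Z_J: "n \<le> N \<Longrightarrow> Z n \<in> J"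
  unfolding Z_def by (intro J_mem U_J G_J)

lemma L2_inner_diff_ge:
  assumes "u \<in> L2 \<Omega>" "v \<in> L2 \<Omega>"
  shows "(L2_norm \<Omega> u)\<^sup>2 - (L2_norm \<Omega> v)\<^sup>2 \<le> 2 * L2_inner \<Omega> (u - v) u"
proof -
  have "0 \<le> L2_inner \<Omega> (u - v) (u - v)" by (rule L2.nonneg[OF L2.mem(3)[OF assms]])
  then show ?thesis
    using L2.commute[OF assms] assms by (simp add: L2_norm_sq L2.linear_simps L2.mem)
qed

lemma a_form_diff:
  assumes "u \<in> vHm 1 \<Omega>" "v \<in> vHm 1 \<Omega>"
  shows "2 * a_form \<Omega> u (u - v) = (gn u)\<^sup>2 - (gn v)\<^sup>2 + (gn (u - v))\<^sup>2"
  using A.commute[OF assms] assms by (simp add: gn_sq A.linear_simps A.mem)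

text \<open>
  A rate at which both parts of the energy are damped: the velocity by viscosity and the Poincare
  inequality, the memory by the decay of the kernel.
\<close>

definition "\<theta> = min (\<mu> / (2 * c\<^sup>2)) (2 * \<delta>)"

definition "energy n = (L2_norm \<Omega> (U n))\<^sup>2 + q / \<gamma> * (gn (G n))\<^sup>2"

text \<open>
  A bound for the initial energy plus the level at which damping balances the force.
\<close>

definition "E\<^sub>0 = M\<^sub>0\<^sup>2 + c\<^sup>2 * M\<^sub>0\<^sup>2 / (\<mu> * \<theta>)"

lemma \<theta>: "0 < \<theta>" "c\<^sup>2 * \<theta> \<le> \<mu> / 2" "\<theta> \<le> 2 * \<delta>"
proof -
  have c: "0 < c\<^sup>2" using c1 by simp
  show "0 < \<theta>" "\<theta> \<le> 2 * \<delta>" using \<mu> \<delta> c by (auto simp: \<theta>_def)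
  have "\<theta> \<le> \<mu> / (2 * c\<^sup>2)" by (simp add: \<theta>_def)
  then show "c\<^sup>2 * \<theta> \<le> \<mu> / 2" using c by (simp add: field_simps)
qed

text \<open>
  Testing with \<open>U (Suc n)\<close>: the convective term vanishes, and by the recursion for \<open>G\<close> the memory
  contributes the increment of \<open>\<parallel>\<nabla>G\<parallel>\<^sup>2\<close> with a positive excess.
\<close>

lemma energy_step:
  assumes n: "n < N"
  shows "(1 + k * \<theta>) * energy (Suc n) + k * (\<mu> / 2) * (gn (U (Suc n)))\<^sup>2 \<le> energy n + k * (c\<^sup>2 * M\<^sub>0\<^sup>2 / \<mu>)"
proof -
  define u where "u = U (Suc n)"
  define g where "g = G (Suc n)"
  have J: "u \<in> J" "U n \<in> J" "g \<in> J" "G n \<in> J" using n by (simp_all add: u_def g_def U_J G_J del: One_nat_def)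
  note L = J[THEN J_L2] and H = J[THEN J_H1]
  have g_eq: "g = (k * \<gamma>) *\<^sub>R u + q *\<^sub>R G n" by (simp add: g_def u_def G_Suc)
  have mem: "(gn g)\<^sup>2 * (2 - q) - q * (gn (G n))\<^sup>2 \<le> 2 * (k * \<gamma>) * a_form \<Omega> g u"
  proof -
    have "(gn g)\<^sup>2 = (k * \<gamma>) * a_form \<Omega> g u + q * a_form \<Omega> g (G n)"
      unfolding gn_sq[OF H(3)] by (subst (2) g_eq) (use H in \<open>simp add: A.linear_simps A.mem\<close>)
    moreover have "2 * a_form \<Omega> g (G n) \<le> (gn g)\<^sup>2 + (gn (G n))\<^sup>2"
    proof -
      have "0 \<le> (gn g - gn (G n))\<^sup>2" by simp
      then show ?thesis using a_cauchy_schwarz[OF H(3,4)] by (simp add: power2_diff)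
    qed
    then have "q * (2 * a_form \<Omega> g (G n)) \<le> q * ((gn g)\<^sup>2 + (gn (G n))\<^sup>2)" using q by (intro mult_left_mono) auto
    ultimately show ?thesis by (simp add: algebra_simps)
  qed
  have poin: "L2_norm \<Omega> u \<le> c * gn u" by (rule poincare'[OF J_H10[OF J(1)]])
  have force: "2 * L2_inner \<Omega> (F n) u \<le> \<mu> * (gn u)\<^sup>2 + c\<^sup>2 * M\<^sub>0\<^sup>2 / \<mu>"
  proof -
    have "L2_inner \<Omega> (F n) u \<le> M\<^sub>0 * (c * gn u)"
      using L2_cauchy_schwarz[OF F(1)[OF n] L(1)] mult_mono[OF F(2)[OF n] poin M0] by simp
    then show ?thesis using young[OF \<mu>, of "gn u" "2 * c * M\<^sub>0"] \<mu> by (simp add: power_mult_distrib mult_ac)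
  qed
  have "(L2_norm \<Omega> u)\<^sup>2 - (L2_norm \<Omega> (U n))\<^sup>2 + 2 * (k * \<mu>) * (gn u)\<^sup>2 + 2 * k * a_form \<Omega> g u
      \<le> 2 * k * L2_inner \<Omega> (F n) u"
    using scheme[OF n J(1)] L2_inner_diff_ge[OF L(1,2)]
    by (simp add: u_def[symmetric] g_def[symmetric] b_skew gn_sq[OF H(1)])
  moreover have "k * (2 * L2_inner \<Omega> (F n) u) \<le> k * (\<mu> * (gn u)\<^sup>2 + c\<^sup>2 * M\<^sub>0\<^sup>2 / \<mu>)"
    by (rule mult_left_mono[OF force]) (use k in simp)
  moreover have "1 / \<gamma> * ((gn g)\<^sup>2 * (2 - q) - q * (gn (G n))\<^sup>2) \<le> 1 / \<gamma> * (2 * (k * \<gamma>) * a_form \<Omega> g u)"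
    by (rule mult_left_mono[OF mem]) (use \<gamma> in simp)
  moreover have "1 / \<gamma> * (2 * (k * \<gamma>) * a_form \<Omega> g u) = 2 * k * a_form \<Omega> g u" using \<gamma> by simp
  moreover have "1 / \<gamma> * ((gn g)\<^sup>2 * (2 - q) - q * (gn (G n))\<^sup>2) = (2 - q) / \<gamma> * (gn g)\<^sup>2 - q / \<gamma> * (gn (G n))\<^sup>2"
    using \<gamma> by (simp add: field_simps)
  moreover have "(1 + k * \<theta>) * (q / \<gamma> * (gn g)\<^sup>2) \<le> (2 - q) / \<gamma> * (gn g)\<^sup>2"
  proof -
    have "(1 + k * \<theta>) * q \<le> (1 + k * (2 * \<delta>)) * q" using k \<theta>(3) q by (intro mult_right_mono add_left_mono mult_left_mono) auto
    also have "\<dots> \<le> 2 - q" using q(4) by (simp add: algebra_simps)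
    finally have "(1 + k * \<theta>) * q * ((gn g)\<^sup>2 / \<gamma>) \<le> (2 - q) * ((gn g)\<^sup>2 / \<gamma>)" by (rule mult_right_mono) (use \<gamma> in simp)
    then show ?thesis by simp
  qed
  moreover have "k * (\<theta> * (L2_norm \<Omega> u)\<^sup>2) \<le> k * (\<mu> / 2 * (gn u)\<^sup>2)"
  proof (rule mult_left_mono)
    have "\<theta> * (L2_norm \<Omega> u)\<^sup>2 \<le> \<theta> * (c * gn u)\<^sup>2" using \<theta>(1) poin by (intro mult_left_mono power_mono) auto
    also have "\<dots> \<le> \<mu> / 2 * (gn u)\<^sup>2"
      using mult_right_mono[OF \<theta>(2), of "(gn u)\<^sup>2"] by (simp add: power_mult_distrib mult_ac)
    finally show "\<theta> * (L2_norm \<Omega> u)\<^sup>2 \<le> \<mu> / 2 * (gn u)\<^sup>2" .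
  qed (use k in simp)
  ultimately show ?thesis
    unfolding energy_def u_def[symmetric] g_def[symmetric] distrib_left distrib_right by simp
qed

lemma energy_nonneg: "0 \<le> energy n" using q \<gamma> by (simp add: energy_def)

lemma E0_nonneg: "0 \<le> E\<^sub>0" using \<mu> \<theta> by (simp add: E\<^sub>0_def)

lemma energy_bound:
  assumes n: "n \<le> N"
  shows "energy n \<le> E\<^sub>0"
proof (rule damped_recursion_bound[OF k(1) \<theta>(1) _ _ _ n])
  fix j assume "j < N"
  then show "(1 + k * \<theta>) * energy (Suc j) \<le> energy j + k * (c\<^sup>2 * M\<^sub>0\<^sup>2 / \<mu>)"
  proof -
    have "0 \<le> k * (\<mu> / 2) * (gn (U (Suc j)))\<^sup>2" using k \<mu> by simp
    then show ?thesis using energy_step[OF \<open>j < N\<close>] by linarith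
  qed
next
  have "gn (G 0) = 0" using A.linear_simps(3)[of 0 0 0] by (simp add: memory_sum_0 gn_eq A.mem)
  moreover have "(L2_norm \<Omega> (U 0))\<^sup>2 \<le> M\<^sub>0\<^sup>2" by (intro power_mono init(1)) simp
  moreover have "0 \<le> c\<^sup>2 * M\<^sub>0\<^sup>2 / (\<mu> * \<theta>)" using \<mu> \<theta> by simp
  ultimately show "energy 0 \<le> E\<^sub>0" by (simp add: energy_def E\<^sub>0_def)
  have "0 \<le> \<theta> * M\<^sub>0\<^sup>2" using \<theta> by simp
  moreover have "\<theta> * (c\<^sup>2 * M\<^sub>0\<^sup>2 / (\<mu> * \<theta>)) = c\<^sup>2 * M\<^sub>0\<^sup>2 / \<mu>" using \<theta> by simp
  ultimately show "c\<^sup>2 * M\<^sub>0\<^sup>2 / \<mu> \<le> \<theta> * E\<^sub>0" unfolding E\<^sub>0_def distrib_left by linarith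
qed

lemma U_norm: "n \<le> N \<Longrightarrow> L2_norm \<Omega> (U n) \<le> sqrt E\<^sub>0"
proof (rule real_le_rsqrt)
  assume "n \<le> N"
  moreover have "0 \<le> q / \<gamma> * (gn (G n))\<^sup>2" using q \<gamma> by simp
  ultimately show "(L2_norm \<Omega> (U n))\<^sup>2 \<le> E\<^sub>0" using energy_bound[of n] by (simp add: energy_def)
qed

definition "\<Gamma> = sqrt (\<gamma> * exp (\<delta> * kmax) * E\<^sub>0)"

lemma \<Gamma>_nonneg: "0 \<le> \<Gamma>" using \<gamma> E0_nonneg by (simp add: \<Gamma>_def)

lemma G_gn: "n \<le> N \<Longrightarrow> gn (G n) \<le> \<Gamma>"
  unfolding \<Gamma>_def
proof (rule real_le_rsqrt)
  assume n: "n \<le> N"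
  have "q / \<gamma> * (gn (G n))\<^sup>2 \<le> E\<^sub>0"
    using energy_bound[OF n] zero_le_power2[of "L2_norm \<Omega> (U n)"] unfolding energy_def by linarith
  then have "\<gamma> / q * (q / \<gamma> * (gn (G n))\<^sup>2) \<le> \<gamma> / q * E\<^sub>0" by (rule mult_left_mono) (use \<gamma> q in simp)
  moreover have "\<gamma> / q * (q / \<gamma> * (gn (G n))\<^sup>2) = (gn (G n))\<^sup>2" using \<gamma> q by simp
  moreover have "\<gamma> / q * E\<^sub>0 = \<gamma> * exp (\<delta> * k) * E\<^sub>0" by (simp add: q_def exp_minus divide_inverse)
  ultimately have "(gn (G n))\<^sup>2 \<le> \<gamma> * exp (\<delta> * k) * E\<^sub>0" by linarith
  also have "\<dots> \<le> \<gamma> * exp (\<delta> * kmax) * E\<^sub>0"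
    using \<gamma> \<delta> k E0_nonneg by (intro mult_right_mono mult_left_mono) auto
  finally show "(gn (G n))\<^sup>2 \<le> \<gamma> * exp (\<delta> * kmax) * E\<^sub>0" .
qed

end

context euler
begin

text \<open>
  Testing with the increment \<open>d = U (Suc n) - U n\<close>, in which the convective term becomes
  \<open>b(U (Suc n), U n, d)\<close>. No power of \<open>k\<close> enters the bound, so that the nonlinear term at the new
  time can be traded for one at the old time.
\<close>

lemma growth:
  assumes n: "n < N"
  defines "R \<equiv> 32 * E\<^sub>0 / \<mu>"
  shows "(gn (U (Suc n)))\<^sup>2 \<le> (2 + 8 * R / \<mu> + 8 * R\<^sup>2 / \<mu>\<^sup>2) * (gn (U n))\<^sup>2
    + (4 * (2 * sqrt E\<^sub>0 * M\<^sub>0) / \<mu> + 8 * \<Gamma>\<^sup>2 / \<mu>\<^sup>2)"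
proof -
  define u where "u = U (Suc n)"
  define d where "d = u - U n"
  define m where "m = sqrt E\<^sub>0"
  have m0: "0 \<le> m" "m\<^sup>2 = E\<^sub>0" using E0_nonneg by (simp_all add: m_def)
  have J: "u \<in> J" "U n \<in> J" "G (Suc n) \<in> J" using n by (simp_all add: u_def U_J G_J)
  then have dJ: "d \<in> J" unfolding d_def by (intro J_mem)
  note L = J[THEN J_L2] and H = J[THEN J_H1] and H0 = J[THEN J_H10]
  have Um: "L2_norm \<Omega> u \<le> m" "L2_norm \<Omega> (U n) \<le> m" using n by (simp_all add: u_def m_def U_norm)
  have dm: "L2_norm \<Omega> d \<le> 2 * m" using L2_triangle_diff[OF L(1,2)] Um by (simp add: d_def)
  have force: "L2_inner \<Omega> (F n) d \<le> 2 * m * M\<^sub>0"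
    using L2_cauchy_schwarz[OF F(1)[OF n] J_L2[OF dJ]] mult_mono[OF F(2)[OF n] dm M0] by (simp add: mult_ac)
  have mem: "- a_form \<Omega> (G (Suc n)) d \<le> \<Gamma> * gn d"
  proof -
    have "gn (G (Suc n)) * gn d \<le> \<Gamma> * gn d" using G_gn[of "Suc n"] n by (intro mult_right_mono) auto
    then show ?thesis using a_cauchy_schwarz[OF H(3) J_H1[OF dJ]] by simp
  qed
  have conv: "- b_form \<Omega> u u d \<le> 4 * m * (gn (U n) * (gn u + gn d) + gn d * sqrt (gn (U n) * gn u))"
  proof -
    have "u = U n + d" by (simp add: d_def)
    then have "b_form \<Omega> u u d = b_form \<Omega> u (U n) d"
      using b_add_mid[OF H0(1,2) J_H10[OF dJ] J_H10[OF dJ]] by (simp add: b_skew)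
    moreover have "\<bar>b_form \<Omega> u (U n) d\<bar> \<le> 4 * N4 u * (gn (U n) * N4 d + gn d * N4 (U n))"
      by (rule b_bound[OF H0(1,2) J_H10[OF dJ]])
    moreover have "N4 u * N4 d \<le> m * (gn u + gn d)"
    proof -
      have "N4 u * N4 d = sqrt ((L2_norm \<Omega> u * gn u) * (L2_norm \<Omega> d * gn d))" by (simp add: N4_def real_sqrt_mult)
      also have "\<dots> \<le> sqrt ((m * gn u) * ((2 * m) * gn d))"
        using Um dm m0 by (intro real_sqrt_le_mono mult_mono mult_right_mono) auto
      also have "\<dots> \<le> m * (gn u + gn d)"
      proof (rule real_le_lsqrt)
        have "m\<^sup>2 * (2 * (gn u * gn d)) \<le> m\<^sup>2 * (gn u + gn d)\<^sup>2" by (intro mult_left_mono) (simp_all add: power2_sum)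
        then show "(m * gn u) * ((2 * m) * gn d) \<le> (m * (gn u + gn d))\<^sup>2"
          by (simp add: power_mult_distrib power2_eq_square mult_ac)
      qed (use m0 in simp)
      finally show ?thesis .
    qed
    then have "gn (U n) * (N4 u * N4 d) \<le> gn (U n) * (m * (gn u + gn d))" by (rule mult_left_mono) simp
    moreover have "N4 u * N4 (U n) \<le> m * sqrt (gn (U n) * gn u)"
    proof -
      have "N4 u * N4 (U n) = sqrt ((L2_norm \<Omega> u * gn u) * (L2_norm \<Omega> (U n) * gn (U n)))" by (simp add: N4_def real_sqrt_mult)
      also have "\<dots> \<le> sqrt ((m * gn u) * (m * gn (U n)))"
        using Um m0 by (intro real_sqrt_le_mono mult_mono mult_right_mono) auto
      also have "\<dots> = m * sqrt (gn (U n) * gn u)" using m0 by (simp add: real_sqrt_mult)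
      finally show ?thesis .
    qed
    then have "gn d * (N4 u * N4 (U n)) \<le> gn d * (m * sqrt (gn (U n) * gn u))" by (rule mult_left_mono) simp
    ultimately show ?thesis by (simp add: algebra_simps)
  qed
  have "k * (\<mu> * a_form \<Omega> u d) \<le> k * (2 * m * M\<^sub>0 + \<Gamma> * gn d
      + 4 * m * (gn (U n) * (gn u + gn d) + gn d * sqrt (gn (U n) * gn u)))"
  proof -
    have "0 \<le> L2_inner \<Omega> d d" by (rule L2.nonneg[OF J_L2[OF dJ]])
    then have "k * (\<mu> * a_form \<Omega> u d) \<le> k * (L2_inner \<Omega> (F n) d - a_form \<Omega> (G (Suc n)) d - b_form \<Omega> u u d)"
      using scheme[OF n dJ] unfolding u_def[symmetric] d_def[symmetric] by (simp add: algebra_simps)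
    also have "\<dots> \<le> k * (2 * m * M\<^sub>0 + \<Gamma> * gn d + 4 * m * (gn (U n) * (gn u + gn d) + gn d * sqrt (gn (U n) * gn u)))"
      using k force mem conv by (intro mult_left_mono) auto
    finally show ?thesis .
  qed
  then have "\<mu> * a_form \<Omega> u d \<le> 2 * m * M\<^sub>0 + \<Gamma> * gn d + 4 * m * (gn (U n) * (gn u + gn d) + gn d * sqrt (gn (U n) * gn u))"
    using k by simp
  moreover have "\<mu> / 2 * ((gn u)\<^sup>2 - (gn (U n))\<^sup>2 + (gn d)\<^sup>2) = \<mu> * a_form \<Omega> u d"
    using a_form_diff[OF H(1,2)] by (simp add: d_def)
  ultimately show ?thesis
    unfolding R_def m_def[symmetric] u_def[symmetric] unfolding m0(2)[symmetric]
    by (intro growth_of_step[where g = "gn d"]) (use \<mu> m0 \<Gamma>_nonneg in auto)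
qed

lemma St_comb:
  assumes "v \<in> J" "w \<in> J"
  shows "L2_norm \<Omega> (St (r *\<^sub>R v + s *\<^sub>R w)) \<le> \<bar>r\<bar> * L2_norm \<Omega> (St v) + \<bar>s\<bar> * L2_norm \<Omega> (St w)"
proof -
  note S = assms[THEN St_mem]
  note L = S[THEN J_L2]
  have "L2_norm \<Omega> (St (r *\<^sub>R v + s *\<^sub>R w)) = L2_norm \<Omega> (r *\<^sub>R St v + s *\<^sub>R St w)"
  proof (rule St_norm_eqI)
    show "r *\<^sub>R v + s *\<^sub>R w \<in> J" "r *\<^sub>R St v + s *\<^sub>R St w \<in> J" using assms S by (auto intro!: J_mem)
    fix \<phi> assume p: "\<phi> \<in> J"
    show "L2_inner \<Omega> (r *\<^sub>R St v + s *\<^sub>R St w) \<phi> = a_form \<Omega> (r *\<^sub>R v + s *\<^sub>R w) \<phi>"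
      using assms[THEN J_H1] J_H1[OF p] L J_L2[OF p] St_inner[OF assms(1) p] St_inner[OF assms(2) p]
      by (simp add: L2.linear_simps A.linear_simps L2.mem A.mem)
  qed
  also have "\<dots> \<le> \<bar>r\<bar> * L2_norm \<Omega> (St v) + \<bar>s\<bar> * L2_norm \<Omega> (St w)"
    using L2_triangle[OF L2.mem(2)[OF L(1), of r] L2.mem(2)[OF L(2), of s]] L by (simp add: L2_norm_scale)
  finally show ?thesis .
qed

text \<open>
  Eliminating \<open>U (Suc n)\<close> in favour of \<open>Z (Suc n)\<close> in the recursion exhibits \<open>G (Suc n)\<close> as almost
  a convex combination of \<open>G n\<close> and \<open>\<mu> Z (Suc n)\<close>.
\<close>

lemma memory_step:
  assumes n: "n < N"
  shows "(1 + k * (\<gamma> / \<mu>)) * (L2_norm \<Omega> (St (G (Suc n))))\<^sup>2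
    \<le> (L2_norm \<Omega> (St (G n)))\<^sup>2 + k * (\<gamma> * \<mu>) * (L2_norm \<Omega> (St (Z (Suc n))))\<^sup>2"
proof -
  define \<kappa> where "\<kappa> = k * (\<gamma> / \<mu>)"
  have \<kappa>: "0 < \<kappa>" using k \<gamma> \<mu> by (simp add: \<kappa>_def)
  define D where "D = \<mu> * L2_norm \<Omega> (St (Z (Suc n)))"
  define y where "y = L2_norm \<Omega> (St (G n))"
  define y' where "y' = L2_norm \<Omega> (St (G (Suc n)))"
  have nn: "0 \<le> D" "0 \<le> y" "0 \<le> y'" using \<mu> by (simp_all add: D_def y_def y'_def)
  have "(1 + \<kappa>) *\<^sub>R G (Suc n) = (\<kappa> * \<mu>) *\<^sub>R Z (Suc n) + q *\<^sub>R G n"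
  proof -
    have "\<kappa> * \<mu> = k * \<gamma>" using \<mu> by (simp add: \<kappa>_def)
    then have "(\<kappa> * \<mu>) *\<^sub>R Z (Suc n) + q *\<^sub>R G n = ((k * \<gamma>) *\<^sub>R U (Suc n) + q *\<^sub>R G n) + \<kappa> *\<^sub>R G (Suc n)"
      using \<mu> by (simp add: Z_def scaleR_add_right) (simp add: \<kappa>_def)
    then show ?thesis unfolding G_Suc[symmetric] by (simp add: scaleR_add_left)
  qed
  then have "G (Suc n) = (1 / (1 + \<kappa>)) *\<^sub>R ((\<kappa> * \<mu>) *\<^sub>R Z (Suc n) + q *\<^sub>R G n)"
    using \<kappa> by (metis (no_types, lifting) add_pos_pos less_numeral_extra(1) less_numeral_extra(3) nonzero_divide_eq_eq scaleR_one scaleR_scaleR)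
  also have "\<dots> = (\<kappa> * \<mu> / (1 + \<kappa>)) *\<^sub>R Z (Suc n) + (q / (1 + \<kappa>)) *\<^sub>R G n" by (simp add: scaleR_add_right)
  finally have "y' \<le> (\<kappa> * \<mu> / (1 + \<kappa>)) * L2_norm \<Omega> (St (Z (Suc n))) + (q / (1 + \<kappa>)) * y"
    using St_comb[OF Z_J[of "Suc n"] G_J[of n], of "\<kappa> * \<mu> / (1 + \<kappa>)" "q / (1 + \<kappa>)"] n \<kappa> \<mu> q
    by (simp add: y'_def y_def)
  then have "(1 + \<kappa>) * y' \<le> (1 + \<kappa>) * ((\<kappa> * \<mu> / (1 + \<kappa>)) * L2_norm \<Omega> (St (Z (Suc n))) + (q / (1 + \<kappa>)) * y)"
    by (rule mult_left_mono) (use \<kappa> in simp)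
  also have "\<dots> = \<kappa> * D + q * y" using \<kappa> by (simp add: D_def distrib_left)
  also have "\<dots> \<le> \<kappa> * D + y" using q mult_right_mono[OF q(2) nn(2)] by simp
  finally have "((1 + \<kappa>) * y')\<^sup>2 \<le> (\<kappa> * D + y)\<^sup>2" using nn \<kappa> by (intro power_mono) auto
  also have "\<dots> \<le> (1 + \<kappa>) * (\<kappa> * D\<^sup>2 + y\<^sup>2)"
  proof -
    have "0 \<le> \<kappa> * (D - y)\<^sup>2" using \<kappa> by simp
    then show ?thesis by (simp add: power2_eq_square algebra_simps)
  qed
  finally have "(1 + \<kappa>) * ((1 + \<kappa>) * y'\<^sup>2) \<le> (1 + \<kappa>) * (\<kappa> * D\<^sup>2 + y\<^sup>2)" by (simp add: power2_eq_square mult_ac)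
  then have "(1 + \<kappa>) * y'\<^sup>2 \<le> \<kappa> * D\<^sup>2 + y\<^sup>2" using \<kappa> by simp
  moreover have "\<kappa> * D\<^sup>2 = k * (\<gamma> * \<mu>) * (L2_norm \<Omega> (St (Z (Suc n))))\<^sup>2"
    using \<mu> by (simp add: \<kappa>_def D_def power2_eq_square)
  ultimately show ?thesis by (simp add: \<kappa>_def y_def y'_def)
qed

lemma St_U_le:
  assumes n: "n \<le> N"
  shows "L2_norm \<Omega> (St (U n)) \<le> L2_norm \<Omega> (St (Z n)) + L2_norm \<Omega> (St (G n)) / \<mu>"
proof -
  have "U n = 1 *\<^sub>R Z n + (- 1 / \<mu>) *\<^sub>R G n" by (simp add: Z_def)
  then show ?thesis using St_comb[OF Z_J[OF n] G_J[OF n], of 1 "- 1 / \<mu>"] \<mu> by simp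
qed

lemma gn_scaled_G: "n \<le> N \<Longrightarrow> gn ((1 / \<mu>) *\<^sub>R G n) \<le> \<Gamma> / \<mu>"
proof -
  assume n: "n \<le> N"
  note H = J_H1[OF G_J[OF n]]
  have "gn ((1 / \<mu>) *\<^sub>R G n) = gn (G n) / \<mu>"
    using H \<mu> by (simp add: gn_eq A.linear_simps A.mem real_sqrt_mult real_sqrt_divide)
  then show ?thesis using G_gn[OF n] \<mu> by (simp add: divide_right_mono)
qed

lemma gn_Z: "n \<le> N \<Longrightarrow> gn (Z n) \<le> gn (U n) + \<Gamma> / \<mu>" "n \<le> N \<Longrightarrow> gn (U n) \<le> gn (Z n) + \<Gamma> / \<mu>"
proof -
  assume n: "n \<le> N"
  note H = J_H1[OF G_J[OF n]] J_H1[OF U_J[OF n]] J_H1[OF Z_J[OF n]] A.mem(2)[OF J_H1[OF G_J[OF n]], of "1 / \<mu>"]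
  show "gn (Z n) \<le> gn (U n) + \<Gamma> / \<mu>"
    using gn_triangle[OF H(2,4)] gn_scaled_G[OF n] by (simp add: Z_def)
  have "U n = Z n - (1 / \<mu>) *\<^sub>R G n" by (simp add: Z_def)
  then show "gn (U n) \<le> gn (Z n) + \<Gamma> / \<mu>"
    using gn_triangle_diff[OF H(3,4)] gn_scaled_G[OF n] by simp
qed

text \<open>
  Testing with \<open>St (Z (Suc n))\<close>. The increment of \<open>U\<close> is that of \<open>Z\<close> minus that of \<open>G/\<mu>\<close>, and the
  latter is explicit in \<open>U\<close> and \<open>G\<close>, hence of lower order.
\<close>

lemma dissipation_step:
  assumes n: "n < N"
    and C: "0 \<le> C" "\<And>u D y s \<beta>. 0 \<le> u \<Longrightarrow> 0 \<le> D \<Longrightarrow> 0 \<le> y \<Longrightarrow> 0 \<le> s \<Longrightarrow> s \<le> D + y / \<mu> \<Longrightarrow>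
       \<beta> \<le> 160 * c ^ 5 * sqrt (sqrt (sqrt E\<^sub>0 * s) ^ 3 * u) * D \<Longrightarrow>
       2 * M\<^sub>0 * D + 2 * \<beta> \<le> \<mu> * D\<^sup>2 + C * (1 + (u\<^sup>2)\<^sup>2 + u * (y * sqrt y))"
  defines "u \<equiv> gn (U (Suc n))" and "y \<equiv> L2_norm \<Omega> (St (G (Suc n)))"
  shows "(gn (Z (Suc n)))\<^sup>2 + k * \<mu> * (L2_norm \<Omega> (St (Z (Suc n))))\<^sup>2
    \<le> (gn (Z n))\<^sup>2 + k * (C + 2 / \<mu> * ((1 + \<Gamma> / \<mu>) * (\<gamma> + \<delta> * \<Gamma>))) * (1 + (u\<^sup>2)\<^sup>2 + u * (y * sqrt y))"
proof -
  define z where "z = Z (Suc n)"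
  define S where "S = St z"
  define D where "D = L2_norm \<Omega> S"
  define g where "g = \<Gamma> / \<mu>"
  define X where "X = 1 + (u\<^sup>2)\<^sup>2 + u * (y * sqrt y)"
  define b where "b = b_form \<Omega> (U (Suc n)) (U (Suc n)) S"
  have J: "U (Suc n) \<in> J" "U n \<in> J" "G (Suc n) \<in> J" "G n \<in> J" "z \<in> J" "Z n \<in> J"
    using n by (simp_all add: z_def U_J G_J Z_J)
  then have SJ: "S \<in> J" unfolding S_def by (intro St_mem)
  note L = J[THEN J_L2] and H = J[THEN J_H1] and SL = J_L2[OF SJ] and SH = J_H1[OF SJ]
  have nn: "0 \<le> u" "0 \<le> y" "0 \<le> D" "0 \<le> g" using \<mu> \<Gamma>_nonneg by (simp_all add: u_def y_def D_def g_def)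
  have visc: "\<mu> * a_form \<Omega> (U (Suc n)) S + a_form \<Omega> (G (Suc n)) S = \<mu> * D\<^sup>2"
  proof -
    have "D\<^sup>2 = a_form \<Omega> z S" using St_inner[OF J(5) SJ] by (simp add: D_def S_def L2_norm_sq SL[unfolded S_def])
    also have "\<dots> = a_form \<Omega> (U (Suc n)) S + 1 / \<mu> * a_form \<Omega> (G (Suc n)) S"
      unfolding z_def Z_def using H SH by (simp add: A.linear_simps A.mem)
    finally show ?thesis using \<mu> by (simp add: distrib_left)
  qed
  have evol: "L2_inner \<Omega> (U (Suc n) - U n) S
      = a_form \<Omega> z (z - Z n) - k * \<gamma> / \<mu> * a_form \<Omega> z (U (Suc n)) + (1 - q) / \<mu> * a_form \<Omega> z (G n)"
  proof -
    have "L2_inner \<Omega> (U (Suc n) - U n) S = a_form \<Omega> z (U (Suc n) - U n)"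
      using L2.commute[OF L2.mem(3)[OF L(1,2)] SL] St_inner[OF J(5) J_mem(3)[OF J(1,2)]] by (simp add: S_def)
    moreover have "a_form \<Omega> z (U n) = a_form \<Omega> z (Z n) - 1 / \<mu> * a_form \<Omega> z (G n)"
      unfolding Z_def using H by (simp add: A.linear_simps A.mem)
    moreover have "a_form \<Omega> z (U (Suc n)) = a_form \<Omega> z z - 1 / \<mu> * (k * \<gamma> * a_form \<Omega> z (U (Suc n)) + q * a_form \<Omega> z (G n))"
    proof -
      have "U (Suc n) = z - (1 / \<mu>) *\<^sub>R ((k * \<gamma>) *\<^sub>R U (Suc n) + q *\<^sub>R G n)"
        unfolding G_Suc[symmetric] by (simp add: z_def Z_def)
      then have "a_form \<Omega> z (U (Suc n)) = a_form \<Omega> z (z - (1 / \<mu>) *\<^sub>R ((k * \<gamma>) *\<^sub>R U (Suc n) + q *\<^sub>R G n))" by simp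
      also have "\<dots> = a_form \<Omega> z z - 1 / \<mu> * (k * \<gamma> * a_form \<Omega> z (U (Suc n)) + q * a_form \<Omega> z (G n))"
        using H by (simp add: A.linear_simps A.mem)
      finally show ?thesis .
    qed
    moreover have "a_form \<Omega> z (U (Suc n) - U n) = a_form \<Omega> z (U (Suc n)) - a_form \<Omega> z (U n)"
      "a_form \<Omega> z (z - Z n) = a_form \<Omega> z z - a_form \<Omega> z (Z n)"
      using H by (simp_all add: A.linear_simps)
    ultimately show ?thesis by (simp add: divide_inverse algebra_simps)
  qed
  have zu: "gn z \<le> u + g" using gn_Z(1)[of "Suc n"] n by (simp add: z_def u_def g_def)
  have mem: "k * \<gamma> / \<mu> * a_form \<Omega> z (U (Suc n)) - (1 - q) / \<mu> * a_form \<Omega> z (G n)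
      \<le> k / \<mu> * ((1 + g) * (\<gamma> + \<delta> * \<Gamma>) * X)"
  proof -
    have "k * \<gamma> / \<mu> * a_form \<Omega> z (U (Suc n)) \<le> k * \<gamma> / \<mu> * ((u + g) * u)"
      using a_cauchy_schwarz[OF H(5,1)] mult_right_mono[OF zu nn(1)] k \<gamma> \<mu> by (intro mult_left_mono) (auto simp: u_def)
    moreover have "(1 - q) / \<mu> * (- a_form \<Omega> z (G n)) \<le> \<delta> * k / \<mu> * ((u + g) * \<Gamma>)"
    proof -
      have 1: "- a_form \<Omega> z (G n) \<le> (u + g) * \<Gamma>"
        using a_cauchy_schwarz[OF H(5,4)] mult_mono[OF zu G_gn[of n]] n nn by simp
      have "(1 - q) / \<mu> * (- a_form \<Omega> z (G n)) \<le> (1 - q) / \<mu> * ((u + g) * \<Gamma>)"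
        by (rule mult_left_mono[OF 1]) (use q \<mu> in simp)
      also have "\<dots> \<le> \<delta> * k / \<mu> * ((u + g) * \<Gamma>)"
        using q(3) \<mu> nn \<Gamma>_nonneg by (intro mult_right_mono divide_right_mono) auto
      finally show ?thesis .
    qed
    moreover have "k / \<mu> * (\<gamma> * ((u + g) * u) + \<delta> * ((u + g) * \<Gamma>)) \<le> k / \<mu> * ((1 + g) * (\<gamma> + \<delta> * \<Gamma>) * X)"
    proof (rule mult_left_mono)
      have Y: "0 \<le> u * (y * sqrt y)" using nn by simp
      have "0 \<le> (u\<^sup>2 - 1)\<^sup>2" by simp
      then have u2: "2 * u\<^sup>2 \<le> 1 + (u\<^sup>2)\<^sup>2" by (simp add: power2_diff)
      have "0 \<le> (u - 1)\<^sup>2" by simp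
      then have u1: "2 * u \<le> 1 + u\<^sup>2" by (simp add: power2_diff)
      have X: "u * u \<le> X" "u \<le> X" "1 \<le> X"
        using u1 u2 Y zero_le_power2[of "u\<^sup>2"] zero_le_power2[of u] unfolding X_def power2_eq_square[of u, symmetric] by linarith+
      have "\<gamma> * ((u + g) * u) \<le> \<gamma> * ((1 + g) * X)"
        using X mult_left_mono[OF X(2) nn(4)] \<gamma> by (intro mult_left_mono) (simp_all add: distrib_right)
      moreover have "\<delta> * ((u + g) * \<Gamma>) \<le> \<delta> * (((1 + g) * X) * \<Gamma>)"
        using X mult_left_mono[OF X(3) nn(4)] \<delta> \<Gamma>_nonneg by (intro mult_left_mono mult_right_mono) (simp_all add: distrib_right)
      ultimately show "\<gamma> * ((u + g) * u) + \<delta> * ((u + g) * \<Gamma>) \<le> (1 + g) * (\<gamma> + \<delta> * \<Gamma>) * X"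
        by (simp add: algebra_simps)
    qed (use k \<mu> in simp)
    ultimately show ?thesis by (simp add: algebra_simps)
  qed
  have dis: "2 * M\<^sub>0 * D + 2 * \<bar>b\<bar> \<le> \<mu> * D\<^sup>2 + C * X"
    unfolding X_def
  proof (rule C(2)[of u D y "L2_norm \<Omega> (St (U (Suc n)))"])
    show "L2_norm \<Omega> (St (U (Suc n))) \<le> D + y / \<mu>"
      using St_U_le[of "Suc n"] n by (simp add: D_def S_def z_def y_def)
    have "\<bar>b\<bar> \<le> 160 * c ^ 5 * sqrt (sqrt (L2_norm \<Omega> (U (Suc n)) * L2_norm \<Omega> (St (U (Suc n)))) ^ 3 * u) * D"
      unfolding b_def u_def D_def by (rule nonlinear_bound[OF J(1) SJ])
    also have "\<dots> \<le> 160 * c ^ 5 * sqrt (sqrt (sqrt E\<^sub>0 * L2_norm \<Omega> (St (U (Suc n)))) ^ 3 * u) * D"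
      using U_norm[of "Suc n"] n nn c1 U_J[of "Suc n"]
      by (intro mult_right_mono mult_left_mono real_sqrt_le_mono power_mono) auto
    finally show "\<bar>b\<bar> \<le> 160 * c ^ 5 * sqrt (sqrt (sqrt E\<^sub>0 * L2_norm \<Omega> (St (U (Suc n)))) ^ 3 * u) * D" .
  qed (use nn in simp_all)
  have force: "L2_inner \<Omega> (F n) S \<le> M\<^sub>0 * D"
    using L2_cauchy_schwarz[OF F(1)[OF n] SL] mult_right_mono[OF F(2)[OF n] nn(3)] by (simp add: D_def)
  have "(gn z)\<^sup>2 - (gn (Z n))\<^sup>2 \<le> 2 * a_form \<Omega> z (z - Z n)"
    using a_form_diff[OF H(5,6)] by simp
  moreover have "k * (\<mu> * a_form \<Omega> (U (Suc n)) S + a_form \<Omega> (G (Suc n)) S) = k * (\<mu> * D\<^sup>2)"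
    unfolding visc ..
  moreover have "2 * k * (L2_inner \<Omega> (F n) S - b) \<le> k * (\<mu> * D\<^sup>2 + C * X)"
  proof -
    have "k * (2 * (L2_inner \<Omega> (F n) S - b)) \<le> k * (\<mu> * D\<^sup>2 + C * X)"
    proof (rule mult_left_mono)
      have "2 * (M\<^sub>0 * D) + 2 * \<bar>b\<bar> \<le> \<mu> * D\<^sup>2 + C * X" using dis by (simp only: mult.assoc)
      moreover have "L2_inner \<Omega> (F n) S - b \<le> M\<^sub>0 * D + \<bar>b\<bar>"
        using add_mono[OF force abs_ge_minus_self[of b]] by simp
      ultimately show "2 * (L2_inner \<Omega> (F n) S - b) \<le> \<mu> * D\<^sup>2 + C * X" by simp
    qed (use k in simp)
    then show ?thesis by (simp add: mult_ac)
  qed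
  moreover note scheme[OF n SJ, folded b_def] mem evol
  ultimately have "(gn z)\<^sup>2 + k * (\<mu> * D\<^sup>2) \<le> (gn (Z n))\<^sup>2 + k * (C * X) + 2 * (k / \<mu> * ((1 + g) * (\<gamma> + \<delta> * \<Gamma>) * X))"
    unfolding distrib_left right_diff_distrib by simp
  also have "\<dots> = (gn (Z n))\<^sup>2 + k * (C + 2 / \<mu> * ((1 + g) * (\<gamma> + \<delta> * \<Gamma>))) * X"
    by (simp add: field_simps)
  finally show ?thesis by (simp add: X_def z_def D_def S_def g_def)
qed

end

lemma two_sq_bound: "0 \<le> s \<Longrightarrow> 0 \<le> t \<Longrightarrow> s \<le> t + g \<Longrightarrow> s\<^sup>2 \<le> 2 * t\<^sup>2 + 2 * (g::real)\<^sup>2"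
proof -
  assume "0 \<le> s" "0 \<le> t" "s \<le> t + g"
  then have "s\<^sup>2 \<le> (t + g)\<^sup>2" by (intro power_mono) auto
  moreover have "0 \<le> (t - g)\<^sup>2" by simp
  ultimately show ?thesis by (simp add: power2_sum power2_diff)
qed

context euler
begin

lemma energy_gradient_step:
  assumes n: "n < N"
  shows "energy (Suc n) + k * (\<mu> / 2) * (gn (U (Suc n)))\<^sup>2 \<le> energy n + k * (c\<^sup>2 * M\<^sub>0\<^sup>2 / \<mu>)"
proof -
  have "0 \<le> k * \<theta> * energy (Suc n)" using k \<theta> energy_nonneg by simp
  then show ?thesis using energy_step[OF n] by (simp add: distrib_right)
qed

lemma St_G_0: "L2_norm \<Omega> (St (G 0)) = 0"
proof -
  have 0: "(0 :: vector_field) \<in> J" by (rule subspace_0[OF subspace_J])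
  have "L2_norm \<Omega> (St 0) \<le> 0" using St_comb[OF 0 0, of 0 0] by simp
  then show ?thesis unfolding memory_sum_0 using L2_norm_nonneg[of \<Omega> "St 0"] by linarith
qed

lemma gn_Z_sq:
  assumes "n \<le> N"
  shows "(gn (Z n))\<^sup>2 \<le> 2 * (gn (U n))\<^sup>2 + 2 * (\<Gamma> / \<mu>)\<^sup>2" "(gn (U n))\<^sup>2 \<le> 2 * (gn (Z n))\<^sup>2 + 2 * (\<Gamma> / \<mu>)\<^sup>2"
  using gn_Z[OF assms] by (auto intro!: two_sq_bound)

end

text \<open>
  All constants are fixed before the discretization is, so that \<open>K\<close> depends on neither \<open>h\<close>, \<open>k\<close>
  nor the number of steps.
\<close>

lemma euler_uniform_bound:
  fixes c \<mu> \<gamma> \<delta> kmax M\<^sub>0 :: real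
  assumes c: "1 \<le> c" and pos: "0 < \<mu>" "0 < \<gamma>" "0 < \<delta>" "0 < kmax"
  shows "\<exists>K>0. \<forall>\<Omega> h Hh Lh k N U F. euler \<Omega> c h Hh Lh \<mu> \<gamma> \<delta> k kmax M\<^sub>0 N U F \<longrightarrow>
    (\<forall>n\<le>N. (L2_norm \<Omega> (grad \<Omega> (U n)))\<^sup>2
      + (L2_norm \<Omega> (disc_stokes_laplacian \<Omega> Hh Lh (memory_sum \<gamma> \<delta> k U n)))\<^sup>2 \<le> K)"
proof -
  define \<theta>' where "\<theta>' = min (\<mu> / (2 * c\<^sup>2)) (2 * \<delta>)"
  define E where "E = M\<^sub>0\<^sup>2 + c\<^sup>2 * M\<^sub>0\<^sup>2 / (\<mu> * \<theta>')"
  define \<Gamma>' where "\<Gamma>' = sqrt (\<gamma> * exp (\<delta> * kmax) * E)"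
  define R where "R = 32 * E / \<mu>"
  have \<theta>': "0 < \<theta>'" using c pos by (simp add: \<theta>'_def)
  have E: "0 \<le> E" using pos \<theta>' by (simp add: E_def)
  have \<Gamma>': "0 \<le> \<Gamma>'" using pos E by (simp add: \<Gamma>'_def)
  have "0 \<le> 160 * c ^ 5" "0 \<le> sqrt E" using c E by simp_all
  then obtain C\<^sub>1 where C1: "0 \<le> C\<^sub>1"
    "\<And>u D y s \<beta>. 0 \<le> u \<Longrightarrow> 0 \<le> D \<Longrightarrow> 0 \<le> y \<Longrightarrow> 0 \<le> s \<Longrightarrow> s \<le> D + y / \<mu> \<Longrightarrow>
       \<beta> \<le> 160 * c ^ 5 * sqrt (sqrt (sqrt E * s) ^ 3 * u) * D \<Longrightarrow>
       2 * M\<^sub>0 * D + 2 * \<beta> \<le> \<mu> * D\<^sup>2 + C\<^sub>1 * (1 + (u\<^sup>2)\<^sup>2 + u * (y * sqrt y))"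
    by (rule dissipation_absorbs[OF pos(1), where M = M\<^sub>0]) (rule that, assumption+)
  define A where "A = 2 + 8 * R / \<mu> + 8 * R\<^sup>2 / \<mu>\<^sup>2"
  define A' where "A' = 4 * (2 * sqrt E * M\<^sub>0) / \<mu> + 8 * \<Gamma>'\<^sup>2 / \<mu>\<^sup>2"
  define B where "B = C\<^sub>1 + 2 / \<mu> * ((1 + \<Gamma>' / \<mu>) * (\<gamma> + \<delta> * \<Gamma>'))"
  define c' where "c' = min (\<mu> / 2) (\<gamma> / \<mu>)"
  define C where "C = max 2 (max E (max (c\<^sup>2 * M\<^sub>0\<^sup>2 / \<mu>) (max (2 * (\<Gamma>' / \<mu>)\<^sup>2)
    (max (2 * (7 * c ^ 3 * M\<^sub>0)\<^sup>2 + 2 * (\<Gamma>' / \<mu>)\<^sup>2) (max A (max A' (max B (\<gamma> * \<mu>))))))))"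
  have C: "2 \<le> C" "E \<le> C" "c\<^sup>2 * M\<^sub>0\<^sup>2 / \<mu> \<le> C" "2 * (\<Gamma>' / \<mu>)\<^sup>2 \<le> C"
    "2 * (7 * c ^ 3 * M\<^sub>0)\<^sup>2 + 2 * (\<Gamma>' / \<mu>)\<^sup>2 \<le> C" "A \<le> C" "A' \<le> C" "B \<le> C" "\<gamma> * \<mu> \<le> C"
    unfolding C_def by linarith+
  have c': "0 < c'" "c' \<le> \<mu> / 2" "c' \<le> \<gamma> / \<mu>"
    unfolding c'_def using pos min.cobounded1[of "\<mu> / 2" "\<gamma> / \<mu>"] min.cobounded2[of "\<mu> / 2" "\<gamma> / \<mu>"] by simp_all
  then have c'_le_\<mu>: "c' \<le> \<mu>" using pos(1) by linarith
  have C1': "1 \<le> C" using C(1) by simp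
  from uniform_bound[OF c'(1) C1' pos(4)] obtain K where K: "0 < K"
    "\<And>k N E a x D y. 0 < k \<Longrightarrow> k \<le> kmax \<Longrightarrow>
    (\<forall>n\<le>N. 0 \<le> E n \<and> E n \<le> C \<and> 0 \<le> a n \<and> 0 \<le> x n \<and> 0 \<le> y n \<and> a n \<le> C * x n + C \<and> x n \<le> C * a n + C) \<Longrightarrow>
    x 0 \<le> C \<Longrightarrow> y 0 = 0 \<Longrightarrow>
    (\<forall>n<N. E (Suc n) + k * c' * a (Suc n) \<le> E n + k * C) \<Longrightarrow>
    (\<forall>n<N. a (Suc n) \<le> C * a n + C) \<Longrightarrow>
    (\<forall>n<N. x (Suc n) + k * c' * (D (Suc n))\<^sup>2
        \<le> x n + k * C * (1 + (a (Suc n))\<^sup>2 + sqrt (a (Suc n)) * (y (Suc n) * sqrt (y (Suc n))))) \<Longrightarrow>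
    (\<forall>n<N. (1 + k * c') * (y (Suc n))\<^sup>2 \<le> (y n)\<^sup>2 + k * C * (D (Suc n))\<^sup>2) \<Longrightarrow>
    (\<forall>n\<le>N. a n + (y n)\<^sup>2 \<le> K)" for N :: nat by blast
  have "(\<forall>n\<le>N. (L2_norm \<Omega> (grad \<Omega> (U n)))\<^sup>2
      + (L2_norm \<Omega> (disc_stokes_laplacian \<Omega> Hh Lh (memory_sum \<gamma> \<delta> k U n)))\<^sup>2 \<le> K)"
    if "euler \<Omega> c h Hh Lh \<mu> \<gamma> \<delta> k kmax M\<^sub>0 N U F" for \<Omega> h Hh Lh k N U F
  proof -
    interpret euler \<Omega> c h Hh Lh \<mu> \<gamma> \<delta> k kmax M\<^sub>0 N U F by (rule that)
    have E_eq: "E\<^sub>0 = E" by (simp add: E\<^sub>0_def \<theta>_def E_def \<theta>'_def)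
    have G_eq: "\<Gamma> = \<Gamma>'" by (simp add: \<Gamma>_def \<Gamma>'_def E_eq)
    define a where "a n = (gn (U n))\<^sup>2" for n
    define x where "x n = (gn (Z n))\<^sup>2" for n
    define y where "y n = L2_norm \<Omega> (St (G n))" for n
    define D where "D n = L2_norm \<Omega> (St (Z n))" for n
    have nn: "0 \<le> a n" "0 \<le> x n" "0 \<le> D n" for n by (simp_all add: a_def x_def D_def)
    have yn: "0 \<le> y n" for n by (simp add: y_def)
    have ax: "a n \<le> C * x n + C" "x n \<le> C * a n + C" if "n \<le> N" for n
      using gn_Z_sq[OF that] mult_right_mono[OF C(1) nn(1)[of n]] mult_right_mono[OF C(1) nn(2)[of n]] C(4)
      unfolding a_def x_def G_eq by linarith+
    have "\<forall>n\<le>N. a n + (y n)\<^sup>2 \<le> K"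
    proof (rule K(2)[OF k, where E = energy and x = x and D = D])
      show "\<forall>n\<le>N. 0 \<le> energy n \<and> energy n \<le> C \<and> 0 \<le> a n \<and> 0 \<le> x n \<and> 0 \<le> y n \<and> a n \<le> C * x n + C \<and> x n \<le> C * a n + C"
        using energy_nonneg energy_bound C(2) nn yn ax unfolding E_eq by (meson order_trans)
      have "(gn (U 0))\<^sup>2 \<le> (7 * c ^ 3 * M\<^sub>0)\<^sup>2" by (intro power_mono init(2)) simp
      then show "x 0 \<le> C" using gn_Z_sq(1)[of 0] C(5) unfolding x_def G_eq by simp
      show "y 0 = 0" unfolding y_def by (rule St_G_0)
      show "\<forall>n<N. energy (Suc n) + k * c' * a (Suc n) \<le> energy n + k * C"
      proof (intro allI impI)
        fix n assume n: "n < N"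
        have "k * c' * a (Suc n) \<le> k * (\<mu> / 2) * a (Suc n)" using k c' nn by (intro mult_right_mono mult_left_mono) auto
        moreover have "k * (c\<^sup>2 * M\<^sub>0\<^sup>2 / \<mu>) \<le> k * C" using k C(3) by (intro mult_left_mono) auto
        ultimately show "energy (Suc n) + k * c' * a (Suc n) \<le> energy n + k * C"
          using energy_gradient_step[OF n] unfolding a_def by linarith
      qed
      show "\<forall>n<N. a (Suc n) \<le> C * a n + C"
      proof (intro allI impI)
        fix n assume n: "n < N"
        have "a (Suc n) \<le> A * a n + A'" using growth[OF n] unfolding a_def A_def A'_def R_def E_eq G_eq .
        then show "a (Suc n) \<le> C * a n + C" using mult_right_mono[OF C(6) nn(1)[of n]] C(7) by linarith
      qed
      show "\<forall>n<N. x (Suc n) + k * c' * (D (Suc n))\<^sup>2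
        \<le> x n + k * C * (1 + (a (Suc n))\<^sup>2 + sqrt (a (Suc n)) * (y (Suc n) * sqrt (y (Suc n))))"
      proof (intro allI impI)
        fix n assume n: "n < N"
        define X where "X = 1 + (a (Suc n))\<^sup>2 + sqrt (a (Suc n)) * (y (Suc n) * sqrt (y (Suc n)))"
        have X0: "0 \<le> X" using yn by (simp add: X_def nn)
        have "k * c' * (D (Suc n))\<^sup>2 \<le> k * \<mu> * (D (Suc n))\<^sup>2" using k c'_le_\<mu> by (intro mult_right_mono mult_left_mono) auto
        moreover have "k * B * X \<le> k * C * X" using k C(8) X0 by (intro mult_right_mono mult_left_mono) auto
        moreover have "x (Suc n) + k * \<mu> * (D (Suc n))\<^sup>2 \<le> x n + k * B * X"
          using dissipation_step[OF n C1(1) C1(2)] unfolding E_eq G_eq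
          by (simp add: x_def D_def X_def B_def a_def y_def)
        ultimately show "x (Suc n) + k * c' * (D (Suc n))\<^sup>2
          \<le> x n + k * C * (1 + (a (Suc n))\<^sup>2 + sqrt (a (Suc n)) * (y (Suc n) * sqrt (y (Suc n))))"
          unfolding X_def by linarith
      qed
      show "\<forall>n<N. (1 + k * c') * (y (Suc n))\<^sup>2 \<le> (y n)\<^sup>2 + k * C * (D (Suc n))\<^sup>2"
      proof (intro allI impI)
        fix n assume n: "n < N"
        have "(1 + k * c') * (y (Suc n))\<^sup>2 \<le> (1 + k * (\<gamma> / \<mu>)) * (y (Suc n))\<^sup>2"
          using k c' by (intro mult_right_mono add_left_mono mult_left_mono) auto
        moreover have "k * (\<gamma> * \<mu>) * (D (Suc n))\<^sup>2 \<le> k * C * (D (Suc n))\<^sup>2"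
          using k C(9) by (intro mult_right_mono mult_left_mono) auto
        ultimately show "(1 + k * c') * (y (Suc n))\<^sup>2 \<le> (y n)\<^sup>2 + k * C * (D (Suc n))\<^sup>2"
          using memory_step[OF n] unfolding y_def D_def by linarith
      qed
    qed
    then show ?thesis by (simp add: a_def y_def gn_def St_norm)
  qed
  then show ?thesis using K(1) by blast
qed

section \<open>The uniform estimate\<close>

lemma span_eq_linear_combinations:
  fixes B :: "('a \<Rightarrow> 'b::real_vector) set"
  assumes "finite B"
  shows "{u. \<exists>c. u = (\<lambda>x. \<Sum>b\<in>B. c b *\<^sub>R b x)} = span B"
proof -
  have "(\<lambda>x. \<Sum>b\<in>B. c b *\<^sub>R b x) = (\<Sum>b\<in>B. c b *\<^sub>R b)" for c
    using assms by (induction B) (auto simp: fun_eq_iff scaleR_fun_apply)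
  then show ?thesis unfolding span_finite[OF assms] by auto
qed

lemma (in bounded_open) vHm_norm_1_ge:
  assumes v: "v \<in> vHm 1 \<Omega>"
  shows "L2_norm \<Omega> v \<le> vHm_norm 1 \<Omega> v" "gn v \<le> vHm_norm 1 \<Omega> v"
proof -
  have "(vHm_norm 1 \<Omega> v)\<^sup>2 = (\<Sum>i\<in>UNIV. (Hm_norm 1 \<Omega> (coord v i))\<^sup>2)"
    unfolding vHm_norm_def by (simp add: sum_nonneg)
  also have "\<dots> = (\<Sum>i\<in>UNIV. (L2_norm \<Omega> (coord v i))\<^sup>2) + (gn v)\<^sup>2"
    unfolding gn_sq_sum[OF v] sum.distrib[symmetric] Hm_norm_1_sq by (simp add: sum_2)
  also have "(\<Sum>i\<in>UNIV. (L2_norm \<Omega> (coord v i))\<^sup>2) = (L2_norm \<Omega> v)\<^sup>2"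
    by (rule L2_norm_vec_sq[OF Hm_L2[OF vHm_coord[OF v]], symmetric])
  finally have *: "(vHm_norm 1 \<Omega> v)\<^sup>2 = (L2_norm \<Omega> v)\<^sup>2 + (gn v)\<^sup>2" .
  show "L2_norm \<Omega> v \<le> vHm_norm 1 \<Omega> v" "gn v \<le> vHm_norm 1 \<Omega> v"
    by (rule power2_le_imp_le; use * in simp)+
qed

theorem lemma4p3:
  fixes \<Omega> :: "(real^2) set"
    and \<mu> \<gamma> \<delta> \<alpha> \<nu>\<^sub>1 M\<^sub>0 C\<^sub>1 C\<^sub>2 C\<^sub>3 :: real
  assumes domain: "planar_domain \<Omega>" "bounded \<Omega>"
    and params: "\<mu> > 0" "\<gamma> > 0" "\<delta> > 0"
    and regularity: "stokes_regularity \<Omega> C\<^sub>1"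
    and eigenvalue: "least_stokes_eigenvalue \<Omega> \<nu>\<^sub>1"
    and alpha: "0 < \<alpha>" "\<alpha> < \<delta>" "\<alpha> < \<mu> * \<nu>\<^sub>1 / 2"
  shows "\<exists>K>0.
    \<forall>(H :: real \<Rightarrow> vector_field set) (L :: real \<Rightarrow> scalar_field set).
      discrete_spaces \<Omega> H L \<longrightarrow>
      approximation_inverse \<Omega> H L C\<^sub>2 \<longrightarrow>
      solenoidal_approximation \<Omega> H L C\<^sub>3 \<longrightarrow>
    (\<forall>h u\<^sub>0 f (T::real) (N::nat) k \<alpha>\<^sub>0 U.
      0 < h \<longrightarrow> h < 1 \<longrightarrow>
      admissible_data \<Omega> M\<^sub>0 u\<^sub>0 f \<longrightarrow>
      0 < T \<longrightarrow> 0 < N \<longrightarrow> k = T / real N \<longrightarrow>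
      0 < \<alpha>\<^sub>0 \<longrightarrow> (\<forall>\<alpha>'. 0 < \<alpha>' \<and> \<alpha>' < \<alpha>\<^sub>0 \<longrightarrow> 1 + \<mu> * \<nu>\<^sub>1 / 2 * k \<ge> exp (\<alpha>' * k)) \<longrightarrow>
      \<alpha> < \<alpha>\<^sub>0 \<longrightarrow>
      backward_euler \<Omega> \<mu> \<gamma> \<delta> (H h) (L h) u\<^sub>0 f k N U \<longrightarrow>
      (\<forall>n\<in>{1..N}.
        (L2_norm \<Omega> (grad \<Omega> (U n)))\<^sup>2
          + exp (- \<delta> * k) / \<gamma>
            * (L2_norm \<Omega> (disc_stokes_laplacian \<Omega> (H h) (L h) (memory_sum \<gamma> \<delta> k U n)))\<^sup>2
        \<le> K))"
proof -
  interpret bounded_open \<Omega> using domain by unfold_locales (auto simp: planar_domain_def)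
  obtain C\<^sub>0 where C0: "0 < C\<^sub>0" "\<And>v. v \<in> vH10 \<Omega> \<Longrightarrow> L2_norm \<Omega> v \<le> C\<^sub>0 * gn v"
    using vector_poincare by blast
  define c where "c = 1 + C\<^sub>0 + \<bar>C\<^sub>1\<bar> + \<bar>C\<^sub>2\<bar> + \<bar>C\<^sub>3\<bar>"
  have c: "1 \<le> c" "C\<^sub>0 \<le> c" "C\<^sub>1 \<le> c" "C\<^sub>2 \<le> c" "C\<^sub>3 \<le> c" using C0(1) by (auto simp: c_def)
  have \<nu>: "0 < \<nu>\<^sub>1" using eigenvalue by (simp add: least_stokes_eigenvalue_def)
  \<comment> \<open>the comparison of \<open>exp (\<alpha> k)\<close> with an affine function of \<open>k\<close> bounds the step size, see below\<close>
  define kmax where "kmax = \<mu> * \<nu>\<^sub>1 / \<alpha>\<^sup>2"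
  have kmax: "0 < kmax" using \<nu> params alpha by (simp add: kmax_def)
  obtain K where K: "0 < K" "\<And>h Hh Lh k N U F n. euler \<Omega> c h Hh Lh \<mu> \<gamma> \<delta> k kmax M\<^sub>0 N U F \<Longrightarrow> n \<le> N \<Longrightarrow>
      (L2_norm \<Omega> (grad \<Omega> (U n)))\<^sup>2
        + (L2_norm \<Omega> (disc_stokes_laplacian \<Omega> Hh Lh (memory_sum \<gamma> \<delta> k U n)))\<^sup>2 \<le> K"
    using euler_uniform_bound[OF c(1) params kmax, of M\<^sub>0] by blast
  show ?thesis
  proof (intro exI conjI allI impI ballI)
    show "0 < (1 + 1 / \<gamma>) * K" using K(1) params(2) by (simp add: add_pos_pos)
    fix H :: "real \<Rightarrow> vector_field set" and L :: "real \<Rightarrow> scalar_field set" and h u\<^sub>0 f and T :: real and N n :: nat and k \<alpha>\<^sub>0 U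
    assume ds: "discrete_spaces \<Omega> H L" and ai: "approximation_inverse \<Omega> H L C\<^sub>2"
      and sa: "solenoidal_approximation \<Omega> H L C\<^sub>3"
      and h: "0 < h" "h < 1" and ad: "admissible_data \<Omega> M\<^sub>0 u\<^sub>0 f"
      and T: "0 < T" "0 < N" "k = T / real N"
      and \<alpha>0: "0 < \<alpha>\<^sub>0" "\<forall>\<alpha>'. 0 < \<alpha>' \<and> \<alpha>' < \<alpha>\<^sub>0 \<longrightarrow> 1 + \<mu> * \<nu>\<^sub>1 / 2 * k \<ge> exp (\<alpha>' * k)" "\<alpha> < \<alpha>\<^sub>0"
      and be: "backward_euler \<Omega> \<mu> \<gamma> \<delta> (H h) (L h) u\<^sub>0 f k N U"
      and n: "n \<in> {1..N}"
    have k: "0 < k" using T by simp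
    have hi: "h \<in> {0<..<1}" using h by simp
    have spaces: "finite_dim_space (H h)" "H h \<subseteq> vH10 \<Omega>" "L h \<subseteq> L2 \<Omega>"
      using bspec[OF ds[unfolded discrete_spaces_def] hi] by simp_all
    note ai' = bspec[OF ai[unfolded approximation_inverse_def] hi, THEN conjunct2]
    note sa' = bspec[OF sa[unfolded solenoidal_approximation_def] hi]
    interpret fem \<Omega> c h "H h" "L h"
    proof unfold_locales
      show "1 \<le> c" "0 < h" by fact+
      show "L2_norm \<Omega> v \<le> c * gn v" if "v \<in> vH10 \<Omega>" for v
        using C0(2)[OF that] mult_right_mono[OF c(2) gn_nonneg[of v]] by linarith
      show "\<exists>w q. stokes_solution \<Omega> g w q \<and> w \<in> vHm 2 \<Omega> \<and> q \<in> Hm 1 \<Omega> \<and>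
        vHm_norm 2 \<Omega> w \<le> c * L2_norm \<Omega> g \<and> H1_quot_norm \<Omega> q \<le> c * L2_norm \<Omega> g" if gL: "g \<in> L2 \<Omega>" for g
      proof -
        obtain w q where "stokes_solution \<Omega> g w q" "w \<in> vHm 2 \<Omega>" "q \<in> Hm 1 \<Omega>"
          "vHm_norm 2 \<Omega> w + H1_quot_norm \<Omega> q \<le> C\<^sub>1 * L2_norm \<Omega> g"
          using regularity gL unfolding stokes_regularity_def by blast
        moreover have "C\<^sub>1 * L2_norm \<Omega> g \<le> c * L2_norm \<Omega> g" by (rule mult_right_mono[OF c(3)]) simp
        moreover note vHm_norm_nonneg[of 2 \<Omega> w] H1_quot_norm_nonneg[of \<Omega> q]
        ultimately have "vHm_norm 2 \<Omega> w \<le> c * L2_norm \<Omega> g" "H1_quot_norm \<Omega> q \<le> c * L2_norm \<Omega> g" by linarith+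
        then show ?thesis
          using \<open>stokes_solution \<Omega> g w q\<close> \<open>w \<in> vHm 2 \<Omega>\<close> \<open>q \<in> Hm 1 \<Omega>\<close> by blast
      qed
      show "\<exists>B. finite B \<and> H h = span B"
      proof -
        obtain B where "finite B" "H h = {u. \<exists>c. u = (\<lambda>x. \<Sum>b\<in>B. c b *\<^sub>R b x)}"
          using spaces(1) unfolding finite_dim_space_def by (elim exE conjE) (rule that)
        then have "finite B \<and> H h = span B" using span_eq_linear_combinations[of B] by simp
        then show ?thesis ..
      qed
      show "H h \<subseteq> vH10 \<Omega>" "L h \<subseteq> L2 \<Omega>" by (rule spaces)+
      show "\<exists>q\<^sub>h\<in>L h. L2_quot_norm \<Omega> (q - q\<^sub>h) \<le> c * h * H1_quot_norm \<Omega> q" if qH: "q \<in> Hm 1 \<Omega>" for q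
      proof -
        obtain q\<^sub>h where "q\<^sub>h \<in> L h" "L2_quot_norm \<Omega> (\<lambda>x. q x - q\<^sub>h x) \<le> C\<^sub>2 * h * H1_quot_norm \<Omega> q"
          using bspec[OF conjunct1[OF ai'] qH] by (elim bexE) (rule that)
        moreover have "C\<^sub>2 * h * H1_quot_norm \<Omega> q \<le> c * h * H1_quot_norm \<Omega> q"
          using c(4) h by (intro mult_right_mono) auto
        ultimately have "L2_quot_norm \<Omega> (q - q\<^sub>h) \<le> c * h * H1_quot_norm \<Omega> q" unfolding fun_diff_def by linarith
        then show ?thesis using \<open>q\<^sub>h \<in> L h\<close> ..
      qed
      show "h * gn w \<le> c * L2_norm \<Omega> w" if "w \<in> H h" for w
      proof -
        have "gn w \<le> C\<^sub>2 * inverse h * L2_norm \<Omega> w"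
          unfolding gn_def by (rule bspec[OF conjunct2[OF ai'] that])
        then have "h * gn w \<le> h * (C\<^sub>2 * inverse h * L2_norm \<Omega> w)" by (rule mult_left_mono) (use h in simp)
        also have "\<dots> = C\<^sub>2 * L2_norm \<Omega> w" using h by simp
        also have "\<dots> \<le> c * L2_norm \<Omega> w" by (rule mult_right_mono[OF c(4)]) simp
        finally show ?thesis .
      qed
      show "\<exists>w\<^sub>h\<in>Jh \<Omega> (H h) (L h). gn (w - w\<^sub>h) \<le> c * h * vHm_norm 2 \<Omega> w" if wJ: "w \<in> J1 \<Omega>" "w \<in> vHm 2 \<Omega>" for w
      proof -
        obtain w\<^sub>h where w: "w\<^sub>h \<in> Jh \<Omega> (H h) (L h)"
          "L2_norm \<Omega> (\<lambda>x. w x - w\<^sub>h x) + h * L2_norm \<Omega> (grad \<Omega> (\<lambda>x. w x - w\<^sub>h x)) \<le> C\<^sub>3 * h\<^sup>2 * vHm_norm 2 \<Omega> w"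
          using bspec[OF sa' IntI[OF wJ]] by (elim bexE) (rule that)
        have "h * gn (w - w\<^sub>h) \<le> C\<^sub>3 * h\<^sup>2 * vHm_norm 2 \<Omega> w"
          using w(2) L2_norm_nonneg[of \<Omega> "\<lambda>x. w x - w\<^sub>h x"] unfolding gn_def fun_diff_def by linarith
        also have "\<dots> = h * (C\<^sub>3 * h * vHm_norm 2 \<Omega> w)" by (simp add: power2_eq_square)
        finally have "gn (w - w\<^sub>h) \<le> C\<^sub>3 * h * vHm_norm 2 \<Omega> w" using h by simp
        also have "\<dots> \<le> c * h * vHm_norm 2 \<Omega> w" using c(5) h by (intro mult_right_mono) auto
        finally show ?thesis using w(1) ..
      qed
    qed
    have "U 0 \<in> J" and U0: "ae_eq \<Omega> (U 0) (L2_proj \<Omega> J u\<^sub>0)" and UJ: "\<And>m. m \<in> {1..N} \<Longrightarrow> U m \<in> J"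
      using be by (auto simp: backward_euler_def)
    then have UJ': "U m \<in> J" if "m \<le> N" for m using that by (cases m) auto
    have u0: "u\<^sub>0 \<in> J1 \<Omega>" "vHm_norm 1 \<Omega> u\<^sub>0 \<le> M\<^sub>0" using ad by (auto simp: admissible_data_def)
    have u01: "u\<^sub>0 \<in> vHm 1 \<Omega>" using u0(1) vH10_vHm by (auto simp: J1_def)
    have M0: "0 \<le> M\<^sub>0" using u0(2) vHm_norm_nonneg[of 1 \<Omega> u\<^sub>0] by linarith
    have proj: "L2_inner \<Omega> (U 0) \<phi> = L2_inner \<Omega> u\<^sub>0 \<phi>" if "\<phi> \<in> J" for \<phi>
      using L2_inner_cong_left[OF J_L2[OF UJ'[of 0]] J_L2[OF L2_proj_spec(1)[OF vHm_L2[OF u01]]] J_L2[OF that] U0]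
        L2_proj_spec(2)[OF vHm_L2[OF u01] that] by simp
    interpret euler \<Omega> c h "H h" "L h" \<mu> \<gamma> \<delta> k kmax M\<^sub>0 N U "\<lambda>n. f (real (Suc n) * k)"
    proof unfold_locales
      show "0 < \<mu>" "0 < \<gamma>" "0 < \<delta>" "0 < k" "0 \<le> M\<^sub>0" by fact+
      show "k \<le> kmax"
      proof -
        \<comment> \<open>the quadratic part of the exponential outgrows the affine majorant\<close>
        have "1 + \<alpha> * k + (\<alpha> * k)\<^sup>2 / 2 \<le> exp (\<alpha> * k)" by (rule exp_lower_Taylor_quadratic) (use alpha k in simp)
        also have "\<dots> \<le> 1 + \<mu> * \<nu>\<^sub>1 / 2 * k" using \<alpha>0 alpha by blast
        finally have "(\<alpha> * k)\<^sup>2 / 2 \<le> \<mu> * \<nu>\<^sub>1 / 2 * k" using alpha k mult_pos_pos[of \<alpha> k] by linarith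
        then have "k * (\<alpha>\<^sup>2 * k) \<le> k * (\<mu> * \<nu>\<^sub>1)" by (simp add: power2_eq_square mult_ac)
        then show ?thesis using k alpha by (simp add: kmax_def field_simps)
      qed
      show "U m \<in> J" if "m \<le> N" for m by (rule UJ'[OF that])
      fix m assume m: "m < N"
      have t: "0 < real (Suc m) * k" using k by simp
      show "f (real (Suc m) * k) \<in> L2 \<Omega>" "L2_norm \<Omega> (f (real (Suc m) * k)) \<le> M\<^sub>0"
        using ad t unfolding admissible_data_def Linf_L2_def by blast+
      fix \<phi> assume p: "\<phi> \<in> J"
      have eq: "L2_inner \<Omega> (bdiff k U (Suc m)) \<phi> + \<mu> * a_form \<Omega> (U (Suc m)) \<phi> + a_form \<Omega> (memory_sum \<gamma> \<delta> k U (Suc m)) \<phi>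
           = L2_inner \<Omega> (f (real (Suc m) * k)) \<phi> - b_form \<Omega> (U (Suc m)) (U (Suc m)) \<phi>"
        using be p m unfolding backward_euler_def by auto
      have "bdiff k U (Suc m) = (1 / k) *\<^sub>R (U (Suc m) - U m)" by (simp add: bdiff_def fun_eq_iff scaleR_fun_apply)
      then have "L2_inner \<Omega> (bdiff k U (Suc m)) \<phi> = 1 / k * L2_inner \<Omega> (U (Suc m) - U m) \<phi>" by (simp only: L2_inner_scale)
      then have "k * (L2_inner \<Omega> (bdiff k U (Suc m)) \<phi>) = L2_inner \<Omega> (U (Suc m) - U m) \<phi>" using k by simp
      then show "L2_inner \<Omega> (U (Suc m) - U m) \<phi> + k * \<mu> * a_form \<Omega> (U (Suc m)) \<phi>
            + k * a_form \<Omega> (memory_sum \<gamma> \<delta> k U (Suc m)) \<phi>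
          = k * L2_inner \<Omega> (f (real (Suc m) * k)) \<phi> - k * b_form \<Omega> (U (Suc m)) (U (Suc m)) \<phi>"
        using arg_cong[OF eq, of "\<lambda>x. k * x"] by (simp add: algebra_simps)
    next
      note S = proj_H1_stable[OF u0(1) UJ'[of 0] proj] and u = vHm_norm_1_ge[OF u01]
      show "L2_norm \<Omega> (U 0) \<le> M\<^sub>0" using S(1) u(1) u0(2) by simp
      have "7 * c ^ 3 * gn u\<^sub>0 \<le> 7 * c ^ 3 * M\<^sub>0" using c(1) u(2) u0(2) by (intro mult_left_mono) auto
      then show "gn (U 0) \<le> 7 * c ^ 3 * M\<^sub>0" using S(2) by simp
    qed
    define p where "p = (L2_norm \<Omega> (grad \<Omega> (U n)))\<^sup>2"
    define r where "r = (L2_norm \<Omega> (disc_stokes_laplacian \<Omega> (H h) (L h) (memory_sum \<gamma> \<delta> k U n)))\<^sup>2"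
    have pr: "p + r \<le> K" "0 \<le> p" "0 \<le> r" using K(2)[OF euler_axioms, of n] n by (simp_all add: p_def r_def)
    have "exp (- \<delta> * k) / \<gamma> * r \<le> 1 / \<gamma> * K"
      using q(2) pr params by (intro mult_mono divide_right_mono) (auto simp: q_def)
    then show "(L2_norm \<Omega> (grad \<Omega> (U n)))\<^sup>2
          + exp (- \<delta> * k) / \<gamma>
            * (L2_norm \<Omega> (disc_stokes_laplacian \<Omega> (H h) (L h) (memory_sum \<gamma> \<delta> k U n)))\<^sup>2
        \<le> (1 + 1 / \<gamma>) * K"
      using pr unfolding p_def[symmetric] r_def[symmetric] by (simp add: distrib_right)
  qed
qed

end
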